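(* Let $G$ be a compact transitive groupoid, let $H$ be a closed wide transitive subgroupoid of $G$, let $\mu$ be a full equivariant measure system on $G/H$, and let $\pi$ be a continuous unitary representation of $H$. Then $\pi$ is a subrepresentation of $(\operatorname{ind}_H^G(\pi),\mu)_{|_H}$, the restriction to $H$ of the induced representation.
   Context: **Groupoids.** All groupoids are second countable, locally compact and Hausdorff topological groupoids. $G^0$ is the unit space, $r,d:G\to G^0$ are the range and domain maps, $x,y$ are composable iff $d(x)=r(y)$, and $G^u=r^{-1}(u)$. $G$ is transitive if for all $u,v\in G^0$ there is $x\in G$ with $r(x)=u$, $d(x)=v$. $G$ carries a (left) Haar system $\lambda=\{\lambda^u\}_{u\in G^0}$. A subgroupoid $H\subseteq G$ is wide if it contains $G^0$; $H$ is assumed to carry a normalized Haar system $\{\lambda_H^u\}_{u\in G^0}$ (each $\lambda_H^u$ a probability measure). **The quotient $G/H$.** $G/H$ is the quotient of $G$ by $l\sim g\iff r(l)=r(g)$ and $l^{-1}g\in H$, with quotient map $q_H:G\to G/H$, $x\mapsto xH$, and the quotient topology. Put $r_{G^0}(xH)=r(x)$; $G$ acts on the left by $g\cdot xH=(gx)H$ when $d(g)=r(x)$. A full equivariant measure system $\mu=\{\mu^u\}_{u\in G^0}$ on $G/H$ is a family of positive Radon measures on $G/H$ with (i) $\operatorname{supp}\mu^u=r_{G^0}^{-1}(u)$; (ii) $u\mapsto\int f\,d\mu^u$ continuous for all $f\in C_c(G/H)$; (iii) $\int f(\gamma\cdot\omega)\,d\mu^{d(\gamma)}(\omega)=\int f(\omega)\,d\mu^{r(\gamma)}(\omega)$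 for all $\gamma\in G$, $f\in C_c(G/H)$. **Representations.** A continuous Hilbert bundle over $G^0$ is a continuous field of Hilbert spaces $\{\mathcal H_u\}_{u\in G^0}$: it has a linear space $\Gamma\subseteq\prod_u\mathcal H_u$ of continuous sections which is fiberwise dense, has $u\mapsto\|\xi(u)\|$ continuous for $\xi\in\Gamma$, and is closed under locally uniform approximation; the total space $\mathcal H$ has the topology generated by the sets $\{h: p(h)\in V,\|h-\xi(p(h))\|<\varepsilon\}$ ($V\subseteq G^0$ open, $\xi\in\Gamma$, $\varepsilon>0$, $p$ the projection). $C_0(G^0,\mathcal H)$ denotes the continuous sections vanishing at infinity. A continuous unitary representation of $G$ is a pair $(\mathcal H^\pi,\pi)$ with $\mathcal H^\pi$ a continuous Hilbert bundle over $G^0$ and unitaries $\pi(x):\mathcal H^\pi_{d(x)}\to\mathcal H^\pi_{r(x)}$, $x\in G$, with $\pi(u)=\mathrm{id}$ for $u\in G^0$, $\pi(x)\pi(y)=\pi(xy)$ for composable $x,y$, $\pi(x)^{-1}=\pi(x^{-1})$, and $x\mapsto\langle\pi(x)\xi(d(x)),\eta(r(x))\rangle$ continuous for all $\xi,\eta\in C_0(G^0,\mathcal H^\pi)$. Likewise for $H$ (whose unit space is $G^0$). A representation $\pi$ of $H$ is a subrepresentation of a representation $\rho$ of $H$ if it is unitarily equivalent to the restriction of $\rho$ to an invariant subbundle, i.e. there are linear isometries $U_u:\mathcal H^\pi_u\to\mathcal H^\rho_u$ ($u\in G^0$), carrying continuous sections to continuous sections, with $U_{r(h)}\pi(h)=\rho(h)U_{d(h)}$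 for all $h\in H$. **Induced representation.** For a continuous unitary representation $(\mathcal H^\sigma,\sigma)$ of $H$, let $\mathcal F_0^\sigma(G)$ be the set of continuous $f:G\to\mathcal H^\sigma$ with $f(x)\in\mathcal H^\sigma_{d(x)}$, $q_H(\operatorname{supp}f)$ compact, and $f(xh)=\sigma(h^{-1})f(x)$ for $h\in H$, $d(x)=r(h)$. Put $\langle f,g\rangle(u)=\int_{G/H}\langle f(x),g(x)\rangle\,d\mu^u(xH)$; $\mathcal F^\sigma(G,\mu)$ is the completion of $\mathcal F_0^\sigma(G)$ in the norm $\sup_u\langle f,f\rangle(u)^{1/2}$, a Hilbert $C_0(G^0)$-module. The corresponding continuous Hilbert bundle $\mathcal H^{\operatorname{ind}_H^G(\sigma)}$ has as fiber at $u$ the completion of $\{f|_{G^u}:f\in\mathcal F_0^\sigma(G)\}$ in the norm $\langle f,f\rangle(u)^{1/2}$, its continuous sections vanishing at infinity being given by the elements of $\mathcal F^\sigma(G,\mu)$. The induced representation $(\operatorname{ind}_H^G(\sigma),\mu)$ of $G$ on this bundle is $(L(x)f)(y)=f(x^{-1}y)$, from the fiber at $d(x)$ to the fiber at $r(x)$. *)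

theory Defs
  imports "HOL-Analysis.Analysis" "HOL-Algebra.Module"
begin

section \<open>Topological groupoids\<close>

text \<open>The arrow space is the carrier \<open>topspace (gtop G)\<close>; units are arrows, so the range and domain
  maps send arrows to arrows and the unit space is a subspace of the arrow space.\<close>

record 'g groupoid =
  gtop :: "'g topology"
  grng :: "'g \<Rightarrow> 'g"
  gdom :: "'g \<Rightarrow> 'g"
  gmul :: "'g \<Rightarrow> 'g \<Rightarrow> 'g"
  ginv :: "'g \<Rightarrow> 'g"

abbreviation arrows :: "'g groupoid \<Rightarrow> 'g set" where
  "arrows G \<equiv> topspace (gtop G)"

definition units :: "'g groupoid \<Rightarrow> 'g set" where
  "units G = grng G ` arrows G"

definition unit_top :: "'g groupoid \<Rightarrow> 'g topology" where
  "unit_top G = subtopology (gtop G) (units G)"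

definition rfib :: "'g groupoid \<Rightarrow> 'g \<Rightarrow> 'g set" where
  "rfib G u = {x \<in> arrows G. grng G x = u}"

definition composable :: "'g groupoid \<Rightarrow> ('g \<times> 'g) set" where
  "composable G = {(x, y). x \<in> arrows G \<and> y \<in> arrows G \<and> gdom G x = grng G y}"

locale topological_groupoid =
  fixes G :: "'g groupoid"
  assumes rng_closed: "x \<in> arrows G \<Longrightarrow> grng G x \<in> arrows G"
    and dom_closed: "x \<in> arrows G \<Longrightarrow> gdom G x \<in> arrows G"
    and inv_closed: "x \<in> arrows G \<Longrightarrow> ginv G x \<in> arrows G"
    and mul_closed: "(x, y) \<in> composable G \<Longrightarrow> gmul G x y \<in> arrows G"
    and rng_mul: "(x, y) \<in> composable G \<Longrightarrow> grng G (gmul G x y) = grng G x"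
    and dom_mul: "(x, y) \<in> composable G \<Longrightarrow> gdom G (gmul G x y) = gdom G y"
    and assoc: "(x, y) \<in> composable G \<Longrightarrow> (y, z) \<in> composable G \<Longrightarrow>
      gmul G (gmul G x y) z = gmul G x (gmul G y z)"
    and rng_dom_rng: "x \<in> arrows G \<Longrightarrow> grng G (grng G x) = grng G x \<and> gdom G (grng G x) = grng G x"
    and rng_dom_dom: "x \<in> arrows G \<Longrightarrow> grng G (gdom G x) = gdom G x \<and> gdom G (gdom G x) = gdom G x"
    and unit_mul: "x \<in> arrows G \<Longrightarrow> gmul G (grng G x) x = x"
    and mul_unit: "x \<in> arrows G \<Longrightarrow> gmul G x (gdom G x) = x"
    and rng_inv: "x \<in> arrows G \<Longrightarrow> grng G (ginv G x) = gdom G x"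
    and dom_inv: "x \<in> arrows G \<Longrightarrow> gdom G (ginv G x) = grng G x"
    and mul_inv: "x \<in> arrows G \<Longrightarrow> gmul G x (ginv G x) = grng G x"
    and inv_mul: "x \<in> arrows G \<Longrightarrow> gmul G (ginv G x) x = gdom G x"
    and continuous_mul: "continuous_map
      (subtopology (prod_topology (gtop G) (gtop G)) (composable G)) (gtop G) (\<lambda>(x, y). gmul G x y)"
    and continuous_inv: "continuous_map (gtop G) (gtop G) (ginv G)"
    and second_countable_gtop: "second_countable (gtop G)"
    and locally_compact_gtop: "locally_compact_space (gtop G)"
    and Hausdorff_gtop: "Hausdorff_space (gtop G)"

definition transitive_groupoid :: "'g groupoid \<Rightarrow> bool" where
  "transitive_groupoid G \<longleftrightarrow>
    (\<forall>u\<in>units G. \<forall>v\<in>units G. \<exists>x\<in>arrows G. grng G x = u \<and> gdom G x = v)"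

locale wide_subgroupoid =
  fixes G :: "'g groupoid" and H :: "'g set"
  assumes sub_arrows: "H \<subseteq> arrows G"
    and sub_wide: "units G \<subseteq> H"
    and sub_inv: "x \<in> H \<Longrightarrow> ginv G x \<in> H"
    and sub_mul: "x \<in> H \<Longrightarrow> y \<in> H \<Longrightarrow> gdom G x = grng G y \<Longrightarrow> gmul G x y \<in> H"

definition restrict_groupoid :: "'g groupoid \<Rightarrow> 'g set \<Rightarrow> 'g groupoid" where
  "restrict_groupoid G H = G\<lparr>gtop := subtopology (gtop G) H\<rparr>"


section \<open>Equivariant measure systems\<close>

definition Cc :: "'a topology \<Rightarrow> ('a \<Rightarrow> complex) set" where
  "Cc X = {f. continuous_map X euclidean f \<and>
    compactin X (X closure_of {x \<in> topspace X. f x \<noteq> 0})}"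

definition radon_measure :: "'a topology \<Rightarrow> 'a measure \<Rightarrow> bool" where
  "radon_measure X M \<longleftrightarrow>
    sets M = sets (sigma (topspace X) {U. openin X U}) \<and>
    (\<forall>K. compactin X K \<longrightarrow> emeasure M K < \<infinity>) \<and>
    (\<forall>A\<in>sets M. emeasure M A = (INF U\<in>{U. openin X U \<and> A \<subseteq> U}. emeasure M U)) \<and>
    (\<forall>U. openin X U \<longrightarrow> emeasure M U = (SUP K\<in>{K. compactin X K \<and> K \<subseteq> U}. emeasure M K))"

definition measure_support :: "'a topology \<Rightarrow> 'a measure \<Rightarrow> 'a set" where
  "measure_support X M = {x \<in> topspace X. \<forall>U. openin X U \<and> x \<in> U \<longrightarrow> emeasure M U > 0}"

text \<open>Full equivariant measure systems on a left \<open>G\<close>-space \<open>X\<close> with anchor map \<open>\<rho>\<close> and action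
  \<open>act\<close>. In the invariance condition \<open>act x\<close> is only meaningful on the anchor fibre over
  \<open>gdom G x\<close>, which supports the measure; hence the set integral.\<close>

locale full_equivariant_system =
  fixes G :: "'g groupoid" and X :: "'a topology" and \<rho> :: "'a \<Rightarrow> 'g"
    and act :: "'g \<Rightarrow> 'a \<Rightarrow> 'a" and \<mu> :: "'g \<Rightarrow> 'a measure"
  assumes radon: "u \<in> units G \<Longrightarrow> radon_measure X (\<mu> u)"
    and full: "u \<in> units G \<Longrightarrow> measure_support X (\<mu> u) = {\<omega> \<in> topspace X. \<rho> \<omega> = u}"
    and continuous: "f \<in> Cc X \<Longrightarrow>
      continuous_map (unit_top G) euclidean (\<lambda>u. integral\<^sup>L (\<mu> u) f)"
    and equivariant: "x \<in> arrows G \<Longrightarrow> f \<in> Cc X \<Longrightarrow>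
      set_lebesgue_integral (\<mu> (gdom G x)) {\<omega> \<in> topspace X. \<rho> \<omega> = gdom G x} (\<lambda>\<omega>. f (act x \<omega>))
        = integral\<^sup>L (\<mu> (grng G x)) f"

text \<open>A left Haar system is a full equivariant measure system for left translation on the arrows.\<close>

definition haar_system :: "'g groupoid \<Rightarrow> ('g \<Rightarrow> 'g measure) \<Rightarrow> bool" where
  "haar_system G l \<longleftrightarrow> full_equivariant_system G (gtop G) (grng G) (gmul G) l"

definition normalized_haar_system :: "'g groupoid \<Rightarrow> ('g \<Rightarrow> 'g measure) \<Rightarrow> bool" where
  "normalized_haar_system G l \<longleftrightarrow>
    haar_system G l \<and> (\<forall>u\<in>units G. emeasure (l u) (space (l u)) = 1)"


section \<open>The coset space\<close>

definition quotient_topology :: "'a topology \<Rightarrow> ('a \<times> 'a) set \<Rightarrow> 'a set topology" where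
  "quotient_topology X R =
    topology (\<lambda>U. U \<subseteq> topspace X // R \<and> openin X {x \<in> topspace X. R `` {x} \<in> U})"

lemma openin_quotient_topology:
  "openin (quotient_topology X R) U \<longleftrightarrow>
    U \<subseteq> topspace X // R \<and> openin X {x \<in> topspace X. R `` {x} \<in> U}"
proof -
  have "istopology (\<lambda>U. U \<subseteq> topspace X // R \<and> openin X {x \<in> topspace X. R `` {x} \<in> U})"
    unfolding istopology_def
  proof (rule conjI; intro allI impI)
    fix S T
    assume S: "S \<subseteq> topspace X // R \<and> openin X {x \<in> topspace X. R `` {x} \<in> S}"
      and T: "T \<subseteq> topspace X // R \<and> openin X {x \<in> topspace X. R `` {x} \<in> T}"
    have "{x \<in> topspace X. R `` {x} \<in> S \<inter> T} =
        {x \<in> topspace X. R `` {x} \<in> S} \<inter> {x \<in> topspace X. R `` {x} \<in> T}"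
      by blast
    then show "S \<inter> T \<subseteq> topspace X // R \<and> openin X {x \<in> topspace X. R `` {x} \<in> S \<inter> T}"
      using S T by (auto intro: openin_Int)
  next
    fix \<K>
    assume K: "\<forall>K\<in>\<K>. K \<subseteq> topspace X // R \<and> openin X {x \<in> topspace X. R `` {x} \<in> K}"
    have "{x \<in> topspace X. R `` {x} \<in> \<Union>\<K>} = (\<Union>K\<in>\<K>. {x \<in> topspace X. R `` {x} \<in> K})"
      by blast
    then show "\<Union>\<K> \<subseteq> topspace X // R \<and> openin X {x \<in> topspace X. R `` {x} \<in> \<Union>\<K>}"
      using K by (auto intro!: openin_Union)
  qed
  then show ?thesis
    unfolding quotient_topology_def by (simp add: topology_inverse')
qed

lemma topspace_quotient_topology: "topspace (quotient_topology X R) = topspace X // R"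
proof -
  have "{x \<in> topspace X. R `` {x} \<in> topspace X // R} = topspace X"
    by (auto simp: quotient_def)
  then have "openin (quotient_topology X R) (topspace X // R)"
    by (simp add: openin_quotient_topology)
  then show ?thesis
    by (meson openin_quotient_topology openin_subset openin_topspace subset_antisym)
qed

definition coset_rel :: "'g groupoid \<Rightarrow> 'g set \<Rightarrow> ('g \<times> 'g) set" where
  "coset_rel G H = {(l, g). l \<in> arrows G \<and> g \<in> arrows G \<and>
    grng G l = grng G g \<and> gmul G (ginv G l) g \<in> H}"

definition coset :: "'g groupoid \<Rightarrow> 'g set \<Rightarrow> 'g \<Rightarrow> 'g set" where
  "coset G H x = coset_rel G H `` {x}"

definition coset_space :: "'g groupoid \<Rightarrow> 'g set \<Rightarrow> 'g set topology" where
  "coset_space G H = quotient_topology (gtop G) (coset_rel G H)"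

text \<open>Functions on the coset space are written down on a chosen representative; all those used below
  do not depend on the choice.\<close>

definition coset_rep :: "'g set \<Rightarrow> 'g" where
  "coset_rep \<omega> = (SOME x. x \<in> \<omega>)"

definition coset_rng :: "'g groupoid \<Rightarrow> 'g set \<Rightarrow> 'g" where
  "coset_rng G \<omega> = grng G (coset_rep \<omega>)"

definition coset_act :: "'g groupoid \<Rightarrow> 'g set \<Rightarrow> 'g \<Rightarrow> 'g set \<Rightarrow> 'g set" where
  "coset_act G H g \<omega> = coset G H (gmul G g (coset_rep \<omega>))"

definition coset_measure_system ::
  "'g groupoid \<Rightarrow> 'g set \<Rightarrow> ('g \<Rightarrow> 'g set measure) \<Rightarrow> bool" where
  "coset_measure_system G H \<mu> \<longleftrightarrow>
    full_equivariant_system G (coset_space G H) (coset_rng G) (coset_act G H) \<mu>"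


section \<open>Hilbert spaces with explicit carrier\<close>

text \<open>The underlying vector space is a module in the sense of HOL-Algebra; the record fields
  \<open>mult\<close> and \<open>one\<close>, inherited from rings, play no role. Inner products are linear in the first and
  conjugate linear in the second argument.\<close>

record 'v hspace = "(complex, 'v) module" +
  hip :: "'v \<Rightarrow> 'v \<Rightarrow> complex"

definition complex_ring :: "complex ring" where
  "complex_ring = \<lparr>carrier = UNIV, mult = (*), one = 1, zero = 0, add = (+)\<rparr>"

definition hnorm :: "'v hspace \<Rightarrow> 'v \<Rightarrow> real" where
  "hnorm V v = sqrt (Re (hip V v v))"

definition hdist :: "'v hspace \<Rightarrow> 'v \<Rightarrow> 'v \<Rightarrow> real" where
  "hdist V v w = hnorm V (v \<oplus>\<^bsub>V\<^esub> (- 1) \<odot>\<^bsub>V\<^esub> w)"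

definition hCauchy :: "'v hspace \<Rightarrow> (nat \<Rightarrow> 'v) \<Rightarrow> bool" where
  "hCauchy V s \<longleftrightarrow> range s \<subseteq> carrier V \<and>
    (\<forall>e>0. \<exists>N. \<forall>m\<ge>N. \<forall>n\<ge>N. hdist V (s m) (s n) < e)"

locale hilbert_space =
  fixes V :: "'v hspace"
  assumes vector_space: "Module.module complex_ring V"
    and ip_add: "\<lbrakk>x \<in> carrier V; y \<in> carrier V; z \<in> carrier V\<rbrakk> \<Longrightarrow>
      hip V (x \<oplus>\<^bsub>V\<^esub> y) z = hip V x z + hip V y z"
    and ip_smult: "\<lbrakk>x \<in> carrier V; z \<in> carrier V\<rbrakk> \<Longrightarrow> hip V (c \<odot>\<^bsub>V\<^esub> x) z = c * hip V x z"
    and ip_cnj: "\<lbrakk>x \<in> carrier V; z \<in> carrier V\<rbrakk> \<Longrightarrow> hip V z x = cnj (hip V x z)"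
    and ip_nonneg: "x \<in> carrier V \<Longrightarrow> 0 \<le> Re (hip V x x)"
    and ip_definite: "x \<in> carrier V \<Longrightarrow> hip V x x = 0 \<Longrightarrow> x = \<zero>\<^bsub>V\<^esub>"
    and complete: "hCauchy V s \<Longrightarrow> \<exists>v\<in>carrier V. (\<lambda>n. hdist V (s n) v) \<longlonglongrightarrow> 0"

definition linear_isometry :: "'v hspace \<Rightarrow> 'w hspace \<Rightarrow> ('v \<Rightarrow> 'w) \<Rightarrow> bool" where
  "linear_isometry V W T \<longleftrightarrow> T \<in> carrier V \<rightarrow> carrier W \<and>
    (\<forall>v\<in>carrier V. \<forall>w\<in>carrier V. T (v \<oplus>\<^bsub>V\<^esub> w) = T v \<oplus>\<^bsub>W\<^esub> T w) \<and>
    (\<forall>c. \<forall>v\<in>carrier V. T (c \<odot>\<^bsub>V\<^esub> v) = c \<odot>\<^bsub>W\<^esub> T v) \<and>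
    (\<forall>v\<in>carrier V. hnorm W (T v) = hnorm V v)"

definition unitary_map :: "'v hspace \<Rightarrow> 'w hspace \<Rightarrow> ('v \<Rightarrow> 'w) \<Rightarrow> bool" where
  "unitary_map V W T \<longleftrightarrow> linear_isometry V W T \<and> bij_betw T (carrier V) (carrier W) \<and>
    (\<forall>v\<in>carrier V. \<forall>w\<in>carrier V. hip W (T v) (T w) = hip V v w)"

text \<open>The Hilbert space completion of a (pre-)inner product space \<open>P\<close>: Cauchy sequences modulo
  sequences at distance tending to zero. The sequence \<open>s\<close> in \<open>completion_class P s\<close> need not lie in
  \<open>P\<close> itself, as long as the operations of \<open>P\<close> make sense for its members.\<close>

definition completion_class :: "'v hspace \<Rightarrow> (nat \<Rightarrow> 'v) \<Rightarrow> (nat \<Rightarrow> 'v) set" where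
  "completion_class P s = {t. hCauchy P t \<and> (\<lambda>n. hdist P (s n) (t n)) \<longlonglongrightarrow> 0}"

definition hcompletion :: "'v hspace \<Rightarrow> (nat \<Rightarrow> 'v) set hspace" where
  "hcompletion P =
    \<lparr>carrier = completion_class P ` {s. hCauchy P s},
     mult = undefined,
     one = undefined,
     zero = completion_class P (\<lambda>n. \<zero>\<^bsub>P\<^esub>),
     add = (\<lambda>A B. \<Union>a\<in>A. \<Union>b\<in>B. completion_class P (\<lambda>n. a n \<oplus>\<^bsub>P\<^esub> b n)),
     smult = (\<lambda>c A. \<Union>a\<in>A. completion_class P (\<lambda>n. c \<odot>\<^bsub>P\<^esub> a n)),
     hip = (\<lambda>A B. THE z. \<forall>a\<in>A. \<forall>b\<in>B. (\<lambda>n. hip P (a n) (b n)) \<longlonglongrightarrow> z)\<rparr>"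

definition completion_embed :: "'v hspace \<Rightarrow> 'v \<Rightarrow> (nat \<Rightarrow> 'v) set" where
  "completion_embed P v = completion_class P (\<lambda>n. v)"


section \<open>Continuous Hilbert bundles\<close>

record ('b, 'v) hbundle =
  fib :: "'b \<Rightarrow> 'v hspace"
  secs :: "('b \<Rightarrow> 'v) set"

definition all_sections :: "'b topology \<Rightarrow> ('b \<Rightarrow> 'v hspace) \<Rightarrow> ('b \<Rightarrow> 'v) set" where
  "all_sections X E = (\<Pi>\<^sub>E u\<in>topspace X. carrier (E u))"

definition locally_uniform_closure ::
  "'b topology \<Rightarrow> ('b \<Rightarrow> 'v hspace) \<Rightarrow> ('b \<Rightarrow> 'v) set \<Rightarrow> ('b \<Rightarrow> 'v) set" where
  "locally_uniform_closure X E S = {\<xi> \<in> all_sections X E.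
    \<forall>u\<in>topspace X. \<forall>e>0. \<exists>V. openin X V \<and> u \<in> V \<and>
      (\<exists>\<eta>\<in>S. \<forall>w\<in>V. hdist (E w) (\<xi> w) (\<eta> w) < e)}"

locale continuous_hilbert_bundle =
  fixes X :: "'b topology" and E :: "('b, 'v) hbundle"
  assumes hilbert_fib: "u \<in> topspace X \<Longrightarrow> hilbert_space (fib E u)"
    and secs_subset: "secs E \<subseteq> all_sections X (fib E)"
    and zero_sec: "(\<lambda>u\<in>topspace X. \<zero>\<^bsub>fib E u\<^esub>) \<in> secs E"
    and add_sec: "\<lbrakk>\<xi> \<in> secs E; \<eta> \<in> secs E\<rbrakk> \<Longrightarrow> (\<lambda>u\<in>topspace X. \<xi> u \<oplus>\<^bsub>fib E u\<^esub> \<eta> u) \<in> secs E"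
    and smult_sec: "\<xi> \<in> secs E \<Longrightarrow> (\<lambda>u\<in>topspace X. c \<odot>\<^bsub>fib E u\<^esub> \<xi> u) \<in> secs E"
    and dense: "\<lbrakk>u \<in> topspace X; v \<in> carrier (fib E u); 0 < e\<rbrakk> \<Longrightarrow>
      \<exists>\<xi>\<in>secs E. hdist (fib E u) (\<xi> u) v < e"
    and continuous_norm: "\<xi> \<in> secs E \<Longrightarrow>
      continuous_map X euclidean (\<lambda>u. hnorm (fib E u) (\<xi> u))"
    and locally_uniformly_closed: "locally_uniform_closure X (fib E) (secs E) \<subseteq> secs E"

definition total_top :: "'b topology \<Rightarrow> ('b, 'v) hbundle \<Rightarrow> ('b \<times> 'v) topology" where
  "total_top X E = topology_generated_by
    {{(u, v). u \<in> V \<and> v \<in> carrier (fib E u) \<and> hdist (fib E u) v (\<xi> u) < e} | V \<xi> e.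
      openin X V \<and> \<xi> \<in> secs E \<and> 0 < e}"

definition C0_secs :: "'b topology \<Rightarrow> ('b, 'v) hbundle \<Rightarrow> ('b \<Rightarrow> 'v) set" where
  "C0_secs X E = {\<xi> \<in> secs E.
    \<forall>e>0. compactin X {u \<in> topspace X. e \<le> hnorm (fib E u) (\<xi> u)}}"


section \<open>Continuous unitary representations\<close>

locale continuous_unitary_rep =
  fixes G :: "'g groupoid" and E :: "('g, 'v) hbundle" and \<pi> :: "'g \<Rightarrow> 'v \<Rightarrow> 'v"
  assumes rep_bundle: "continuous_hilbert_bundle (unit_top G) E"
    and unitary: "x \<in> arrows G \<Longrightarrow> unitary_map (fib E (gdom G x)) (fib E (grng G x)) (\<pi> x)"
    and rep_unit: "\<lbrakk>u \<in> units G; v \<in> carrier (fib E u)\<rbrakk> \<Longrightarrow> \<pi> u v = v"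
    and rep_mul: "\<lbrakk>(x, y) \<in> composable G; v \<in> carrier (fib E (gdom G y))\<rbrakk> \<Longrightarrow>
      \<pi> x (\<pi> y v) = \<pi> (gmul G x y) v"
    and rep_inv: "\<lbrakk>x \<in> arrows G; v \<in> carrier (fib E (gdom G x))\<rbrakk> \<Longrightarrow> \<pi> (ginv G x) (\<pi> x v) = v"
    and rep_continuous: "\<lbrakk>\<xi> \<in> C0_secs (unit_top G) E; \<eta> \<in> C0_secs (unit_top G) E\<rbrakk> \<Longrightarrow>
      continuous_map (gtop G) euclidean
        (\<lambda>x. hip (fib E (grng G x)) (\<pi> x (\<xi> (gdom G x))) (\<eta> (grng G x)))"

definition subrepresentation :: "'g groupoid \<Rightarrow> ('g, 'v) hbundle \<Rightarrow> ('g \<Rightarrow> 'v \<Rightarrow> 'v) \<Rightarrow>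
    ('g, 'w) hbundle \<Rightarrow> ('g \<Rightarrow> 'w \<Rightarrow> 'w) \<Rightarrow> bool" where
  "subrepresentation G E \<pi> F \<rho> \<longleftrightarrow> (\<exists>U.
    (\<forall>u\<in>units G. linear_isometry (fib E u) (fib F u) (U u)) \<and>
    (\<forall>\<xi>\<in>secs E. (\<lambda>u\<in>units G. U u (\<xi> u)) \<in> secs F) \<and>
    (\<forall>x\<in>arrows G. \<forall>v\<in>carrier (fib E (gdom G x)).
      U (grng G x) (\<pi> x v) = \<rho> x (U (gdom G x) v)))"


section \<open>The induced representation\<close>

definition ind_F0 :: "'g groupoid \<Rightarrow> 'g set \<Rightarrow> ('g, 'v) hbundle \<Rightarrow> ('g \<Rightarrow> 'v \<Rightarrow> 'v) \<Rightarrow>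
    ('g \<Rightarrow> 'v) set" where
  "ind_F0 G H E \<sigma> = {f \<in> \<Pi>\<^sub>E x\<in>arrows G. carrier (fib E (gdom G x)).
    continuous_map (gtop G) (total_top (unit_top G) E) (\<lambda>x. (gdom G x, f x)) \<and>
    compactin (coset_space G H)
      (coset G H ` (gtop G closure_of {x \<in> arrows G. f x \<noteq> \<zero>\<^bsub>fib E (gdom G x)\<^esub>})) \<and>
    (\<forall>x\<in>arrows G. \<forall>h\<in>H. gdom G x = grng G h \<longrightarrow> f (gmul G x h) = \<sigma> (ginv G h) (f x))}"

text \<open>The restrictions to \<open>rfib G u\<close> of the functions in \<open>ind_F0\<close>, with the inner product
  \<open>\<langle>f, g\<rangle>(u)\<close>. The integral is taken over the fibre over \<open>u\<close>, where the restricted functions are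
  defined and which supports \<open>\<mu> u\<close>.\<close>

definition ind_pre :: "'g groupoid \<Rightarrow> 'g set \<Rightarrow> ('g \<Rightarrow> 'g set measure) \<Rightarrow> ('g, 'v) hbundle \<Rightarrow>
    ('g \<Rightarrow> 'v \<Rightarrow> 'v) \<Rightarrow> 'g \<Rightarrow> ('g \<Rightarrow> 'v) hspace" where
  "ind_pre G H \<mu> E \<sigma> u =
    \<lparr>carrier = (\<lambda>f. restrict f (rfib G u)) ` ind_F0 G H E \<sigma>,
     mult = undefined,
     one = undefined,
     zero = (\<lambda>x\<in>rfib G u. \<zero>\<^bsub>fib E (gdom G x)\<^esub>),
     add = (\<lambda>a b. \<lambda>x\<in>rfib G u. a x \<oplus>\<^bsub>fib E (gdom G x)\<^esub> b x),
     smult = (\<lambda>c a. \<lambda>x\<in>rfib G u. c \<odot>\<^bsub>fib E (gdom G x)\<^esub> a x),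
     hip = (\<lambda>a b. set_lebesgue_integral (\<mu> u)
       {\<omega> \<in> topspace (coset_space G H). coset_rng G \<omega> = u}
       (\<lambda>\<omega>. let x = coset_rep \<omega> in hip (fib E (gdom G x)) (a x) (b x)))\<rparr>"

definition ind_fib :: "'g groupoid \<Rightarrow> 'g set \<Rightarrow> ('g \<Rightarrow> 'g set measure) \<Rightarrow> ('g, 'v) hbundle \<Rightarrow>
    ('g \<Rightarrow> 'v \<Rightarrow> 'v) \<Rightarrow> 'g \<Rightarrow> (nat \<Rightarrow> 'g \<Rightarrow> 'v) set hspace" where
  "ind_fib G H \<mu> E \<sigma> u = hcompletion (ind_pre G H \<mu> E \<sigma> u)"

definition ind_section :: "'g groupoid \<Rightarrow> 'g set \<Rightarrow> ('g \<Rightarrow> 'g set measure) \<Rightarrow> ('g, 'v) hbundle \<Rightarrow>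
    ('g \<Rightarrow> 'v \<Rightarrow> 'v) \<Rightarrow> ('g \<Rightarrow> 'v) \<Rightarrow> 'g \<Rightarrow> (nat \<Rightarrow> 'g \<Rightarrow> 'v) set" where
  "ind_section G H \<mu> E \<sigma> f =
    (\<lambda>u\<in>units G. completion_embed (ind_pre G H \<mu> E \<sigma> u) (restrict f (rfib G u)))"

text \<open>The completion of \<open>ind_F0\<close> in the norm \<open>sup\<^sub>u \<langle>f, f\<rangle>(u)\<^sup>1\<^sup>/\<^sup>2\<close>, realised as the closure of
  its image among the sections of the completed fibres with respect to uniform convergence.\<close>

definition ind_module :: "'g groupoid \<Rightarrow> 'g set \<Rightarrow> ('g \<Rightarrow> 'g set measure) \<Rightarrow> ('g, 'v) hbundle \<Rightarrow>
    ('g \<Rightarrow> 'v \<Rightarrow> 'v) \<Rightarrow> ('g \<Rightarrow> (nat \<Rightarrow> 'g \<Rightarrow> 'v) set) set" where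
  "ind_module G H \<mu> E \<sigma> = {\<xi> \<in> all_sections (unit_top G) (ind_fib G H \<mu> E \<sigma>).
    \<forall>e>0. \<exists>f\<in>ind_F0 G H E \<sigma>. \<forall>u\<in>units G.
      hdist (ind_fib G H \<mu> E \<sigma> u) (\<xi> u) (ind_section G H \<mu> E \<sigma> f u) < e}"

text \<open>A continuous field is recovered from its sections vanishing at infinity by locally uniform
  approximation; over a compact unit space the closure adds nothing to \<open>ind_module\<close>.\<close>

definition ind_bundle :: "'g groupoid \<Rightarrow> 'g set \<Rightarrow> ('g \<Rightarrow> 'g set measure) \<Rightarrow> ('g, 'v) hbundle \<Rightarrow>
    ('g \<Rightarrow> 'v \<Rightarrow> 'v) \<Rightarrow> ('g, (nat \<Rightarrow> 'g \<Rightarrow> 'v) set) hbundle" where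
  "ind_bundle G H \<mu> E \<sigma> =
    \<lparr>fib = ind_fib G H \<mu> E \<sigma>,
     secs = locally_uniform_closure (unit_top G) (ind_fib G H \<mu> E \<sigma>) (ind_module G H \<mu> E \<sigma>)\<rparr>"

definition left_translate :: "'g groupoid \<Rightarrow> 'g \<Rightarrow> ('g \<Rightarrow> 'v) \<Rightarrow> 'g \<Rightarrow> 'v" where
  "left_translate G x a = (\<lambda>y\<in>rfib G (grng G x). a (gmul G (ginv G x) y))"

text \<open>Left translation extended by continuity to the completed fibres.\<close>

definition ind_rep :: "'g groupoid \<Rightarrow> 'g set \<Rightarrow> ('g \<Rightarrow> 'g set measure) \<Rightarrow> ('g, 'v) hbundle \<Rightarrow>
    ('g \<Rightarrow> 'v \<Rightarrow> 'v) \<Rightarrow> 'g \<Rightarrow> (nat \<Rightarrow> 'g \<Rightarrow> 'v) set \<Rightarrow> (nat \<Rightarrow> 'g \<Rightarrow> 'v) set" where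
  "ind_rep G H \<mu> E \<sigma> x A =
    (\<Union>a\<in>A. completion_class (ind_pre G H \<mu> E \<sigma> (grng G x)) (\<lambda>n. left_translate G x (a n)))"

end

theory Submission
  imports Defs
begin

text \<open>Fix a unit \<open>u\<close>, and let \<open>S\<close> be the fibre of the representation \<open>\<pi>\<close> over \<open>u\<close>, \<open>K\<close> the isotropy
  group of \<open>H\<close> at \<open>u\<close> and \<open>G0\<close> that of \<open>G\<close>. Frobenius reciprocity suggests to embed \<open>\<pi>\<close> into the
  restriction of the induced representation by sending a vector \<open>v\<close> over \<open>w\<close> to a function on the
  arrows \<open>y\<close> with range \<open>w\<close>, with values over the domain of \<open>y\<close>, that depends linearly on \<open>v\<close> and
  is compatible with \<open>H\<close> on both sides. Such functions are given by an operator-valued kernel on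
  \<open>G\<close>; since \<open>H\<close> is transitive, the kernel is determined by its values on \<open>G0\<close>, where it has to
  satisfy \<open>Ker (h x k) = \<pi>(k)\<^sup>-\<^sup>1 Ker x \<pi>(h)\<^sup>-\<^sup>1\<close> for \<open>h\<close> and \<open>k\<close> in \<open>K\<close>.

  The kernel is obtained by averaging over \<open>K\<close>. An invariant mean on \<open>K\<close> comes from the Haar system
  of \<open>H\<close>, restricted to shrinking tubes around \<open>K\<close> (\<open>ex_invariant_mean\<close>). Weighting \<open>\<pi>\<close> with bump
  functions of \<open>G\<close> that shrink to the unit \<open>u\<close> gives operators \<open>Q n y\<close> that are defined for all \<open>y\<close>
  in \<open>G0\<close> and approximate multiples of \<open>\<pi>(y)\<close> when \<open>y\<close> lies in \<open>K\<close>. An average of their products,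
  summed over \<open>n\<close> with weights \<open>2\<^sup>-\<^sup>n\<^sup>-\<^sup>1\<close>, is the kernel. It is strongly continuous, and at the
  unit it is a sum of positive operators that have no common null vector except zero
  (\<open>Ker_left\<close>, \<open>Ker_right\<close>, \<open>Ker_hcont\<close>, \<open>Ker_unit_nonzero\<close>).

  Transporting the kernel along arrows of \<open>H\<close> yields a map \<open>v \<mapsto> vec_fun v\<close> from each fibre of \<open>\<pi>\<close>
  to the corresponding fibre of the induced representation. It intertwines \<open>H\<close>
  (\<open>vec_fun_translate\<close>), it takes continuous sections to elements of the space \<open>\<F>\<^sub>0\<close>
  (\<open>sec_fun_eqv\<close>), and it is injective because the measures have full support (\<open>\<tau>_pos\<close>). By
  equivariance of the measures its inner products over any unit are those over \<open>u\<close>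
  (\<open>hip_vec_fun\<close>), so its failure to be isometric is measured by a single positive operator on \<open>S\<close>.

  Polar decomposition repairs this failure. After rescaling by a constant \<open>M\<close>, the operator is
  \<open>1 - D\<close> with a positive contraction \<open>D\<close> without nonzero fixed vectors that commutes with \<open>K\<close>. The
  partial sums of the binomial series of \<open>(1 - D) powr (- 1 / 2)\<close> need not converge on \<open>S\<close>, but
  they do after applying the map: the deviation from an isometry is bounded by a moment
  \<open>\<langle>D\<^sup>n v, v\<rangle>\<close>, and the moments decrease to zero (\<open>invsqrt_form\<close>, \<open>moment_tendsto_0\<close>). The limits
  in the completed fibres define the isometry \<open>U\<close>. It maps continuous sections to continuous
  sections because, over the compact unit space, the moments tend to zero uniformly
  (\<open>moment_uniform\<close>, \<open>U_section\<close>).\<close>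

text \<open>The operations of a completion are unions over all representatives of the arguments. They reduce
  to the value at one pair of representatives as soon as the summands agree.\<close>

lemma UN_UN_constant:
  assumes "x \<in> A" "y \<in> B" "\<And>a b. a \<in> A \<Longrightarrow> b \<in> B \<Longrightarrow> F a b = K"
  shows "(\<Union>a\<in>A. \<Union>b\<in>B. F a b) = K"
  using assms by blast

lemma UN_constant_eqI:
  assumes "x \<in> A" "\<And>a. a \<in> A \<Longrightarrow> F a = K"
  shows "(\<Union>a\<in>A. F a) = K"
  using assms by blast

section \<open>Semi-inner product spaces and their completions\<close>

text \<open>The carrier of the pre-Hilbert space of the induced representation consists of restrictions of
  globally defined functions; it is not visibly stable under translation by arrows. The set
  \<open>W\<close> is a larger space on which the inner product still behaves well, so that
  distances to translated functions can be estimated. A vector enters the estimates only through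
  its inner products with other vectors.\<close>

locale semi_inner =
  fixes P :: "'v hspace" and W :: "'v set"
  assumes add_mem: "x \<in> W \<Longrightarrow> y \<in> W \<Longrightarrow> x \<oplus>\<^bsub>P\<^esub> y \<in> W"
    and smult_mem: "x \<in> W \<Longrightarrow> c \<odot>\<^bsub>P\<^esub> x \<in> W"
    and hip_add: "x \<in> W \<Longrightarrow> y \<in> W \<Longrightarrow> z \<in> W \<Longrightarrow> hip P (x \<oplus>\<^bsub>P\<^esub> y) z = hip P x z + hip P y z"
    and hip_smult: "x \<in> W \<Longrightarrow> z \<in> W \<Longrightarrow> hip P (c \<odot>\<^bsub>P\<^esub> x) z = c * hip P x z"
    and hip_cnj: "x \<in> W \<Longrightarrow> z \<in> W \<Longrightarrow> hip P z x = cnj (hip P x z)"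
    and hip_nonneg: "x \<in> W \<Longrightarrow> 0 \<le> Re (hip P x x)"
begin

abbreviation diff :: "'v \<Rightarrow> 'v \<Rightarrow> 'v" where
  "diff x y \<equiv> x \<oplus>\<^bsub>P\<^esub> (- 1) \<odot>\<^bsub>P\<^esub> y"

lemma diff_mem: "x \<in> W \<Longrightarrow> y \<in> W \<Longrightarrow> diff x y \<in> W"
  by (simp add: add_mem smult_mem)

lemma hip_add_right:
  "x \<in> W \<Longrightarrow> y \<in> W \<Longrightarrow> z \<in> W \<Longrightarrow> hip P z (x \<oplus>\<^bsub>P\<^esub> y) = hip P z x + hip P z y"
  by (metis add_mem hip_add hip_cnj complex_cnj_add)

lemma hip_smult_right:
  "x \<in> W \<Longrightarrow> z \<in> W \<Longrightarrow> hip P z (c \<odot>\<^bsub>P\<^esub> x) = cnj c * hip P z x"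
  by (metis smult_mem hip_smult hip_cnj complex_cnj_mult)

lemmas hip_simps = add_mem smult_mem hip_add hip_smult hip_add_right hip_smult_right

lemma hip_self: "x \<in> W \<Longrightarrow> hip P x x = complex_of_real (Re (hip P x x))"
  by (metis hip_cnj Reals_cnj_iff of_real_Re)

lemma hnorm_nonneg: "x \<in> W \<Longrightarrow> 0 \<le> hnorm P x"
  by (simp add: hnorm_def hip_nonneg)

lemma hnorm_sq: "x \<in> W \<Longrightarrow> (hnorm P x)\<^sup>2 = Re (hip P x x)"
  by (simp add: hnorm_def hip_nonneg)

lemma hip_self_hnorm: "x \<in> W \<Longrightarrow> hip P x x = complex_of_real ((hnorm P x)\<^sup>2)"
  using hip_self hnorm_sq by metis

lemma Cauchy_Schwarz:
  assumes x: "x \<in> W" and y: "y \<in> W"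
  shows "cmod (hip P x y) \<le> hnorm P x * hnorm P y"
proof -
  define c where "c = hip P x y"
  define a where "a = Re (hip P x x)"
  define b where "b = Re (hip P y y)"
  have ha: "hip P x x = of_real a" and hb: "hip P y y = of_real b" and hc: "hip P y x = cnj c"
    using hip_self[OF x] hip_self[OF y] hip_cnj[OF x y] by (simp_all add: a_def b_def c_def)
  have gen: "0 \<le> s\<^sup>2 * a - 2 * s * r * (cmod c)\<^sup>2 + r\<^sup>2 * (cmod c)\<^sup>2 * b" for s r :: real
  proof -
    let ?z = "of_real s \<odot>\<^bsub>P\<^esub> x \<oplus>\<^bsub>P\<^esub> (- of_real r * c) \<odot>\<^bsub>P\<^esub> y"
    have cc: "c * cnj c = of_real ((cmod c)\<^sup>2)" by (rule complex_norm_square[symmetric])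
    have "hip P ?z ?z = of_real (s\<^sup>2 * a) - of_real (2 * s * r) * (c * cnj c) + of_real (r\<^sup>2 * b) * (c * cnj c)"
      using x y by (simp add: hip_simps ha hb hc c_def[symmetric] algebra_simps power2_eq_square)
    also have "\<dots> = of_real (s\<^sup>2 * a - 2 * s * r * (cmod c)\<^sup>2 + r\<^sup>2 * (cmod c)\<^sup>2 * b)"
      unfolding cc by (simp add: algebra_simps)
    finally have "Re (hip P ?z ?z) = s\<^sup>2 * a - 2 * s * r * (cmod c)\<^sup>2 + r\<^sup>2 * (cmod c)\<^sup>2 * b" by (metis Re_complex_of_real)
    then show ?thesis using hip_nonneg[of ?z] x y by (simp add: hip_simps)
  qed
  have a0: "a \<ge> 0" and b0: "b \<ge> 0" using hip_nonneg x y by (auto simp: a_def b_def)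
  have "(cmod c)\<^sup>2 \<le> a * b"
  proof (cases "b = 0")
    case True
    have "(cmod c)\<^sup>2 = 0"
    proof (rule ccontr)
      assume "(cmod c)\<^sup>2 \<noteq> 0"
      then have p: "(cmod c)\<^sup>2 > 0" by simp
      have "2 * ((a + 1) / (cmod c)\<^sup>2) * (cmod c)\<^sup>2 = 2 * (a + 1)" using p by simp
      then show False using gen[of 1 "(a + 1) / (cmod c)\<^sup>2"] a0 unfolding True by simp
    qed
    then show ?thesis by (simp add: a0 b0)
  next
    case False
    then have "b > 0" using b0 by simp
    moreover have "0 \<le> b * (b * a - (cmod c)\<^sup>2)"
      using gen[of b 1] by (simp add: algebra_simps power2_eq_square)
    ultimately show ?thesis by (simp add: zero_le_mult_iff mult.commute)
  qed
  then have "cmod c \<le> sqrt (a * b)" by (simp add: real_le_rsqrt)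
  then show ?thesis by (simp add: hnorm_def a_def b_def c_def real_sqrt_mult)
qed

lemma hnorm_add_le:
  assumes x: "x \<in> W" and y: "y \<in> W"
  shows "hnorm P (x \<oplus>\<^bsub>P\<^esub> y) \<le> hnorm P x + hnorm P y"
proof (rule power2_le_imp_le)
  have "Re (hip P x y) \<le> hnorm P x * hnorm P y"
    using Cauchy_Schwarz[OF x y] complex_Re_le_cmod order_trans by blast
  moreover have "Re (hip P y x) = Re (hip P x y)" using hip_cnj[OF x y] by simp
  ultimately show "(hnorm P (x \<oplus>\<^bsub>P\<^esub> y))\<^sup>2 \<le> (hnorm P x + hnorm P y)\<^sup>2"
    using x y by (simp add: hnorm_sq hip_simps power2_sum)
  show "0 \<le> hnorm P x + hnorm P y" using x y by (simp add: hnorm_nonneg)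
qed

lemma hnorm_smult: "x \<in> W \<Longrightarrow> hnorm P (c \<odot>\<^bsub>P\<^esub> x) = cmod c * hnorm P x"
proof -
  assume x: "x \<in> W"
  have "hip P (c \<odot>\<^bsub>P\<^esub> x) (c \<odot>\<^bsub>P\<^esub> x) = (c * cnj c) * hip P x x"
    using x by (simp add: hip_simps)
  also have "\<dots> = of_real ((cmod c)\<^sup>2 * Re (hip P x x))"
    by (metis hip_self[OF x] complex_norm_square of_real_mult)
  finally show ?thesis by (simp add: hnorm_def real_sqrt_mult)
qed

text \<open>A stand-in for the identities of a vector space, such as \<open>a x - b x = (a - b) x\<close>:
  both sides have the same inner products with all vectors, so they have the same norm.\<close>

lemma hnorm_cong:
  assumes "a \<in> W" "b \<in> W" "\<And>w. w \<in> W \<Longrightarrow> hip P a w = hip P b w"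
  shows "hnorm P a = hnorm P b"
  using assms by (metis hnorm_def hip_cnj)

lemma hip_diff: "x \<in> W \<Longrightarrow> y \<in> W \<Longrightarrow> z \<in> W \<Longrightarrow> hip P (diff x y) z = hip P x z - hip P y z"
  by (simp add: hip_simps)

lemma hip_diff_right: "x \<in> W \<Longrightarrow> y \<in> W \<Longrightarrow> z \<in> W \<Longrightarrow> hip P z (diff x y) = hip P z x - hip P z y"
  by (simp add: hip_simps)

lemma hdist_nonneg: "x \<in> W \<Longrightarrow> y \<in> W \<Longrightarrow> 0 \<le> hdist P x y"
  by (simp add: hdist_def hnorm_nonneg diff_mem)

lemma hdist_sq:
  "x \<in> W \<Longrightarrow> y \<in> W \<Longrightarrow> (hdist P x y)\<^sup>2 = (hnorm P x)\<^sup>2 + (hnorm P y)\<^sup>2 - 2 * Re (hip P x y)"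
  using hip_cnj[of x y] by (simp add: hdist_def hnorm_sq hip_diff hip_diff_right hip_simps)

lemma hdist_self: "x \<in> W \<Longrightarrow> hdist P x x = 0"
  using hdist_sq[of x x] hnorm_sq[of x] by simp

lemma hdist_commute: "x \<in> W \<Longrightarrow> y \<in> W \<Longrightarrow> hdist P x y = hdist P y x"
proof -
  assume x: "x \<in> W" and y: "y \<in> W"
  have "(hdist P x y)\<^sup>2 = (hdist P y x)\<^sup>2"
    using x y hip_cnj[OF x y] by (simp add: hdist_sq)
  then show ?thesis using hdist_nonneg x y by (metis power2_eq_iff_nonneg)
qed

lemma hdist_triangle:
  assumes "x \<in> W" "y \<in> W" "z \<in> W"
  shows "hdist P x z \<le> hdist P x y + hdist P y z"
proof -
  have "hdist P x z = hnorm P (diff x y \<oplus>\<^bsub>P\<^esub> diff y z)"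
    unfolding hdist_def by (rule hnorm_cong) (use assms in \<open>simp_all add: hip_simps\<close>)
  also have "\<dots> \<le> hdist P x y + hdist P y z"
    unfolding hdist_def by (rule hnorm_add_le) (use assms in \<open>simp_all add: diff_mem\<close>)
  finally show ?thesis .
qed

lemma hnorm_diff_le:
  assumes "x \<in> W" "y \<in> W"
  shows "hnorm P x \<le> hnorm P y + hdist P x y"
proof -
  have "hnorm P x = hnorm P (y \<oplus>\<^bsub>P\<^esub> diff x y)"
    by (rule hnorm_cong) (use assms in \<open>simp_all add: hip_simps\<close>)
  also have "\<dots> \<le> hnorm P y + hdist P x y"
    unfolding hdist_def by (rule hnorm_add_le) (use assms in \<open>simp_all add: diff_mem\<close>)
  finally show ?thesis .
qed

lemma abs_hnorm_diff_le:
  assumes "x \<in> W" "y \<in> W"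
  shows "\<bar>hnorm P x - hnorm P y\<bar> \<le> hdist P x y"
  using hnorm_diff_le[OF assms] hnorm_diff_le[OF assms(2,1)] hdist_commute[OF assms] by linarith

lemma hdist_add:
  assumes "x \<in> W" "y \<in> W" "x' \<in> W" "y' \<in> W"
  shows "hdist P (x \<oplus>\<^bsub>P\<^esub> y) (x' \<oplus>\<^bsub>P\<^esub> y') \<le> hdist P x x' + hdist P y y'"
proof -
  have "hdist P (x \<oplus>\<^bsub>P\<^esub> y) (x' \<oplus>\<^bsub>P\<^esub> y') = hnorm P (diff x x' \<oplus>\<^bsub>P\<^esub> diff y y')"
    unfolding hdist_def by (rule hnorm_cong) (use assms in \<open>simp_all add: hip_simps\<close>)
  also have "\<dots> \<le> hdist P x x' + hdist P y y'"
    unfolding hdist_def by (rule hnorm_add_le) (use assms in \<open>simp_all add: diff_mem\<close>)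
  finally show ?thesis .
qed

lemma hdist_smult:
  assumes "x \<in> W" "y \<in> W"
  shows "hdist P (c \<odot>\<^bsub>P\<^esub> x) (c \<odot>\<^bsub>P\<^esub> y) = cmod c * hdist P x y"
proof -
  have "hdist P (c \<odot>\<^bsub>P\<^esub> x) (c \<odot>\<^bsub>P\<^esub> y) = hnorm P (c \<odot>\<^bsub>P\<^esub> diff x y)"
    unfolding hdist_def
    by (rule hnorm_cong) (use assms in \<open>simp_all add: hip_simps algebra_simps\<close>)
  then show ?thesis using assms by (simp add: hnorm_smult diff_mem hdist_def)
qed

lemma hip_diff_le:
  assumes "x \<in> W" "y \<in> W" "x' \<in> W" "y' \<in> W"
  shows "cmod (hip P x y - hip P x' y') \<le> hdist P x x' * hnorm P y + hnorm P x' * hdist P y y'"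
proof -
  have "hip P x y - hip P x' y' = hip P (diff x x') y + hip P x' (diff y y')"
    using assms by (simp add: hip_diff hip_diff_right)
  also have "cmod \<dots> \<le> cmod (hip P (diff x x') y) + cmod (hip P x' (diff y y'))"
    by (rule norm_triangle_ineq)
  also have "\<dots> \<le> hdist P x x' * hnorm P y + hnorm P x' * hdist P y y'"
    unfolding hdist_def using assms by (intro add_mono Cauchy_Schwarz diff_mem)
  finally show ?thesis .
qed

text \<open>Testing against the vector itself. The lemma bounds norms of vectors that are given by a form
  through the representation theorem of Riesz.\<close>

lemma hnorm_le_test:
  assumes "x \<in> W" "0 \<le> C" "\<And>w. w \<in> W \<Longrightarrow> cmod (hip P x w) \<le> C * hnorm P w"
  shows "hnorm P x \<le> C"
proof (cases "hnorm P x = 0")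
  case False
  then have pos: "hnorm P x > 0" using hnorm_nonneg[OF assms(1)] by simp
  have "(hnorm P x)\<^sup>2 = cmod (hip P x x)"
    using hip_self_hnorm[OF assms(1)] by (simp add: norm_power)
  also have "\<dots> \<le> C * hnorm P x" using assms by blast
  finally show ?thesis using pos by (simp add: power2_eq_square)
qed (use assms in simp)

end

locale pre_hilbert = semi_inner +
  assumes carrier_subset: "carrier P \<subseteq> W"
    and carrier_add: "x \<in> carrier P \<Longrightarrow> y \<in> carrier P \<Longrightarrow> x \<oplus>\<^bsub>P\<^esub> y \<in> carrier P"
    and carrier_smult: "x \<in> carrier P \<Longrightarrow> c \<odot>\<^bsub>P\<^esub> x \<in> carrier P"
begin

lemma hCauchy_mem: "hCauchy P s \<Longrightarrow> s n \<in> carrier P" "hCauchy P s \<Longrightarrow> s n \<in> W"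
  using carrier_subset by (auto simp: hCauchy_def)

lemma hCauchy_obtain:
  assumes "hCauchy P s" "0 < e"
  obtains N where "\<And>m n. N \<le> m \<Longrightarrow> N \<le> n \<Longrightarrow> hdist P (s m) (s n) < e"
proof -
  have "\<forall>e>0. \<exists>N. \<forall>m\<ge>N. \<forall>n\<ge>N. hdist P (s m) (s n) < e" using assms(1) by (simp add: hCauchy_def)
  then have "\<exists>N. \<forall>m\<ge>N. \<forall>n\<ge>N. hdist P (s m) (s n) < e" using assms(2) by blast
  then show ?thesis using that by auto
qed

lemma completion_class_self: "hCauchy P s \<Longrightarrow> s \<in> completion_class P s"
  using hCauchy_mem[of s] by (simp add: completion_class_def hdist_self)

text \<open>The sequences are only required to lie in \<open>W\<close>, not in the carrier: the induced
  representation acts on classes by translating representatives.\<close>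

lemma completion_class_eqI:
  assumes "\<And>n. s n \<in> W" "\<And>n. t n \<in> W" "(\<lambda>n. hdist P (s n) (t n)) \<longlonglongrightarrow> 0"
  shows "completion_class P s = completion_class P t"
proof -
  have *: "completion_class P s \<subseteq> completion_class P t"
    if s: "\<And>n. s n \<in> W" and t: "\<And>n. t n \<in> W" and st: "(\<lambda>n. hdist P (s n) (t n)) \<longlonglongrightarrow> 0" for s t
  proof
    fix a assume a: "a \<in> completion_class P s"
    then have aC: "hCauchy P a" and lim: "(\<lambda>n. hdist P (s n) (a n)) \<longlonglongrightarrow> 0"
      by (auto simp: completion_class_def)
    have aW: "a n \<in> W" for n using aC hCauchy_mem by blast
    have "(\<lambda>n. hdist P (t n) (a n)) \<longlonglongrightarrow> 0"
    proof (rule tendsto_sandwich[OF _ _ tendsto_const])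
      show "\<forall>\<^sub>F n in sequentially. 0 \<le> hdist P (t n) (a n)" using t aW by (simp add: hdist_nonneg)
      show "\<forall>\<^sub>F n in sequentially. hdist P (t n) (a n) \<le> hdist P (s n) (t n) + hdist P (s n) (a n)"
        using s t aW hdist_triangle hdist_commute by (intro always_eventually allI) metis
      show "(\<lambda>n. hdist P (s n) (t n) + hdist P (s n) (a n)) \<longlonglongrightarrow> 0"
        using tendsto_add[OF st lim] by simp
    qed
    then show "a \<in> completion_class P t" using aC by (simp add: completion_class_def)
  qed
  have "(\<lambda>n. hdist P (t n) (s n)) \<longlonglongrightarrow> 0" using assms hdist_commute by simp
  then show ?thesis using *[of s t] *[of t s] assms by blast
qed

lemma completion_class_memD:
  assumes "hCauchy P s" "a \<in> completion_class P s"
  shows "hCauchy P a" "(\<lambda>n. hdist P (s n) (a n)) \<longlonglongrightarrow> 0" "\<And>n. a n \<in> W" "\<And>n. a n \<in> carrier P"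
  using assms hCauchy_mem by (auto simp: completion_class_def)

lemma hCauchy_hnorm_bounded:
  assumes "hCauchy P s" obtains B where "\<And>n. hnorm P (s n) \<le> B" "0 \<le> B"
proof -
  obtain N where N: "\<And>m n. m \<ge> N \<Longrightarrow> n \<ge> N \<Longrightarrow> hdist P (s m) (s n) < 1"
    by (rule hCauchy_obtain[OF assms zero_less_one]) blast
  define B where "B = Max ((\<lambda>n. hnorm P (s n)) ` {..N}) + 1"
  have le: "hnorm P (s n) \<le> B" for n
  proof (cases "n \<le> N")
    case True
    then have "hnorm P (s n) \<le> Max ((\<lambda>n. hnorm P (s n)) ` {..N})" by (intro Max_ge) auto
    then show ?thesis by (simp add: B_def)
  next
    case False
    have "hnorm P (s n) \<le> hnorm P (s N) + hdist P (s n) (s N)"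
      using assms hCauchy_mem by (intro hnorm_diff_le) auto
    also have "hdist P (s n) (s N) < 1" using N False by simp
    finally have "hnorm P (s n) \<le> hnorm P (s N) + 1" by simp
    also have "hnorm P (s N) \<le> Max ((\<lambda>n. hnorm P (s n)) ` {..N})" by (intro Max_ge) auto
    finally show ?thesis by (simp add: B_def)
  qed
  moreover have "0 \<le> B" using le[of 0] hnorm_nonneg hCauchy_mem(2)[OF assms] order_trans by blast
  ultimately show ?thesis using that by blast
qed

lemma hip_convergent:
  assumes s: "hCauchy P s" and t: "hCauchy P t"
  shows "convergent (\<lambda>n. hip P (s n) (t n))"
proof -
  obtain A where A: "\<And>n. hnorm P (s n) \<le> A" "0 \<le> A" by (rule hCauchy_hnorm_bounded[OF s]) blast
  obtain B where B: "\<And>n. hnorm P (t n) \<le> B" "0 \<le> B" by (rule hCauchy_hnorm_bounded[OF t]) blast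
  have sW: "s n \<in> W" and tW: "t n \<in> W" for n using s t hCauchy_mem by blast+
  have "Cauchy (\<lambda>n. hip P (s n) (t n))"
  proof (rule metric_CauchyI)
    fix e :: real assume e: "e > 0"
    define d where "d = e / (2 * (A + B + 1))"
    have d: "d > 0" using e A B by (simp add: d_def)
    obtain M where M: "\<And>m n. m \<ge> M \<Longrightarrow> n \<ge> M \<Longrightarrow> hdist P (s m) (s n) < d"
      by (rule hCauchy_obtain[OF s d]) blast
    obtain N where N: "\<And>m n. m \<ge> N \<Longrightarrow> n \<ge> N \<Longrightarrow> hdist P (t m) (t n) < d"
      by (rule hCauchy_obtain[OF t d]) blast
    show "\<exists>K. \<forall>m\<ge>K. \<forall>n\<ge>K. dist (hip P (s m) (t m)) (hip P (s n) (t n)) < e"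
    proof (intro exI[of _ "max M N"] allI impI)
      fix m n assume mn: "m \<ge> max M N" "n \<ge> max M N"
      have "dist (hip P (s m) (t m)) (hip P (s n) (t n))
          \<le> hdist P (s m) (s n) * hnorm P (t m) + hnorm P (s n) * hdist P (t m) (t n)"
        unfolding dist_norm by (rule hip_diff_le[OF sW tW sW tW])
      also have "\<dots> \<le> d * B + A * d"
        using A B M[of m n] N[of m n] mn d
        by (intro add_mono mult_mono) (auto simp: hnorm_nonneg sW tW hdist_nonneg)
      also have "\<dots> < e"
      proof -
        have "d * (2 * (A + B + 1)) = e" using A B by (simp add: d_def)
        moreover have "d * (2 * (A + B + 1)) = 2 * (d * B + A * d) + 2 * d" by (simp add: algebra_simps)
        ultimately show ?thesis using d e by argo
      qed
      finally show "dist (hip P (s m) (t m)) (hip P (s n) (t n)) < e" .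
    qed
  qed
  then show ?thesis by (simp add: Cauchy_convergent_iff)
qed

lemma hCauchy_add:
  assumes s: "hCauchy P s" and t: "hCauchy P t"
  shows "hCauchy P (\<lambda>n. s n \<oplus>\<^bsub>P\<^esub> t n)"
  unfolding hCauchy_def
proof (intro conjI allI impI)
  show "range (\<lambda>n. s n \<oplus>\<^bsub>P\<^esub> t n) \<subseteq> carrier P"
    using hCauchy_mem(1)[OF s] hCauchy_mem(1)[OF t] carrier_add by auto
  fix e :: real assume e: "e > 0"
  obtain M where M: "\<And>m n. m \<ge> M \<Longrightarrow> n \<ge> M \<Longrightarrow> hdist P (s m) (s n) < e/2"
    by (rule hCauchy_obtain[OF s half_gt_zero[OF e]]) blast
  obtain N where N: "\<And>m n. m \<ge> N \<Longrightarrow> n \<ge> N \<Longrightarrow> hdist P (t m) (t n) < e/2"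
    by (rule hCauchy_obtain[OF t half_gt_zero[OF e]]) blast
  show "\<exists>N. \<forall>m\<ge>N. \<forall>n\<ge>N. hdist P (s m \<oplus>\<^bsub>P\<^esub> t m) (s n \<oplus>\<^bsub>P\<^esub> t n) < e"
  proof (intro exI[of _ "max M N"] allI impI)
    fix m n assume mn: "m \<ge> max M N" "n \<ge> max M N"
    have "hdist P (s m \<oplus>\<^bsub>P\<^esub> t m) (s n \<oplus>\<^bsub>P\<^esub> t n) \<le> hdist P (s m) (s n) + hdist P (t m) (t n)"
      using hCauchy_mem(2)[OF s] hCauchy_mem(2)[OF t] by (intro hdist_add)
    then show "hdist P (s m \<oplus>\<^bsub>P\<^esub> t m) (s n \<oplus>\<^bsub>P\<^esub> t n) < e"
      using M[of m n] N[of m n] mn by simp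
  qed
qed

lemma hCauchy_smult:
  assumes s: "hCauchy P s" shows "hCauchy P (\<lambda>n. c \<odot>\<^bsub>P\<^esub> s n)"
  unfolding hCauchy_def
proof (intro conjI allI impI)
  show "range (\<lambda>n. c \<odot>\<^bsub>P\<^esub> s n) \<subseteq> carrier P"
    using hCauchy_mem(1)[OF s] carrier_smult by auto
  fix e :: real assume e: "e > 0"
  then have e': "e / (cmod c + 1) > 0" by (simp add: add_nonneg_pos)
  obtain M where M: "\<And>m n. m \<ge> M \<Longrightarrow> n \<ge> M \<Longrightarrow> hdist P (s m) (s n) < e / (cmod c + 1)"
    by (rule hCauchy_obtain[OF s e']) blast
  show "\<exists>N. \<forall>m\<ge>N. \<forall>n\<ge>N. hdist P (c \<odot>\<^bsub>P\<^esub> s m) (c \<odot>\<^bsub>P\<^esub> s n) < e"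
  proof (intro exI[of _ M] allI impI)
    fix m n assume mn: "m \<ge> M" "n \<ge> M"
    have "hdist P (c \<odot>\<^bsub>P\<^esub> s m) (c \<odot>\<^bsub>P\<^esub> s n) = cmod c * hdist P (s m) (s n)"
      using hCauchy_mem(2)[OF s] by (intro hdist_smult)
    also have "\<dots> \<le> (cmod c + 1) * hdist P (s m) (s n)"
      using hCauchy_mem(2)[OF s] by (simp add: mult_right_mono hdist_nonneg)
    also have "\<dots> < e" using M[OF mn] by (simp add: pos_less_divide_eq add_nonneg_pos mult.commute)
    finally show "hdist P (c \<odot>\<^bsub>P\<^esub> s m) (c \<odot>\<^bsub>P\<^esub> s n) < e" .
  qed
qed

lemma hcompletion_add:
  assumes s: "hCauchy P s" and t: "hCauchy P t"
  shows "completion_class P s \<oplus>\<^bsub>hcompletion P\<^esub> completion_class P t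
    = completion_class P (\<lambda>n. s n \<oplus>\<^bsub>P\<^esub> t n)"
proof -
  have "completion_class P (\<lambda>n. a n \<oplus>\<^bsub>P\<^esub> b n) = completion_class P (\<lambda>n. s n \<oplus>\<^bsub>P\<^esub> t n)"
    if a: "a \<in> completion_class P s" and b: "b \<in> completion_class P t" for a b
  proof (rule completion_class_eqI[symmetric])
    note A = completion_class_memD[OF s a] and B = completion_class_memD[OF t b]
    note S = hCauchy_mem(2)[OF s] and T = hCauchy_mem(2)[OF t]
    show "s n \<oplus>\<^bsub>P\<^esub> t n \<in> W" "a n \<oplus>\<^bsub>P\<^esub> b n \<in> W" for n
      using A B S T by (auto intro: add_mem)
    show "(\<lambda>n. hdist P (s n \<oplus>\<^bsub>P\<^esub> t n) (a n \<oplus>\<^bsub>P\<^esub> b n)) \<longlonglongrightarrow> 0"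
    proof (rule tendsto_sandwich[OF _ _ tendsto_const])
      show "(\<lambda>n. hdist P (s n) (a n) + hdist P (t n) (b n)) \<longlonglongrightarrow> 0"
        using tendsto_add[OF A(2) B(2)] by simp
      show "\<forall>\<^sub>F n in sequentially. 0 \<le> hdist P (s n \<oplus>\<^bsub>P\<^esub> t n) (a n \<oplus>\<^bsub>P\<^esub> b n)"
        using A B S T by (intro always_eventually allI hdist_nonneg add_mem)
      show "\<forall>\<^sub>F n in sequentially. hdist P (s n \<oplus>\<^bsub>P\<^esub> t n) (a n \<oplus>\<^bsub>P\<^esub> b n)
          \<le> hdist P (s n) (a n) + hdist P (t n) (b n)"
        using A B S T by (intro always_eventually allI hdist_add)
    qed
  qed
  then have "(\<Union>a\<in>completion_class P s. \<Union>b\<in>completion_class P t. completion_class P (\<lambda>n. a n \<oplus>\<^bsub>P\<^esub> b n))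
      = completion_class P (\<lambda>n. s n \<oplus>\<^bsub>P\<^esub> t n)"
    by (intro UN_UN_constant[OF completion_class_self[OF s] completion_class_self[OF t]])
  then show ?thesis by (simp add: hcompletion_def)
qed

lemma hcompletion_smult:
  assumes s: "hCauchy P s"
  shows "c \<odot>\<^bsub>hcompletion P\<^esub> completion_class P s = completion_class P (\<lambda>n. c \<odot>\<^bsub>P\<^esub> s n)"
proof -
  have "completion_class P (\<lambda>n. c \<odot>\<^bsub>P\<^esub> a n) = completion_class P (\<lambda>n. c \<odot>\<^bsub>P\<^esub> s n)"
    if a: "a \<in> completion_class P s" for a
  proof (rule completion_class_eqI[symmetric])
    note A = completion_class_memD[OF s a]
    note S = hCauchy_mem(2)[OF s]
    show "c \<odot>\<^bsub>P\<^esub> s n \<in> W" "c \<odot>\<^bsub>P\<^esub> a n \<in> W" for n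
      using A S by (auto intro: smult_mem)
    have "(\<lambda>n. cmod c * hdist P (s n) (a n)) \<longlonglongrightarrow> 0"
      using tendsto_mult_left[OF A(2), of "cmod c"] by simp
    then show "(\<lambda>n. hdist P (c \<odot>\<^bsub>P\<^esub> s n) (c \<odot>\<^bsub>P\<^esub> a n)) \<longlonglongrightarrow> 0"
      using A S by (simp add: hdist_smult)
  qed
  then have "(\<Union>a\<in>completion_class P s. completion_class P (\<lambda>n. c \<odot>\<^bsub>P\<^esub> a n))
      = completion_class P (\<lambda>n. c \<odot>\<^bsub>P\<^esub> s n)"
    by (intro UN_constant_eqI[OF completion_class_self[OF s]])
  then show ?thesis by (simp add: hcompletion_def)
qed

lemma hcompletion_hip:
  assumes s: "hCauchy P s" and t: "hCauchy P t"
    and lim: "(\<lambda>n. hip P (s n) (t n)) \<longlonglongrightarrow> l"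
  shows "hip (hcompletion P) (completion_class P s) (completion_class P t) = l"
proof -
  have conv: "(\<lambda>n. hip P (a n) (b n)) \<longlonglongrightarrow> l"
    if a: "a \<in> completion_class P s" and b: "b \<in> completion_class P t" for a b
  proof -
    note A = completion_class_memD[OF s a] and B = completion_class_memD[OF t b]
    note S = hCauchy_mem(2)[OF s] and T = hCauchy_mem(2)[OF t]
    obtain C where C: "\<And>n. hnorm P (t n) \<le> C" "0 \<le> C" by (rule hCauchy_hnorm_bounded[OF t]) blast
    obtain D where D: "\<And>n. hnorm P (a n) \<le> D" "0 \<le> D" by (rule hCauchy_hnorm_bounded[OF A(1)]) blast
    have "(\<lambda>n. hip P (s n) (t n) - hip P (a n) (b n)) \<longlonglongrightarrow> 0"
    proof (rule Lim_null_comparison)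
      show "(\<lambda>n. hdist P (s n) (a n) * C + D * hdist P (t n) (b n)) \<longlonglongrightarrow> 0"
        using tendsto_add[OF tendsto_mult_right[OF A(2), of C] tendsto_mult_left[OF B(2), of D]] by simp
      have "cmod (hip P (s n) (t n) - hip P (a n) (b n))
          \<le> hdist P (s n) (a n) * C + D * hdist P (t n) (b n)" for n
        by (rule order_trans[OF hip_diff_le[OF S T A(3) B(3)]])
          (use C D S T A B in \<open>auto intro!: add_mono mult_mono hdist_nonneg hnorm_nonneg\<close>)
      then show "\<forall>\<^sub>F n in sequentially. cmod (hip P (s n) (t n) - hip P (a n) (b n))
          \<le> hdist P (s n) (a n) * C + D * hdist P (t n) (b n)" by simp
    qed
    then have "(\<lambda>n. hip P (s n) (t n) - (hip P (s n) (t n) - hip P (a n) (b n))) \<longlonglongrightarrow> l - 0"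
      by (intro tendsto_diff lim)
    then show ?thesis by simp
  qed
  have "(THE z. \<forall>a\<in>completion_class P s. \<forall>b\<in>completion_class P t.
      (\<lambda>n. hip P (a n) (b n)) \<longlonglongrightarrow> z) = l"
  proof (rule the_equality)
    show "\<forall>a\<in>completion_class P s. \<forall>b\<in>completion_class P t. (\<lambda>n. hip P (a n) (b n)) \<longlonglongrightarrow> l"
      using conv by blast
    fix z assume "\<forall>a\<in>completion_class P s. \<forall>b\<in>completion_class P t. (\<lambda>n. hip P (a n) (b n)) \<longlonglongrightarrow> z"
    then have "(\<lambda>n. hip P (s n) (t n)) \<longlonglongrightarrow> z"
      using completion_class_self[OF s] completion_class_self[OF t] by blast
    then show "z = l" using lim LIMSEQ_unique by blast
  qed
  then show ?thesis by (simp add: hcompletion_def)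
qed

lemma hcompletion_hnorm:
  assumes s: "hCauchy P s" and lim: "(\<lambda>n. hnorm P (s n)) \<longlonglongrightarrow> l"
  shows "hnorm (hcompletion P) (completion_class P s) = l"
proof -
  have "hip P (s n) (s n) = of_real ((hnorm P (s n))\<^sup>2)" for n
    using hip_self_hnorm hCauchy_mem(2)[OF s] by blast
  moreover have "(\<lambda>n. complex_of_real ((hnorm P (s n))\<^sup>2)) \<longlonglongrightarrow> of_real (l\<^sup>2)"
    by (intro tendsto_intros lim)
  ultimately have "(\<lambda>n. hip P (s n) (s n)) \<longlonglongrightarrow> of_real (l\<^sup>2)" by simp
  from hcompletion_hip[OF s s this]
  have "hnorm (hcompletion P) (completion_class P s) = \<bar>l\<bar>" by (simp add: hnorm_def)
  moreover have "0 \<le> l"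
    using lim hnorm_nonneg hCauchy_mem(2)[OF s] by (intro LIMSEQ_le_const[OF lim]) auto
  ultimately show ?thesis by simp
qed

lemma hnorm_convergent:
  assumes s: "hCauchy P s" shows "convergent (\<lambda>n. hnorm P (s n))"
proof -
  obtain l where "(\<lambda>n. hip P (s n) (s n)) \<longlonglongrightarrow> l"
    using hip_convergent[OF s s] by (auto simp: convergent_def)
  then have "(\<lambda>n. sqrt (Re (hip P (s n) (s n)))) \<longlonglongrightarrow> sqrt (Re l)"
    by (intro tendsto_intros)
  then show ?thesis by (auto simp: hnorm_def convergent_def)
qed

lemma hcompletion_hdist_le:
  assumes s: "hCauchy P s" and t: "hCauchy P t"
    and le: "\<forall>\<^sub>F n in sequentially. hdist P (s n) (t n) \<le> B"
  shows "hdist (hcompletion P) (completion_class P s) (completion_class P t) \<le> B"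
proof -
  let ?d = "\<lambda>n. diff (s n) (t n)"
  have d: "hCauchy P ?d" by (intro hCauchy_add hCauchy_smult s t)
  obtain l where l: "(\<lambda>n. hnorm P (?d n)) \<longlonglongrightarrow> l"
    using hnorm_convergent[OF d] by (auto simp: convergent_def)
  have "hdist (hcompletion P) (completion_class P s) (completion_class P t)
      = hnorm (hcompletion P) (completion_class P ?d)"
    unfolding hdist_def by (simp only: hcompletion_smult[OF t] hcompletion_add[OF s hCauchy_smult[OF t]])
  also have "\<dots> = l" by (rule hcompletion_hnorm[OF d l])
  also have "l \<le> B"
    using l le by (intro tendsto_upperbound[OF l]) (auto simp: hdist_def)
  finally show ?thesis .
qed

lemma hCauchy_const: "v \<in> carrier P \<Longrightarrow> hCauchy P (\<lambda>n. v)"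
  using carrier_subset by (auto simp: hCauchy_def hdist_self)

end

section \<open>Hilbert spaces with explicit carrier\<close>

context hilbert_space
begin

abbreviation C :: "'v set" where "C \<equiv> carrier V"

lemma module_V: "Module.module complex_ring V"
  by (rule vector_space)

lemma add_C: "x \<in> C \<Longrightarrow> y \<in> C \<Longrightarrow> x \<oplus>\<^bsub>V\<^esub> y \<in> C"
  using module_V by (meson abelian_group_def abelian_monoid.a_closed module.axioms(2))

lemma smult_C: "x \<in> C \<Longrightarrow> c \<odot>\<^bsub>V\<^esub> x \<in> C"
  using module.smult_closed[OF module_V, of c x] by (simp add: complex_ring_def)

lemma zero_C: "\<zero>\<^bsub>V\<^esub> \<in> C"
  using module_V by (meson abelian_group_def abelian_monoid.zero_closed module.axioms(2))

sublocale semi_inner V C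
  by unfold_locales (auto intro: add_C smult_C ip_add ip_smult ip_cnj ip_nonneg)

lemma hip_zero: "w \<in> C \<Longrightarrow> hip V \<zero>\<^bsub>V\<^esub> w = 0"
proof -
  assume w: "w \<in> C"
  have "\<zero>\<^bsub>V\<^esub> \<oplus>\<^bsub>V\<^esub> \<zero>\<^bsub>V\<^esub> = \<zero>\<^bsub>V\<^esub>"
    using module_V zero_C by (meson abelian_group_def abelian_monoid.l_zero module.axioms(2))
  then have "hip V \<zero>\<^bsub>V\<^esub> w = hip V \<zero>\<^bsub>V\<^esub> w + hip V \<zero>\<^bsub>V\<^esub> w"
    using ip_add[OF zero_C zero_C w] by simp
  then show ?thesis by simp
qed

lemma hnorm_zero: "hnorm V \<zero>\<^bsub>V\<^esub> = 0"
  by (simp add: hnorm_def hip_zero zero_C)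

lemma hnorm_eq_0: "x \<in> C \<Longrightarrow> hnorm V x = 0 \<Longrightarrow> x = \<zero>\<^bsub>V\<^esub>"
  using hip_self_hnorm[of x] ip_definite[of x] by simp

lemma hdist_zero: "x \<in> C \<Longrightarrow> hdist V x \<zero>\<^bsub>V\<^esub> = hnorm V x"
proof -
  assume x: "x \<in> C"
  have "hip V x \<zero>\<^bsub>V\<^esub> = 0" using hip_zero[OF x] ip_cnj[OF zero_C x] by simp
  then have "(hdist V x \<zero>\<^bsub>V\<^esub>)\<^sup>2 = (hnorm V x)\<^sup>2"
    using hdist_sq[OF x zero_C] by (simp add: hnorm_zero)
  then show ?thesis by (metis hdist_nonneg hnorm_nonneg power2_eq_iff_nonneg x zero_C)
qed

lemma hdist_eq_0:
  assumes x: "x \<in> C" and y: "y \<in> C" and 0: "hdist V x y = 0" shows "x = y"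
proof -
  have ab: "abelian_group V" and cr: "cring complex_ring"
    using module_V by (auto dest: module.axioms)
  have my: "(- 1) \<odot>\<^bsub>V\<^esub> y \<in> C" using smult_C[OF y] .
  have z: "x \<oplus>\<^bsub>V\<^esub> (- 1) \<odot>\<^bsub>V\<^esub> y = \<zero>\<^bsub>V\<^esub>"
    by (rule hnorm_eq_0) (use 0 x y in \<open>auto simp: hdist_def hip_simps\<close>)
  have "(- 1) \<odot>\<^bsub>V\<^esub> y \<oplus>\<^bsub>V\<^esub> y = (- 1) \<odot>\<^bsub>V\<^esub> y \<oplus>\<^bsub>V\<^esub> 1 \<odot>\<^bsub>V\<^esub> y"
    using module.smult_one[OF module_V y] by (simp add: complex_ring_def)
  also have "\<dots> = (- 1 + 1) \<odot>\<^bsub>V\<^esub> y"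
    using module.smult_l_distr[OF module_V, of "-1" 1 y] y by (simp add: complex_ring_def)
  also have "\<dots> = \<zero>\<^bsub>V\<^esub>"
    using module.smult_l_null[OF module_V y] by (simp add: complex_ring_def)
  finally have zy: "(- 1) \<odot>\<^bsub>V\<^esub> y \<oplus>\<^bsub>V\<^esub> y = \<zero>\<^bsub>V\<^esub>" .
  interpret abelian_group V by (rule ab)
  have "x = x \<oplus>\<^bsub>V\<^esub> ((- 1) \<odot>\<^bsub>V\<^esub> y \<oplus>\<^bsub>V\<^esub> y)" using x by (simp add: zy)
  also have "\<dots> = (x \<oplus>\<^bsub>V\<^esub> (- 1) \<odot>\<^bsub>V\<^esub> y) \<oplus>\<^bsub>V\<^esub> y" using x y my by (simp add: a_assoc)
  also have "\<dots> = y" using y by (simp add: z)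
  finally show ?thesis .
qed

lemma vec_eqI:
  assumes "x \<in> C" "y \<in> C" "\<And>w. w \<in> C \<Longrightarrow> hip V x w = hip V y w"
  shows "x = y"
proof (rule hdist_eq_0)
  have "(hdist V x y)\<^sup>2 = Re (hip V (diff x y) (diff x y))"
    using assms by (simp add: hdist_def hnorm_sq diff_mem)
  also have "\<dots> = 0" using assms diff_mem by (subst hip_diff) auto
  finally show "hdist V x y = 0" by simp
qed (use assms in auto)

text \<open>The vector is the minimiser of \<open>\<parallel>v\<parallel>\<^sup>2 - 2 Re (f v)\<close>; the parallelogram law makes a minimising
  sequence Cauchy.\<close>

lemma Riesz_representation:
  assumes f_add: "\<And>x y. x \<in> C \<Longrightarrow> y \<in> C \<Longrightarrow> f (x \<oplus>\<^bsub>V\<^esub> y) = f x + f y"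
    and f_smult: "\<And>c x. x \<in> C \<Longrightarrow> f (c \<odot>\<^bsub>V\<^esub> x) = cnj c * f x"
    and f_le: "\<And>x. x \<in> C \<Longrightarrow> cmod (f x) \<le> B * hnorm V x"
  shows "\<exists>z\<in>C. \<forall>w\<in>C. hip V z w = f w"
proof -
  define Q where "Q v = (hnorm V v)\<^sup>2 - 2 * Re (f v)" for v
  have Q_ge: "- B\<^sup>2 \<le> Q v" if v: "v \<in> C" for v
  proof -
    have "Re (f v) \<le> B * hnorm V v" using f_le[OF v] complex_Re_le_cmod order_trans by blast
    moreover have "0 \<le> (hnorm V v - B)\<^sup>2" by simp
    ultimately show ?thesis unfolding Q_def by (simp add: power2_diff mult.commute)
  qed
  define m where "m = Inf (Q ` C)"
  have bdd: "bdd_below (Q ` C)" using Q_ge by (intro bdd_belowI2)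
  have m_le: "m \<le> Q v" if "v \<in> C" for v
    unfolding m_def using that bdd by (intro cInf_lower) auto
  have "\<exists>v\<in>C. Q v < m + 1 / real (Suc n)" for n
  proof -
    have "Inf (Q ` C) < m + 1 / real (Suc n)" by (simp add: m_def)
    then show ?thesis using zero_C bdd cInf_less_iff[of "Q ` C"] by auto
  qed
  then obtain s where sC: "\<And>n. s n \<in> C" and s: "\<And>n. Q (s n) < m + 1 / real (Suc n)" by metis
  have par: "(hdist V x y)\<^sup>2 \<le> 2 * (Q x + Q y - 2 * m)" if x: "x \<in> C" and y: "y \<in> C" for x y
  proof -
    let ?w = "(1/2) \<odot>\<^bsub>V\<^esub> (x \<oplus>\<^bsub>V\<^esub> y)"
    have "hip V y x = cnj (hip V x y)" using ip_cnj x y by blast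
    then have 1: "(hnorm V ?w)\<^sup>2 = ((hnorm V x)\<^sup>2 + (hnorm V y)\<^sup>2 + 2 * Re (hip V x y)) / 4"
      using x y by (simp add: hnorm_sq hip_simps add_divide_distrib)
    have 2: "f ?w = (f x + f y) / 2" using x y by (simp add: f_smult f_add hip_simps)
    have "m \<le> Q ?w" using x y by (intro m_le) (simp add: hip_simps)
    then show ?thesis unfolding hdist_sq[OF x y] Q_def 1 2 by (simp add: field_simps)
  qed
  have "hCauchy V s"
    unfolding hCauchy_def
  proof (intro conjI allI impI)
    show "range s \<subseteq> C" using sC by auto
    fix e :: real assume e: "e > 0"
    obtain N where N: "1 / real (Suc N) < e\<^sup>2 / 4" using e nat_approx_posE by (metis zero_less_divide_iff zero_less_numeral zero_less_power)
    show "\<exists>N. \<forall>m\<ge>N. \<forall>n\<ge>N. hdist V (s m) (s n) < e"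
    proof (intro exI[of _ N] allI impI)
      fix i j assume "i \<ge> N" "j \<ge> N"
      then have "1 / real (Suc i) \<le> 1 / real (Suc N)" "1 / real (Suc j) \<le> 1 / real (Suc N)"
        by (auto simp: frac_le)
      then have "(hdist V (s i) (s j))\<^sup>2 < e\<^sup>2"
        using par[OF sC sC, of i j] s[of i] s[of j] N by simp
      then show "hdist V (s i) (s j) < e" using e by (simp add: power_less_imp_less_base)
    qed
  qed
  then obtain z where z: "z \<in> C" and lim: "(\<lambda>n. hdist V (s n) z) \<longlonglongrightarrow> 0"
    using complete by blast
  have "(\<lambda>n. hnorm V (s n) - hnorm V z) \<longlonglongrightarrow> 0"
    by (rule Lim_null_comparison[OF _ lim]) (use sC z abs_hnorm_diff_le in auto)
  then have n: "(\<lambda>n. hnorm V (s n)) \<longlonglongrightarrow> hnorm V z" using LIM_zero_iff by blast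
  have "(\<lambda>n. f (s n) - f z) \<longlonglongrightarrow> 0"
  proof (rule Lim_null_comparison)
    have "f (s n) - f z = f (diff (s n) z)" for n
      using sC z by (simp add: f_add f_smult hip_simps)
    then show "\<forall>\<^sub>F n in sequentially. norm (f (s n) - f z) \<le> B * hdist V (s n) z"
      using f_le sC z by (auto simp: hdist_def diff_mem)
    show "(\<lambda>n. B * hdist V (s n) z) \<longlonglongrightarrow> 0" using tendsto_mult_left[OF lim, of B] by simp
  qed
  then have f: "(\<lambda>n. f (s n)) \<longlonglongrightarrow> f z" using LIM_zero_iff by blast
  have "(\<lambda>n. Q (s n)) \<longlonglongrightarrow> Q z" unfolding Q_def by (intro tendsto_intros n f)
  moreover have "(\<lambda>n. m + 1 / real (Suc n)) \<longlonglongrightarrow> m + 0"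
    by (intro tendsto_intros LIMSEQ_Suc[OF lim_1_over_n])
  ultimately have "Q z \<le> m + 0"
    using s by (intro LIMSEQ_le[of "\<lambda>n. Q (s n)" "Q z"]) (auto intro: less_imp_le)
  then have Qz: "Q z \<le> Q v" if "v \<in> C" for v using m_le[OF that] by simp
  have "hip V z w = f w" if w: "w \<in> C" for w
  proof -
    define d where "d = hip V z w - f w"
    define t where "t = 1 / ((hnorm V w)\<^sup>2 + 1)"
    have wz: "hip V w z = cnj (hip V z w)" using ip_cnj z w by blast
    have "0 < (hnorm V w)\<^sup>2 + 1" by (simp add: add_nonneg_pos)
    then have t: "t > 0" and tw: "t * (hnorm V w)\<^sup>2 < 1" by (simp_all add: t_def field_simps)
    let ?c = "- of_real t * d"
    let ?v = "z \<oplus>\<^bsub>V\<^esub> ?c \<odot>\<^bsub>V\<^esub> w"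
    have v: "?v \<in> C" using z w by (simp add: hip_simps)
    have cc: "cnj d * d = of_real ((cmod d)\<^sup>2)" by (metis complex_norm_square mult.commute)
    have "hip V ?v ?v = hip V z z + (cnj ?c * hip V z w + cnj (cnj ?c * hip V z w)) + of_real (t\<^sup>2) * (cnj d * d) * hip V w w"
      using z w by (simp add: hip_simps wz algebra_simps power2_eq_square)
    then have "complex_of_real ((hnorm V ?v)\<^sup>2)
        = of_real ((hnorm V z)\<^sup>2 + 2 * Re (cnj ?c * hip V z w) + t\<^sup>2 * (cmod d)\<^sup>2 * (hnorm V w)\<^sup>2)"
      unfolding cc complex_add_cnj hip_self_hnorm[OF z] hip_self_hnorm[OF w] hip_self_hnorm[OF v]
      by (simp only: of_real_add of_real_mult)
    then have "(hnorm V ?v)\<^sup>2 = (hnorm V z)\<^sup>2 + 2 * Re (cnj ?c * hip V z w) + t\<^sup>2 * (cmod d)\<^sup>2 * (hnorm V w)\<^sup>2"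
      by (simp only: of_real_eq_iff)
    moreover have "f ?v = f z + cnj ?c * f w" using z w by (simp add: f_add f_smult hip_simps)
    then have "Re (f ?v) = Re (f z) + Re (cnj ?c * f w)" by (simp only: plus_complex.sel)
    moreover have "Re (cnj ?c * d) = Re (cnj ?c * hip V z w) - Re (cnj ?c * f w)"
      by (simp only: d_def right_diff_distrib minus_complex.sel)
    ultimately have "Q ?v = Q z + 2 * Re (cnj ?c * d) + t\<^sup>2 * (cmod d)\<^sup>2 * (hnorm V w)\<^sup>2"
      unfolding Q_def by linarith
    also have "cnj ?c * d = of_real (- t * (cmod d)\<^sup>2)" using cc by simp
    finally have "0 \<le> - 2 * t * (cmod d)\<^sup>2 + t\<^sup>2 * (cmod d)\<^sup>2 * (hnorm V w)\<^sup>2"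
      using Qz[OF v] by simp
    also have "\<dots> = t * (cmod d)\<^sup>2 * (t * (hnorm V w)\<^sup>2 - 2)" by (simp add: algebra_simps power2_eq_square)
    finally have "(cmod d)\<^sup>2 = 0"
      using t tw by (smt (verit) mult_pos_neg mult_pos_pos zero_le_power2)
    then show ?thesis by (simp add: d_def)
  qed
  then show ?thesis using z by blast
qed

text \<open>A map with an adjoint is linear, because vectors are determined by their pairings.\<close>

lemma adjoint_imp_linear:
  assumes A: "\<And>x. x \<in> C \<Longrightarrow> A x \<in> C" and B: "\<And>x. x \<in> C \<Longrightarrow> B x \<in> C"
    and ad: "\<And>x w. x \<in> C \<Longrightarrow> w \<in> C \<Longrightarrow> hip V (A x) w = hip V x (B w)"
  shows "\<And>x y. x \<in> C \<Longrightarrow> y \<in> C \<Longrightarrow> A (x \<oplus>\<^bsub>V\<^esub> y) = A x \<oplus>\<^bsub>V\<^esub> A y"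
    and "\<And>c x. x \<in> C \<Longrightarrow> A (c \<odot>\<^bsub>V\<^esub> x) = c \<odot>\<^bsub>V\<^esub> A x"
  by (rule vec_eqI; simp add: assms hip_simps)+

end

section \<open>The inverse square root of a positive operator\<close>

text \<open>The coefficients of the power series of \<open>(1 - s) powr (- 1 / 2)\<close>. Only two of their
  properties matter below: they are nonnegative, and their Cauchy square is the geometric series.\<close>

definition invsqrt_coeff :: "nat \<Rightarrow> real" where
  "invsqrt_coeff k = (- 1) ^ k * ((- 1 / 2) gchoose k)"

lemma invsqrt_coeff_0: "invsqrt_coeff 0 = 1"
  by (simp add: invsqrt_coeff_def)

lemma invsqrt_coeff_nonneg: "0 \<le> invsqrt_coeff k"
proof (induction k)
  case (Suc k)
  have "(- 1 / 2 :: real) * ((- 1 / 2) gchoose k)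
      = of_nat k * ((- 1 / 2) gchoose k) + of_nat (Suc k) * ((- 1 / 2) gchoose (Suc k))"
    by (rule gbinomial_mult_1)
  then have rec: "((- 1 / 2 :: real) gchoose (Suc k)) * real (Suc k) = - (real k + 1/2) * ((- 1 / 2) gchoose k)"
    by (simp add: algebra_simps)
  have "invsqrt_coeff (Suc k) * real (Suc k) = - ((- 1) ^ k) * (((- 1 / 2) gchoose (Suc k)) * real (Suc k))"
    by (simp add: invsqrt_coeff_def)
  also have "\<dots> = (real k + 1/2) * invsqrt_coeff k"
    unfolding rec by (simp add: invsqrt_coeff_def algebra_simps)
  also have "\<dots> \<ge> 0" using Suc by simp
  finally show ?case by (simp add: zero_le_mult_iff)
qed (simp add: invsqrt_coeff_def)

text \<open>Vandermonde convolution: the square of \<open>(1 - s) powr (- 1 / 2)\<close> is \<open>1 / (1 -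
  s)\<close>.\<close>

lemma invsqrt_coeff_convolution: "(\<Sum>k\<le>n. invsqrt_coeff k * invsqrt_coeff (n - k)) = 1"
proof -
  have "(\<Sum>k\<le>n. invsqrt_coeff k * invsqrt_coeff (n - k))
      = (\<Sum>k\<le>n. (- 1) ^ n * (((- 1 / 2) gchoose k) * ((- 1 / 2) gchoose (n - k))))"
  proof (rule sum.cong)
    fix k assume "k \<in> {..n}"
    then have "(- 1 :: real) ^ n = (- 1) ^ k * (- 1) ^ (n - k)" by (simp flip: power_add)
    then show "invsqrt_coeff k * invsqrt_coeff (n - k)
        = (- 1) ^ n * (((- 1 / 2) gchoose k) * ((- 1 / 2) gchoose (n - k)))"
      by (simp add: invsqrt_coeff_def)
  qed simp
  also have "\<dots> = (- 1) ^ n * (\<Sum>k\<le>n. ((- 1 / 2) gchoose k) * ((- 1 / 2) gchoose (n - k)))"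
    by (simp add: sum_distrib_left)
  also have "(\<Sum>k\<le>n. ((- 1 / 2 :: real) gchoose k) * ((- 1 / 2) gchoose (n - k))) = (- 1 gchoose n)"
    using gbinomial_Vandermonde[of "- 1 / 2 :: real" "- 1 / 2" n] by (simp add: atLeast0AtMost)
  also have "(- 1 :: real) ^ n * (- 1 gchoose n) = 1"
    using gbinomial_minus[of "1::real" n] by (simp add: binomial_gbinomial[symmetric] flip: power_mult_distrib)
  finally show ?thesis .
qed

text \<open>Collecting the terms with \<open>k + l = j\<close> produces \<open>g j\<close>. The square
  \<open>{..n} \<times> {..m}\<close> contains the triangle \<open>k + l \<le> min n m\<close> and
  is contained in the triangle \<open>k + l \<le> n + m\<close>.\<close>

lemma sum_convolution_square_bounds:
  fixes b g :: "nat \<Rightarrow> real"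
  assumes b: "\<And>k. 0 \<le> b k" and conv: "\<And>n. (\<Sum>k\<le>n. b k * b (n - k)) = 1" and g: "\<And>k. 0 \<le> g k"
  shows "(\<Sum>j\<le>min n m. g j) \<le> (\<Sum>k\<le>n. \<Sum>l\<le>m. b k * b l * g (k + l))"
    and "(\<Sum>k\<le>n. \<Sum>l\<le>m. b k * b l * g (k + l)) \<le> (\<Sum>j\<le>n + m. g j)"
proof -
  let ?f = "\<lambda>(k, l). b k * b l * g (k + l)"
  have tri: "sum ?f {(k, l). k + l \<le> p} = (\<Sum>j\<le>p. g j)" for p
  proof -
    have "sum ?f {(k, l). k + l \<le> p} = (\<Sum>j\<le>p. \<Sum>k\<le>j. b k * b (j - k) * g (k + (j - k)))"
      by (rule sum.triangle_reindex_eq)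
    also have "\<dots> = (\<Sum>j\<le>p. (\<Sum>k\<le>j. b k * b (j - k)) * g j)"
      by (simp add: sum_distrib_right)
    finally show ?thesis by (simp add: conv)
  qed
  have fin: "finite {(k, l). k + l \<le> (p::nat)}" for p
    by (rule finite_subset[of _ "{..p} \<times> {..p}"]) auto
  have sq: "(\<Sum>k\<le>n. \<Sum>l\<le>m. b k * b l * g (k + l)) = sum ?f ({..n} \<times> {..m})"
    by (simp add: sum.cartesian_product)
  have f0: "0 \<le> ?f x" for x using b g by (auto split: prod.splits)
  show "(\<Sum>j\<le>min n m. g j) \<le> (\<Sum>k\<le>n. \<Sum>l\<le>m. b k * b l * g (k + l))"
    unfolding sq tri[symmetric] by (rule sum_mono2) (use f0 in auto)
  show "(\<Sum>k\<le>n. \<Sum>l\<le>m. b k * b l * g (k + l)) \<le> (\<Sum>j\<le>n + m. g j)"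
    unfolding sq tri[symmetric] by (rule sum_mono2) (use f0 fin in auto)
qed

text \<open>The operator \<open>1 - D\<close> is positive, and by the last assumption it is injective; it need
  not have a bounded inverse. Its inverse square root is approximated by the partial sums
  \<open>invsqrt_sum n\<close> of the binomial series in \<open>D\<close>, which are controlled
  through the moments of the spectral measure of \<open>D\<close> at a vector.\<close>

locale positive_contraction = hilbert_space V for V :: "'v hspace" +
  fixes D :: "'v \<Rightarrow> 'v"
  assumes D_mem: "v \<in> C \<Longrightarrow> D v \<in> C"
    and D_self_adjoint: "v \<in> C \<Longrightarrow> w \<in> C \<Longrightarrow> hip V (D v) w = hip V v (D w)"
    and D_nonneg: "v \<in> C \<Longrightarrow> 0 \<le> Re (hip V (D v) v)"
    and D_le: "v \<in> C \<Longrightarrow> Re (hip V (D v) v) \<le> Re (hip V v v)"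
    and D_strict: "v \<in> C \<Longrightarrow> Re (hip V (D v) v) = Re (hip V v v) \<Longrightarrow> v = \<zero>\<^bsub>V\<^esub>"
begin

definition moment :: "nat \<Rightarrow> 'v \<Rightarrow> real" where
  "moment n v = Re (hip V ((D ^^ n) v) v)"

lemma Dpow_mem: "v \<in> C \<Longrightarrow> (D ^^ n) v \<in> C"
  by (induction n) (auto simp: D_mem)

lemma Dpow_self_adjoint: "v \<in> C \<Longrightarrow> w \<in> C \<Longrightarrow> hip V ((D ^^ n) v) w = hip V v ((D ^^ n) w)"
proof (induction n arbitrary: w)
  case (Suc n)
  have "hip V ((D ^^ Suc n) v) w = hip V ((D ^^ n) v) (D w)"
    using Suc by (simp add: D_self_adjoint Dpow_mem)
  also have "\<dots> = hip V v ((D ^^ n) (D w))" using Suc by (simp add: D_mem)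
  finally show ?case by (simp add: funpow_swap1)
qed simp

lemma hip_Dpow: "v \<in> C \<Longrightarrow> hip V ((D ^^ i) v) ((D ^^ j) v) = of_real (moment (i + j) v)"
proof -
  assume v: "v \<in> C"
  have eq: "hip V ((D ^^ i) v) ((D ^^ j) v) = hip V ((D ^^ (i + j)) v) v" for i j
    using Dpow_self_adjoint[of "(D ^^ i) v" v j] v by (simp add: Dpow_mem funpow_add add.commute[of i j])
  have "cnj (hip V ((D ^^ (i + j)) v) v) = hip V v ((D ^^ (i + j)) v)"
    using ip_cnj Dpow_mem v by metis
  also have "\<dots> = hip V ((D ^^ (i + j)) v) v" using Dpow_self_adjoint v by metis
  finally show ?thesis unfolding eq moment_def by (metis Reals_cnj_iff of_real_Re)
qed

lemma moment_0: "v \<in> C \<Longrightarrow> moment 0 v = (hnorm V v)\<^sup>2"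
  by (simp add: moment_def hnorm_sq)

lemma moment_even: "v \<in> C \<Longrightarrow> moment (2 * n) v = (hnorm V ((D ^^ n) v))\<^sup>2"
  using hip_Dpow[of v n n] by (simp add: hnorm_sq Dpow_mem mult_2)

lemma moment_odd: "v \<in> C \<Longrightarrow> moment (2 * n + 1) v = Re (hip V (D ((D ^^ n) v)) ((D ^^ n) v))"
  using hip_Dpow[of v "Suc n" n] by (simp add: mult_2)

lemma moment_nonneg: "v \<in> C \<Longrightarrow> 0 \<le> moment n v"
proof (cases "even n")
  case False
  then obtain k where "n = 2 * k + 1" by (auto elim: oddE)
  then show "v \<in> C \<Longrightarrow> 0 \<le> moment n v" by (simp only: moment_odd D_nonneg Dpow_mem)
qed (auto elim!: evenE simp: moment_even)

text \<open>Even moments are of the form \<open>\<langle>x, x\<rangle>\<close> with \<open>x = D\<^sup>k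
  v\<close>, and \<open>D \<le> 1\<close> applies. The odd case rests on \<open>D (1 - D) = D (1 -
  D) D + (1 - D) D (1 - D)\<close>, a sum of positive operators.\<close>

lemma moment_Suc_le: "v \<in> C \<Longrightarrow> moment (Suc n) v \<le> moment n v"
proof (cases "even n")
  case True
  then obtain k where k: "n = 2 * k" by (auto elim: evenE)
  assume v: "v \<in> C"
  show ?thesis
    unfolding k Suc_eq_plus1 moment_odd[OF v] moment_even[OF v] hnorm_sq[OF Dpow_mem[OF v]]
    by (rule D_le[OF Dpow_mem[OF v]])
next
  case False
  then obtain k where k: "n = 2 * k + 1" by (auto elim: oddE)
  assume v: "v \<in> C"
  define x where "x = (D ^^ k) v"
  have x: "x \<in> C" "D x \<in> C" "D (D x) \<in> C" using v by (auto simp: x_def Dpow_mem D_mem)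
  have m: "moment (2 * k + j) v = Re (hip V ((D ^^ j) x) x)" for j
    using hip_Dpow[OF v, of "j + k" k] by (simp add: x_def funpow_add mult_2 add_ac)
  have 1: "0 \<le> Re (hip V (D x) (D x)) - Re (hip V (D (D x)) (D x))" using D_le[OF x(2)] by simp
  let ?z = "diff x (D x)"
  have z: "?z \<in> C" using x by (simp add: diff_mem)
  have "hip V (D ?z) ?z = hip V (D ?z) x - hip V (D ?z) (D x)"
    using x z by (simp only: hip_diff_right D_mem)
  also have "\<dots> = hip V ?z (D x) - hip V ?z (D (D x))"
    using x z by (simp only: D_self_adjoint)
  also have "\<dots> = hip V x (D x) - hip V (D x) (D x) - (hip V x (D (D x)) - hip V (D x) (D (D x)))"
    using x by (simp only: hip_diff)
  finally have Dz: "hip V (D ?z) ?z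
      = hip V x (D x) - hip V (D x) (D x) - (hip V x (D (D x)) - hip V (D x) (D (D x)))" .
  have 2: "0 \<le> Re (hip V (D ?z) ?z)" by (rule D_nonneg[OF z])
  have s: "hip V x (D x) = hip V (D x) x" "hip V x (D (D x)) = hip V (D x) (D x)"
    "hip V (D x) (D (D x)) = hip V (D (D x)) (D x)" "hip V (D (D x)) x = hip V (D x) (D x)"
    using x by (simp_all only: D_self_adjoint)
  have "0 \<le> Re (hip V (D x) x) - Re (hip V (D (D x)) x)" using 1 2 unfolding Dz s by simp
  then show ?thesis using m[of 1] m[of 2] by (simp add: k numeral_2_eq_2)
qed

lemma moment_antimono: "v \<in> C \<Longrightarrow> m \<le> n \<Longrightarrow> moment n v \<le> moment m v"
  by (rule lift_Suc_antimono_le[of "\<lambda>n. moment n v"]) (auto simp: moment_Suc_le)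

lemma hnorm_Dpow_le: "v \<in> C \<Longrightarrow> hnorm V ((D ^^ n) v) \<le> hnorm V v"
  using moment_antimono[of v 0 "2 * n"]
  by (simp add: moment_even moment_0 power2_le_iff_abs_le hnorm_nonneg Dpow_mem)

text \<open>The sequence \<open>D\<^sup>n v\<close> is Cauchy because its moments decrease to some limit: the
  square of \<open>\<parallel>D\<^sup>m v - D\<^sup>n v\<parallel>\<close> is a combination of
  moments that cancels in the limit. The limit vector is fixed by \<open>D\<close>, hence zero.\<close>

lemma moment_tendsto_0:
  assumes v: "v \<in> C" shows "(\<lambda>n. moment n v) \<longlonglongrightarrow> 0"
proof -
  let ?s = "\<lambda>n. (D ^^ n) v"
  have "decseq (\<lambda>n. moment n v)" using moment_antimono[OF v] by (simp add: decseq_def)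
  then obtain l where l: "(\<lambda>n. moment n v) \<longlonglongrightarrow> l" and le: "\<And>n. l \<le> moment n v"
    using decseq_convergent[of "\<lambda>n. moment n v" 0] moment_nonneg[OF v] by blast
  have "hCauchy V ?s"
    unfolding hCauchy_def
  proof (intro conjI allI impI)
    show "range ?s \<subseteq> C" using v by (auto simp: Dpow_mem)
    fix e :: real assume e: "e > 0"
    then have "\<forall>\<^sub>F n in sequentially. moment n v < l + e\<^sup>2 / 2" by (intro order_tendstoD(2)[OF l]) simp
    then obtain N where N: "\<And>n. n \<ge> N \<Longrightarrow> moment n v < l + e\<^sup>2 / 2" by (auto simp: eventually_sequentially)
    show "\<exists>N. \<forall>m\<ge>N. \<forall>n\<ge>N. hdist V (?s m) (?s n) < e"
    proof (intro exI[of _ N] allI impI)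
      fix m n assume mn: "m \<ge> N" "n \<ge> N"
      have "(hdist V (?s m) (?s n))\<^sup>2 = moment (2 * m) v + moment (2 * n) v - 2 * moment (m + n) v"
        using v by (simp add: hdist_sq Dpow_mem moment_even hip_Dpow)
      also have "\<dots> < e\<^sup>2" using N[of "2 * m"] N[of "2 * n"] le[of "m + n"] mn by simp
      finally show "hdist V (?s m) (?s n) < e" using e by (simp add: power_less_imp_less_base)
    qed
  qed
  then obtain w where w: "w \<in> C" and lim: "(\<lambda>n. hdist V (?s n) w) \<longlonglongrightarrow> 0" using complete by blast
  have weak: "(\<lambda>n. hip V (?s n) z) \<longlonglongrightarrow> hip V w z" if z: "z \<in> C" for z
  proof -
    have "(\<lambda>n. hip V (?s n) z - hip V w z) \<longlonglongrightarrow> 0"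
    proof (rule Lim_null_comparison)
      have "cmod (hip V (?s n) z - hip V w z) \<le> hdist V (?s n) w * hnorm V z" for n
        using hip_diff_le[of "?s n" z w z] v w z by (simp add: Dpow_mem hdist_self)
      then show "\<forall>\<^sub>F n in sequentially. cmod (hip V (?s n) z - hip V w z) \<le> hdist V (?s n) w * hnorm V z"
        by simp
      show "(\<lambda>n. hdist V (?s n) w * hnorm V z) \<longlonglongrightarrow> 0" using tendsto_mult_right[OF lim] by simp
    qed
    then show ?thesis using LIM_zero_iff by blast
  qed
  have "D w = w"
  proof (rule vec_eqI)
    fix z assume z: "z \<in> C"
    have "(\<lambda>n. hip V (?s n) (D z)) \<longlonglongrightarrow> hip V w (D z)" using weak z by (simp add: D_mem)
    moreover have "hip V (?s n) (D z) = hip V (?s (Suc n)) z" for n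
      using v z by (simp add: D_self_adjoint Dpow_mem)
    ultimately have "(\<lambda>n. hip V (?s (Suc n)) z) \<longlonglongrightarrow> hip V (D w) z" using w z by (simp add: D_self_adjoint)
    then show "hip V (D w) z = hip V w z" using LIMSEQ_Suc[OF weak[OF z]] LIMSEQ_unique by blast
  qed (use w in \<open>auto simp: D_mem\<close>)
  then have "w = \<zero>\<^bsub>V\<^esub>" using D_strict[OF w] by simp
  then have "(\<lambda>n. hnorm V (?s n)) \<longlonglongrightarrow> 0" using lim v by (simp add: hdist_zero Dpow_mem)
  then have "(\<lambda>n. moment (2 * n) v) \<longlonglongrightarrow> 0\<^sup>2"
    unfolding moment_even[OF v] by (intro tendsto_intros)
  moreover have "(\<lambda>n. moment (2 * n) v) \<longlonglongrightarrow> l"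
    using LIMSEQ_subseq_LIMSEQ[OF l, of "\<lambda>n. 2 * n"] by (simp add: strict_mono_def o_def)
  ultimately show ?thesis using l LIMSEQ_unique by fastforce
qed

fun invsqrt_sum :: "nat \<Rightarrow> 'v \<Rightarrow> 'v" where
  "invsqrt_sum 0 v = v"
| "invsqrt_sum (Suc n) v = invsqrt_sum n v \<oplus>\<^bsub>V\<^esub> of_real (invsqrt_coeff (Suc n)) \<odot>\<^bsub>V\<^esub> (D ^^ Suc n) v"

lemma invsqrt_sum_mem: "v \<in> C \<Longrightarrow> invsqrt_sum n v \<in> C"
  by (induction n) (auto simp del: funpow.simps intro!: add_C smult_C Dpow_mem)

lemma hip_invsqrt_sum:
  "v \<in> C \<Longrightarrow> w \<in> C \<Longrightarrow> hip V (invsqrt_sum n v) w = (\<Sum>k\<le>n. of_real (invsqrt_coeff k) * hip V ((D ^^ k) v) w)"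
proof (induction n)
  case (Suc n)
  then show ?case
    by (simp del: funpow.simps add: hip_simps invsqrt_sum_mem Dpow_mem)
qed (simp add: invsqrt_coeff_0)

lemma invsqrt_sum_self_adjoint:
  "v \<in> C \<Longrightarrow> w \<in> C \<Longrightarrow> hip V (invsqrt_sum n v) w = hip V v (invsqrt_sum n w)"
proof -
  assume v: "v \<in> C" and w: "w \<in> C"
  have "hip V v (invsqrt_sum n w) = cnj (hip V (invsqrt_sum n w) v)"
    using ip_cnj v w invsqrt_sum_mem by blast
  also have "\<dots> = (\<Sum>k\<le>n. of_real (invsqrt_coeff k) * hip V v ((D ^^ k) w))"
    using v w by (simp add: hip_invsqrt_sum ip_cnj[OF Dpow_mem, of w v])
  also have "\<dots> = hip V (invsqrt_sum n v) w"
    using v w by (simp add: hip_invsqrt_sum Dpow_self_adjoint)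
  finally show ?thesis by simp
qed

lemmas invsqrt_sum_linear =
  adjoint_imp_linear[OF invsqrt_sum_mem invsqrt_sum_mem invsqrt_sum_self_adjoint]

lemma hnorm_invsqrt_sum_le:
  "v \<in> C \<Longrightarrow> hnorm V (invsqrt_sum n v) \<le> (\<Sum>k\<le>n. invsqrt_coeff k) * hnorm V v"
proof (induction n)
  case (Suc n)
  have "hnorm V (invsqrt_sum (Suc n) v)
      \<le> hnorm V (invsqrt_sum n v) + invsqrt_coeff (Suc n) * hnorm V ((D ^^ Suc n) v)"
    unfolding invsqrt_sum.simps
    by (rule order_trans[OF hnorm_add_le])
      (use Suc invsqrt_coeff_nonneg in \<open>auto simp del: funpow.simps simp: invsqrt_sum_mem Dpow_mem smult_mem hnorm_smult\<close>)
  also have "\<dots> \<le> (\<Sum>k\<le>n. invsqrt_coeff k) * hnorm V v + invsqrt_coeff (Suc n) * hnorm V v"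
    using Suc invsqrt_coeff_nonneg by (intro add_mono mult_left_mono hnorm_Dpow_le) auto
  finally show ?case by (simp add: algebra_simps)
qed (simp add: invsqrt_coeff_0)

lemma invsqrt_sum_commute:
  assumes P: "\<And>x. x \<in> C \<Longrightarrow> P x \<in> C"
    and P_add: "\<And>x y. x \<in> C \<Longrightarrow> y \<in> C \<Longrightarrow> P (x \<oplus>\<^bsub>V\<^esub> y) = P x \<oplus>\<^bsub>V\<^esub> P y"
    and P_smult: "\<And>c x. x \<in> C \<Longrightarrow> P (c \<odot>\<^bsub>V\<^esub> x) = c \<odot>\<^bsub>V\<^esub> P x"
    and comm: "\<And>x. x \<in> C \<Longrightarrow> D (P x) = P (D x)" and v: "v \<in> C"
  shows "invsqrt_sum n (P v) = P (invsqrt_sum n v)"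
proof -
  have D: "(D ^^ n) (P v) = P ((D ^^ n) v)" for n
    by (induction n) (simp_all add: comm Dpow_mem v)
  show ?thesis
    by (induction n)
      (simp_all del: funpow.simps add: D P_add P_smult invsqrt_sum_mem Dpow_mem smult_mem v)
qed

text \<open>With \<open>p\<^sub>n\<close> the partial sums of the binomial series, the number
  \<open>\<langle>(1 - D) p\<^sub>n(D) v, p\<^sub>m(D) v\<rangle>\<close> equals
  \<open>\<parallel>v\<parallel>\<^sup>2\<close> up to a moment of high order: the coefficients of
  \<open>p\<^sub>n p\<^sub>m\<close> agree with those of the geometric series up to degree
  \<open>min n m\<close> and do not exceed them afterwards, and \<open>1 - D\<close> makes the
  geometric series telescope.\<close>

lemma invsqrt_form:
  assumes v: "v \<in> C"
  shows "\<exists>r. hip V (invsqrt_sum n v) (invsqrt_sum m v) - hip V (D (invsqrt_sum n v)) (invsqrt_sum m v)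
      = of_real r \<and> (hnorm V v)\<^sup>2 - moment (Suc (min n m)) v \<le> r \<and> r \<le> (hnorm V v)\<^sup>2"
proof -
  let ?b = invsqrt_coeff
  define g where "g j = moment j v - moment (Suc j) v" for j
  define r where "r = (\<Sum>k\<le>n. \<Sum>l\<le>m. ?b k * ?b l * g (k + l))"
  have g0: "0 \<le> g j" for j using moment_Suc_le[OF v] by (simp add: g_def)
  have gsum: "(\<Sum>j\<le>p. g j) = (hnorm V v)\<^sup>2 - moment (Suc p) v" for p
    unfolding g_def moment_0[OF v, symmetric] by (induction p) auto
  have one: "hip V x (invsqrt_sum m v) = (\<Sum>l\<le>m. of_real (?b l) * hip V x ((D ^^ l) v))" if x: "x \<in> C" for x
  proof -
    have "hip V x (invsqrt_sum m v) = cnj (hip V (invsqrt_sum m v) x)"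
      using x v by (metis ip_cnj invsqrt_sum_mem)
    also have "\<dots> = (\<Sum>l\<le>m. of_real (?b l) * hip V x ((D ^^ l) v))"
      using x v by (simp add: hip_invsqrt_sum ip_cnj[OF Dpow_mem, of v x])
    finally show ?thesis .
  qed
  have h: "hip V ((D ^^ k) v) (invsqrt_sum m v) = (\<Sum>l\<le>m. of_real (?b l * moment (k + l) v))" for k
    using v by (simp add: one Dpow_mem hip_Dpow)
  have "hip V (invsqrt_sum n v) (invsqrt_sum m v)
      = (\<Sum>k\<le>n. of_real (?b k) * hip V ((D ^^ k) v) (invsqrt_sum m v))"
    using v by (simp add: hip_invsqrt_sum invsqrt_sum_mem)
  also have "\<dots> = of_real (\<Sum>k\<le>n. \<Sum>l\<le>m. ?b k * ?b l * moment (k + l) v)"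
    unfolding h by (simp add: sum_distrib_left mult.assoc)
  finally have 1: "hip V (invsqrt_sum n v) (invsqrt_sum m v)
      = of_real (\<Sum>k\<le>n. \<Sum>l\<le>m. ?b k * ?b l * moment (k + l) v)" .
  have "hip V (D (invsqrt_sum n v)) (invsqrt_sum m v) = hip V (invsqrt_sum n v) (D (invsqrt_sum m v))"
    using v by (simp add: D_self_adjoint invsqrt_sum_mem)
  also have "\<dots> = (\<Sum>k\<le>n. of_real (?b k) * hip V ((D ^^ k) v) (D (invsqrt_sum m v)))"
    using v by (simp add: hip_invsqrt_sum invsqrt_sum_mem D_mem)
  also have "\<dots> = (\<Sum>k\<le>n. of_real (?b k) * hip V ((D ^^ Suc k) v) (invsqrt_sum m v))"
    using v by (simp add: D_self_adjoint invsqrt_sum_mem Dpow_mem)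
  also have "\<dots> = of_real (\<Sum>k\<le>n. \<Sum>l\<le>m. ?b k * ?b l * moment (Suc (k + l)) v)"
    unfolding h by (simp add: sum_distrib_left mult.assoc)
  finally have 2: "hip V (D (invsqrt_sum n v)) (invsqrt_sum m v)
      = of_real (\<Sum>k\<le>n. \<Sum>l\<le>m. ?b k * ?b l * moment (Suc (k + l)) v)" .
  have "hip V (invsqrt_sum n v) (invsqrt_sum m v) - hip V (D (invsqrt_sum n v)) (invsqrt_sum m v) = of_real r"
    unfolding 1 2 r_def g_def by (simp add: sum_subtractf algebra_simps)
  moreover have "(\<Sum>j\<le>min n m. g j) \<le> r" "r \<le> (\<Sum>j\<le>n + m. g j)"
    unfolding r_def
    using sum_convolution_square_bounds[of ?b g, OF invsqrt_coeff_nonneg invsqrt_coeff_convolution g0] by auto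
  ultimately show ?thesis using moment_nonneg[OF v, of "Suc (n + m)"] unfolding gsum by (intro exI[of _ r]) auto
qed

end

section \<open>Continuous maps into Euclidean spaces\<close>

lemma continuous_map_tendsto:
  "continuous_map X euclidean f \<longleftrightarrow> (\<forall>x\<in>topspace X. (f \<longlongrightarrow> f x) (atin X x))"
  by (simp add: continuous_map_atin)

lemma continuous_map_dist:
  fixes f :: "'a \<Rightarrow> 'b::metric_space"
  shows "continuous_map X euclidean f \<longleftrightarrow>
    (\<forall>x\<in>topspace X. \<forall>e>0. \<exists>U. openin X U \<and> x \<in> U \<and> (\<forall>y\<in>U. dist (f x) (f y) < e))"
  using Met_TC.continuous_map_to_metric[of X f]
  by (simp only: mtopology_is_euclidean mball_eq_ball mem_ball)

lemma continuous_map_distD: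
  fixes f :: "'a \<Rightarrow> 'b::metric_space"
  assumes "continuous_map X euclidean f" "x \<in> topspace X" "0 < e"
  obtains U where "openin X U" "x \<in> U" "\<And>y. y \<in> U \<Longrightarrow> dist (f y) (f x) < e"
  using assms unfolding continuous_map_dist by (metis dist_commute)

lemma continuous_map_complex_mult:
  fixes f g :: "'a \<Rightarrow> complex"
  shows "continuous_map X euclidean f \<Longrightarrow> continuous_map X euclidean g \<Longrightarrow>
    continuous_map X euclidean (\<lambda>x. f x * g x)"
  by (auto simp: continuous_map_tendsto intro!: tendsto_intros)

lemma continuous_map_Re_Im:
  "continuous_map X euclidean f \<longleftrightarrow>
    continuous_map X euclidean (\<lambda>x. Re (f x)) \<and> continuous_map X euclidean (\<lambda>x. Im (f x))"
  unfolding continuous_map_tendsto by (subst tendsto_complex_iff) auto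

lemma continuous_map_preimage_less:
  fixes f :: "'a \<Rightarrow> real"
  assumes "continuous_map X euclidean f" shows "openin X {x \<in> topspace X. f x < e}"
  using openin_continuous_map_preimage[OF assms, of "{..<e}"] by simp

section \<open>Continuous Hilbert bundles\<close>

lemma (in semi_inner) hdist_smult_left:
  assumes "x \<in> W"
  shows "hdist P (a \<odot>\<^bsub>P\<^esub> x) (b \<odot>\<^bsub>P\<^esub> x) = cmod (a - b) * hnorm P x"
proof -
  have "hdist P (a \<odot>\<^bsub>P\<^esub> x) (b \<odot>\<^bsub>P\<^esub> x) = hnorm P ((a - b) \<odot>\<^bsub>P\<^esub> x)"
    unfolding hdist_def
    by (rule hnorm_cong) (use assms in \<open>simp_all add: hip_simps algebra_simps\<close>)
  then show ?thesis using assms by (simp add: hnorm_smult)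
qed

lemma (in hilbert_space) geometric_limit:
  assumes s: "\<And>n. s n \<in> C" and step: "\<And>n. hdist V (s (Suc n)) (s n) \<le> c * (1/2) ^ n"
  obtains z where "z \<in> C" "\<And>n. hdist V (s n) z \<le> 2 * c * (1/2) ^ n"
proof -
  have c: "0 \<le> c" using order_trans[OF hdist_nonneg[OF s s] step[of 0]] by simp
  have tail: "hdist V (s (n + k)) (s n) \<le> c * (1/2) ^ n * (2 - 2 * (1/2) ^ k)" for n k
  proof (induction k)
    case (Suc k)
    have "hdist V (s (n + Suc k)) (s n) \<le> hdist V (s (Suc (n + k))) (s (n + k)) + hdist V (s (n + k)) (s n)"
      using hdist_triangle[OF s s s] by simp
    also have "\<dots> \<le> c * (1/2) ^ (n + k) + c * (1/2) ^ n * (2 - 2 * (1/2) ^ k)"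
      using step[of "n + k"] Suc by simp
    also have "\<dots> = c * (1/2) ^ n * (2 - 2 * (1/2) ^ Suc k)"
      by (simp add: power_add algebra_simps)
    finally show ?case .
  qed (simp add: hdist_self s)
  have tail': "hdist V (s m) (s n) \<le> 2 * c * (1/2) ^ n" if "n \<le> m" for m n
  proof -
    have "hdist V (s m) (s n) \<le> c * (1/2) ^ n * (2 - 2 * (1/2) ^ (m - n))"
      using tail[of n "m - n"] that by simp
    also have "\<dots> \<le> c * (1/2) ^ n * 2" using c by (intro mult_left_mono) auto
    finally show ?thesis by (simp add: mult_ac)
  qed
  have lim0: "(\<lambda>n. 2 * c * (1/2 :: real) ^ n) \<longlonglongrightarrow> 0"
    using tendsto_mult_left[OF LIMSEQ_power_zero[of "1/2 :: real"], of "2 * c"] by simp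
  have "hCauchy V s"
    unfolding hCauchy_def
  proof (intro conjI allI impI)
    show "range s \<subseteq> C" using s by auto
    fix e :: real assume "e > 0"
    then have "\<forall>\<^sub>F n in sequentially. 2 * c * (1/2) ^ n < e" by (rule order_tendstoD(2)[OF lim0])
    then obtain N where N: "\<And>n. n \<ge> N \<Longrightarrow> 2 * c * (1/2) ^ n < e" by (auto simp: eventually_sequentially)
    show "\<exists>N. \<forall>m\<ge>N. \<forall>n\<ge>N. hdist V (s m) (s n) < e"
    proof (intro exI[of _ N] allI impI)
      fix m n assume mn: "N \<le> m" "N \<le> n"
      show "hdist V (s m) (s n) < e"
        using tail'[of n m] tail'[of m n] N[OF mn(1)] N[OF mn(2)] hdist_commute[OF s s, of m n]
        by (cases "n \<le> m") auto
    qed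
  qed
  then obtain z where z: "z \<in> C" and lim: "(\<lambda>n. hdist V (s n) z) \<longlonglongrightarrow> 0" using complete by blast
  have "hdist V (s n) z \<le> 2 * c * (1/2) ^ n" for n
  proof (rule LIMSEQ_le_const)
    show "(\<lambda>m. 2 * c * (1/2) ^ n + hdist V (s m) z) \<longlonglongrightarrow> 2 * c * (1/2) ^ n"
      using tendsto_add[OF tendsto_const lim, of "2 * c * (1/2) ^ n"] by simp
    have "hdist V (s n) z \<le> 2 * c * (1/2) ^ n + hdist V (s m) z" if "n \<le> m" for m
      using hdist_triangle[OF s[of n] s[of m] z] tail'[OF that] hdist_commute[OF s s, of m n] by simp
    then show "\<exists>N. \<forall>m\<ge>N. hdist V (s n) z \<le> 2 * c * (1/2) ^ n + hdist V (s m) z" by blast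
  qed
  with z show ?thesis using that by blast
qed

context continuous_hilbert_bundle
begin

abbreviation F where "F u \<equiv> fib E u"

lemma sec_mem: "\<xi> \<in> secs E \<Longrightarrow> u \<in> topspace X \<Longrightarrow> \<xi> u \<in> carrier (F u)"
  using secs_subset by (auto simp: all_sections_def)

lemma semi_inner_fib: "u \<in> topspace X \<Longrightarrow> semi_inner (F u) (carrier (F u))"
proof -
  assume "u \<in> topspace X"
  then interpret hilbert_space "F u" by (rule hilbert_fib)
  show ?thesis by (rule semi_inner_axioms)
qed

text \<open>Polarisation reduces inner products to norms of sections.\<close>

lemma sec_hip_continuous:
  assumes \<xi>: "\<xi> \<in> secs E" and \<eta>: "\<eta> \<in> secs E"
  shows "continuous_map X euclidean (\<lambda>u. hip (F u) (\<xi> u) (\<eta> u))"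
proof -
  have Re: "continuous_map X euclidean (\<lambda>u. Re (hip (F u) (\<xi> u) (\<eta> u)))"
    if \<xi>: "\<xi> \<in> secs E" and \<eta>: "\<eta> \<in> secs E" for \<xi> \<eta>
  proof -
    let ?s = "\<lambda>u\<in>topspace X. \<xi> u \<oplus>\<^bsub>F u\<^esub> \<eta> u"
    have "continuous_map X euclidean (\<lambda>u. ((hnorm (F u) (?s u))\<^sup>2 - (hnorm (F u) (\<xi> u))\<^sup>2 - (hnorm (F u) (\<eta> u))\<^sup>2) / 2)"
      using continuous_norm[OF add_sec[OF \<xi> \<eta>]] continuous_norm[OF \<xi>] continuous_norm[OF \<eta>]
      unfolding continuous_map_tendsto by (auto intro!: tendsto_intros)
    then show ?thesis
    proof (rule continuous_map_eq)
      fix u assume u: "u \<in> topspace X"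
      interpret hilbert_space "F u" by (rule hilbert_fib[OF u])
      have m: "\<xi> u \<in> C" "\<eta> u \<in> C" using sec_mem \<xi> \<eta> u by auto
      then show "((hnorm (F u) (?s u))\<^sup>2 - (hnorm (F u) (\<xi> u))\<^sup>2 - (hnorm (F u) (\<eta> u))\<^sup>2) / 2
          = Re (hip (F u) (\<xi> u) (\<eta> u))"
        using u hip_cnj[OF m] by (simp add: hnorm_sq hip_simps)
    qed
  qed
  have "continuous_map X euclidean (\<lambda>u. Re (hip (F u) (\<xi> u) ((\<lambda>u\<in>topspace X. \<i> \<odot>\<^bsub>F u\<^esub> \<eta> u) u)))"
    by (rule Re[OF \<xi> smult_sec[OF \<eta>]])
  then have "continuous_map X euclidean (\<lambda>u. Im (hip (F u) (\<xi> u) (\<eta> u)))"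
  proof (rule continuous_map_eq)
    fix u assume u: "u \<in> topspace X"
    interpret hilbert_space "F u" by (rule hilbert_fib[OF u])
    show "Re (hip (F u) (\<xi> u) ((\<lambda>u\<in>topspace X. \<i> \<odot>\<^bsub>F u\<^esub> \<eta> u) u)) = Im (hip (F u) (\<xi> u) (\<eta> u))"
      using u sec_mem \<xi> \<eta> by (simp add: hip_simps)
  qed
  then show ?thesis using Re[OF \<xi> \<eta>] by (simp add: continuous_map_Re_Im)
qed

text \<open>Near a point \<open>u\<close> the product with \<open>\<phi>\<close> is uniformly close to the
  multiple by the constant \<open>\<phi> u\<close>, so closure under locally uniform approximation
  applies.\<close>

lemma mult_sec:
  fixes \<phi> :: "'b \<Rightarrow> complex"
  assumes \<phi>: "continuous_map X euclidean \<phi>" and \<xi>: "\<xi> \<in> secs E"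
  shows "(\<lambda>u\<in>topspace X. \<phi> u \<odot>\<^bsub>F u\<^esub> \<xi> u) \<in> secs E"
proof (rule subsetD[OF locally_uniformly_closed], unfold locally_uniform_closure_def, safe)
  show "(\<lambda>u\<in>topspace X. \<phi> u \<odot>\<^bsub>F u\<^esub> \<xi> u) \<in> all_sections X (fib E)"
    unfolding all_sections_def
    using hilbert_space.smult_C[OF hilbert_fib] sec_mem[OF \<xi>] by auto
  fix u and e :: real assume u: "u \<in> topspace X" and e: "0 < e"
  let ?f = "\<lambda>w. cmod (\<phi> w - \<phi> u) * hnorm (F w) (\<xi> w)"
  have cont: "continuous_map X euclidean ?f"
    using \<phi> continuous_norm[OF \<xi>] unfolding continuous_map_tendsto by (auto intro!: tendsto_intros)
  show "\<exists>V. openin X V \<and> u \<in> V \<and> (\<exists>\<eta>\<in>secs E. \<forall>w\<in>V.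
      hdist (F w) ((\<lambda>u\<in>topspace X. \<phi> u \<odot>\<^bsub>F u\<^esub> \<xi> u) w) (\<eta> w) < e)"
  proof (intro exI[of _ "{w \<in> topspace X. ?f w < e}"] conjI bexI[OF _ smult_sec[OF \<xi>, of "\<phi> u"]] ballI)
    show "openin X {w \<in> topspace X. ?f w < e}" by (rule continuous_map_preimage_less[OF cont])
    show "u \<in> {w \<in> topspace X. ?f w < e}" using u e by simp
    fix w assume w: "w \<in> {w \<in> topspace X. ?f w < e}"
    then interpret hilbert_space "F w" using hilbert_fib by simp
    show "hdist (F w) ((\<lambda>u\<in>topspace X. \<phi> u \<odot>\<^bsub>F u\<^esub> \<xi> u) w) ((\<lambda>w\<in>topspace X. \<phi> u \<odot>\<^bsub>F w\<^esub> \<xi> w) w) < e"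
      using w sec_mem[OF \<xi>] by (simp add: hdist_smult_left)
  qed
qed

text \<open>Multiplication by the continuous function \<open>c / max c \<parallel>\<xi>\<parallel>\<close>
  truncates a section and leaves it unchanged where its norm is at most \<open>c\<close>.\<close>

lemma truncate_sec:
  assumes \<xi>: "\<xi> \<in> secs E" and c: "0 < c"
  obtains \<eta> where "\<eta> \<in> secs E" "\<And>w. w \<in> topspace X \<Longrightarrow> hnorm (F w) (\<eta> w) \<le> c"
    "\<And>w. w \<in> topspace X \<Longrightarrow> hnorm (F w) (\<xi> w) \<le> c \<Longrightarrow> \<eta> w = \<xi> w"
proof -
  define \<phi> where "\<phi> w = complex_of_real (c / max c (hnorm (F w) (\<xi> w)))" for w
  have "continuous_map X euclidean \<phi>"
    using continuous_norm[OF \<xi>] c unfolding continuous_map_tendsto \<phi>_def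
    by (auto intro!: tendsto_intros)
  note sec = mult_sec[OF this \<xi>]
  show ?thesis
  proof (rule that[OF sec])
    fix w assume w: "w \<in> topspace X"
    interpret hilbert_space "F w" by (rule hilbert_fib[OF w])
    have x: "\<xi> w \<in> C" by (rule sec_mem[OF \<xi> w])
    show "hnorm (F w) ((\<lambda>u\<in>topspace X. \<phi> u \<odot>\<^bsub>F u\<^esub> \<xi> u) w) \<le> c"
      using w x c by (simp add: hnorm_smult \<phi>_def norm_divide field_simps max_def)
    assume "hnorm (F w) (\<xi> w) \<le> c"
    then have "\<phi> w = 1" using c by (simp add: \<phi>_def)
    then show "(\<lambda>u\<in>topspace X. \<phi> u \<odot>\<^bsub>F u\<^esub> \<xi> u) w = \<xi> w"
      using w x module.smult_one[OF module_V] by (simp add: complex_ring_def)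
  qed
qed

text \<open>Density only provides sections passing close to a given vector; summing a geometrically
  decaying series of truncated corrections gives one passing through it.\<close>

lemma sec_through:
  assumes u: "u \<in> topspace X" and v: "v \<in> carrier (F u)"
  obtains \<zeta> where "\<zeta> \<in> secs E" "\<zeta> u = v"
proof -
  interpret U: hilbert_space "F u" by (rule hilbert_fib[OF u])
  define b where "b = hnorm (F u) v + 1"
  have b: "0 < b" using U.hnorm_nonneg[OF v] by (simp add: b_def)
  let ?B = "\<lambda>n. b * (1/2) ^ n"
  have "\<exists>\<sigma>. \<forall>n. (\<sigma> n \<in> secs E \<and> hdist (F u) (\<sigma> n u) v < ?B n)
      \<and> (\<forall>w\<in>topspace X. hdist (F w) (\<sigma> (Suc n) w) (\<sigma> n w) \<le> 2 * ?B n)"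
  proof (rule dependent_nat_choice)
    let ?z = "\<lambda>u\<in>topspace X. \<zero>\<^bsub>F u\<^esub>"
    have "hdist (F u) (?z u) v = hnorm (F u) v"
      using u U.hdist_zero[OF v] U.hdist_commute[OF v U.zero_C] by simp
    then show "\<exists>\<sigma>. \<sigma> \<in> secs E \<and> hdist (F u) (\<sigma> u) v < ?B 0"
      using zero_sec by (intro exI[of _ ?z]) (simp add: b_def)
  next
    fix \<sigma> n assume "\<sigma> \<in> secs E \<and> hdist (F u) (\<sigma> u) v < ?B n"
    then have \<sigma>: "\<sigma> \<in> secs E" and d: "hdist (F u) (\<sigma> u) v < ?B n" by auto
    have \<sigma>u: "\<sigma> u \<in> U.C" by (rule sec_mem[OF \<sigma> u])
    let ?r = "U.diff v (\<sigma> u)"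
    have r: "?r \<in> U.C" by (rule U.diff_mem[OF v \<sigma>u])
    have pos: "0 < ?B (Suc n)" using b by simp
    from dense[OF u r this] obtain \<xi> where \<xi>: "\<xi> \<in> secs E" and \<xi>d: "hdist (F u) (\<xi> u) ?r < ?B (Suc n)" by blast
    have \<xi>u: "\<xi> u \<in> U.C" by (rule sec_mem[OF \<xi> u])
    have "hnorm (F u) ?r < ?B n"
      using d U.hdist_commute[OF v \<sigma>u] by (simp add: hdist_def)
    then have small: "hnorm (F u) (\<xi> u) \<le> 2 * ?B n"
      using U.hnorm_diff_le[OF \<xi>u r] \<xi>d pos by simp
    have "0 < 2 * ?B n" using b by simp
    from truncate_sec[OF \<xi> this] obtain \<eta> where \<eta>: "\<eta> \<in> secs E"
      and \<eta>n: "\<And>w. w \<in> topspace X \<Longrightarrow> hnorm (F w) (\<eta> w) \<le> 2 * ?B n" and \<eta>u: "\<eta> u = \<xi> u"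
      using small u by metis
    let ?s = "\<lambda>w\<in>topspace X. \<sigma> w \<oplus>\<^bsub>F w\<^esub> \<eta> w"
    have "hdist (F u) (?s u) v = hdist (F u) (\<xi> u) ?r"
      unfolding hdist_def
      by (rule U.hnorm_cong) (use u v \<sigma>u \<xi>u r \<eta>u in \<open>simp_all add: U.hip_simps\<close>)
    moreover have "hdist (F w) (?s w) (\<sigma> w) \<le> 2 * ?B n" if w: "w \<in> topspace X" for w
    proof -
      interpret W: hilbert_space "F w" by (rule hilbert_fib[OF w])
      have "hdist (F w) (?s w) (\<sigma> w) = hnorm (F w) (\<eta> w)"
        unfolding hdist_def
        by (rule W.hnorm_cong) (use w sec_mem[OF \<sigma>] sec_mem[OF \<eta>] in \<open>simp_all add: W.hip_simps\<close>)
      then show ?thesis using \<eta>n[OF w] by simp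
    qed
    ultimately show "\<exists>\<tau>. (\<tau> \<in> secs E \<and> hdist (F u) (\<tau> u) v < ?B (Suc n))
        \<and> (\<forall>w\<in>topspace X. hdist (F w) (\<tau> w) (\<sigma> w) \<le> 2 * ?B n)"
      using add_sec[OF \<sigma> \<eta>] \<xi>d by (intro exI[of _ ?s]) simp
  qed
  then obtain \<sigma> where \<sigma>: "\<And>n. \<sigma> n \<in> secs E" and \<sigma>u: "\<And>n. hdist (F u) (\<sigma> n u) v < ?B n"
    and step: "\<And>n w. w \<in> topspace X \<Longrightarrow> hdist (F w) (\<sigma> (Suc n) w) (\<sigma> n w) \<le> 2 * ?B n"
    by blast
  have "\<exists>z\<in>carrier (F w). \<forall>n. hdist (F w) (\<sigma> n w) z \<le> 2 * (2 * b) * (1/2) ^ n" if w: "w \<in> topspace X" for w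
    using hilbert_space.geometric_limit[OF hilbert_fib[OF w], of "\<lambda>n. \<sigma> n w" "2 * b"]
      sec_mem[OF \<sigma> w] step[OF w] by (metis mult.assoc)
  then obtain z where z: "\<And>w. w \<in> topspace X \<Longrightarrow> z w \<in> carrier (F w)"
    and zd: "\<And>w n. w \<in> topspace X \<Longrightarrow> hdist (F w) (\<sigma> n w) (z w) \<le> 2 * (2 * b) * (1/2) ^ n"
    by metis
  define \<zeta> where "\<zeta> = restrict z (topspace X)"
  have lim: "(\<lambda>n. 2 * (2 * b) * (1/2 :: real) ^ n) \<longlonglongrightarrow> 0"
    using tendsto_mult_left[OF LIMSEQ_power_zero[of "1/2 :: real"], of "2 * (2 * b)"] by simp
  have "\<zeta> \<in> locally_uniform_closure X (fib E) (secs E)"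
    unfolding locally_uniform_closure_def
  proof safe
    show "\<zeta> \<in> all_sections X (fib E)" using z by (auto simp: \<zeta>_def all_sections_def)
    fix x and e :: real assume x: "x \<in> topspace X" and "0 < e"
    then have "\<forall>\<^sub>F n in sequentially. 2 * (2 * b) * (1/2) ^ n < e" by (intro order_tendstoD(2)[OF lim])
    then obtain n where n: "2 * (2 * b) * (1/2) ^ n < e" by (auto simp: eventually_sequentially)
    have "hdist (F w) (\<zeta> w) (\<sigma> n w) < e" if w: "w \<in> topspace X" for w
    proof -
      interpret W: hilbert_space "F w" by (rule hilbert_fib[OF w])
      show ?thesis
        using W.hdist_commute[OF z[OF w] sec_mem[OF \<sigma> w]] zd[OF w] n w
        by (simp add: \<zeta>_def) (meson le_less_trans)
    qed
    then show "\<exists>V. openin X V \<and> x \<in> V \<and> (\<exists>\<eta>\<in>secs E. \<forall>w\<in>V. hdist (F w) (\<zeta> w) (\<eta> w) < e)"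
      using x \<sigma> by (intro exI[of _ "topspace X"]) auto
  qed
  then have sec: "\<zeta> \<in> secs E" using locally_uniformly_closed by blast
  have "hdist (F u) v (z u) \<le> 0"
  proof (rule LIMSEQ_le_const)
    have "(\<lambda>n. 5 * b * (1/2 :: real) ^ n) \<longlonglongrightarrow> 0"
      using tendsto_mult_left[OF LIMSEQ_power_zero[of "1/2 :: real"], of "5 * b"] by simp
    then show "(\<lambda>n. 5 * b * (1/2 :: real) ^ n) \<longlonglongrightarrow> 0" .
    have "hdist (F u) v (z u) \<le> 5 * b * (1/2) ^ n" for n
    proof -
      have "hdist (F u) v (z u) \<le> hdist (F u) v (\<sigma> n u) + hdist (F u) (\<sigma> n u) (z u)"
        using v sec_mem[OF \<sigma> u] z[OF u] by (rule U.hdist_triangle)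
      then show ?thesis using \<sigma>u[of n] zd[OF u, of n] U.hdist_commute[OF v sec_mem[OF \<sigma> u], of n] by simp
    qed
    then show "\<exists>N. \<forall>n\<ge>N. hdist (F u) v (z u) \<le> 5 * b * (1/2) ^ n" by blast
  qed
  then have "v = z u"
    using U.hdist_nonneg[OF v z[OF u]] by (intro U.hdist_eq_0[OF v z[OF u]]) simp
  then have "\<zeta> u = v" using u by (simp add: \<zeta>_def)
  with sec show ?thesis using that by blast
qed

text \<open>For continuous \<open>a\<close>, a lift \<open>g\<close> of \<open>a\<close> to the total space is
  continuous if and only if it is locally uniformly close to pullbacks of continuous sections.
  This form of continuity is visibly inherited by sums and scalar multiples.\<close>

definition section_approximable :: "'z topology \<Rightarrow> ('z \<Rightarrow> 'b) \<Rightarrow> ('z \<Rightarrow> 'v) \<Rightarrow> bool" where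
  "section_approximable Z a g \<longleftrightarrow> (\<forall>z\<in>topspace Z. g z \<in> carrier (F (a z))) \<and>
    (\<forall>z\<in>topspace Z. \<forall>e>0. \<exists>U \<xi>. openin Z U \<and> z \<in> U \<and> \<xi> \<in> secs E \<and>
      (\<forall>y\<in>U. hdist (F (a y)) (g y) (\<xi> (a y)) < e))"

lemma continuous_map_total_topI:
  assumes a: "continuous_map Z X a"
    and g: "\<And>z. z \<in> topspace Z \<Longrightarrow> g z \<in> carrier (F (a z))"
    and d: "\<And>\<xi>. \<xi> \<in> secs E \<Longrightarrow> continuous_map Z euclidean (\<lambda>z. hdist (F (a z)) (g z) (\<xi> (a z)))"
  shows "continuous_map Z (total_top X E) (\<lambda>z. (a z, g z))"
  unfolding total_top_def
proof (rule continuous_on_generated_topo)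
  fix S assume "S \<in> {{(u, v). u \<in> V \<and> v \<in> carrier (F u) \<and> hdist (F u) v (\<xi> u) < e} | V \<xi> e.
      openin X V \<and> \<xi> \<in> secs E \<and> 0 < e}"
  then obtain V \<xi> e where S: "S = {(u, v). u \<in> V \<and> v \<in> carrier (F u) \<and> hdist (F u) v (\<xi> u) < e}"
    and V: "openin X V" and \<xi>: "\<xi> \<in> secs E" by blast
  have "(\<lambda>z. (a z, g z)) -` S \<inter> topspace Z
      = {z \<in> topspace Z. a z \<in> V} \<inter> {z \<in> topspace Z. hdist (F (a z)) (g z) (\<xi> (a z)) < e}"
    using g by (auto simp: S)
  then show "openin Z ((\<lambda>z. (a z, g z)) -` S \<inter> topspace Z)"
    using openin_continuous_map_preimage[OF a V] continuous_map_preimage_less[OF d[OF \<xi>]] by auto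
next
  have az: "a z \<in> topspace X" if "z \<in> topspace Z" for z
    using a that by (auto simp: continuous_map_def)
  show "(\<lambda>z. (a z, g z)) ` topspace Z \<subseteq> \<Union> {{(u, v). u \<in> V \<and> v \<in> carrier (F u) \<and> hdist (F u) v (\<xi> u) < e} | V \<xi> e.
      openin X V \<and> \<xi> \<in> secs E \<and> 0 < e}"
  proof safe
    fix z assume z: "z \<in> topspace Z"
    obtain \<xi> where "\<xi> \<in> secs E" "hdist (F (a z)) (\<xi> (a z)) (g z) < 1"
      using dense[OF az[OF z] g[OF z] zero_less_one] by blast
    moreover from this have "hdist (F (a z)) (g z) (\<xi> (a z)) < 1"
      using semi_inner.hdist_commute[OF semi_inner_fib[OF az[OF z]]] g[OF z] sec_mem az[OF z] by metis
    ultimately show "(a z, g z) \<in> \<Union> {{(u, v). u \<in> V \<and> v \<in> carrier (F u) \<and> hdist (F u) v (\<xi> u) < e} | V \<xi> e.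
      openin X V \<and> \<xi> \<in> secs E \<and> 0 < e}"
      using az[OF z] g[OF z]
      by (intro UnionI[of "{(u, v). u \<in> topspace X \<and> v \<in> carrier (F u) \<and> hdist (F u) v (\<xi> u) < 1}"])
        (auto intro!: exI[of _ "topspace X"] exI[of _ \<xi>] exI[of _ "1::real"])
  qed
qed

lemma total_top_section_approximable:
  assumes c: "continuous_map Z (total_top X E) (\<lambda>z. (a z, g z))"
  shows "section_approximable Z a g"
  unfolding section_approximable_def
proof (intro conjI ballI allI impI)
  let ?T = "\<lambda>V \<xi> e. {(u, v). u \<in> V \<and> v \<in> carrier (F u) \<and> hdist (F u) v (\<xi> u) < e}"
  have "topspace (total_top X E) \<subseteq> {(u, v). u \<in> topspace X \<and> v \<in> carrier (F u)}"
    unfolding total_top_def topology_generated_by_topspace by (auto dest: openin_subset)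
  then have ag: "a z \<in> topspace X \<and> g z \<in> carrier (F (a z))" if "z \<in> topspace Z" for z
    using c that by (auto simp: continuous_map_def)
  then show "g z \<in> carrier (F (a z))" if "z \<in> topspace Z" for z using that by blast
  fix z and e :: real assume z: "z \<in> topspace Z" and e: "0 < e"
  have m: "a z \<in> topspace X" "g z \<in> carrier (F (a z))" using ag[OF z] by auto
  obtain \<xi> where \<xi>: "\<xi> \<in> secs E" "hdist (F (a z)) (\<xi> (a z)) (g z) < e"
    using dense[OF m e] by blast
  then have "hdist (F (a z)) (g z) (\<xi> (a z)) < e"
    using semi_inner.hdist_commute[OF semi_inner_fib[OF m(1)] m(2) sec_mem[OF \<xi>(1) m(1)]] by simp
  moreover have "openin (total_top X E) (?T (topspace X) \<xi> e)"
    unfolding total_top_def using \<xi> e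
    by (intro topology_generated_by_Basis) (auto intro!: exI[of _ "topspace X"])
  then have "openin Z {z \<in> topspace Z. (a z, g z) \<in> ?T (topspace X) \<xi> e}"
    by (rule openin_continuous_map_preimage[OF c])
  ultimately show "\<exists>U \<xi>. openin Z U \<and> z \<in> U \<and> \<xi> \<in> secs E \<and>
      (\<forall>y\<in>U. hdist (F (a y)) (g y) (\<xi> (a y)) < e)"
    using \<xi> z m
    by (intro exI[of _ "{z \<in> topspace Z. (a z, g z) \<in> ?T (topspace X) \<xi> e}"] exI[of _ \<xi>]) auto
qed

lemma section_approximable_compose:
  assumes g: "section_approximable Z a g" and f: "continuous_map Y Z f"
  shows "section_approximable Y (\<lambda>y. a (f y)) (\<lambda>y. g (f y))"
  unfolding section_approximable_def
proof (intro conjI ballI allI impI)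
  have fy: "f y \<in> topspace Z" if "y \<in> topspace Y" for y using f that by (auto simp: continuous_map_def)
  then show "g (f y) \<in> carrier (F (a (f y)))" if "y \<in> topspace Y" for y
    using g that by (auto simp: section_approximable_def)
  fix y and e :: real assume y: "y \<in> topspace Y" and e: "0 < e"
  obtain U \<xi> where U: "openin Z U" "f y \<in> U" "\<xi> \<in> secs E" "\<And>z. z \<in> U \<Longrightarrow> hdist (F (a z)) (g z) (\<xi> (a z)) < e"
    using g fy[OF y] e unfolding section_approximable_def by metis
  then show "\<exists>U \<xi>. openin Y U \<and> y \<in> U \<and> \<xi> \<in> secs E \<and> (\<forall>x\<in>U. hdist (F (a (f x))) (g (f x)) (\<xi> (a (f x))) < e)"
    using openin_continuous_map_preimage[OF f U(1)] y
    by (intro exI[of _ "{y \<in> topspace Y. f y \<in> U}"] exI[of _ \<xi>]) auto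
qed

lemma section_approximable_subset:
  assumes "section_approximable Z a g" shows "section_approximable (subtopology Z S) a g"
  using section_approximable_compose[OF assms continuous_map_id_subt[of Z S]] by simp

lemma section_approximable_cong:
  assumes g: "section_approximable Z a g"
    and eq: "\<And>z. z \<in> topspace Z \<Longrightarrow> a z = a' z" "\<And>z. z \<in> topspace Z \<Longrightarrow> g z = g' z"
  shows "section_approximable Z a' g'"
  unfolding section_approximable_def
proof (intro conjI ballI allI impI)
  show "g' z \<in> carrier (F (a' z))" if "z \<in> topspace Z" for z
    using g eq[OF that, symmetric] that by (simp add: section_approximable_def)
  fix z and e :: real assume z: "z \<in> topspace Z" and e: "0 < e"
  then obtain U \<xi> where U: "openin Z U" "z \<in> U" "\<xi> \<in> secs E" "\<And>y. y \<in> U \<Longrightarrow> hdist (F (a y)) (g y) (\<xi> (a y)) < e"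
    using g unfolding section_approximable_def by metis
  have "hdist (F (a' y)) (g' y) (\<xi> (a' y)) < e" if "y \<in> U" for y
    using U(4)[OF that] eq[of y] openin_subset[OF U(1)] that by auto
  then show "\<exists>U \<xi>. openin Z U \<and> z \<in> U \<and> \<xi> \<in> secs E \<and> (\<forall>y\<in>U. hdist (F (a' y)) (g' y) (\<xi> (a' y)) < e)"
    using U by blast
qed

lemma section_approximable_add:
  assumes a: "a ` topspace Z \<subseteq> topspace X"
    and g: "section_approximable Z a g" and h: "section_approximable Z a h"
  shows "section_approximable Z a (\<lambda>z. g z \<oplus>\<^bsub>F (a z)\<^esub> h z)"
  unfolding section_approximable_def
proof (intro conjI ballI allI impI)
  have si: "semi_inner (F (a z)) (carrier (F (a z)))" if "z \<in> topspace Z" for z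
    using a that by (intro semi_inner_fib) auto
  have m: "g z \<in> carrier (F (a z))" "h z \<in> carrier (F (a z))" if "z \<in> topspace Z" for z
    using g h that by (auto simp: section_approximable_def)
  show "g z \<oplus>\<^bsub>F (a z)\<^esub> h z \<in> carrier (F (a z))" if "z \<in> topspace Z" for z
    using semi_inner.add_mem[OF si[OF that]] m[OF that] by blast
  fix z and e :: real assume z: "z \<in> topspace Z" and e: "0 < e"
  obtain U \<xi> where U: "openin Z U" "z \<in> U" "\<xi> \<in> secs E" "\<And>z. z \<in> U \<Longrightarrow> hdist (F (a z)) (g z) (\<xi> (a z)) < e/2"
    using g z e unfolding section_approximable_def by (metis half_gt_zero)
  obtain V \<eta> where V: "openin Z V" "z \<in> V" "\<eta> \<in> secs E" "\<And>z. z \<in> V \<Longrightarrow> hdist (F (a z)) (h z) (\<eta> (a z)) < e/2"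
    using h z e unfolding section_approximable_def by (metis half_gt_zero)
  let ?s = "\<lambda>u\<in>topspace X. \<xi> u \<oplus>\<^bsub>F u\<^esub> \<eta> u"
  show "\<exists>U \<xi>. openin Z U \<and> z \<in> U \<and> \<xi> \<in> secs E \<and>
      (\<forall>y\<in>U. hdist (F (a y)) (g y \<oplus>\<^bsub>F (a y)\<^esub> h y) (\<xi> (a y)) < e)"
  proof (intro exI[of _ "U \<inter> V"] exI[of _ ?s] conjI ballI)
    fix y assume y: "y \<in> U \<inter> V"
    then have yZ: "y \<in> topspace Z" using openin_subset U(1) by blast
    then have ay: "a y \<in> topspace X" using a by auto
    have "hdist (F (a y)) (g y \<oplus>\<^bsub>F (a y)\<^esub> h y) (\<xi> (a y) \<oplus>\<^bsub>F (a y)\<^esub> \<eta> (a y))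
        \<le> hdist (F (a y)) (g y) (\<xi> (a y)) + hdist (F (a y)) (h y) (\<eta> (a y))"
      using semi_inner.hdist_add[OF si[OF yZ]] m[OF yZ] sec_mem ay U(3) V(3) by blast
    then show "hdist (F (a y)) (g y \<oplus>\<^bsub>F (a y)\<^esub> h y) (?s (a y)) < e"
      using U(4)[of y] V(4)[of y] y ay by simp
  qed (use U V add_sec in auto)
qed

lemma section_approximable_smult:
  assumes a: "a ` topspace Z \<subseteq> topspace X" and g: "section_approximable Z a g"
  shows "section_approximable Z a (\<lambda>z. c \<odot>\<^bsub>F (a z)\<^esub> g z)"
  unfolding section_approximable_def
proof (intro conjI ballI allI impI)
  have si: "semi_inner (F (a z)) (carrier (F (a z)))" if "z \<in> topspace Z" for z
    using a that by (intro semi_inner_fib) auto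
  have m: "g z \<in> carrier (F (a z))" if "z \<in> topspace Z" for z
    using g that by (auto simp: section_approximable_def)
  show "c \<odot>\<^bsub>F (a z)\<^esub> g z \<in> carrier (F (a z))" if "z \<in> topspace Z" for z
    using semi_inner.smult_mem[OF si[OF that]] m[OF that] by blast
  fix z and e :: real assume z: "z \<in> topspace Z" and e: "0 < e"
  have c: "0 < cmod c + 1" by (simp add: add_nonneg_pos)
  then have "0 < e / (cmod c + 1)" using e by simp
  then obtain U \<xi> where U: "openin Z U" "z \<in> U" "\<xi> \<in> secs E"
    "\<And>z. z \<in> U \<Longrightarrow> hdist (F (a z)) (g z) (\<xi> (a z)) < e / (cmod c + 1)"
    using g z unfolding section_approximable_def by metis
  let ?s = "\<lambda>u\<in>topspace X. c \<odot>\<^bsub>F u\<^esub> \<xi> u"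
  show "\<exists>U \<xi>. openin Z U \<and> z \<in> U \<and> \<xi> \<in> secs E \<and>
      (\<forall>y\<in>U. hdist (F (a y)) (c \<odot>\<^bsub>F (a y)\<^esub> g y) (\<xi> (a y)) < e)"
  proof (intro exI[of _ U] exI[of _ ?s] conjI ballI)
    fix y assume y: "y \<in> U"
    then have yZ: "y \<in> topspace Z" using openin_subset U(1) by blast
    then have ay: "a y \<in> topspace X" using a by auto
    interpret semi_inner "F (a y)" "carrier (F (a y))" by (rule si[OF yZ])
    have "hdist (F (a y)) (c \<odot>\<^bsub>F (a y)\<^esub> g y) (c \<odot>\<^bsub>F (a y)\<^esub> \<xi> (a y)) = cmod c * hdist (F (a y)) (g y) (\<xi> (a y))"
      using m[OF yZ] sec_mem[OF U(3) ay] by (rule hdist_smult)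
    also have "\<dots> \<le> (cmod c + 1) * hdist (F (a y)) (g y) (\<xi> (a y))"
      using hdist_nonneg[OF m[OF yZ] sec_mem[OF U(3) ay]] by (simp add: mult_right_mono)
    also have "\<dots> < e" using U(4)[OF y] c by (simp add: pos_less_divide_eq mult.commute)
    finally show "hdist (F (a y)) (c \<odot>\<^bsub>F (a y)\<^esub> g y) (?s (a y)) < e" using ay by simp
  qed (use U smult_sec in auto)
qed

text \<open>Near a point both lifts are uniformly close to pullbacks of sections, whose inner product is
  continuous; boundedness of the norms carries the approximation over to inner products.\<close>

lemma section_approximable_hip_continuous:
  assumes a: "continuous_map Z X a"
    and g: "section_approximable Z a g" and h: "section_approximable Z a h"
  shows "continuous_map Z euclidean (\<lambda>z. hip (F (a z)) (g z) (h z))"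
  unfolding continuous_map_dist
proof (intro ballI allI impI)
  have aZ: "a z \<in> topspace X" if "z \<in> topspace Z" for z using a that by (auto simp: continuous_map_def)
  have m: "g z \<in> carrier (F (a z))" "h z \<in> carrier (F (a z))" if "z \<in> topspace Z" for z
    using g h that by (auto simp: section_approximable_def)
  fix z and e :: real assume z: "z \<in> topspace Z" and e: "0 < e"
  \<comment> \<open>A bound for the norms of the approximating sections near \<open>z\<close>. The tolerance
    \<open>d\<close> makes the error \<open>2 d (M + 1)\<close> of the inner product at most
    \<open>e / 4\<close>.\<close>
  define M where "M = hnorm (F (a z)) (g z) + hnorm (F (a z)) (h z) + 2"
  have M: "2 \<le> M"
    using semi_inner.hnorm_nonneg[OF semi_inner_fib[OF aZ[OF z]]] m[OF z] by (simp add: M_def)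
  define d where "d = min 1 (e / (8 * (M + 1)))"
  have d: "0 < d" "d \<le> 1" using M e by (auto simp: d_def)
  have dM: "8 * (d * (M + 1)) \<le> e"
  proof -
    have "d \<le> e / (8 * (M + 1))" by (simp add: d_def)
    then show ?thesis using M by (simp add: pos_le_divide_eq mult_ac)
  qed
  obtain U \<xi> where U: "openin Z U" "z \<in> U" "\<xi> \<in> secs E" "\<And>z. z \<in> U \<Longrightarrow> hdist (F (a z)) (g z) (\<xi> (a z)) < d"
    using g z d unfolding section_approximable_def by metis
  obtain V \<eta> where V: "openin Z V" "z \<in> V" "\<eta> \<in> secs E" "\<And>z. z \<in> V \<Longrightarrow> hdist (F (a z)) (h z) (\<eta> (a z)) < d"
    using h z d unfolding section_approximable_def by metis
  have c1: "continuous_map Z euclidean (\<lambda>z. hip (F (a z)) (\<xi> (a z)) (\<eta> (a z)))"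
    using continuous_map_compose[OF a sec_hip_continuous[OF U(3) V(3)]] by (simp add: o_def)
  have c2: "continuous_map Z euclidean (\<lambda>z. hnorm (F (a z)) (\<xi> (a z)))"
    using continuous_map_compose[OF a continuous_norm[OF U(3)]] by (simp add: o_def)
  have c3: "continuous_map Z euclidean (\<lambda>z. hnorm (F (a z)) (\<eta> (a z)))"
    using continuous_map_compose[OF a continuous_norm[OF V(3)]] by (simp add: o_def)
  have e4: "0 < e / 4" using e by simp
  obtain A where A: "openin Z A" "z \<in> A" "\<And>y. y \<in> A \<Longrightarrow> dist (hip (F (a y)) (\<xi> (a y)) (\<eta> (a y))) (hip (F (a z)) (\<xi> (a z)) (\<eta> (a z))) < e / 4"
    using continuous_map_distD[OF c1 z e4] by metis
  have hz: "hnorm (F (a z)) (h z) + 1 < M"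
    using semi_inner.hnorm_nonneg[OF semi_inner_fib[OF aZ[OF z]] m(1)[OF z]] by (simp add: M_def)
  have nz: "hnorm (F (a z)) (\<xi> (a z)) < M" "hnorm (F (a z)) (\<eta> (a z)) < M"
  proof -
    interpret semi_inner "F (a z)" "carrier (F (a z))" by (rule semi_inner_fib[OF aZ[OF z]])
    note x = m[OF z] sec_mem[OF U(3) aZ[OF z]] sec_mem[OF V(3) aZ[OF z]]
    show "hnorm (F (a z)) (\<xi> (a z)) < M"
      using hnorm_diff_le[OF x(3) x(1)] hdist_commute[OF x(3) x(1)] U(4)[OF U(2)] d hnorm_nonneg[OF x(2)] by (simp add: M_def)
    show "hnorm (F (a z)) (\<eta> (a z)) < M"
      using hnorm_diff_le[OF x(4) x(2)] hdist_commute[OF x(4) x(2)] V(4)[OF V(2)] d hnorm_nonneg[OF x(1)] by (simp add: M_def)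
  qed
  define Q where "Q = U \<inter> V \<inter> A \<inter> {y \<in> topspace Z. hnorm (F (a y)) (\<xi> (a y)) < M} \<inter> {y \<in> topspace Z. hnorm (F (a y)) (\<eta> (a y)) < M}"
  have Q: "openin Z Q" unfolding Q_def
    by (intro openin_Int U V A continuous_map_preimage_less c2 c3)
  have zQ: "z \<in> Q" using z U V A nz by (auto simp: Q_def)
  have close: "cmod (hip (F (a y)) (g y) (h y) - hip (F (a y)) (\<xi> (a y)) (\<eta> (a y))) < e / 3" if y: "y \<in> Q" for y
  proof -
    have yZ: "y \<in> topspace Z" using y by (auto simp: Q_def)
    interpret semi_inner "F (a y)" "carrier (F (a y))" by (rule semi_inner_fib[OF aZ[OF yZ]])
    note x = m[OF yZ] sec_mem[OF U(3) aZ[OF yZ]] sec_mem[OF V(3) aZ[OF yZ]]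
    have n: "hnorm (F (a y)) (\<xi> (a y)) \<le> M" "hnorm (F (a y)) (\<eta> (a y)) \<le> M"
      "hdist (F (a y)) (g y) (\<xi> (a y)) \<le> d" "hdist (F (a y)) (h y) (\<eta> (a y)) \<le> d"
      using y U V by (auto simp: Q_def intro: less_imp_le)
    have nh: "hnorm (F (a y)) (h y) \<le> M + 1"
      using hnorm_diff_le[OF x(2) x(4)] n d by simp
    have "cmod (hip (F (a y)) (g y) (h y) - hip (F (a y)) (\<xi> (a y)) (\<eta> (a y)))
        \<le> hdist (F (a y)) (g y) (\<xi> (a y)) * hnorm (F (a y)) (h y) + hnorm (F (a y)) (\<xi> (a y)) * hdist (F (a y)) (h y) (\<eta> (a y))"
      by (rule hip_diff_le) (use x in auto)
    also have "\<dots> \<le> d * (M + 1) + M * d"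
      using n nh d M x by (intro add_mono mult_mono) (auto simp: hnorm_nonneg hdist_nonneg)
    also have "\<dots> \<le> 2 * (d * (M + 1))" using d by (simp add: algebra_simps)
    also have "\<dots> < e / 3" using dM e by simp
    finally show ?thesis .
  qed
  show "\<exists>U. openin Z U \<and> z \<in> U \<and> (\<forall>y\<in>U. dist (hip (F (a z)) (g z) (h z)) (hip (F (a y)) (g y) (h y)) < e)"
  proof (intro exI[of _ Q] conjI ballI Q zQ)
    fix y assume y: "y \<in> Q"
    have yA: "cmod (hip (F (a y)) (\<xi> (a y)) (\<eta> (a y)) - hip (F (a z)) (\<xi> (a z)) (\<eta> (a z))) < e / 4"
      using A(3)[of y] y by (simp add: Q_def dist_norm)
    have "hip (F (a y)) (g y) (h y) - hip (F (a z)) (g z) (h z)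
      = (hip (F (a y)) (g y) (h y) - hip (F (a y)) (\<xi> (a y)) (\<eta> (a y)))
      + (hip (F (a y)) (\<xi> (a y)) (\<eta> (a y)) - hip (F (a z)) (\<xi> (a z)) (\<eta> (a z)))
      - (hip (F (a z)) (g z) (h z) - hip (F (a z)) (\<xi> (a z)) (\<eta> (a z)))" by simp
    also have "cmod \<dots> \<le> cmod (hip (F (a y)) (g y) (h y) - hip (F (a y)) (\<xi> (a y)) (\<eta> (a y)))
      + cmod (hip (F (a y)) (\<xi> (a y)) (\<eta> (a y)) - hip (F (a z)) (\<xi> (a z)) (\<eta> (a z)))
      + cmod (hip (F (a z)) (g z) (h z) - hip (F (a z)) (\<xi> (a z)) (\<eta> (a z)))"
      by (meson add_right_mono norm_triangle_ineq norm_triangle_ineq4 order_trans)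
    also have "\<dots> < e" using close[OF y] close[OF zQ] yA e by simp
    finally show "dist (hip (F (a z)) (g z) (h z)) (hip (F (a y)) (g y) (h y)) < e" by (simp add: dist_norm norm_minus_commute)
  qed
qed

lemma section_approximable_sec:
  assumes a: "continuous_map Z X a" and \<xi>: "\<xi> \<in> secs E"
  shows "section_approximable Z a (\<lambda>z. \<xi> (a z))"
  unfolding section_approximable_def
proof (intro conjI ballI allI impI)
  have aZ: "a z \<in> topspace X" if "z \<in> topspace Z" for z using a that by (auto simp: continuous_map_def)
  then show m: "\<xi> (a z) \<in> carrier (F (a z))" if "z \<in> topspace Z" for z using sec_mem[OF \<xi>] that by blast
  fix z and e :: real assume z: "z \<in> topspace Z" and e: "0 < e"
  show "\<exists>U \<eta>. openin Z U \<and> z \<in> U \<and> \<eta> \<in> secs E \<and> (\<forall>y\<in>U. hdist (F (a y)) (\<xi> (a y)) (\<eta> (a y)) < e)"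
    using z e \<xi> semi_inner.hdist_self[OF semi_inner_fib[OF aZ] m]
    by (intro exI[of _ "topspace Z"] exI[of _ \<xi>]) auto
qed

lemma section_approximable_continuous_total_top:
  assumes a: "continuous_map Z X a" and g: "section_approximable Z a g"
  shows "continuous_map Z (total_top X E) (\<lambda>z. (a z, g z))"
proof (rule continuous_map_total_topI[OF a])
  show m: "g z \<in> carrier (F (a z))" if "z \<in> topspace Z" for z
    using g that by (auto simp: section_approximable_def)
  have aZ: "a z \<in> topspace X" if "z \<in> topspace Z" for z using a that by (auto simp: continuous_map_def)
  fix \<xi> assume \<xi>: "\<xi> \<in> secs E"
  note s = section_approximable_sec[OF a \<xi>]
  note cont = section_approximable_hip_continuous[OF a]
  have "continuous_map Z euclidean (\<lambda>z. sqrt (Re (hip (F (a z)) (g z) (g z)) + Re (hip (F (a z)) (\<xi> (a z)) (\<xi> (a z)))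
      - 2 * Re (hip (F (a z)) (g z) (\<xi> (a z)))))"
    using cont[OF g g] cont[OF s s] cont[OF g s] unfolding continuous_map_tendsto
    by (auto intro!: tendsto_intros)
  then show "continuous_map Z euclidean (\<lambda>z. hdist (F (a z)) (g z) (\<xi> (a z)))"
  proof (rule continuous_map_eq)
    fix z assume z: "z \<in> topspace Z"
    interpret semi_inner "F (a z)" "carrier (F (a z))" by (rule semi_inner_fib[OF aZ[OF z]])
    note x = m[OF z] sec_mem[OF \<xi> aZ[OF z]]
    show "sqrt (Re (hip (F (a z)) (g z) (g z)) + Re (hip (F (a z)) (\<xi> (a z)) (\<xi> (a z)))
      - 2 * Re (hip (F (a z)) (g z) (\<xi> (a z)))) = hdist (F (a z)) (g z) (\<xi> (a z))"
      using hdist_sq[OF x] hnorm_sq x hdist_nonneg[OF x] by (metis real_sqrt_unique)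
  qed
qed

end

section \<open>Measure systems with compact total space\<close>

locale compact_measure_system = full_equivariant_system G X \<rho> act \<mu>
  for G :: "'g groupoid" and X :: "'a topology" and \<rho> :: "'a \<Rightarrow> 'g"
    and act :: "'g \<Rightarrow> 'a \<Rightarrow> 'a" and \<mu> :: "'g \<Rightarrow> 'a measure" +
  assumes compact_X: "compact_space X"
    and closedin_Fib: "u \<in> units G \<Longrightarrow> closedin X {\<omega> \<in> topspace X. \<rho> \<omega> = u}"
begin

abbreviation Fib where "Fib u \<equiv> {\<omega> \<in> topspace X. \<rho> \<omega> = u}"

lemma Cc_X: "continuous_map X euclidean f \<Longrightarrow> f \<in> Cc X"
  by (simp add: Cc_def closedin_compact_space[OF compact_X])

context
  fixes u assumes u: "u \<in> units G"
begin

lemma radon_measure_\<mu>: "radon_measure X (\<mu> u)"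
  using radon[OF u] .

lemma sets_measure_\<mu>: "sets (\<mu> u) = sets (sigma (topspace X) {U. openin X U})"
  using radon_measure_\<mu> by (simp add: radon_measure_def)

lemma space_measure_\<mu>: "space (\<mu> u) = topspace X"
  using sets_eq_imp_space_eq[OF sets_measure_\<mu>] by (simp add: space_measure_of_conv)

lemma open_sets: "openin X U \<Longrightarrow> U \<in> sets (\<mu> u)"
  by (simp add: sets_measure_\<mu>) (rule in_measure_of, auto dest: openin_subset)

lemma closed_sets: "closedin X K \<Longrightarrow> K \<in> sets (\<mu> u)"
  using sets.compl_sets[OF open_sets, of "topspace X - K"] closedin_subset[of Y K]
  by (simp add: closedin_def space_measure_\<mu> double_diff)

lemma finite_measure_\<mu>: "finite_measure (\<mu> u)"
proof (rule finite_measureI)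
  have "emeasure (\<mu> u) (topspace X) < \<infinity>"
    using radon_measure_\<mu> compact_X unfolding radon_measure_def compact_space_def by blast
  then show "emeasure (\<mu> u) (space (\<mu> u)) \<noteq> \<infinity>" by (simp add: space_measure_\<mu>)
qed

text \<open>Inner regularity: a compact set that misses the support is covered by finitely many open null
  sets.\<close>

lemma emeasure_off_Fib: "emeasure (\<mu> u) (topspace X - Fib u) = 0"
proof -
  let ?O = "topspace X - Fib u"
  have O: "openin X ?O" using closedin_Fib[OF u] by (simp add: closedin_def)
  have null: "emeasure (\<mu> u) K = 0" if K: "compactin X K" "K \<subseteq> ?O" for K
  proof -
    have "\<exists>U. openin X U \<and> x \<in> U \<and> emeasure (\<mu> u) U = 0" if "x \<in> K" for x
    proof -
      have "x \<notin> measure_support X (\<mu> u)" using that K(2) full[OF u] by auto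
      then show ?thesis using that K(2) by (auto simp: measure_support_def not_gr_zero)
    qed
    then obtain N where N: "\<And>x. x \<in> K \<Longrightarrow> openin X (N x) \<and> x \<in> N x \<and> emeasure (\<mu> u) (N x) = 0" by metis
    have "\<exists>\<F>. finite \<F> \<and> \<F> \<subseteq> N ` K \<and> K \<subseteq> \<Union>\<F>"
      using K(1) N unfolding compactin_def by (elim conjE allE[of _ "N ` K"]) auto
    then obtain \<F> where \<F>: "finite \<F>" "\<F> \<subseteq> N ` K" "K \<subseteq> \<Union>\<F>" by blast
    have "\<Union>\<F> \<in> null_sets (\<mu> u)"
      using \<F>(1,2) N open_sets by (intro null_sets.finite_Union) auto
    then show ?thesis using \<F>(3) by (meson emeasure_eq_0 null_setsD1 null_setsD2)
  qed
  have "emeasure (\<mu> u) ?O = (SUP K\<in>{K. compactin X K \<and> K \<subseteq> ?O}. emeasure (\<mu> u) K)"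
    using radon_measure_\<mu> O unfolding radon_measure_def by blast
  also have "\<dots> = (SUP K\<in>{K. compactin X K \<and> K \<subseteq> ?O}. 0)"
    by (rule SUP_cong) (use null in auto)
  also have "\<dots> = 0" by (simp add: SUP_constant bot_ennreal)
  finally show ?thesis .
qed

lemma AE_Fib: "AE \<omega> in \<mu> u. \<omega> \<in> Fib u"
proof (rule AE_I)
  show "{\<omega> \<in> space (\<mu> u). \<omega> \<notin> Fib u} \<subseteq> topspace X - Fib u" by (auto simp: space_measure_\<mu>)
  show "topspace X - Fib u \<in> sets (\<mu> u)" using open_sets closedin_Fib[OF u] by (simp add: closedin_def)
qed (rule emeasure_off_Fib)

lemma set_integrable_Fib:
  fixes f :: "'a \<Rightarrow> complex"
  assumes f: "continuous_map (subtopology X (Fib u)) euclidean f"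
  shows "set_integrable (\<mu> u) (Fib u) f"
proof -
  interpret finite_measure "\<mu> u" by (rule finite_measure_\<mu>)
  let ?f = "\<lambda>\<omega>. indicator (Fib u) \<omega> *\<^sub>R f \<omega>"
  have K: "Fib u \<in> sets (\<mu> u)" by (rule closed_sets[OF closedin_Fib[OF u]])
  have "compactin X (Fib u)" by (rule closedin_compact_space[OF compact_X closedin_Fib[OF u]])
  then have "compactin (subtopology X (Fib u)) (Fib u)" by (simp add: compactin_subtopology)
  then have "compactin euclidean (f ` Fib u)" using f by (rule image_compactin)
  then have "bounded (f ` Fib u)" by (simp add: compact_imp_bounded)
  then obtain B where B: "\<And>\<omega>. \<omega> \<in> Fib u \<Longrightarrow> cmod (f \<omega>) \<le> B" unfolding bounded_iff by blast
  have "?f \<in> borel_measurable (\<mu> u)"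
  proof (rule borel_measurableI)
    fix S :: "complex set" assume S: "open S"
    have "openin (subtopology X (Fib u)) {\<omega> \<in> topspace (subtopology X (Fib u)). f \<omega> \<in> S}"
      using f S by (intro openin_continuous_map_preimage) auto
    then obtain W where W: "openin X W"
      and eq: "{\<omega> \<in> topspace (subtopology X (Fib u)). f \<omega> \<in> S} = W \<inter> Fib u"
      by (auto simp: openin_subtopology)
    have "?f -` S \<inter> space (\<mu> u) = (W \<inter> Fib u) \<union> (if 0 \<in> S then space (\<mu> u) - Fib u else {})"
      unfolding eq[symmetric] by (auto simp: space_measure_\<mu> split: split_indicator_asm)
    also have "\<dots> \<in> sets (\<mu> u)" using K open_sets[OF W] by auto
    finally show "?f -` S \<inter> space (\<mu> u) \<in> sets (\<mu> u)" .
  qed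
  moreover have "AE \<omega> in \<mu> u. norm (?f \<omega>) \<le> max B 0"
    using B by (intro AE_I2) (fastforce simp: indicator_def)
  ultimately show ?thesis unfolding set_integrable_def by (rule integrable_const_bound[rotated])
qed

lemma integral_eq_Fib:
  fixes f :: "'a \<Rightarrow> complex"
  assumes f: "continuous_map X euclidean f"
  shows "integral\<^sup>L (\<mu> u) f = set_lebesgue_integral (\<mu> u) (Fib u) f"
  unfolding set_lebesgue_integral_def
proof (rule integral_cong_AE)
  show "f \<in> borel_measurable (\<mu> u)"
  proof (rule borel_measurableI)
    fix S :: "complex set" assume "open S"
    then have "openin X {\<omega> \<in> topspace X. f \<omega> \<in> S}" using f by (intro openin_continuous_map_preimage) auto
    then show "f -` S \<inter> space (\<mu> u) \<in> sets (\<mu> u)"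
      using open_sets by (simp add: space_measure_\<mu> vimage_def Int_def conj_commute)
  qed
  show "(\<lambda>\<omega>. indicator (Fib u) \<omega> *\<^sub>R f \<omega>) \<in> borel_measurable (\<mu> u)"
    using set_integrable_Fib[OF continuous_map_from_subtopology[OF f]]
    by (auto simp: set_integrable_def dest: borel_measurable_integrable)
  show "AE \<omega> in \<mu> u. f \<omega> = indicator (Fib u) \<omega> *\<^sub>R f \<omega>"
    using AE_Fib by eventually_elim auto
qed

text \<open>Fullness of the system: the points where \<open>Re f\<close> exceeds half of its value at
  \<open>\<omega>\<close> form an open neighbourhood of a point of the support.\<close>

lemma set_integral_pos:
  fixes f :: "'a \<Rightarrow> complex"
  assumes f: "continuous_map X euclidean f"
    and nonneg: "\<And>\<omega>. \<omega> \<in> Fib u \<Longrightarrow> 0 \<le> Re (f \<omega>)"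
    and \<omega>: "\<omega> \<in> Fib u" and pos: "0 < Re (f \<omega>)"
  shows "0 < Re (set_lebesgue_integral (\<mu> u) (Fib u) f)"
proof -
  interpret finite_measure "\<mu> u" by (rule finite_measure_\<mu>)
  define c where "c = Re (f \<omega>) / 2"
  define U where "U = {\<omega> \<in> topspace X. c < Re (f \<omega>)}"
  have "continuous_map X euclidean (\<lambda>\<omega>. Re (f \<omega>))" using f by (simp add: continuous_map_Re_Im)
  then have U: "openin X U"
    using openin_continuous_map_preimage[of X euclidean _ "{c<..}"] by (simp add: U_def)
  have "\<omega> \<in> measure_support X (\<mu> u)" using full[OF u] \<omega> by simp
  then have "0 < emeasure (\<mu> u) U"
    using U \<omega> pos by (auto simp: measure_support_def U_def c_def)
  moreover have "emeasure (\<mu> u) (U \<inter> Fib u) = emeasure (\<mu> u) U"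
    using AE_Fib open_sets[OF U] closed_sets[OF closedin_Fib[OF u]]
    by (intro emeasure_eq_AE) auto
  ultimately have mpos: "0 < measure (\<mu> u) (U \<inter> Fib u)"
    by (simp add: emeasure_eq_measure)
  note int = set_integrable_Fib[OF continuous_map_from_subtopology[OF f]]
  let ?f = "\<lambda>\<omega>. Re (indicator (Fib u) \<omega> *\<^sub>R f \<omega>)"
  have int': "integrable (\<mu> u) ?f" using int unfolding set_integrable_def by (rule integrable_Re)
  have "0 < c * measure (\<mu> u) (U \<inter> Fib u)" using mpos pos by (simp add: c_def)
  also have "\<dots> = integral\<^sup>L (\<mu> u) (\<lambda>\<omega>. c * indicator (U \<inter> Fib u) \<omega>)"
  proof -
    have "U \<inter> Fib u \<inter> topspace X = U \<inter> Fib u" by blast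
    then show ?thesis by (simp add: space_measure_\<mu>)
  qed
  also have "\<dots> \<le> integral\<^sup>L (\<mu> u) ?f"
  proof (rule integral_mono)
    show "integrable (\<mu> u) (\<lambda>\<omega>. c * indicator (U \<inter> Fib u) \<omega>)"
      using open_sets[OF U] closed_sets[OF closedin_Fib[OF u]]
      by (intro integrable_mult_right integrable_real_indicator) (auto simp: less_top[symmetric])
    show "c * indicator (U \<inter> Fib u) \<omega> \<le> ?f \<omega>" for \<omega>
      using nonneg[of \<omega>] by (auto simp: U_def indicator_def)
  qed (rule int')
  also have "\<dots> = Re (set_lebesgue_integral (\<mu> u) (Fib u) f)"
    unfolding set_lebesgue_integral_def by (rule integral_Re[OF int[unfolded set_integrable_def]])
  finally show ?thesis .
qed

end

lemma set_integral_act: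
  fixes f :: "'a \<Rightarrow> complex"
  assumes x: "x \<in> arrows G" "grng G x \<in> units G" and f: "continuous_map X euclidean f"
  shows "set_lebesgue_integral (\<mu> (gdom G x)) (Fib (gdom G x)) (\<lambda>\<omega>. f (act x \<omega>))
    = set_lebesgue_integral (\<mu> (grng G x)) (Fib (grng G x)) f"
  using equivariant[OF x(1) Cc_X[OF f]] by (simp add: integral_eq_Fib[OF x(2) f])

end

section \<open>Compact groupoids and their coset spaces\<close>

context topological_groupoid
begin

abbreviation r where "r \<equiv> grng G"
abbreviation d where "d \<equiv> gdom G"
abbreviation i where "i \<equiv> ginv G"
abbreviation A where "A \<equiv> arrows G"
abbreviation mult (infixl "\<cdot>" 70) where "x \<cdot> y \<equiv> gmul G x y"

lemma composable_iff: "(x, y) \<in> composable G \<longleftrightarrow> x \<in> A \<and> y \<in> A \<and> d x = r y"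
  by (simp add: composable_def)

lemma units_iff: "u \<in> units G \<longleftrightarrow> u \<in> A \<and> r u = u"
  using rng_closed rng_dom_rng by (auto simp: units_def) (metis imageI)

lemma unit_arrow: "u \<in> units G \<Longrightarrow> u \<in> A"
  and unit_rng: "u \<in> units G \<Longrightarrow> r u = u"
  and unit_dom: "u \<in> units G \<Longrightarrow> d u = u"
  using units_iff rng_dom_rng by (blast, blast, metis)

lemma rng_unit: "x \<in> A \<Longrightarrow> r x \<in> units G"
  by (simp add: units_def)

lemma dom_unit: "x \<in> A \<Longrightarrow> d x \<in> units G"
  by (simp add: units_iff dom_closed rng_dom_dom)

lemma mult_arrow: "x \<in> A \<Longrightarrow> y \<in> A \<Longrightarrow> d x = r y \<Longrightarrow> x \<cdot> y \<in> A"
  and mult_rng: "x \<in> A \<Longrightarrow> y \<in> A \<Longrightarrow> d x = r y \<Longrightarrow> r (x \<cdot> y) = r x"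
  and mult_dom: "x \<in> A \<Longrightarrow> y \<in> A \<Longrightarrow> d x = r y \<Longrightarrow> d (x \<cdot> y) = d y"
  by (simp_all add: mul_closed rng_mul dom_mul composable_iff)

lemma mult_assoc:
  "x \<in> A \<Longrightarrow> y \<in> A \<Longrightarrow> z \<in> A \<Longrightarrow> d x = r y \<Longrightarrow> d y = r z \<Longrightarrow> x \<cdot> y \<cdot> z = x \<cdot> (y \<cdot> z)"
  by (simp add: assoc composable_iff)

lemmas gsimps = mult_arrow mult_rng mult_dom mult_assoc inv_closed rng_inv dom_inv mul_inv inv_mul
  unit_mul mul_unit

lemma unit_mult: "x \<in> A \<Longrightarrow> r x = u \<Longrightarrow> u \<cdot> x = x"
  and mult_unit: "x \<in> A \<Longrightarrow> d x = u \<Longrightarrow> x \<cdot> u = x"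
  using unit_mul mul_unit by auto

lemma inv_mult_cancel: "x \<in> A \<Longrightarrow> y \<in> A \<Longrightarrow> d x = r y \<Longrightarrow> i x \<cdot> (x \<cdot> y) = y"
  by (simp add: mult_assoc[symmetric] gsimps(5-9) unit_mult)

lemma mult_inv_cancel: "x \<in> A \<Longrightarrow> y \<in> A \<Longrightarrow> r x = r y \<Longrightarrow> x \<cdot> (i x \<cdot> y) = y"
  by (simp add: mult_assoc[symmetric] gsimps(5-9) unit_mult)

lemma left_cancel:
  assumes "x \<in> A" "y \<in> A" "z \<in> A" "d x = r y" "d x = r z" "x \<cdot> y = x \<cdot> z" shows "y = z"
  using assms inv_mult_cancel by metis

lemma inv_inv: "x \<in> A \<Longrightarrow> i (i x) = x"
  by (rule left_cancel[of "i x"]) (simp_all add: gsimps)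

lemma inv_mult: "x \<in> A \<Longrightarrow> y \<in> A \<Longrightarrow> d x = r y \<Longrightarrow> i (x \<cdot> y) = i y \<cdot> i x"
  by (rule left_cancel[of "x \<cdot> y"]) (simp_all add: gsimps mult_inv_cancel)

lemma inv_unit: "u \<in> units G \<Longrightarrow> i u = u"
  by (metis mul_inv unit_arrow unit_rng unit_dom mult_assoc inv_closed rng_inv dom_inv unit_mult)

lemma continuous_mult:
  assumes f: "continuous_map Z (gtop G) f" and g: "continuous_map Z (gtop G) g"
    and fg: "\<And>z. z \<in> topspace Z \<Longrightarrow> d (f z) = r (g z)"
  shows "continuous_map Z (gtop G) (\<lambda>z. f z \<cdot> g z)"
proof -
  have "f z \<in> A \<and> g z \<in> A" if "z \<in> topspace Z" for z using f g that by (auto simp: continuous_map_def)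
  then have "continuous_map Z (subtopology (prod_topology (gtop G) (gtop G)) (composable G)) (\<lambda>z. (f z, g z))"
    using f g fg by (auto simp: continuous_map_in_subtopology composable_iff intro: continuous_map_pairedI)
  from continuous_map_compose[OF this continuous_mul] show ?thesis by (simp add: o_def)
qed

lemma continuous_inv': "continuous_map Z (gtop G) f \<Longrightarrow> continuous_map Z (gtop G) (\<lambda>z. i (f z))"
  using continuous_map_compose[OF _ continuous_inv, of Z f] by (simp add: o_def)

lemma continuous_rng: "continuous_map (gtop G) (gtop G) r"
proof (rule continuous_map_eq)
  show "continuous_map (gtop G) (gtop G) (\<lambda>x. x \<cdot> i x)"
    by (rule continuous_mult) (use continuous_inv rng_inv in \<open>auto simp: continuous_map_id[unfolded id_def]\<close>)
qed (simp add: mul_inv)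

lemma continuous_dom: "continuous_map (gtop G) (gtop G) d"
proof (rule continuous_map_eq)
  show "continuous_map (gtop G) (gtop G) (\<lambda>x. r (i x))"
    using continuous_map_compose[OF continuous_inv continuous_rng] by (simp add: o_def)
qed (simp add: rng_inv)

lemma topspace_unit_top: "topspace (unit_top G) = units G"
  using unit_arrow by (auto simp: unit_top_def)

lemma continuous_rng_unit: "continuous_map (gtop G) (unit_top G) r"
  and continuous_dom_unit: "continuous_map (gtop G) (unit_top G) d"
  unfolding unit_top_def
  using continuous_rng continuous_dom rng_unit dom_unit by (auto simp: continuous_map_in_subtopology)

lemma closedin_equalizer_gtop:
  assumes "continuous_map (gtop G) (gtop G) f" "continuous_map (gtop G) (gtop G) g"
  shows "closedin (gtop G) {x \<in> A. f x = g x}"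
  using Hausdorff_gtop assms by (rule closedin_continuous_maps_eq)

lemma closedin_units: "closedin (gtop G) (units G)"
proof -
  have "units G = {x \<in> A. r x = id x}" by (auto simp: units_iff)
  then show ?thesis using closedin_equalizer_gtop[OF continuous_rng continuous_map_id] by simp
qed

lemma closedin_rfib: "closedin (gtop G) (rfib G u)"
proof (cases "u \<in> A")
  case True
  then show ?thesis unfolding rfib_def by (intro closedin_equalizer_gtop continuous_rng) simp
next
  case False
  then have "rfib G u = {}" using rng_closed by (auto simp: rfib_def)
  then show ?thesis by simp
qed

end

lemma UN_quotient: "topspace X // R = (\<lambda>x. R `` {x}) ` topspace X"
  by (auto simp: quotient_def)

locale groupoid_pair = topological_groupoid G + wide_subgroupoid G H
  for G :: "'g groupoid" and H :: "'g set" +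
  assumes compact_gtop: "compact_space (gtop G)" and closed_H: "closedin (gtop G) H"
begin

abbreviation Y where "Y \<equiv> coset_space G H"
abbreviation q where "q \<equiv> coset G H"

lemma H_arrow: "h \<in> H \<Longrightarrow> h \<in> A"
  using sub_arrows by blast

lemma arrows_restrict: "arrows (restrict_groupoid G H) = H"
  using sub_arrows by (auto simp: restrict_groupoid_def)

lemma restrict_simps:
  "gtop (restrict_groupoid G H) = subtopology (gtop G) H"
  "grng (restrict_groupoid G H) = r" "gdom (restrict_groupoid G H) = d"
  "gmul (restrict_groupoid G H) = gmul G" "ginv (restrict_groupoid G H) = i"
  by (simp_all add: restrict_groupoid_def)

lemma units_restrict: "units (restrict_groupoid G H) = units G"
proof -
  have "u \<in> r ` H" if "u \<in> units G" for u
    using that sub_wide unit_rng by (metis imageI subsetD)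
  then show ?thesis
    using rng_unit H_arrow by (auto simp: units_def[of "restrict_groupoid G H"] arrows_restrict restrict_simps(2))
qed

lemma coset_eq: "x \<in> A \<Longrightarrow> q x = {y \<in> A. r y = r x \<and> i x \<cdot> y \<in> H}"
  by (auto simp: coset_def coset_rel_def)

lemma coset_memD: "y \<in> q x \<Longrightarrow> x \<in> A \<and> y \<in> A \<and> r y = r x \<and> i x \<cdot> y \<in> H"
  by (auto simp: coset_def coset_rel_def)

lemma coset_self: "x \<in> A \<Longrightarrow> x \<in> q x"
  using sub_wide dom_unit by (auto simp: coset_eq inv_mul)

lemma coset_eqI:
  assumes "y \<in> q x" shows "q y = q x"
proof -
  have x: "x \<in> A" and y: "y \<in> A" and ryx: "r y = r x" and h: "i x \<cdot> y \<in> H"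
    using coset_memD[OF assms] by auto
  have h': "i y \<cdot> x \<in> H"
    using sub_inv[OF h] x y ryx by (simp add: inv_mult inv_inv gsimps)
  have tr: "i b \<cdot> z \<in> H" if "a \<in> A" "b \<in> A" "z \<in> A" "r a = r b" "r z = r b" "i b \<cdot> a \<in> H" "i a \<cdot> z \<in> H" for a b z
  proof -
    have "(i b \<cdot> a) \<cdot> (i a \<cdot> z) \<in> H" by (rule sub_mul[OF that(6,7)]) (use that in \<open>simp add: gsimps\<close>)
    moreover have "(i b \<cdot> a) \<cdot> (i a \<cdot> z) = i b \<cdot> z" using that by (simp add: gsimps mult_inv_cancel)
    ultimately show ?thesis by simp
  qed
  have "i x \<cdot> z \<in> H \<longleftrightarrow> i y \<cdot> z \<in> H" if "z \<in> A" "r z = r x" for z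
    using tr[OF x y that(1) _ _ h'] tr[OF y x that(1) _ _ h] that ryx by auto
  then show ?thesis using x y ryx by (auto simp: coset_eq)
qed

lemma coset_mult: "x \<in> A \<Longrightarrow> h \<in> H \<Longrightarrow> d x = r h \<Longrightarrow> q (x \<cdot> h) = q x"
  by (rule coset_eqI) (use H_arrow in \<open>auto simp: coset_eq gsimps inv_mult_cancel\<close>)

lemma coset_mem_mult:
  assumes "y \<in> q x" obtains h where "h \<in> H" "d x = r h" "y = x \<cdot> h"
proof
  note c = coset_memD[OF assms]
  show "i x \<cdot> y \<in> H" "d x = r (i x \<cdot> y)" "y = x \<cdot> (i x \<cdot> y)"
    using c by (auto simp: gsimps mult_inv_cancel)
qed

lemma topspace_Y: "topspace Y = q ` A"
  by (simp add: coset_space_def topspace_quotient_topology UN_quotient coset_def)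

lemma quotient_map_q: "quotient_map (gtop G) Y q"
  unfolding quotient_map_def
  by (auto simp: topspace_Y) (auto simp: coset_space_def openin_quotient_topology coset_def UN_quotient)

lemma coset_rep_mem: "x \<in> A \<Longrightarrow> coset_rep (q x) \<in> q x"
  unfolding coset_rep_def by (rule someI, rule coset_self)

lemma coset_rng_coset: "x \<in> A \<Longrightarrow> coset_rng G (q x) = r x"
  using coset_memD[OF coset_rep_mem] by (simp add: coset_rng_def)

lemma coset_act_coset:
  assumes g: "g \<in> A" and x: "x \<in> A" and gx: "d g = r x"
  shows "coset_act G H g (q x) = q (g \<cdot> x)"
proof -
  obtain h where h: "h \<in> H" "d x = r h" "coset_rep (q x) = x \<cdot> h"
    by (rule coset_mem_mult[OF coset_rep_mem[OF x]])
  then have "coset_act G H g (q x) = q (g \<cdot> x \<cdot> h)"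
    using g x gx H_arrow by (simp add: coset_act_def gsimps)
  also have "\<dots> = q (g \<cdot> x)" using g x gx h by (intro coset_mult) (auto simp: gsimps)
  finally show ?thesis .
qed

abbreviation Fib where "Fib u \<equiv> {\<omega> \<in> topspace Y. coset_rng G \<omega> = u}"

lemma Fib_eq: "Fib u = q ` rfib G u"
  by (auto simp: topspace_Y rfib_def coset_rng_coset)

lemma preimage_Fib: "{x \<in> A. q x \<in> Fib u} = rfib G u"
  by (auto simp: topspace_Y rfib_def coset_rng_coset)

lemma closedin_Fib: "closedin Y (Fib u)"
proof -
  have "\<forall>U. U \<subseteq> topspace Y \<longrightarrow> closedin (gtop G) {x \<in> A. q x \<in> U} = closedin Y U"
    using quotient_map_q unfolding quotient_map_closedin by (rule conjunct2)
  then have "closedin (gtop G) {x \<in> A. q x \<in> Fib u} = closedin Y (Fib u)"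
    by (elim allE[of _ "Fib u"]) simp
  then show ?thesis unfolding preimage_Fib using closedin_rfib by blast
qed

lemma quotient_map_Fib:
  "quotient_map (subtopology (gtop G) (rfib G u)) (subtopology Y (Fib u)) q"
  by (rule quotient_map_restriction[OF quotient_map_q preimage_Fib disjI2[OF closedin_Fib]])

lemma compact_Y: "compact_space Y"
  using image_compactin[OF _ quotient_imp_continuous_map[OF quotient_map_q], of A] compact_gtop
  by (simp add: compact_space_def topspace_Y)

text \<open>A function on a fibre of the coset space is continuous if its composition with the quotient map
  is, since that map restricts to a quotient map over the closed fibre.\<close>

lemma coset_fun_continuous:
  assumes f: "continuous_map (subtopology (gtop G) (rfib G u)) euclidean f"
    and g: "\<And>x. x \<in> rfib G u \<Longrightarrow> g (q x) = f x"
  shows "continuous_map (subtopology Y (Fib u)) euclidean g"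
proof (rule continuous_compose_quotient_map[OF quotient_map_Fib])
  show "continuous_map (subtopology (gtop G) (rfib G u)) euclidean (g \<circ> q)"
    by (rule continuous_map_eq[OF f]) (simp add: g)
qed

lemma coset_fun_continuous_all:
  assumes f: "continuous_map (gtop G) euclidean f" and g: "\<And>x. x \<in> A \<Longrightarrow> g (q x) = f x"
  shows "continuous_map Y euclidean g"
proof (rule continuous_compose_quotient_map[OF quotient_map_q])
  show "continuous_map (gtop G) euclidean (g \<circ> q)"
    by (rule continuous_map_eq[OF f]) (simp add: g)
qed

end

locale coset_measures = groupoid_pair G H for G :: "'g groupoid" and H :: "'g set" +
  fixes \<mu> :: "'g \<Rightarrow> 'g set measure"
  assumes coset_measure_system: "coset_measure_system G H \<mu>"
begin

sublocale \<mu>: compact_measure_system G Y "coset_rng G" "coset_act G H" \<mu>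
  using coset_measure_system compact_Y closedin_Fib
  by (simp add: coset_measure_system_def compact_measure_system_def compact_measure_system_axioms_def)

lemma set_integral_translate:
  fixes f :: "'g set \<Rightarrow> complex"
  assumes g: "g \<in> A" and f: "continuous_map Y euclidean f"
  shows "set_lebesgue_integral (\<mu> (r g)) (Fib (r g)) (\<lambda>\<omega>. f (coset_act G H (i g) \<omega>))
    = set_lebesgue_integral (\<mu> (d g)) (Fib (d g)) f"
  using \<mu>.set_integral_act[OF inv_closed[OF g] _ f] g dom_unit by (simp add: gsimps)

end

section \<open>The pre-Hilbert spaces of the induced representation\<close>

locale groupoid_pair_rep = groupoid_pair G H for G :: "'g groupoid" and H :: "'g set" +
  fixes E :: "('g, 'v) hbundle" and \<pi> :: "'g \<Rightarrow> 'v \<Rightarrow> 'v"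
  assumes rep: "continuous_unitary_rep (restrict_groupoid G H) E \<pi>"
begin

abbreviation F where "F u \<equiv> fib E u"

lemma unit_top_restrict: "unit_top (restrict_groupoid G H) = unit_top G"
  unfolding unit_top_def units_restrict restrict_simps(1)
  using sub_wide by (simp add: subtopology_subtopology Int_absorb1 Int_absorb2 inf.absorb2)

sublocale bun: continuous_hilbert_bundle "unit_top G" E
  using continuous_unitary_rep.rep_bundle[OF rep] by (simp add: unit_top_restrict)

lemma fib_hilbert: "u \<in> units G \<Longrightarrow> hilbert_space (F u)"
  using bun.hilbert_fib by (simp add: topspace_unit_top)

lemma fib_semi: "u \<in> units G \<Longrightarrow> semi_inner (F u) (carrier (F u))"
  using bun.semi_inner_fib by (simp add: topspace_unit_top)

lemma \<pi>_unitary: "h \<in> H \<Longrightarrow> unitary_map (F (d h)) (F (r h)) (\<pi> h)"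
  using continuous_unitary_rep.unitary[OF rep, of h] by (simp only: arrows_restrict restrict_simps(2-5))

lemma \<pi>_mem: "h \<in> H \<Longrightarrow> v \<in> carrier (F (d h)) \<Longrightarrow> \<pi> h v \<in> carrier (F (r h))"
  and \<pi>_add: "h \<in> H \<Longrightarrow> v \<in> carrier (F (d h)) \<Longrightarrow> w \<in> carrier (F (d h)) \<Longrightarrow>
    \<pi> h (v \<oplus>\<^bsub>F (d h)\<^esub> w) = \<pi> h v \<oplus>\<^bsub>F (r h)\<^esub> \<pi> h w"
  and \<pi>_smult: "h \<in> H \<Longrightarrow> v \<in> carrier (F (d h)) \<Longrightarrow> \<pi> h (c \<odot>\<^bsub>F (d h)\<^esub> v) = c \<odot>\<^bsub>F (r h)\<^esub> \<pi> h v"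
  and \<pi>_hip: "h \<in> H \<Longrightarrow> v \<in> carrier (F (d h)) \<Longrightarrow> w \<in> carrier (F (d h)) \<Longrightarrow>
    hip (F (r h)) (\<pi> h v) (\<pi> h w) = hip (F (d h)) v w"
  using \<pi>_unitary[of h] by (auto simp: unitary_map_def linear_isometry_def)

lemma \<pi>_hnorm: "h \<in> H \<Longrightarrow> v \<in> carrier (F (d h)) \<Longrightarrow> hnorm (F (r h)) (\<pi> h v) = hnorm (F (d h)) v"
  by (simp add: hnorm_def \<pi>_hip)

lemma \<pi>_unit: "u \<in> units G \<Longrightarrow> v \<in> carrier (F u) \<Longrightarrow> \<pi> u v = v"
  using continuous_unitary_rep.rep_unit[OF rep] by (simp only: units_restrict)

lemma \<pi>_mult:
  "x \<in> H \<Longrightarrow> y \<in> H \<Longrightarrow> d x = r y \<Longrightarrow> v \<in> carrier (F (d y)) \<Longrightarrow> \<pi> x (\<pi> y v) = \<pi> (x \<cdot> y) v"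
  using continuous_unitary_rep.rep_mul[OF rep, of x y v]
  by (simp add: composable_def arrows_restrict[simplified] restrict_simps) (use H_arrow in blast)

lemma \<pi>_inv: "h \<in> H \<Longrightarrow> v \<in> carrier (F (d h)) \<Longrightarrow> \<pi> (i h) (\<pi> h v) = v"
  using continuous_unitary_rep.rep_inv[OF rep, of h v] by (simp only: arrows_restrict restrict_simps(2-5))

lemma compact_unit_top: "compact_space (unit_top G)"
  unfolding unit_top_def
  by (intro compact_space_subtopology closedin_compact_space closedin_units compact_gtop)

lemma C0_secs_eq: "C0_secs (unit_top G) E = secs E"
proof -
  have "compactin (unit_top G) {u \<in> topspace (unit_top G). e \<le> hnorm (F u) (\<xi> u)}" if "\<xi> \<in> secs E" for e \<xi>
    using closedin_continuous_map_preimage[OF bun.continuous_norm[OF that], of "{e..}"]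
    by (intro closedin_compact_space compact_unit_top) simp
  then show ?thesis by (auto simp: C0_secs_def)
qed

lemma \<pi>_continuous: "\<xi> \<in> secs E \<Longrightarrow> \<eta> \<in> secs E \<Longrightarrow>
    continuous_map (subtopology (gtop G) H) euclidean (\<lambda>h. hip (F (r h)) (\<pi> h (\<xi> (d h))) (\<eta> (r h)))"
  using continuous_unitary_rep.rep_continuous[OF rep, of \<xi> \<eta>]
  by (simp only: unit_top_restrict C0_secs_eq restrict_simps)

text \<open>Functions on \<open>S\<close>, continuous with values in the bundle pulled back along
  \<open>d\<close>, that transform under right translation by \<open>H\<close> like the elements
  of the induced representation. For \<open>S\<close> the space of all arrows this is the space
  \<open>\<F>\<^sub>0\<close>; for an \<open>r\<close>-fibre it serves as the larger space
  \<open>W\<close> around the pre-Hilbert space.\<close>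

definition eqv :: "'g set \<Rightarrow> ('g \<Rightarrow> 'v) set" where
  "eqv S = {a \<in> \<Pi>\<^sub>E x\<in>S. carrier (F (d x)).
    bun.section_approximable (subtopology (gtop G) S) d a \<and>
    (\<forall>x\<in>S. \<forall>h\<in>H. d x = r h \<longrightarrow> x \<cdot> h \<in> S \<longrightarrow> a (x \<cdot> h) = \<pi> (i h) (a x))}"

lemma dom_units_sub: "S \<subseteq> A \<Longrightarrow> d ` topspace (subtopology (gtop G) S) \<subseteq> topspace (unit_top G)"
  using dom_unit by (auto simp: topspace_unit_top)

lemma eqv_mem: "a \<in> eqv S \<Longrightarrow> x \<in> S \<Longrightarrow> a x \<in> carrier (F (d x))"
  by (auto simp: eqv_def)

lemma eqv_mult: "a \<in> eqv S \<Longrightarrow> x \<in> S \<Longrightarrow> h \<in> H \<Longrightarrow> d x = r h \<Longrightarrow> x \<cdot> h \<in> S \<Longrightarrow> a (x \<cdot> h) = \<pi> (i h) (a x)"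
  by (auto simp: eqv_def)

lemma eqv_add:
  assumes S: "S \<subseteq> A" and a: "a \<in> eqv S" and b: "b \<in> eqv S"
  shows "(\<lambda>x\<in>S. a x \<oplus>\<^bsub>F (d x)\<^esub> b x) \<in> eqv S"
proof -
  have SA: "x \<in> A" if "x \<in> S" for x using S that by blast
  have mem: "(\<lambda>x\<in>S. a x \<oplus>\<^bsub>F (d x)\<^esub> b x) \<in> (\<Pi>\<^sub>E x\<in>S. carrier (F (d x)))"
    using eqv_mem[OF a] eqv_mem[OF b] semi_inner.add_mem[OF fib_semi[OF dom_unit]] SA by auto
  have "bun.section_approximable (subtopology (gtop G) S) d (\<lambda>x. a x \<oplus>\<^bsub>F (d x)\<^esub> b x)"
    using a b by (intro bun.section_approximable_add dom_units_sub S) (auto simp: eqv_def)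
  then have app: "bun.section_approximable (subtopology (gtop G) S) d (\<lambda>x\<in>S. a x \<oplus>\<^bsub>F (d x)\<^esub> b x)"
    by (rule bun.section_approximable_cong) auto
  have "(a (x \<cdot> h)) \<oplus>\<^bsub>F (d (x \<cdot> h))\<^esub> b (x \<cdot> h) = \<pi> (i h) (a x \<oplus>\<^bsub>F (d x)\<^esub> b x)"
    if "x \<in> S" "h \<in> H" "d x = r h" "x \<cdot> h \<in> S" for x h
    using that eqv_mult[OF a that] eqv_mult[OF b that] \<pi>_add[OF sub_inv[OF that(2)], of "a x" "b x"]
      eqv_mem[OF a that(1)] eqv_mem[OF b that(1)] SA H_arrow
    by (simp add: gsimps)
  then show ?thesis using mem app unfolding eqv_def by auto
qed

lemma eqv_smult:
  assumes S: "S \<subseteq> A" and a: "a \<in> eqv S"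
  shows "(\<lambda>x\<in>S. c \<odot>\<^bsub>F (d x)\<^esub> a x) \<in> eqv S"
proof -
  have SA: "x \<in> A" if "x \<in> S" for x using S that by blast
  have mem: "(\<lambda>x\<in>S. c \<odot>\<^bsub>F (d x)\<^esub> a x) \<in> (\<Pi>\<^sub>E x\<in>S. carrier (F (d x)))"
    using eqv_mem[OF a] semi_inner.smult_mem[OF fib_semi[OF dom_unit]] SA by auto
  have "bun.section_approximable (subtopology (gtop G) S) d (\<lambda>x. c \<odot>\<^bsub>F (d x)\<^esub> a x)"
    using a by (intro bun.section_approximable_smult dom_units_sub S) (auto simp: eqv_def)
  then have app: "bun.section_approximable (subtopology (gtop G) S) d (\<lambda>x\<in>S. c \<odot>\<^bsub>F (d x)\<^esub> a x)"
    by (rule bun.section_approximable_cong) auto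
  have "c \<odot>\<^bsub>F (d (x \<cdot> h))\<^esub> (a (x \<cdot> h)) = \<pi> (i h) (c \<odot>\<^bsub>F (d x)\<^esub> a x)"
    if "x \<in> S" "h \<in> H" "d x = r h" "x \<cdot> h \<in> S" for x h
    using that eqv_mult[OF a that] \<pi>_smult[OF sub_inv[OF that(2)], of "a x"]
      eqv_mem[OF a that(1)] SA H_arrow
    by (simp add: gsimps)
  then show ?thesis using mem app unfolding eqv_def by auto
qed

lemma eqv_subset:
  assumes a: "a \<in> eqv S" and T: "T \<subseteq> S" shows "restrict a T \<in> eqv T"
proof -
  have "bun.section_approximable (subtopology (subtopology (gtop G) S) T) d a"
    by (rule bun.section_approximable_subset) (use a in \<open>simp add: eqv_def\<close>)
  then have "bun.section_approximable (subtopology (gtop G) T) d a"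
    using T by (simp add: subtopology_subtopology inf.absorb2)
  then have "bun.section_approximable (subtopology (gtop G) T) d (restrict a T)"
    by (rule bun.section_approximable_cong) auto
  then show ?thesis using a T unfolding eqv_def by auto
qed

text \<open>On a compact groupoid the support condition holds automatically.\<close>

lemma ind_F0_eq_eqv: "ind_F0 G H E \<pi> = eqv A"
proof (intro equalityI subsetI)
  have sub: "subtopology (gtop G) A = gtop G" by simp
  fix f
  { assume f: "f \<in> ind_F0 G H E \<pi>"
    then have "bun.section_approximable (gtop G) d f"
      by (intro bun.total_top_section_approximable) (auto simp: ind_F0_def)
    then show "f \<in> eqv A" using f unfolding ind_F0_def eqv_def sub by auto }
  assume f: "f \<in> eqv A"
  then have "continuous_map (gtop G) (total_top (unit_top G) E) (\<lambda>x. (d x, f x))"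
    unfolding eqv_def sub
    by (intro bun.section_approximable_continuous_total_top continuous_dom_unit) auto
  moreover have "compactin Y (q ` (gtop G closure_of {x \<in> A. f x \<noteq> \<zero>\<^bsub>F (d x)\<^esub>}))"
    by (intro image_compactin[OF closedin_compact_space[OF compact_gtop]]
      quotient_imp_continuous_map[OF quotient_map_q]) simp
  ultimately show "f \<in> ind_F0 G H E \<pi>"
    using f mult_arrow H_arrow unfolding ind_F0_def eqv_def by auto
qed

lemma rfib_sub: "rfib G u \<subseteq> A"
  by (auto simp: rfib_def)

text \<open>Unitarity of \<open>\<pi>\<close> makes the pointwise inner product independent of the
  representative of the coset.\<close>

lemma eqv_hip_coset:
  assumes a: "a \<in> eqv (rfib G u)" and b: "b \<in> eqv (rfib G u)" and x: "x \<in> rfib G u"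
  shows "(let y = coset_rep (q x) in hip (F (d y)) (a y) (b y)) = hip (F (d x)) (a x) (b x)"
proof -
  have xA: "x \<in> A" and rx: "r x = u" using x by (auto simp: rfib_def)
  obtain h where h: "h \<in> H" "d x = r h" "coset_rep (q x) = x \<cdot> h"
    by (rule coset_mem_mult[OF coset_rep_mem[OF xA]])
  have hA: "h \<in> A" using h H_arrow by blast
  have xh: "x \<cdot> h \<in> rfib G u" using xA rx h hA by (simp add: rfib_def gsimps)
  have "hip (F (d h)) (\<pi> (i h) (a x)) (\<pi> (i h) (b x)) = hip (F (d x)) (a x) (b x)"
    using \<pi>_hip[OF sub_inv[OF h(1)], of "a x" "b x"] eqv_mem[OF a x] eqv_mem[OF b x] h(2) hA
    by (simp add: gsimps)
  then show ?thesis
    using h(3) eqv_mult[OF a x h(1,2) xh] eqv_mult[OF b x h(1,2) xh] xA hA h(2)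
    by (simp add: Let_def gsimps)
qed

lemma eqv_hip_continuous:
  assumes S: "S \<subseteq> A" and a: "a \<in> eqv S" and b: "b \<in> eqv S"
  shows "continuous_map (subtopology (gtop G) S) euclidean (\<lambda>x. hip (F (d x)) (a x) (b x))"
  using a b by (intro bun.section_approximable_hip_continuous
      continuous_map_from_subtopology[OF continuous_dom_unit]) (auto simp: eqv_def)

lemma left_translate_eqv:
  assumes g: "g \<in> A" and a: "a \<in> eqv (rfib G (d g))"
  shows "left_translate G g a \<in> eqv (rfib G (r g))"
proof -
  let ?R = "rfib G (r g)"
  have R: "i g \<cdot> y \<in> rfib G (d g) \<and> d (i g \<cdot> y) = d y" if "y \<in> ?R" for y
    using g that by (auto simp: rfib_def gsimps)
  have "continuous_map (subtopology (gtop G) ?R) (gtop G) (\<lambda>y. i g \<cdot> y)"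
    using g by (intro continuous_mult continuous_map_from_subtopology[OF continuous_map_id[unfolded id_def]])
      (auto simp: rfib_def gsimps)
  then have cont: "continuous_map (subtopology (gtop G) ?R) (subtopology (gtop G) (rfib G (d g))) (\<lambda>y. i g \<cdot> y)"
    using R by (auto simp: continuous_map_in_subtopology)
  have "bun.section_approximable (subtopology (gtop G) ?R) (\<lambda>y. d (i g \<cdot> y)) (\<lambda>y. a (i g \<cdot> y))"
    using a by (intro bun.section_approximable_compose[OF _ cont]) (auto simp: eqv_def)
  then have app: "bun.section_approximable (subtopology (gtop G) ?R) d (left_translate G g a)"
    by (rule bun.section_approximable_cong) (use R in \<open>auto simp: left_translate_def\<close>)
  have "left_translate G g a (y \<cdot> h) = \<pi> (i h) (left_translate G g a y)"
    if y: "y \<in> ?R" and h: "h \<in> H" "d y = r h" and yh: "y \<cdot> h \<in> ?R" for y h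
  proof -
    have yA: "y \<in> A" "r y = r g" using y by (auto simp: rfib_def)
    have e: "i g \<cdot> (y \<cdot> h) = (i g \<cdot> y) \<cdot> h" using g yA h H_arrow by (simp add: gsimps)
    show ?thesis
      using y yh R[OF y] R[OF yh] h eqv_mult[OF a, of "i g \<cdot> y" h]
      by (simp add: left_translate_def e)
  qed
  moreover have "left_translate G g a \<in> (\<Pi>\<^sub>E y\<in>?R. carrier (F (d y)))"
    using R eqv_mem[OF a] by (force simp: left_translate_def)
  ultimately show ?thesis using app by (auto simp: eqv_def)
qed

end

locale induced_setting = coset_measures G H \<mu> + groupoid_pair_rep G H E \<pi>
  for G :: "'g groupoid" and H :: "'g set" and \<mu> :: "'g \<Rightarrow> 'g set measure"
    and E :: "('g, 'v) hbundle" and \<pi> :: "'g \<Rightarrow> 'v \<Rightarrow> 'v"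
begin

abbreviation P where "P u \<equiv> ind_pre G H \<mu> E \<pi> u"
abbreviation W where "W u \<equiv> eqv (rfib G u)"
abbreviation pairing where "pairing a b \<equiv> (\<lambda>\<omega>. let x = coset_rep \<omega> in hip (F (d x)) (a x) (b x))"

lemma P_simps:
  "carrier (P u) = (\<lambda>f. restrict f (rfib G u)) ` eqv A"
  "a \<oplus>\<^bsub>P u\<^esub> b = (\<lambda>x\<in>rfib G u. a x \<oplus>\<^bsub>F (d x)\<^esub> b x)"
  "c \<odot>\<^bsub>P u\<^esub> a = (\<lambda>x\<in>rfib G u. c \<odot>\<^bsub>F (d x)\<^esub> a x)"
  "hip (P u) a b = set_lebesgue_integral (\<mu> u) (Fib u) (pairing a b)"
  by (simp_all add: ind_pre_def ind_F0_eq_eqv)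

lemma pairing_integrable:
  assumes u: "u \<in> units G" and a: "a \<in> W u" and b: "b \<in> W u"
  shows "set_integrable (\<mu> u) (Fib u) (pairing a b)"
  by (intro \<mu>.set_integrable_Fib[OF u] coset_fun_continuous[OF eqv_hip_continuous[OF rfib_sub a b]]
      eqv_hip_coset[OF a b])

lemma hip_P_cong:
  assumes "u \<in> units G" "\<And>x. x \<in> rfib G u \<Longrightarrow> pairing a b (q x) = f (q x)"
  shows "hip (P u) a b = set_lebesgue_integral (\<mu> u) (Fib u) f"
  unfolding P_simps
  by (rule set_lebesgue_integral_cong[OF \<mu>.closed_sets[OF assms(1) closedin_Fib]])
    (use assms(2) in \<open>auto simp: topspace_Y rfib_def coset_rng_coset\<close>)

lemma semi_inner_P: "u \<in> units G \<Longrightarrow> semi_inner (P u) (W u)"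
proof
  assume u: "u \<in> units G"
  have du: "d x \<in> units G" if "x \<in> rfib G u" for x using that dom_unit by (auto simp: rfib_def)
  show add: "a \<oplus>\<^bsub>P u\<^esub> b \<in> W u" if "a \<in> W u" "b \<in> W u" for a b
    using that by (simp add: P_simps eqv_add rfib_sub)
  show smult: "c \<odot>\<^bsub>P u\<^esub> a \<in> W u" if "a \<in> W u" for a c
    using that by (simp add: P_simps eqv_smult rfib_sub)
  show "hip (P u) (a \<oplus>\<^bsub>P u\<^esub> b) c = hip (P u) a c + hip (P u) b c"
    if abc: "a \<in> W u" "b \<in> W u" "c \<in> W u" for a b c
  proof -
    have "hip (P u) (a \<oplus>\<^bsub>P u\<^esub> b) c = set_lebesgue_integral (\<mu> u) (Fib u) (\<lambda>\<omega>. pairing a c \<omega> + pairing b c \<omega>)"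
    proof (rule hip_P_cong[OF u])
      fix x assume x: "x \<in> rfib G u"
      interpret semi_inner "F (d x)" "carrier (F (d x))" by (rule fib_semi[OF du[OF x]])
      show "pairing (a \<oplus>\<^bsub>P u\<^esub> b) c (q x) = pairing a c (q x) + pairing b c (q x)"
        using x abc eqv_mem[of _ "rfib G u" x]
        unfolding eqv_hip_coset[OF add[OF abc(1,2)] abc(3) x] eqv_hip_coset[OF abc(1,3) x] eqv_hip_coset[OF abc(2,3) x]
        by (simp add: P_simps hip_simps)
    qed
    also have "\<dots> = hip (P u) a c + hip (P u) b c"
      unfolding P_simps by (rule set_integral_add) (intro pairing_integrable u abc)+
    finally show ?thesis .
  qed
  show "hip (P u) (k \<odot>\<^bsub>P u\<^esub> a) c = k * hip (P u) a c" if ac: "a \<in> W u" "c \<in> W u" for a c k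
  proof -
    have "hip (P u) (k \<odot>\<^bsub>P u\<^esub> a) c = set_lebesgue_integral (\<mu> u) (Fib u) (\<lambda>\<omega>. k * pairing a c \<omega>)"
    proof (rule hip_P_cong[OF u])
      fix x assume x: "x \<in> rfib G u"
      interpret semi_inner "F (d x)" "carrier (F (d x))" by (rule fib_semi[OF du[OF x]])
      show "pairing (k \<odot>\<^bsub>P u\<^esub> a) c (q x) = k * pairing a c (q x)"
        using x ac eqv_mem[of _ "rfib G u" x]
        unfolding eqv_hip_coset[OF smult[OF ac(1)] ac(2) x] eqv_hip_coset[OF ac x]
        by (simp add: P_simps hip_simps)
    qed
    also have "\<dots> = k * hip (P u) a c"
      unfolding P_simps by (rule set_integral_mult_right)
    finally show ?thesis .
  qed
  show "hip (P u) b a = cnj (hip (P u) a b)" if ab: "a \<in> W u" "b \<in> W u" for a b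
  proof -
    have "hip (P u) b a = set_lebesgue_integral (\<mu> u) (Fib u) (\<lambda>\<omega>. cnj (pairing a b \<omega>))"
    proof (rule hip_P_cong[OF u])
      fix x assume x: "x \<in> rfib G u"
      interpret semi_inner "F (d x)" "carrier (F (d x))" by (rule fib_semi[OF du[OF x]])
      show "pairing b a (q x) = cnj (pairing a b (q x))"
        unfolding eqv_hip_coset[OF ab x] eqv_hip_coset[OF ab(2,1) x]
        using hip_cnj eqv_mem[OF ab(1) x] eqv_mem[OF ab(2) x] by blast
    qed
    also have "\<dots> = cnj (hip (P u) a b)"
      unfolding P_simps set_lebesgue_integral_def by (simp only: Bochner_Integration.integral_cnj complex_cnj_scaleR[symmetric])
    finally show ?thesis .
  qed
  show "0 \<le> Re (hip (P u) a a)" if a: "a \<in> W u" for a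
  proof -
    have int: "integrable (\<mu> u) (\<lambda>\<omega>. indicator (Fib u) \<omega> *\<^sub>R pairing a a \<omega>)"
      using pairing_integrable[OF u a a] by (simp add: set_integrable_def)
    have "0 \<le> Re (pairing a a \<omega>)" if w: "\<omega> \<in> Fib u" for \<omega>
    proof -
      obtain x where x: "x \<in> rfib G u" "\<omega> = q x" using w unfolding Fib_eq by blast
      interpret semi_inner "F (d x)" "carrier (F (d x))" by (rule fib_semi[OF du[OF x(1)]])
      show ?thesis unfolding x(2) eqv_hip_coset[OF a a x(1)] using hip_nonneg eqv_mem[OF a x(1)] by blast
    qed
    then have "0 \<le> integral\<^sup>L (\<mu> u) (\<lambda>\<omega>. Re (indicator (Fib u) \<omega> *\<^sub>R pairing a a \<omega>))"
      by (intro integral_nonneg_AE AE_I2) (simp add: indicator_def del: mem_Collect_eq)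
    then show ?thesis
      unfolding P_simps set_lebesgue_integral_def integral_Re[OF int] .
  qed
qed

lemma pre_hilbert_P: "u \<in> units G \<Longrightarrow> pre_hilbert (P u) (W u)"
proof (intro pre_hilbert.intro semi_inner_P pre_hilbert_axioms.intro)
  assume u: "u \<in> units G"
  show "carrier (P u) \<subseteq> W u" using eqv_subset rfib_sub by (auto simp: P_simps)
  show "x \<oplus>\<^bsub>P u\<^esub> y \<in> carrier (P u)" if xy: "x \<in> carrier (P u)" "y \<in> carrier (P u)" for x y
  proof -
    obtain f g where fg: "f \<in> eqv A" "g \<in> eqv A" "x = restrict f (rfib G u)" "y = restrict g (rfib G u)"
      using xy by (auto simp: P_simps)
    have eq: "x \<oplus>\<^bsub>P u\<^esub> y = restrict (\<lambda>x\<in>A. f x \<oplus>\<^bsub>F (d x)\<^esub> g x) (rfib G u)"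
      using rfib_sub by (auto simp: P_simps fg fun_eq_iff restrict_def)
    show ?thesis unfolding P_simps(1) by (rule image_eqI[where f = "\<lambda>f. restrict f (rfib G u)", OF eq eqv_add[OF order_refl fg(1,2)]])
  qed
  show "c \<odot>\<^bsub>P u\<^esub> x \<in> carrier (P u)" if x: "x \<in> carrier (P u)" for x c
  proof -
    obtain f where f: "f \<in> eqv A" "x = restrict f (rfib G u)"
      using x by (auto simp: P_simps)
    have eq: "c \<odot>\<^bsub>P u\<^esub> x = restrict (\<lambda>x\<in>A. c \<odot>\<^bsub>F (d x)\<^esub> f x) (rfib G u)"
      using rfib_sub by (auto simp: P_simps f fun_eq_iff restrict_def)
    show ?thesis unfolding P_simps(1) by (rule image_eqI[where f = "\<lambda>f. restrict f (rfib G u)", OF eq eqv_smult[OF order_refl f(1)]])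
  qed
qed

text \<open>Equivariance of the measures concerns continuous functions on the whole coset space. The pointwise
  inner product of two elements of the carrier extends to such a function, because they are
  restrictions of functions on all of \<open>G\<close>.\<close>

lemma hip_left_translate:
  assumes g: "g \<in> A" and a: "a \<in> carrier (P (d g))" and b: "b \<in> carrier (P (d g))"
  shows "hip (P (r g)) (left_translate G g a) (left_translate G g b) = hip (P (d g)) a b"
proof -
  obtain f f' where f: "f \<in> eqv A" "f' \<in> eqv A" and ab: "a = restrict f (rfib G (d g))" "b = restrict f' (rfib G (d g))"
    using a b by (auto simp: P_simps)
  have aW: "a \<in> W (d g)" "b \<in> W (d g)" using f ab eqv_subset rfib_sub by auto
  note L = left_translate_eqv[OF g aW(1)] left_translate_eqv[OF g aW(2)]
  have ff: "pairing f f' (q x) = hip (F (d x)) (f x) (f' x)" if "x \<in> A" for x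
    using eqv_hip_coset[of "restrict f (rfib G (r x))" "r x" "restrict f' (rfib G (r x))" x] that
      eqv_subset[OF f(1) rfib_sub] eqv_subset[OF f(2) rfib_sub] coset_memD[OF coset_rep_mem[OF that]]
    by (simp add: rfib_def Let_def)
  have "continuous_map (gtop G) euclidean (\<lambda>x. hip (F (d x)) (f x) (f' x))"
    using eqv_hip_continuous[OF order_refl f] by simp
  then have cont: "continuous_map Y euclidean (pairing f f')"
    using ff by (rule coset_fun_continuous_all)
  have "hip (P (r g)) (left_translate G g a) (left_translate G g b)
      = set_lebesgue_integral (\<mu> (r g)) (Fib (r g)) (\<lambda>\<omega>. pairing f f' (coset_act G H (i g) \<omega>))"
  proof (rule hip_P_cong[OF rng_unit[OF g]])
    fix x assume x: "x \<in> rfib G (r g)"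
    have "pairing f f' (coset_act G H (i g) (q x)) = hip (F (d x)) (f (i g \<cdot> x)) (f' (i g \<cdot> x))"
      using x g by (simp add: coset_act_coset rfib_def gsimps ff del: Let_def)
    moreover have "i g \<cdot> x \<in> rfib G (d g)" using x g by (simp add: rfib_def gsimps)
    ultimately show "pairing (left_translate G g a) (left_translate G g b) (q x) = pairing f f' (coset_act G H (i g) (q x))"
      unfolding eqv_hip_coset[OF L x] using x by (simp add: left_translate_def ab)
  qed
  also have "\<dots> = set_lebesgue_integral (\<mu> (d g)) (Fib (d g)) (pairing f f')"
    by (rule set_integral_translate[OF g cont])
  also have "\<dots> = hip (P (d g)) a b"
  proof (rule hip_P_cong[OF dom_unit[OF g], symmetric])
    fix x assume x: "x \<in> rfib G (d g)"
    show "pairing a b (q x) = pairing f f' (q x)"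
      using x unfolding eqv_hip_coset[OF aW x] by (subst ff) (auto simp: ab rfib_def)
  qed
  finally show ?thesis .
qed

text \<open>The pointwise norm is continuous and nonnegative on the coset space, and the measures have full
  support.\<close>

lemma hip_P_pos:
  assumes u: "u \<in> units G" and f: "f \<in> eqv A" and x: "x \<in> rfib G u" and pos: "hip (F (d x)) (f x) (f x) \<noteq> 0"
  shows "0 < Re (hip (P u) (restrict f (rfib G u)) (restrict f (rfib G u)))"
proof -
  let ?f = "restrict f (rfib G u)"
  have fW: "?f \<in> W u" using f eqv_subset rfib_sub by auto
  have ff: "pairing f f (q x) = hip (F (d x)) (f x) (f x)" if "x \<in> A" for x
    using eqv_hip_coset[of "restrict f (rfib G (r x))" "r x" "restrict f (rfib G (r x))" x] that
      eqv_subset[OF f(1) rfib_sub] coset_memD[OF coset_rep_mem[OF that]]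
    by (simp add: rfib_def Let_def)
  have "continuous_map (gtop G) euclidean (\<lambda>x. hip (F (d x)) (f x) (f x))"
    using eqv_hip_continuous[OF order_refl f f] by simp
  then have cont: "continuous_map Y euclidean (pairing f f)"
    using ff by (rule coset_fun_continuous_all)
  have nn: "0 \<le> Re (hip (F (d x)) (f x) (f x))" if "x \<in> A" for x
    using semi_inner.hip_nonneg[OF fib_semi[OF dom_unit[OF that]] eqv_mem[OF f that]] .
  have xA: "x \<in> A" using x by (simp add: rfib_def)
  have "0 < Re (set_lebesgue_integral (\<mu> u) (Fib u) (pairing f f))"
  proof (rule \<mu>.set_integral_pos[OF u cont])
    show "q x \<in> Fib u" using x unfolding Fib_eq by blast
    show "0 \<le> Re (pairing f f \<omega>)" if w: "\<omega> \<in> Fib u" for \<omega>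
    proof -
      obtain y where "y \<in> A" "\<omega> = q y" using w by (auto simp: topspace_Y)
      then show ?thesis using ff nn by metis
    qed
    have "Re (hip (F (d x)) (f x) (f x)) \<noteq> 0"
      using semi_inner.hip_self[OF fib_semi[OF dom_unit[OF xA]] eqv_mem[OF f xA]] pos by (metis of_real_0)
    then show "0 < Re (pairing f f (q x))" using nn[OF xA] unfolding ff[OF xA] by linarith
  qed
  also have "set_lebesgue_integral (\<mu> u) (Fib u) (pairing f f) = hip (P u) ?f ?f"
  proof (rule hip_P_cong[OF u, symmetric])
    fix x assume x: "x \<in> rfib G u"
    show "pairing ?f ?f (q x) = pairing f f (q x)"
      using x unfolding eqv_hip_coset[OF fW fW x] by (subst ff) (auto simp: rfib_def)
  qed
  finally show ?thesis .
qed

end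

section \<open>Generalised limits and continuous functions vanishing at one point\<close>

locale generalized_limit =
  fixes L :: "(nat \<Rightarrow> complex) \<Rightarrow> complex"
  assumes L_add: "bounded (range s) \<Longrightarrow> bounded (range t) \<Longrightarrow> L (\<lambda>n. s n + t n) = L s + L t"
    and L_mult: "bounded (range s) \<Longrightarrow> L (\<lambda>n. c * s n) = c * L s"
    and L_closed: "bounded (range s) \<Longrightarrow> closed K \<Longrightarrow> \<forall>\<^sub>F n in sequentially. s n \<in> K \<Longrightarrow> L s \<in> K"

text \<open>A cluster point of the evaluations at \<open>n\<close>, taken in a product of discs, one for each
  bounded sequence; in effect a limit along an ultrafilter. Additivity and homogeneity hold for
  every evaluation and define closed conditions, so they survive at the cluster point.\<close>

lemma ex_generalized_limit: "\<exists>L. generalized_limit L"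
proof -
  define x :: "nat \<Rightarrow> (nat \<Rightarrow> complex) \<Rightarrow> complex"
    where "x n = (\<lambda>s. if bounded (range s) then s n else 0)" for n
  have "\<exists>b. 0 \<le> b \<and> (bounded (range s) \<longrightarrow> (\<forall>n. cmod (s n) \<le> b))" for s :: "nat \<Rightarrow> complex"
  proof (cases "bounded (range s)")
    case True
    then obtain b where "\<And>n. cmod (s n) \<le> b" unfolding bounded_iff by blast
    then show ?thesis by (intro exI[of _ b]) (use norm_ge_zero order_trans in blast)
  qed auto
  then obtain b where b0: "\<And>s :: nat \<Rightarrow> complex. 0 \<le> b s"
    and b: "\<And>s n. bounded (range s) \<Longrightarrow> cmod (s n) \<le> b s" by metis
  define U where "U = PiE UNIV (\<lambda>s :: nat \<Rightarrow> complex. cball (0 :: complex) (b s))"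
  have "compactin (product_topology (\<lambda>_. euclidean) UNIV) U"
    unfolding U_def compactin_PiE by simp
  then have cU: "compact U" by (simp add: euclidean_product_topology)
  have xU: "x n \<in> U" for n using b b0 by (auto simp: x_def U_def)
  have "filtermap x sequentially \<noteq> bot" "eventually (\<lambda>f. f \<in> U) (filtermap x sequentially)"
    using xU by (auto simp: filtermap_bot_iff eventually_filtermap)
  then obtain L where L: "inf (nhds L) (filtermap x sequentially) \<noteq> bot"
    using cU unfolding compact_filter by blast
  have cl: "L \<in> C" if C: "closed C" and ev: "\<forall>\<^sub>F n in sequentially. x n \<in> C" for C
  proof (rule ccontr)
    assume "L \<notin> C"
    then have "eventually (\<lambda>f. f \<in> - C) (nhds L)" using C by (intro eventually_nhds_in_open) auto
    moreover have "eventually (\<lambda>f. f \<in> C) (filtermap x sequentially)" using ev by (simp add: eventually_filtermap)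
    ultimately have "eventually (\<lambda>f. False) (inf (nhds L) (filtermap x sequentially))"
      unfolding eventually_inf by (intro exI[of _ "\<lambda>f. f \<in> - C"] exI[of _ "\<lambda>f. f \<in> C"]) auto
    then show False using L by (simp add: eventually_False)
  qed
  note cont = continuous_on_product_coordinates
  have "generalized_limit L"
  proof
    fix s t :: "nat \<Rightarrow> complex" assume s: "bounded (range s)" and t: "bounded (range t)"
    have st: "bounded (range (\<lambda>n. s n + t n))"
      using bounded_plus_comp[OF s t] by simp
    have "L \<in> {f. f (\<lambda>n. s n + t n) = f s + f t}"
      by (rule cl) (use s t st in \<open>auto simp: x_def intro!: closed_Collect_eq continuous_intros cont\<close>)
    then show "L (\<lambda>n. s n + t n) = L s + L t" by simp
  next
    fix c and s :: "nat \<Rightarrow> complex" assume s: "bounded (range s)"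
    have cs: "bounded (range (\<lambda>n. c * s n))"
      using bounded_linear_image[OF s bounded_linear_mult_right[of c]] by (simp add: image_image)
    have "L \<in> {f. f (\<lambda>n. c * s n) = c * f s}"
      by (rule cl) (use s cs in \<open>auto simp: x_def intro!: closed_Collect_eq continuous_intros cont\<close>)
    then show "L (\<lambda>n. c * s n) = c * L s" by simp
  next
    fix s :: "nat \<Rightarrow> complex" and K assume s: "bounded (range s)" and K: "closed K"
      and ev: "\<forall>\<^sub>F n in sequentially. s n \<in> K"
    have "L \<in> (\<lambda>f. f s) -` K"
      by (rule cl) (use s ev in \<open>auto simp: x_def intro!: closed_vimage[OF K] cont\<close>)
    then show "L s \<in> K" by simp
  qed
  then show ?thesis by blast
qed

text \<open>A weighted sum of Urysohn functions that vanish at \<open>z\<close> and equal one outside the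
  members of a countable neighbourhood base.\<close>

lemma ex_continuous_zero_at_point:
  assumes X: "normal_space X" "t1_space X" "second_countable X" and z: "z \<in> topspace X"
  obtains \<rho> :: "'a \<Rightarrow> real" where "continuous_map X euclidean \<rho>" "\<And>x. 0 \<le> \<rho> x"
    "\<And>x. x \<in> topspace X \<Longrightarrow> \<rho> x = 0 \<longleftrightarrow> x = z"
proof -
  obtain \<B> where \<B>: "countable \<B>" "\<And>V. V \<in> \<B> \<Longrightarrow> openin X V"
    and base: "\<And>U x. openin X U \<Longrightarrow> x \<in> U \<Longrightarrow> \<exists>V\<in>\<B>. x \<in> V \<and> V \<subseteq> U"
    using X(3) unfolding second_countable_def by metis
  define N where "N = {V \<in> \<B>. z \<in> V}"
  have N: "countable N" "N \<noteq> {}"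
    using \<B>(1) base[OF openin_topspace z] by (auto simp: N_def)
  define B where "B = from_nat_into N"
  have BN: "B n \<in> N" for n unfolding B_def by (rule from_nat_into[OF N(2)])
  have "\<exists>f :: 'a \<Rightarrow> real. continuous_map X euclidean f \<and> f z = 0 \<and> (\<forall>x\<in>topspace X. 0 \<le> f x \<and> f x \<le> 1)
      \<and> (\<forall>x\<in>topspace X - B n. f x = 1)" for n
  proof -
    have 1: "closedin X {z}" using X(2) z by (simp add: t1_space_closedin_singleton)
    have 2: "closedin X (topspace X - B n)" using BN[of n] \<B>(2) by (auto simp: N_def intro!: closedin_diff)
    have 3: "disjnt {z} (topspace X - B n)" using BN[of n] by (auto simp: N_def disjnt_def)
    obtain f where "continuous_map X (top_of_set {0..1::real}) f" "f ` {z} \<subseteq> {0}" "f ` (topspace X - B n) \<subseteq> {1}"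
      using Urysohn_lemma[OF X(1) 1 2 3, of 0 1] by auto
    then show ?thesis by (intro exI[of _ f]) (auto simp: continuous_map_in_subtopology)
  qed
  then obtain f where f: "\<And>n. continuous_map X euclidean (f n)" "\<And>n. f n z = (0 :: real)"
    "\<And>n x. x \<in> topspace X \<Longrightarrow> 0 \<le> f n x" "\<And>n x. x \<in> topspace X \<Longrightarrow> f n x \<le> 1"
    "\<And>n x. x \<in> topspace X \<Longrightarrow> x \<notin> B n \<Longrightarrow> f n x = 1" by (metis DiffI)
  define g where "g n x = (1/2) ^ n * f n x" for n x
  define \<rho> where "\<rho> x = (if x \<in> topspace X then (\<Sum>n. g n x) else 0)" for x
  have gle: "norm (g n x) \<le> (1/2) ^ n" if "x \<in> topspace X" for n x
    using f(3,4)[OF that, of n] by (simp add: g_def mult_left_le)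
  have sm: "summable (\<lambda>n. (1/2 :: real) ^ n)" by (rule summable_geometric) simp
  have smg: "summable (\<lambda>n. g n x)" if "x \<in> topspace X" for x
    using gle[OF that] by (intro summable_comparison_test[OF _ sm]) auto
  have ul: "uniform_limit (topspace X) (\<lambda>n x. \<Sum>i<n. g i x) (\<lambda>x. \<Sum>i. g i x) sequentially"
    by (rule Weierstrass_m_test[OF gle sm])
  have "continuous_map X Met_TC.mtopology (\<lambda>x. \<Sum>i. g i x)"
  proof (rule Met_TC.continuous_map_uniform_limit[where F = sequentially and f = "\<lambda>n x. \<Sum>i<n. g i x"])
    show "\<forall>\<^sub>F n in sequentially. continuous_map X Met_TC.mtopology (\<lambda>x. \<Sum>i<n. g i x)"
      using f(1) unfolding g_def mtopology_is_euclidean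
      by (intro always_eventually allI continuous_map_sum continuous_map_real_mult_left) auto
    show "\<And>\<epsilon>. 0 < \<epsilon> \<Longrightarrow> \<forall>\<^sub>F n in sequentially. \<forall>x\<in>topspace X. (\<Sum>i. g i x) \<in> UNIV \<and> dist (\<Sum>i<n. g i x) (\<Sum>i. g i x) < \<epsilon>"
      using ul by (simp add: uniform_limit_iff)
  qed simp
  then have "continuous_map X euclidean (\<lambda>x. \<Sum>i. g i x)" by simp
  then have "continuous_map X euclidean \<rho>" by (rule continuous_map_eq) (simp add: \<rho>_def)
  moreover have nn: "0 \<le> g n x" if "x \<in> topspace X" for n x using f(3)[OF that] by (simp add: g_def)
  then have "0 \<le> \<rho> x" for x by (auto simp: \<rho>_def intro!: suminf_nonneg smg)
  moreover have "\<rho> x = 0 \<longleftrightarrow> x = z" if x: "x \<in> topspace X" for x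
  proof
    assume "\<rho> x = 0"
    then have "\<And>n. g n x = 0" using x nn[OF x] suminf_eq_zero_iff[OF smg[OF x]] by (auto simp: \<rho>_def)
    then have xB: "x \<in> B n" for n using f(5)[OF x, of n] by (auto simp: g_def)
    show "x = z"
    proof (rule ccontr)
      assume "x \<noteq> z"
      then obtain U where "openin X U" "z \<in> U" "x \<notin> U"
        using X(2) x z unfolding t1_space_def by metis
      then obtain V where V: "V \<in> \<B>" "z \<in> V" "V \<subseteq> U" using base by blast
      then have "V \<in> N" by (simp add: N_def)
      then obtain n where "B n = V" unfolding B_def using from_nat_into_surj[OF N(1)] by blast
      then show False using xB[of n] V \<open>x \<notin> U\<close> by blast
    qed
  qed (use z f(2) in \<open>simp add: \<rho>_def g_def\<close>)
  ultimately show ?thesis using that by blast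
qed

lemma Tietze_extension_complex:
  fixes f :: "'a \<Rightarrow> complex"
  assumes X: "normal_space X" "closedin X S" and f: "continuous_map (subtopology X S) euclidean f"
  obtains g where "continuous_map X euclidean g" "\<And>x. x \<in> S \<Longrightarrow> g x = f x"
proof -
  obtain a where a: "continuous_map X euclideanreal a" "\<And>x. x \<in> S \<Longrightarrow> a x = Re (f x)"
    using Tietze_extension_realinterval[OF X, of UNIV "\<lambda>x. Re (f x)"] f
    by (auto simp: continuous_map_Re_Im)
  obtain b where b: "continuous_map X euclideanreal b" "\<And>x. x \<in> S \<Longrightarrow> b x = Im (f x)"
    using Tietze_extension_realinterval[OF X, of UNIV "\<lambda>x. Im (f x)"] f
    by (auto simp: continuous_map_Re_Im)
  show ?thesis
    by (rule that[of "\<lambda>x. Complex (a x) (b x)"]) (use a b in \<open>auto simp: continuous_map_Re_Im complex_eq_iff\<close>)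
qed

section \<open>An invariant mean on an isotropy group\<close>

context groupoid_pair
begin

definition isotropy :: "'g \<Rightarrow> 'g set" where
  "isotropy u = {h \<in> H. r h = u \<and> d h = u}"

lemma normal_gtop: "normal_space (gtop G)"
  using compact_Hausdorff_or_regular_imp_normal_space compact_gtop Hausdorff_gtop by blast

lemma closedin_isotropy: "u \<in> units G \<Longrightarrow> closedin (gtop G) (isotropy u)"
proof -
  assume u: "u \<in> units G"
  have "isotropy u = H \<inter> ({x \<in> A. r x = u} \<inter> {x \<in> A. d x = u})"
    using H_arrow by (auto simp: isotropy_def)
  then show ?thesis
    using u unit_arrow
    by (auto intro!: closedin_Int closed_H closedin_equalizer_gtop continuous_rng continuous_dom)
qed

end

locale invariant_mean = groupoid_pair G H for G :: "'g groupoid" and H :: "'g set" +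
  fixes u :: 'g and I :: "('g \<Rightarrow> complex) \<Rightarrow> complex"
  assumes u: "u \<in> units G"
    and I_add: "continuous_map (subtopology (gtop G) (isotropy u)) euclidean f \<Longrightarrow>
      continuous_map (subtopology (gtop G) (isotropy u)) euclidean g \<Longrightarrow> I (\<lambda>x. f x + g x) = I f + I g"
    and I_mult: "continuous_map (subtopology (gtop G) (isotropy u)) euclidean f \<Longrightarrow> I (\<lambda>x. c * f x) = c * I f"
    and I_le: "continuous_map (subtopology (gtop G) (isotropy u)) euclidean f \<Longrightarrow>
      (\<And>x. x \<in> isotropy u \<Longrightarrow> cmod (f x) \<le> B) \<Longrightarrow> cmod (I f) \<le> B"
    and I_one: "I (\<lambda>x. 1) = 1"
    and I_translate: "continuous_map (subtopology (gtop G) (isotropy u)) euclidean f \<Longrightarrow> h \<in> isotropy u \<Longrightarrow>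
      I (\<lambda>x. f (h \<cdot> x)) = I f"

context groupoid_pair
begin

text \<open>A Haar measure on \<open>K\<close> itself is not given. Instead the Haar measure on the
  \<open>r\<close>-fibre of \<open>H\<close> over \<open>u\<close> is restricted to tubes of
  arrows whose domain is close to \<open>u\<close>, normalised, and a generalised limit is taken
  along shrinking tubes. Invariance under the isotropy group survives since the tubes are
  described by the domain map, which does not change under left translation.\<close>

lemma ex_invariant_mean:
  assumes haar: "haar_system (restrict_groupoid G H) l" and u: "u \<in> units G"
  shows "\<exists>I. invariant_mean G H u I"
proof -
  let ?R = "restrict_groupoid G H"
  let ?X = "subtopology (gtop G) H"
  let ?K = "isotropy u"
  let ?D = "{p \<in> H. r p = u}"
  have topX: "topspace ?X = H" using sub_arrows by auto
  note unitsR = units_restrict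
  have closedD': "closedin (gtop G) {p \<in> H. r p = v}" if "v \<in> units G" for v
  proof -
    have "{p \<in> H. r p = v} = H \<inter> {x \<in> A. r x = v}" using H_arrow by auto
    then show ?thesis
      using that unit_arrow by (auto intro!: closedin_Int closed_H closedin_equalizer_gtop continuous_rng)
  qed
  have Fib: "{\<omega> \<in> topspace ?X. r \<omega> = v} = {p \<in> H. r p = v}" for v using topX by auto
  interpret hm0: full_equivariant_system ?R ?X r "gmul G" l
    using haar by (simp add: haar_system_def restrict_groupoid_def)
  interpret hm: compact_measure_system ?R ?X r "gmul G" l
  proof
    show "compact_space ?X"
      by (intro compact_space_subtopology closedin_compact_space[OF compact_gtop] closed_H)
    show "closedin ?X {\<omega> \<in> topspace ?X. r \<omega> = v}" if "v \<in> units ?R" for v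
      using closedD'[of v] that unfolding Fib unitsR by (intro closedin_subset_topspace) auto
  qed
  have uR: "u \<in> units ?R" using u by (simp add: unitsR)
  have uH: "u \<in> H" using u sub_wide by blast
  have t1: "t1_space (gtop G)" using Hausdorff_gtop Hausdorff_imp_t1_space by blast
  obtain \<rho> where \<rho>: "continuous_map (gtop G) euclideanreal \<rho>" and \<rho>0: "\<And>x. 0 \<le> \<rho> x"
    and \<rho>z: "\<And>x. x \<in> A \<Longrightarrow> \<rho> x = 0 \<longleftrightarrow> x = u"
    using ex_continuous_zero_at_point[OF normal_gtop t1 second_countable_gtop unit_arrow[OF u]] by metis
  \<comment> \<open>The weight functions of the tubes; \<open>\<rho> (d p)\<close> vanishes exactly on the isotropy
    group.\<close>
  define tube where "tube n p = max 0 (1 / real (Suc n) - \<rho> (d p))" for n p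
  have \<rho>d: "continuous_map (gtop G) euclideanreal (\<lambda>p. \<rho> (d p))"
    using continuous_map_compose[OF continuous_dom \<rho>] by (simp add: o_def)
  have tube: "continuous_map (gtop G) euclideanreal (tube n)" for n
    unfolding tube_def using \<rho>d by (intro continuous_intros) auto
  have tube0: "0 \<le> tube n p" for n p by (simp add: tube_def)
  note [simp del] = of_real_mult of_real_divide
  let ?Y = "subtopology (gtop G) ?D"
  have subY: "subtopology ?X (hm.Fib u) = ?Y"
    unfolding Fib subtopology_subtopology by (rule arg_cong[where f = "subtopology (gtop G)"]) auto
  define N where "N n g = set_lebesgue_integral (l u) ?D (\<lambda>p. of_real (tube n p) * g p)" for n and g :: "'g \<Rightarrow> complex"
  have cY: "continuous_map ?Y euclidean f" if "continuous_map (gtop G) euclidean f" for f :: "'g \<Rightarrow> complex"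
    using that by (rule continuous_map_from_subtopology)
  have cX: "continuous_map ?X euclidean f" if "continuous_map (gtop G) euclidean f" for f :: "'g \<Rightarrow> complex"
    using that by (rule continuous_map_from_subtopology)
  have tubec: "continuous_map (gtop G) euclidean (\<lambda>p. complex_of_real (tube n p))" for n
    using tube[of n] by (simp add: continuous_map_Re_Im)
  have int: "set_integrable (l u) ?D f" if "continuous_map ?Y euclidean f" for f :: "'g \<Rightarrow> complex"
    using hm.set_integrable_Fib[OF uR, of f] that unfolding subY unfolding Fib .
  have intN: "set_integrable (l u) ?D (\<lambda>p. of_real (tube n p) * g p)" if "continuous_map ?Y euclidean g" for n and g :: "'g \<Rightarrow> complex"
    by (rule int[OF continuous_map_complex_mult[OF cY[OF tubec] that]])
  define c where "c n = Re (N n (\<lambda>p. 1))" for n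
  have cpos: "0 < c n" for n
  proof -
    have "0 < Re (set_lebesgue_integral (l u) (hm.Fib u) (\<lambda>p. of_real (tube n p)))"
    proof (rule hm.set_integral_pos[OF uR cX[OF tubec]])
      show "u \<in> hm.Fib u" using uH u unit_rng topX by auto
      show "0 < Re (complex_of_real (tube n u))"
        using \<rho>z[OF unit_arrow[OF u]] u unit_dom by (simp add: tube_def)
    qed (simp add: tube0)
    then show ?thesis unfolding c_def N_def Fib by simp
  qed
  have Nc: "N n (\<lambda>p. 1) = of_real (c n)" for n
  proof -
    have "N n (\<lambda>p. 1) = of_real (LINT p:?D|l u. tube n p)"
      unfolding N_def by (simp add: set_integral_complex_of_real)
    then show ?thesis by (simp add: c_def)
  qed
  have Nbound: "cmod (N n g) \<le> B * c n"
    if g: "continuous_map ?Y euclidean g" and B: "\<And>p. p \<in> ?D \<Longrightarrow> tube n p \<noteq> 0 \<Longrightarrow> cmod (g p) \<le> B" for n g B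
  proof -
    have sr: "set_integrable (l u) ?D (\<lambda>p. tube n p)"
      using integrable_Re[OF int[OF cY[OF tubec[of n]], unfolded set_integrable_def]]
      by (simp add: set_integrable_def)
    have "cmod (N n g) \<le> (LINT p:?D|l u. cmod (of_real (tube n p) * g p))"
      unfolding N_def set_lebesgue_integral_def
      using integral_norm_bound[of "l u" "\<lambda>p. indicator ?D p *\<^sub>R (of_real (tube n p) * g p)"] by simp
    also have "\<dots> \<le> (LINT p:?D|l u. B * tube n p)"
    proof (rule set_integral_mono)
      show "set_integrable (l u) ?D (\<lambda>p. cmod (of_real (tube n p) * g p))"
        using set_integrable_norm[OF intN[OF g]] .
      show "set_integrable (l u) ?D (\<lambda>p. B * tube n p)" by (rule set_integrable_mult_right) (rule sr)
      fix p assume p: "p \<in> ?D"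
      show "cmod (of_real (tube n p) * g p) \<le> B * tube n p"
      proof (cases "tube n p = 0")
        case False
        then show ?thesis using B[OF p] tube0[of n p] by (simp add: norm_mult mult.commute mult_right_mono)
      qed simp
    qed
    also have "\<dots> = B * (LINT p:?D|l u. tube n p)" by simp
    also have "(LINT p:?D|l u. tube n p) = c n"
      using Nc[of n] unfolding N_def by (simp add: set_integral_complex_of_real)
    finally show ?thesis .
  qed
  define s where "s g n = N n g / of_real (c n)" for g n
  have sbound: "cmod (s g n) \<le> B"
    if g: "continuous_map ?Y euclidean g" and B: "\<And>p. p \<in> ?D \<Longrightarrow> tube n p \<noteq> 0 \<Longrightarrow> cmod (g p) \<le> B" for n g B
    using Nbound[OF g B] cpos[of n] by (simp add: s_def norm_divide pos_divide_le_eq)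
  have compD: "compact_space ?Y"
    by (intro compact_space_subtopology closedin_compact_space[OF compact_gtop] closedD' u)
  have topD: "topspace ?Y = ?D" using H_arrow by auto
  have bdd: "bounded (range (s g))" if g: "continuous_map ?Y euclidean g" for g
  proof -
    have "compactin ?Y (topspace ?Y)" using compD by (simp only: compact_space_def)
    from image_compactin[OF this g] have "compactin euclidean (g ` ?D)" unfolding topD .
    then have "bounded (g ` ?D)" by (simp add: compact_imp_bounded)
    then obtain B where "\<And>p. p \<in> ?D \<Longrightarrow> cmod (g p) \<le> B" unfolding bounded_iff by blast
    then have "cmod (s g n) \<le> B" for n by (intro sbound[OF g])
    then show ?thesis unfolding bounded_iff by (intro exI[of _ B]) auto
  qed
  obtain L where "generalized_limit L" using ex_generalized_limit by blast
  then interpret generalized_limit L .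
  define J where "J g = L (s g)" for g
  have J_add: "J (\<lambda>x. f x + g x) = J f + J g"
    if f: "continuous_map ?Y euclidean f" and g: "continuous_map ?Y euclidean g" for f g
  proof -
    have "s (\<lambda>x. f x + g x) = (\<lambda>n. s f n + s g n)"
      using set_integral_add(2)[OF intN[OF f] intN[OF g]]
      by (simp add: s_def N_def fun_eq_iff distrib_left add_divide_distrib)
    then show ?thesis unfolding J_def by (simp add: L_add bdd f g)
  qed
  have J_mult: "J (\<lambda>x. k * f x) = k * J f" if f: "continuous_map ?Y euclidean f" for f k
  proof -
    have "N n (\<lambda>x. k * f x) = k * N n f" for n
      unfolding N_def by (simp add: mult.left_commute[of _ k])
    then have "s (\<lambda>x. k * f x) = (\<lambda>n. k * s f n)" by (simp add: s_def fun_eq_iff)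
    then show ?thesis unfolding J_def by (simp add: L_mult bdd f)
  qed
  have KD: "?K \<subseteq> ?D" by (auto simp: isotropy_def)
  \<comment> \<open>The mean only sees the isotropy group: by compactness, a function bounded by \<open>B\<close>
    there is bounded by \<open>B + e\<close> on all sufficiently thin tubes.\<close>
  have J_le: "cmod (J g) \<le> B"
    if g: "continuous_map ?Y euclidean g" and B: "\<And>h. h \<in> ?K \<Longrightarrow> cmod (g h) \<le> B" for g B
  proof (rule field_le_epsilon)
    fix e :: real assume e: "0 < e"
    define Z where "Z = {p \<in> ?D. cmod (g p) \<in> {B + e..}}"
    have "continuous_map ?Y euclidean (\<lambda>p. cmod (g p))" using g by (intro continuous_intros)
    then have "closedin ?Y {p \<in> topspace ?Y. cmod (g p) \<in> {B + e..}}"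
      by (rule closedin_continuous_map_preimage) simp
    then have "compactin ?Y Z" unfolding Z_def topD by (rule closedin_compact_space[OF compD])
    moreover have "continuous_map ?Y euclidean (\<lambda>p. \<rho> (d p))" using \<rho>d by (rule continuous_map_from_subtopology)
    ultimately have comp: "compact ((\<lambda>p. \<rho> (d p)) ` Z)"
      using image_compactin by fastforce
    have pos: "0 < \<rho> (d p)" if "p \<in> Z" for p
    proof -
      have p: "p \<in> H" "r p = u" "B + e \<le> cmod (g p)" using that by (auto simp: Z_def)
      have "d p \<noteq> u" using B[of p] p e by (auto simp: isotropy_def)
      then have "\<rho> (d p) \<noteq> 0" using \<rho>z[OF dom_closed] p H_arrow by blast
      then show ?thesis using \<rho>0[of "d p"] by simp
    qed
    obtain \<delta> where \<delta>: "0 < \<delta>" "\<And>p. p \<in> Z \<Longrightarrow> \<delta> \<le> \<rho> (d p)"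
    proof (cases "Z = {}")
      case False
      then obtain p0 where "p0 \<in> Z" "\<And>p. p \<in> Z \<Longrightarrow> \<rho> (d p0) \<le> \<rho> (d p)"
        using compact_attains_inf[OF comp] by auto
      then show ?thesis using pos that by blast
    qed (use that[of 1] in auto)
    obtain m where m: "1 / real (Suc m) < \<delta>" using \<delta>(1) nat_approx_posE by metis
    have "cmod (s g n) \<le> B + e" if n: "m \<le> n" for n
    proof (rule sbound[OF g])
      fix p assume p: "p \<in> ?D" "tube n p \<noteq> 0"
      then have "\<rho> (d p) < 1 / real (Suc n)" by (auto simp: tube_def max_def split: if_splits)
      also have "\<dots> \<le> 1 / real (Suc m)" using n by (simp add: frac_le)
      finally have "p \<notin> Z" using m \<delta>(2)[of p] by force
      then show "cmod (g p) \<le> B + e" using p(1) by (auto simp: Z_def)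
    qed
    then have "\<forall>\<^sub>F n in sequentially. s g n \<in> cball 0 (B + e)" by (auto simp: eventually_sequentially)
    then have "L (s g) \<in> cball 0 (B + e)" by (rule L_closed[OF bdd[OF g] closed_cball])
    then show "cmod (J g) \<le> B + e" by (simp add: J_def)
  qed
  have J_cong: "J f = J g" if f: "continuous_map ?Y euclidean f" and g: "continuous_map ?Y euclidean g"
    and eq: "\<And>h. h \<in> ?K \<Longrightarrow> f h = g h" for f g
  proof -
    have mg: "continuous_map ?Y euclidean (\<lambda>x. (- 1) * g x)" using g by (intro continuous_map_complex_mult) auto
    have "continuous_map ?Y euclidean (\<lambda>x. f x + (- 1) * g x)" using f mg by (rule continuous_map_add)
    then have "cmod (J (\<lambda>x. f x + (- 1) * g x)) \<le> 0" by (rule J_le) (simp add: eq)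
    then show ?thesis unfolding J_add[OF f mg] J_mult[OF g] by simp
  qed
  have J_1: "J (\<lambda>x. 1) = 1"
  proof -
    have eq: "s (\<lambda>x. 1) n = 1" for n using cpos[of n] by (simp add: s_def Nc)
    have "L (s (\<lambda>x. 1)) \<in> {1}" by (rule L_closed[OF bdd]) (auto simp: eq)
    then show ?thesis by (simp add: J_def)
  qed
  have J_inv: "J (\<lambda>p. g (h \<cdot> p)) = J g" if g: "continuous_map (gtop G) euclidean g" and h: "h \<in> ?K" for g h
  proof -
    have hh: "h \<in> H" "r h = u" "d h = u" "h \<in> A" using h H_arrow by (auto simp: isotropy_def)
    have "N n (\<lambda>p. g (h \<cdot> p)) = N n g" for n
    proof -
      have DS: "?D \<in> sets (l u)" using hm.closed_sets[OF uR hm.closedin_Fib[OF uR]] unfolding Fib .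
      have "N n (\<lambda>p. g (h \<cdot> p)) = (LINT p:?D|l u. of_real (tube n (h \<cdot> p)) * g (h \<cdot> p))"
        unfolding N_def
      proof (rule set_lebesgue_integral_cong[OF DS], intro allI impI)
        fix p assume p: "p \<in> ?D"
        then have "d (h \<cdot> p) = d p" using hh H_arrow by (intro mult_dom) auto
        then show "of_real (tube n p) * g (h \<cdot> p) = of_real (tube n (h \<cdot> p)) * g (h \<cdot> p)" by (simp add: tube_def)
      qed
      also have "\<dots> = (LINT p:?D|l u. of_real (tube n p) * g p)"
        using hm.set_integral_act[of h "\<lambda>p. of_real (tube n p) * g p", OF _ _ continuous_map_complex_mult[OF cX[OF tubec] cX[OF g]]]
          hh uR topX unfolding Fib by (simp add: restrict_groupoid_def)
      finally show ?thesis unfolding N_def .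
    qed
    then have "s (\<lambda>p. g (h \<cdot> p)) = s g" by (simp add: s_def fun_eq_iff)
    then show ?thesis by (simp add: J_def)
  qed
  \<comment> \<open>Functions on the isotropy group are extended to all arrows before the mean is applied;
    \<open>J_cong\<close> makes the choice of the extension immaterial.\<close>
  define ext where "ext f = (SOME g. continuous_map (gtop G) euclidean g \<and> (\<forall>x\<in>?K. g x = f x))" for f :: "'g \<Rightarrow> complex"
  have ext: "continuous_map (gtop G) euclidean (ext f) \<and> (\<forall>x\<in>?K. ext f x = f x)"
    if f: "continuous_map (subtopology (gtop G) ?K) euclidean f" for f
  proof -
    obtain g where "continuous_map (gtop G) euclidean g" "\<And>x. x \<in> ?K \<Longrightarrow> g x = f x"
      by (rule Tietze_extension_complex[OF normal_gtop closedin_isotropy[OF u] f]) blast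
    then have "\<exists>g. continuous_map (gtop G) euclidean g \<and> (\<forall>x\<in>?K. g x = f x)" by blast
    then show ?thesis unfolding ext_def by (rule someI_ex)
  qed
  have extY: "continuous_map ?Y euclidean (ext f)"
    if "continuous_map (subtopology (gtop G) ?K) euclidean f" for f
    using ext[OF that] cY by blast
  have "invariant_mean G H u (\<lambda>f. J (ext f))"
  proof
    show "u \<in> units G" by (rule u)
  next
    fix f g :: "'g \<Rightarrow> complex" assume f: "continuous_map (subtopology (gtop G) ?K) euclidean f"
      and g: "continuous_map (subtopology (gtop G) ?K) euclidean g"
    have fg: "continuous_map (subtopology (gtop G) ?K) euclidean (\<lambda>x. f x + g x)"
      using f g by (rule continuous_map_add)
    have "J (ext (\<lambda>x. f x + g x)) = J (\<lambda>x. ext f x + ext g x)"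
      by (intro J_cong extY fg continuous_map_add f g) (use ext[OF f] ext[OF g] ext[OF fg] in auto)
    then show "J (ext (\<lambda>x. f x + g x)) = J (ext f) + J (ext g)" by (simp add: J_add extY f g)
  next
    fix f :: "'g \<Rightarrow> complex" and k assume f: "continuous_map (subtopology (gtop G) ?K) euclidean f"
    have kf: "continuous_map (subtopology (gtop G) ?K) euclidean (\<lambda>x. k * f x)"
      using f by (intro continuous_map_complex_mult) auto
    have "J (ext (\<lambda>x. k * f x)) = J (\<lambda>x. k * ext f x)"
      by (intro J_cong extY kf continuous_map_complex_mult f) (use ext[OF f] ext[OF kf] in auto)
    then show "J (ext (\<lambda>x. k * f x)) = k * J (ext f)" by (simp add: J_mult extY f)
  next
    fix f :: "'g \<Rightarrow> complex" and B assume f: "continuous_map (subtopology (gtop G) ?K) euclidean f"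
      and B: "\<And>x. x \<in> ?K \<Longrightarrow> cmod (f x) \<le> B"
    show "cmod (J (ext f)) \<le> B" by (rule J_le[OF extY[OF f]]) (use ext[OF f] B in auto)
  next
    have "J (ext (\<lambda>x. 1)) = J (\<lambda>x. 1)" by (intro J_cong extY) (use ext[of "\<lambda>x. 1"] in auto)
    then show "J (ext (\<lambda>x. 1)) = 1" by (simp add: J_1)
  next
    fix f :: "'g \<Rightarrow> complex" and h assume f: "continuous_map (subtopology (gtop G) ?K) euclidean f" and h: "h \<in> ?K"
    have hh: "h \<in> H" "r h = u" "d h = u" "h \<in> A" using h H_arrow by (auto simp: isotropy_def)
    have hK: "h \<cdot> x \<in> ?K" if "x \<in> ?K" for x
      using that hh H_arrow sub_mul by (auto simp: isotropy_def gsimps)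
    have tr: "continuous_map (subtopology (gtop G) T) (gtop G) (\<lambda>x. h \<cdot> x)" if "\<And>x. x \<in> T \<Longrightarrow> r x = u" for T
      using that hh by (intro continuous_mult continuous_map_from_subtopology[OF continuous_map_id[unfolded id_def]]) auto
    have "continuous_map (subtopology (gtop G) ?K) (subtopology (gtop G) ?K) (\<lambda>x. h \<cdot> x)"
      using tr[of ?K] hK by (auto simp: continuous_map_in_subtopology isotropy_def)
    from continuous_map_compose[OF this f]
    have fh: "continuous_map (subtopology (gtop G) ?K) euclidean (\<lambda>x. f (h \<cdot> x))" by (simp add: o_def)
    have "continuous_map ?Y euclidean (\<lambda>x. ext f (h \<cdot> x))"
      using continuous_map_compose[OF tr[of ?D] conjunct1[OF ext[OF f]]] by (simp add: o_def)
    then have "J (ext (\<lambda>x. f (h \<cdot> x))) = J (\<lambda>x. ext f (h \<cdot> x))"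
      by (intro J_cong extY fh) (use ext[OF f] ext[OF fh] hK in auto)
    then show "J (ext (\<lambda>x. f (h \<cdot> x))) = J (ext f)" using J_inv[OF conjunct1[OF ext[OF f]] h] by simp
  qed
  then show ?thesis by blast
qed

end

section \<open>Norm continuity and vector-valued means\<close>

lemma eventually_atin_topspace: "\<forall>\<^sub>F y in atin Z z. y \<in> topspace Z"
  unfolding eventually_atin by (cases "z \<in> topspace Z") (auto intro!: exI[of _ "topspace Z"])

lemma compact_space_continuous_bounded:
  fixes f :: "'a \<Rightarrow> real"
  assumes "compact_space Z" "continuous_map Z euclidean f"
  obtains B where "\<And>z. z \<in> topspace Z \<Longrightarrow> f z \<le> B"
proof -
  have "compactin Z (topspace Z)" using assms(1) by (simp add: compact_space_def)
  from image_compactin[OF this assms(2)] have "bounded (f ` topspace Z)"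
    by (simp add: compact_imp_bounded)
  then obtain B where "\<And>z. z \<in> topspace Z \<Longrightarrow> \<bar>f z\<bar> \<le> B" unfolding bounded_iff by auto
  then show ?thesis using that abs_le_D1 by blast
qed

lemma compact_space_continuous_positive:
  fixes f :: "'a \<Rightarrow> real"
  assumes Z: "compact_space Z" and f: "continuous_map Z euclidean f" and C: "closedin Z C"
    and pos: "\<And>z. z \<in> C \<Longrightarrow> 0 < f z"
  obtains e where "0 < e" "\<And>z. z \<in> C \<Longrightarrow> e \<le> f z"
proof (cases "C = {}")
  case False
  have "compact (f ` C)" using image_compactin[OF closedin_compact_space[OF Z C] f] by simp
  then obtain z0 where "z0 \<in> C" "\<And>z. z \<in> C \<Longrightarrow> f z0 \<le> f z"
    using compact_attains_inf[of "f ` C"] False by auto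
  then show ?thesis using pos that by blast
qed (use that[of 1] in auto)

text \<open>An instance of the tube lemma for the parameter space \<open>C\<close>.\<close>

lemma compact_parameter_uniform:
  fixes f :: "'a \<times> 'b \<Rightarrow> real"
  assumes f: "continuous_map (prod_topology Z C) euclidean f" and C: "compact_space C"
    and z: "z \<in> topspace Z" and e: "0 < e"
  obtains U where "openin Z U" "z \<in> U" "\<And>y c. y \<in> U \<Longrightarrow> c \<in> topspace C \<Longrightarrow> \<bar>f (z, c) - f (y, c)\<bar> < e"
proof -
  have "continuous_map (prod_topology Z C) (prod_topology Z C) (\<lambda>p. (z, snd p))"
    by (intro continuous_map_pairedI continuous_map_snd) (simp add: z)
  from continuous_map_compose[OF this f]
  have "continuous_map (prod_topology Z C) euclidean (\<lambda>p. f (z, snd p))" by (simp add: o_def)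
  with f have "continuous_map (prod_topology Z C) euclidean (\<lambda>p. \<bar>f (z, snd p) - f p\<bar>)"
    by (intro continuous_intros)
  then have W: "openin (prod_topology Z C) {p \<in> topspace (prod_topology Z C). \<bar>f (z, snd p) - f p\<bar> < e}"
    by (rule continuous_map_preimage_less)
  have c: "compactin C (topspace C)" using C by (simp add: compact_space_def)
  have "{z} \<times> topspace C \<subseteq> {p \<in> topspace (prod_topology Z C). \<bar>f (z, snd p) - f p\<bar> < e}"
    using z e by auto
  from tube_lemma_right[OF W c z this]
  obtain U V where "openin Z U" "z \<in> U" "topspace C \<subseteq> V"
    "U \<times> V \<subseteq> {p \<in> topspace (prod_topology Z C). \<bar>f (z, snd p) - f p\<bar> < e}"
    by blast
  note UV = this
  show ?thesis
  proof (rule that[OF UV(1,2)])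
    fix y c assume "y \<in> U" "c \<in> topspace C"
    then have "(y, c) \<in> U \<times> V" using UV(3) by blast
    then show "\<bar>f (z, c) - f (y, c)\<bar> < e" using UV(4) by auto
  qed
qed

context semi_inner
begin

text \<open>Norm continuity of maps into one fixed space. A filter formulation lets limit rules be used.\<close>

definition hcont :: "'z topology \<Rightarrow> ('z \<Rightarrow> 'v) \<Rightarrow> bool" where
  "hcont Z s \<longleftrightarrow> (\<forall>z\<in>topspace Z. s z \<in> W \<and> ((\<lambda>y. hdist P (s z) (s y)) \<longlongrightarrow> 0) (atin Z z))"

lemma hcont_mem: "hcont Z s \<Longrightarrow> z \<in> topspace Z \<Longrightarrow> s z \<in> W"
  and hcont_tendsto: "hcont Z s \<Longrightarrow> z \<in> topspace Z \<Longrightarrow> ((\<lambda>y. hdist P (s z) (s y)) \<longlongrightarrow> 0) (atin Z z)"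
  by (simp_all add: hcont_def)

lemma hcontI_le:
  assumes "\<And>z. z \<in> topspace Z \<Longrightarrow> s z \<in> W"
    and "\<And>z. z \<in> topspace Z \<Longrightarrow> (f z \<longlongrightarrow> 0) (atin Z z)"
    and "\<And>z y. z \<in> topspace Z \<Longrightarrow> y \<in> topspace Z \<Longrightarrow> hdist P (s z) (s y) \<le> f z y"
  shows "hcont Z s"
  unfolding hcont_def
proof (intro ballI conjI assms(1))
  fix z assume z: "z \<in> topspace Z"
  show "((\<lambda>y. hdist P (s z) (s y)) \<longlongrightarrow> 0) (atin Z z)"
  proof (rule Lim_null_comparison[OF _ assms(2)[OF z]])
    show "\<forall>\<^sub>F y in atin Z z. norm (hdist P (s z) (s y)) \<le> f z y"
      using eventually_atin_topspace[of Z z]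
      by eventually_elim (use assms z in \<open>simp add: hdist_nonneg\<close>)
  qed
qed

text \<open>The estimates below come as a fixed multiple of an arbitrary \<open>e\<close>, with a multiple
  that may be zero.\<close>

lemma hcontI_uniform:
  assumes "\<And>z. z \<in> topspace Z \<Longrightarrow> s z \<in> W"
    and "\<And>z e. z \<in> topspace Z \<Longrightarrow> 0 < e \<Longrightarrow> \<exists>U. openin Z U \<and> z \<in> U \<and> (\<forall>y\<in>U. hdist P (s z) (s y) \<le> c * e)"
  shows "hcont Z s"
  unfolding hcont_def
proof (intro ballI conjI assms(1))
  fix z assume z: "z \<in> topspace Z"
  show "((\<lambda>y. hdist P (s z) (s y)) \<longlongrightarrow> 0) (atin Z z)"
  proof (rule tendstoI)
    fix e :: real assume e: "0 < e"
    have "0 < e / (\<bar>c\<bar> + 1)" using e by (simp add: add_nonneg_pos)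
    then obtain U where U: "openin Z U" "z \<in> U" "\<And>y. y \<in> U \<Longrightarrow> hdist P (s z) (s y) \<le> c * (e / (\<bar>c\<bar> + 1))"
      using assms(2)[OF z] by metis
    have "c * (e / (\<bar>c\<bar> + 1)) < e"
    proof -
      have "c * e < (\<bar>c\<bar> + 1) * e" using e by (intro mult_strict_right_mono) auto
      then show ?thesis by (simp add: pos_divide_less_eq add_nonneg_pos mult.commute)
    qed
    then have "hdist P (s z) (s y) < e" if "y \<in> U" for y using U(3)[OF that] by simp
    moreover have "0 \<le> hdist P (s z) (s y)" if "y \<in> U" for y
      using assms(1) z openin_subset[OF U(1)] that by (intro hdist_nonneg) auto
    ultimately show "\<forall>\<^sub>F y in atin Z z. dist (hdist P (s z) (s y)) 0 < e"
      unfolding eventually_atin using U(1,2) by (auto intro!: exI[of _ U])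
  qed
qed

lemma hcont_const: "v \<in> W \<Longrightarrow> hcont Z (\<lambda>_. v)"
  by (simp add: hcont_def hdist_self)

lemma hcont_compose:
  assumes s: "hcont Z s" and f: "continuous_map Y Z f" shows "hcont Y (\<lambda>y. s (f y))"
  unfolding hcont_def
proof (intro ballI conjI)
  have fy: "f y \<in> topspace Z" if "y \<in> topspace Y" for y using f that by (auto simp: continuous_map_def)
  then show "s (f y) \<in> W" if "y \<in> topspace Y" for y using hcont_mem[OF s] that by blast
  fix y assume y: "y \<in> topspace Y"
  show "((\<lambda>x. hdist P (s (f y)) (s (f x))) \<longlongrightarrow> 0) (atin Y y)"
  proof (rule tendstoI)
    fix e :: real assume e: "0 < e"
    then have "\<forall>\<^sub>F x in atin Z (f y). dist (hdist P (s (f y)) (s x)) 0 < e"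
      by (rule tendstoD[OF hcont_tendsto[OF s fy[OF y]]])
    then obtain U where U: "openin Z U" "f y \<in> U" "\<And>x. x \<in> U - {f y} \<Longrightarrow> dist (hdist P (s (f y)) (s x)) 0 < e"
      using fy[OF y] unfolding eventually_atin by metis
    have U': "dist (hdist P (s (f y)) (s x)) 0 < e" if "x \<in> U" for x
      using U(3)[of x] that e hdist_self[OF hcont_mem[OF s fy[OF y]]] by (cases "x = f y") auto
    show "\<forall>\<^sub>F x in atin Y y. dist (hdist P (s (f y)) (s (f x))) 0 < e"
      unfolding eventually_atin
      using openin_continuous_map_preimage[OF f U(1)] U(2) U' y
      by (intro disjI2 exI[of _ "{x \<in> topspace Y. f x \<in> U}"]) auto
  qed
qed

lemma hcont_cong:
  assumes s: "hcont Z s" and eq: "\<And>z. z \<in> topspace Z \<Longrightarrow> s z = t z" shows "hcont Z t"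
proof (rule hcontI_le[OF _ hcont_tendsto[OF s]])
  show "t z \<in> W" if "z \<in> topspace Z" for z using hcont_mem[OF s that] eq[OF that] by simp
qed (auto simp: eq[symmetric])

lemma hcont_hip:
  assumes s: "hcont Z s" and t: "hcont Z t"
  shows "continuous_map Z euclidean (\<lambda>z. hip P (s z) (t z))"
  unfolding continuous_map_tendsto
proof
  fix z assume z: "z \<in> topspace Z"
  note S = hcont_tendsto[OF s z] and T = hcont_tendsto[OF t z]
  have "((\<lambda>y. hip P (s z) (t z) - hip P (s y) (t y)) \<longlongrightarrow> 0) (atin Z z)"
  proof (rule Lim_null_comparison)
    show "((\<lambda>y. hdist P (s z) (s y) * hnorm P (t z) + (hnorm P (s z) + hdist P (s z) (s y)) * hdist P (t z) (t y)) \<longlongrightarrow> 0) (atin Z z)"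
      using tendsto_add[OF tendsto_mult_right[OF S, of "hnorm P (t z)"]
        tendsto_mult[OF tendsto_add[OF tendsto_const S, of "hnorm P (s z)"] T]] by simp
    show "\<forall>\<^sub>F y in atin Z z. norm (hip P (s z) (t z) - hip P (s y) (t y))
        \<le> hdist P (s z) (s y) * hnorm P (t z) + (hnorm P (s z) + hdist P (s z) (s y)) * hdist P (t z) (t y)"
      using eventually_atin_topspace[of Z z]
    proof eventually_elim
      fix y assume y: "y \<in> topspace Z"
      note m = hcont_mem[OF s z] hcont_mem[OF t z] hcont_mem[OF s y] hcont_mem[OF t y]
      have "hnorm P (s y) \<le> hnorm P (s z) + hdist P (s z) (s y)"
        using hnorm_diff_le[OF m(3) m(1)] hdist_commute[OF m(1) m(3)] by simp
      then have "hnorm P (s y) * hdist P (t z) (t y) \<le> (hnorm P (s z) + hdist P (s z) (s y)) * hdist P (t z) (t y)"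
        using m by (intro mult_right_mono hdist_nonneg)
      then show "norm (hip P (s z) (t z) - hip P (s y) (t y))
        \<le> hdist P (s z) (s y) * hnorm P (t z) + (hnorm P (s z) + hdist P (s z) (s y)) * hdist P (t z) (t y)"
        using hip_diff_le[OF m] by simp
    qed
  qed
  from tendsto_diff[OF tendsto_const[of "hip P (s z) (t z)"] this]
  show "((\<lambda>z. hip P (s z) (t z)) \<longlongrightarrow> hip P (s z) (t z)) (atin Z z)" by simp
qed

lemma hcont_hnorm: "hcont Z s \<Longrightarrow> continuous_map Z euclidean (\<lambda>z. hnorm P (s z))"
  unfolding hnorm_def using hcont_hip[of Z s s]
  by (auto simp: continuous_map_tendsto intro!: tendsto_intros)

lemma hcont_hdist:
  assumes s: "hcont Z s" and t: "hcont Z t"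
  shows "continuous_map Z euclidean (\<lambda>z. hdist P (s z) (t z))"
proof (rule continuous_map_eq)
  show "continuous_map Z euclidean (\<lambda>z. sqrt (Re (hip P (s z) (s z)) + Re (hip P (t z) (t z)) - 2 * Re (hip P (s z) (t z))))"
    using hcont_hip[OF s s] hcont_hip[OF t t] hcont_hip[OF s t]
    by (auto simp: continuous_map_tendsto intro!: tendsto_intros)
  fix z assume z: "z \<in> topspace Z"
  note m = hcont_mem[OF s z] hcont_mem[OF t z]
  show "sqrt (Re (hip P (s z) (s z)) + Re (hip P (t z) (t z)) - 2 * Re (hip P (s z) (t z))) = hdist P (s z) (t z)"
    using hdist_sq[OF m] hnorm_sq m hdist_nonneg[OF m] by (metis real_sqrt_unique)
qed

lemma hcont_smult:
  fixes \<phi> :: "'z \<Rightarrow> complex"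
  assumes s: "hcont Z s" and \<phi>: "continuous_map Z euclidean \<phi>"
  shows "hcont Z (\<lambda>z. \<phi> z \<odot>\<^bsub>P\<^esub> s z)"
proof (rule hcontI_le)
  show "\<phi> z \<odot>\<^bsub>P\<^esub> s z \<in> W" if "z \<in> topspace Z" for z using hcont_mem[OF s that] by (rule smult_mem)
  show "((\<lambda>y. cmod (\<phi> z - \<phi> y) * hnorm P (s z) + cmod (\<phi> y) * hdist P (s z) (s y)) \<longlongrightarrow> 0) (atin Z z)"
    if z: "z \<in> topspace Z" for z
  proof -
    have p: "(\<phi> \<longlongrightarrow> \<phi> z) (atin Z z)" using \<phi> z by (simp add: continuous_map_tendsto)
    have "((\<lambda>y. cmod (\<phi> z - \<phi> y) * hnorm P (s z) + cmod (\<phi> y) * hdist P (s z) (s y)) \<longlongrightarrow>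
        cmod (\<phi> z - \<phi> z) * hnorm P (s z) + cmod (\<phi> z) * 0) (atin Z z)"
      by (intro tendsto_intros p hcont_tendsto[OF s z])
    then show ?thesis by simp
  qed
  fix z y assume z: "z \<in> topspace Z" and y: "y \<in> topspace Z"
  note m = hcont_mem[OF s z] hcont_mem[OF s y]
  have "hdist P (\<phi> z \<odot>\<^bsub>P\<^esub> s z) (\<phi> y \<odot>\<^bsub>P\<^esub> s y)
      \<le> hdist P (\<phi> z \<odot>\<^bsub>P\<^esub> s z) (\<phi> y \<odot>\<^bsub>P\<^esub> s z) + hdist P (\<phi> y \<odot>\<^bsub>P\<^esub> s z) (\<phi> y \<odot>\<^bsub>P\<^esub> s y)"
    using m by (intro hdist_triangle smult_mem)
  then show "hdist P (\<phi> z \<odot>\<^bsub>P\<^esub> s z) (\<phi> y \<odot>\<^bsub>P\<^esub> s y)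
      \<le> cmod (\<phi> z - \<phi> y) * hnorm P (s z) + cmod (\<phi> y) * hdist P (s z) (s y)"
    using m by (simp add: hdist_smult hdist_smult_left)
qed

lemma hcont_bounded_op:
  assumes s: "hcont Z s" and T: "\<And>x. x \<in> W \<Longrightarrow> T x \<in> W"
    and le: "\<And>x y. x \<in> W \<Longrightarrow> y \<in> W \<Longrightarrow> hdist P (T x) (T y) \<le> c * hdist P x y"
  shows "hcont Z (\<lambda>z. T (s z))"
proof (rule hcontI_le[where f = "\<lambda>z y. c * hdist P (s z) (s y)"])
  show "((\<lambda>y. c * hdist P (s z) (s y)) \<longlongrightarrow> 0) (atin Z z)" if "z \<in> topspace Z" for z
    using tendsto_mult_left[OF hcont_tendsto[OF s that], of c] by simp
qed (use T le hcont_mem[OF s] in auto)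

end

section \<open>Properties of the invariant mean\<close>

context invariant_mean
begin

abbreviation K where "K \<equiv> isotropy u"
abbreviation KT where "KT \<equiv> subtopology (gtop G) K"

lemma K_mem:
  assumes "k \<in> K" shows "k \<in> H" "k \<in> A" "r k = u" "d k = u" "i k \<in> K"
proof -
  show k: "k \<in> H" "k \<in> A" "r k = u" "d k = u" using assms H_arrow by (auto simp: isotropy_def)
  then show "i k \<in> K" using sub_inv by (simp add: isotropy_def gsimps)
qed

lemma K_mult: "k \<in> K \<Longrightarrow> l \<in> K \<Longrightarrow> k \<cdot> l \<in> K"
  using H_arrow sub_mul by (simp add: isotropy_def gsimps)

lemma u_K: "u \<in> K"
  using u sub_wide unit_rng unit_dom by (auto simp: isotropy_def)

lemma topspace_KT: "topspace KT = K"
  using K_mem(2) by auto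

lemma compact_KT: "compact_space KT"
  by (intro compact_space_subtopology closedin_compact_space[OF compact_gtop] closedin_isotropy u)

lemma translate_K_continuous: "h \<in> K \<Longrightarrow> continuous_map KT KT (\<lambda>x. h \<cdot> x)"
proof -
  assume h: "h \<in> K"
  have "continuous_map KT (gtop G) (\<lambda>x. h \<cdot> x)"
    using K_mem[OF h] K_mem(3)
    by (intro continuous_mult continuous_map_from_subtopology[OF continuous_map_id[unfolded id_def]]) auto
  then show ?thesis using K_mult[OF h] by (auto simp: continuous_map_in_subtopology)
qed

lemma K_fun_bounded:
  fixes f :: "'g \<Rightarrow> complex"
  assumes "continuous_map KT euclidean f"
  obtains B where "\<And>x. x \<in> K \<Longrightarrow> cmod (f x) \<le> B" "0 \<le> B"
proof -
  obtain B where B: "\<And>x. x \<in> topspace KT \<Longrightarrow> cmod (f x) \<le> B"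
    using compact_space_continuous_bounded[OF compact_KT continuous_map_norm[OF assms]] by blast
  then have "cmod (f u) \<le> B" using u_K by (simp only: topspace_KT)
  then have "0 \<le> B" using norm_ge_zero order_trans by blast
  moreover have "cmod (f x) \<le> B" if "x \<in> K" for x using B[of x] that unfolding topspace_KT .
  ultimately show ?thesis by (intro that[of B])
qed

lemma I_const: "I (\<lambda>x. c) = c"
  using I_mult[of "\<lambda>x. 1" c] by (simp add: I_one)

lemma I_diff:
  assumes f: "continuous_map KT euclidean f" and g: "continuous_map KT euclidean g"
  shows "I (\<lambda>x. f x - g x) = I f - I g"
proof -
  have "continuous_map KT euclidean (\<lambda>x. (- 1) * g x)" using g by (intro continuous_map_complex_mult) auto
  from I_add[OF f this] I_mult[OF g, of "- 1"] show ?thesis by simp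
qed

lemma I_cong:
  assumes f: "continuous_map KT euclidean f" and g: "continuous_map KT euclidean g"
    and eq: "\<And>x. x \<in> K \<Longrightarrow> f x = g x"
  shows "I f = I g"
proof -
  have "cmod (I (\<lambda>x. f x - g x)) \<le> 0"
    by (rule I_le) (use f g eq in \<open>auto intro: continuous_map_diff\<close>)
  then show ?thesis by (simp add: I_diff f g)
qed

text \<open>A normalised functional of norm one is real on real functions: adding a large imaginary constant
  \<open>\<i> t\<close> to a real function increases its norm by less than it would increase the
  modulus of a nonreal mean.\<close>

lemma Im_I_eq_0:
  assumes f: "continuous_map KT euclidean f" and real: "\<And>x. x \<in> K \<Longrightarrow> Im (f x) = 0"
  shows "Im (I f) = 0"
proof (rule ccontr)
  assume nz: "Im (I f) \<noteq> 0"
  obtain B where B: "\<And>x. x \<in> K \<Longrightarrow> cmod (f x) \<le> B" "0 \<le> B" by (rule K_fun_bounded[OF f]) blast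
  define t where "t = (B\<^sup>2 + 1) / (2 * Im (I f))"
  have "cmod (I (\<lambda>x. f x + \<i> * of_real t)) \<le> sqrt (B\<^sup>2 + t\<^sup>2)"
  proof (rule I_le)
    show "continuous_map KT euclidean (\<lambda>x. f x + \<i> * of_real t)" using f by (intro continuous_map_add) auto
    fix x assume x: "x \<in> K"
    have "\<bar>Re (f x)\<bar> \<le> B" using B(1)[OF x] abs_Re_le_cmod order_trans by blast
    then have "(Re (f x))\<^sup>2 \<le> B\<^sup>2" using B(2) by (simp add: abs_le_square_iff[symmetric])
    then show "cmod (f x + \<i> * of_real t) \<le> sqrt (B\<^sup>2 + t\<^sup>2)" using real[OF x] by (simp add: cmod_def)
  qed
  moreover have "I (\<lambda>x. f x + \<i> * of_real t) = I f + \<i> * of_real t"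
    using I_add[OF f, of "\<lambda>x. \<i> * of_real t"] by (simp add: I_const)
  ultimately have "sqrt ((Re (I f))\<^sup>2 + (Im (I f) + t)\<^sup>2) \<le> sqrt (B\<^sup>2 + t\<^sup>2)" by (simp add: cmod_def)
  then have "(Re (I f))\<^sup>2 + (Im (I f) + t)\<^sup>2 \<le> B\<^sup>2 + t\<^sup>2" by simp
  moreover have "2 * Im (I f) * t = B\<^sup>2 + 1" using nz by (simp add: t_def)
  moreover have "0 \<le> (Re (I f))\<^sup>2" "0 \<le> (Im (I f))\<^sup>2" by auto
  ultimately show False by (simp add: power2_sum)
qed

text \<open>A nonnegative function bounded by \<open>B\<close> is within \<open>B / 2\<close> of the constant
  \<open>B / 2\<close>.\<close>

lemma I_Re_nonneg:
  assumes f: "continuous_map KT euclidean f" and nonneg: "\<And>x. x \<in> K \<Longrightarrow> 0 \<le> Re (f x)"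
  shows "0 \<le> Re (I f)"
proof -
  have re: "continuous_map KT euclidean (\<lambda>x. complex_of_real (Re (f x)))"
    and im: "continuous_map KT euclidean (\<lambda>x. complex_of_real (Im (f x)))"
    using f by (auto simp: continuous_map_Re_Im)
  have iim: "continuous_map KT euclidean (\<lambda>x. \<i> * complex_of_real (Im (f x)))"
    using im by (intro continuous_map_complex_mult) auto
  have "I f = I (\<lambda>x. complex_of_real (Re (f x)) + \<i> * complex_of_real (Im (f x)))"
    by (intro I_cong f continuous_map_add re iim) (simp add: complex_eq[symmetric])
  also have "\<dots> = I (\<lambda>x. complex_of_real (Re (f x))) + \<i> * I (\<lambda>x. complex_of_real (Im (f x)))"
    by (simp add: I_add re iim I_mult im)
  finally have eq: "Re (I f) = Re (I (\<lambda>x. complex_of_real (Re (f x))))"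
    using Im_I_eq_0[OF im] by simp
  obtain B where B: "\<And>x. x \<in> K \<Longrightarrow> cmod (f x) \<le> B" "0 \<le> B" by (rule K_fun_bounded[OF f]) blast
  have "cmod (I (\<lambda>x. complex_of_real (Re (f x)) - of_real (B/2))) \<le> B / 2"
  proof (rule I_le)
    show "continuous_map KT euclidean (\<lambda>x. complex_of_real (Re (f x)) - of_real (B/2))"
      by (intro continuous_map_diff re) auto
    fix x assume x: "x \<in> K"
    have "Re (f x) \<le> B" using B(1)[OF x] complex_Re_le_cmod order_trans by blast
    then have "\<bar>Re (f x) - B / 2\<bar> \<le> B / 2" using nonneg[OF x] unfolding abs_le_iff by linarith
    then show "cmod (complex_of_real (Re (f x)) - of_real (B/2)) \<le> B / 2"
      by (metis norm_of_real of_real_diff)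
  qed
  then have "\<bar>Re (I (\<lambda>x. complex_of_real (Re (f x)) - of_real (B/2)))\<bar> \<le> B / 2"
    using abs_Re_le_cmod order_trans by blast
  moreover have "I (\<lambda>x. complex_of_real (Re (f x)) - of_real (B/2)) = I (\<lambda>x. complex_of_real (Re (f x))) - of_real (B/2)"
    using I_diff[OF re, of "\<lambda>x. of_real (B/2)"] by (simp add: I_const)
  ultimately have "\<bar>Re (I (\<lambda>x. complex_of_real (Re (f x)))) - B / 2\<bar> \<le> B / 2" by simp
  then have "0 \<le> Re (I (\<lambda>x. complex_of_real (Re (f x))))" by linarith
  then show ?thesis by (simp only: eq)
qed

text \<open>Faithfulness: finitely many translates of the open set where \<open>Re f > e\<close> cover the
  compact group, so the sum of the corresponding translates of \<open>f\<close>, which all have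
  the same mean, is bounded below by \<open>e\<close>.\<close>

lemma I_Re_pos:
  assumes f: "continuous_map KT euclidean f" and nonneg: "\<And>x. x \<in> K \<Longrightarrow> 0 \<le> Re (f x)"
    and x0: "x0 \<in> K" and pos: "0 < Re (f x0)"
  shows "0 < Re (I f)"
proof -
  define e where "e = Re (f x0) / 2"
  have e: "0 < e" "e < Re (f x0)" using pos by (auto simp: e_def)
  have fh: "continuous_map KT euclidean (\<lambda>x. f (h \<cdot> x))" if "h \<in> K" for h
    using continuous_map_compose[OF translate_K_continuous[OF that] f] by (simp add: o_def)
  define V where "V h = {x \<in> topspace KT. Re (f (h \<cdot> x)) \<in> {e<..}}" for h
  have V: "openin KT (V h)" if "h \<in> K" for h
    unfolding V_def using fh[OF that] by (intro openin_continuous_map_preimage) (auto simp: continuous_map_Re_Im)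
  have "K \<subseteq> \<Union> (V ` K)"
  proof
    fix x assume x: "x \<in> K"
    have h: "x0 \<cdot> i x \<in> K" using K_mult[OF x0 K_mem(5)[OF x]] .
    have "x0 \<cdot> i x \<cdot> x = x0" using K_mem[OF x] K_mem[OF x0] by (simp add: gsimps mult_unit)
    then have "x \<in> V (x0 \<cdot> i x)" using x e K_mem(2)[OF x] by (simp add: V_def)
    then show "x \<in> \<Union> (V ` K)" using h by blast
  qed
  moreover have "compactin KT K" using compact_KT unfolding compact_space_def topspace_KT .
  ultimately have "\<exists>\<F>. finite \<F> \<and> \<F> \<subseteq> V ` K \<and> K \<subseteq> \<Union>\<F>"
    using V unfolding compactin_def by (elim conjE allE[of _ "V ` K"]) auto
  then obtain \<F> where \<F>: "finite \<F>" "\<F> \<subseteq> V ` K" "K \<subseteq> \<Union>\<F>" by blast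
  obtain T where T: "finite T" "T \<subseteq> K" "\<F> = V ` T" using finite_subset_image[OF \<F>(1,2)] by blast
  have sum: "continuous_map KT euclidean (\<lambda>x. \<Sum>h\<in>T. f (h \<cdot> x)) \<and> I (\<lambda>x. \<Sum>h\<in>T. f (h \<cdot> x)) = of_nat (card T) * I f"
    using T(1,2)
  proof (induction T rule: finite_induct)
    case (insert h T)
    then show ?case
      using fh[of h] I_add[OF fh[of h], of "\<lambda>x. \<Sum>h\<in>T. f (h \<cdot> x)"] I_translate[OF f, of h]
      by (auto simp: algebra_simps intro: continuous_map_add)
  qed (simp add: I_const)
  have "0 \<le> Re (I (\<lambda>x. (\<Sum>h\<in>T. f (h \<cdot> x)) - of_real e))"
  proof (rule I_Re_nonneg)
    show "continuous_map KT euclidean (\<lambda>x. (\<Sum>h\<in>T. f (h \<cdot> x)) - of_real e)"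
      using sum by (intro continuous_map_diff) auto
    fix x assume x: "x \<in> K"
    then obtain h where h: "h \<in> T" "x \<in> V h" using \<F>(3) T(3) by blast
    have "e \<le> Re (f (h \<cdot> x))" using h by (simp add: V_def)
    also have "\<dots> \<le> (\<Sum>h\<in>T. Re (f (h \<cdot> x)))"
      using T nonneg x K_mult h(1) by (intro member_le_sum) (auto intro!: nonneg)
    finally show "0 \<le> Re ((\<Sum>h\<in>T. f (h \<cdot> x)) - of_real e)" by simp
  qed
  moreover have "I (\<lambda>x. (\<Sum>h\<in>T. f (h \<cdot> x)) - of_real e) = of_nat (card T) * I f - of_real e"
    using I_diff[OF conjunct1[OF sum], of "\<lambda>x. of_real e"] sum by (simp add: I_const)
  ultimately have "0 < real (card T) * Re (I f)" using e by simp
  then show ?thesis by (simp add: zero_less_mult_iff)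
qed

end

section \<open>An intertwining kernel over an isotropy group\<close>

text \<open>The function \<open>\<rho>\<close> plays the role of a distance to the unit \<open>u\<close>; its
  sublevel sets describe small neighbourhoods of \<open>u\<close> in \<open>G\<close>. The kernel
  lives on the isotropy group \<open>G0\<close> of \<open>G\<close>, and the arrows in
  \<open>PD\<close> connect \<open>u\<close> to the other units.\<close>

locale intertwining_kernel = groupoid_pair_rep G H E \<pi> + invariant_mean G H u I
  for G :: "'g groupoid" and H :: "'g set" and E :: "('g, 'v) hbundle" and \<pi> :: "'g \<Rightarrow> 'v \<Rightarrow> 'v"
    and u :: 'g and I :: "('g \<Rightarrow> complex) \<Rightarrow> complex" +
  fixes \<rho> :: "'g \<Rightarrow> real"
  assumes \<rho>_continuous: "continuous_map (gtop G) euclidean \<rho>"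
    and \<rho>_nonneg: "0 \<le> \<rho> x"
    and \<rho>_zero: "x \<in> A \<Longrightarrow> \<rho> x = 0 \<longleftrightarrow> x = u"
begin

sublocale S: hilbert_space "F u"
  by (rule fib_hilbert[OF u])

definition G0 where "G0 = {x \<in> A. r x = u \<and> d x = u}"
abbreviation GT where "GT \<equiv> subtopology (gtop G) G0"
definition PD where "PD = {p \<in> H. d p = u}"
abbreviation PT where "PT \<equiv> subtopology (gtop G) PD"

lemma \<pi>_K:
  assumes k: "k \<in> K"
  shows "v \<in> S.C \<Longrightarrow> \<pi> k v \<in> S.C"
    and "v \<in> S.C \<Longrightarrow> w \<in> S.C \<Longrightarrow> \<pi> k (v \<oplus>\<^bsub>F u\<^esub> w) = \<pi> k v \<oplus>\<^bsub>F u\<^esub> \<pi> k w"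
    and "v \<in> S.C \<Longrightarrow> \<pi> k (c \<odot>\<^bsub>F u\<^esub> v) = c \<odot>\<^bsub>F u\<^esub> \<pi> k v"
    and "v \<in> S.C \<Longrightarrow> w \<in> S.C \<Longrightarrow> hip (F u) (\<pi> k v) (\<pi> k w) = hip (F u) v w"
    and "v \<in> S.C \<Longrightarrow> hnorm (F u) (\<pi> k v) = hnorm (F u) v"
    and "v \<in> S.C \<Longrightarrow> l \<in> K \<Longrightarrow> \<pi> k (\<pi> l v) = \<pi> (k \<cdot> l) v"
  using K_mem[OF k] \<pi>_mem[of k v] \<pi>_add[of k v w] \<pi>_smult[of k v] \<pi>_hip[of k v w] \<pi>_hnorm[of k v]
    \<pi>_mult[of k l v] K_mem[of l] by auto

lemma \<pi>_u: "v \<in> S.C \<Longrightarrow> \<pi> u v = v"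
  by (rule \<pi>_unit[OF u])

lemma \<pi>_K_adjoint:
  assumes k: "k \<in> K" and v: "v \<in> S.C" and w: "w \<in> S.C"
  shows "hip (F u) (\<pi> (i k) v) w = hip (F u) v (\<pi> k w)"
proof -
  have "hip (F u) v (\<pi> k w) = hip (F u) (\<pi> (i k) v) (\<pi> (i k) (\<pi> k w))"
    using \<pi>_K(4)[OF K_mem(5)[OF k] v \<pi>_K(1)[OF k w]] by simp
  also have "\<pi> (i k) (\<pi> k w) = w" using \<pi>_inv[of k w] K_mem[OF k] w by simp
  finally show ?thesis by simp
qed

text \<open>A section moved into the fibre over \<open>u\<close> along arrows of \<open>H\<close>. It trades
  sections of a bundle for maps into one Hilbert space.\<close>

definition pull :: "('g \<Rightarrow> 'v) \<Rightarrow> 'g \<Rightarrow> 'v" where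
  "pull \<eta> p = \<pi> (i p) (\<eta> (r p))"

lemma PD_mem: "p \<in> PD \<Longrightarrow> p \<in> H" "p \<in> PD \<Longrightarrow> p \<in> A" "p \<in> PD \<Longrightarrow> d p = u" "p \<in> PD \<Longrightarrow> r p \<in> units G"
  using H_arrow rng_unit by (auto simp: PD_def)

lemma topspace_PT: "topspace PT = PD"
  using PD_mem(2) by auto

lemma sec_mem_unit: "\<eta> \<in> secs E \<Longrightarrow> v \<in> units G \<Longrightarrow> \<eta> v \<in> carrier (F v)"
  using bun.sec_mem by (simp add: topspace_unit_top)

lemma pull_mem: "\<eta> \<in> secs E \<Longrightarrow> p \<in> PD \<Longrightarrow> pull \<eta> p \<in> S.C"
  and hnorm_pull: "\<eta> \<in> secs E \<Longrightarrow> p \<in> PD \<Longrightarrow> hnorm (F u) (pull \<eta> p) = hnorm (F (r p)) (\<eta> (r p))"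
proof -
  assume \<eta>: "\<eta> \<in> secs E" and p: "p \<in> PD"
  have pA: "p \<in> A" and ip: "i p \<in> H" using PD_mem[OF p] sub_inv by auto
  have "\<eta> (r p) \<in> carrier (F (d (i p)))" using sec_mem_unit[OF \<eta> rng_unit[OF pA]] pA by (simp add: gsimps)
  from \<pi>_mem[OF ip this] \<pi>_hnorm[OF ip this]
  show "pull \<eta> p \<in> S.C" "hnorm (F u) (pull \<eta> p) = hnorm (F (r p)) (\<eta> (r p))"
    using PD_mem(3)[OF p] pA by (simp_all add: pull_def gsimps)
qed

text \<open>Weak continuity together with continuity of the norms gives norm continuity. Continuity of the
  representation is only about coefficients with sections, so a section through the limit vector
  is used for the weak part.\<close>

lemma pull_hcont:
  assumes \<eta>: "\<eta> \<in> secs E" shows "S.hcont PT (pull \<eta>)"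
  unfolding S.hcont_def topspace_PT
proof (intro ballI conjI pull_mem[OF \<eta>])
  fix p assume p: "p \<in> PD"
  have uX: "u \<in> topspace (unit_top G)" using u by (simp add: topspace_unit_top)
  obtain \<zeta> where \<zeta>: "\<zeta> \<in> secs E" "\<zeta> u = pull \<eta> p"
    by (rule bun.sec_through[OF uX pull_mem[OF \<eta> p]])
  have inv: "continuous_map PT (subtopology (gtop G) H) i"
    using sub_inv PD_mem(1) continuous_map_from_subtopology[OF continuous_inv] by (auto simp: continuous_map_in_subtopology)
  have "continuous_map PT euclidean (\<lambda>y. hip (F (r (i y))) (\<pi> (i y) (\<eta> (d (i y)))) (\<zeta> (r (i y))))"
    using continuous_map_compose[OF inv \<pi>_continuous[OF \<eta> \<zeta>(1)]] by (simp add: o_def)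
  then have c1: "continuous_map PT euclidean (\<lambda>y. hip (F u) (pull \<eta> y) (pull \<eta> p))"
  proof (rule continuous_map_eq)
    fix y assume "y \<in> topspace PT"
    then have "y \<in> A" "d y = u" using PD_mem by auto
    then show "hip (F (r (i y))) (\<pi> (i y) (\<eta> (d (i y)))) (\<zeta> (r (i y))) = hip (F u) (pull \<eta> y) (pull \<eta> p)"
      by (simp add: gsimps pull_def[of _ y] \<zeta>)
  qed
  have "continuous_map PT euclidean (\<lambda>y. hnorm (F (r y)) (\<eta> (r y)))"
    using continuous_map_compose[OF continuous_map_from_subtopology[OF continuous_rng_unit] bun.continuous_norm[OF \<eta>]]
    by (simp add: o_def)
  then have c2: "continuous_map PT euclidean (\<lambda>y. hnorm (F u) (pull \<eta> y))"
    by (rule continuous_map_eq) (simp add: hnorm_pull[OF \<eta>] topspace_PT[unfolded topspace_subtopology])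
  have "continuous_map PT euclidean (\<lambda>y. sqrt ((hnorm (F u) (pull \<eta> p))\<^sup>2 + (hnorm (F u) (pull \<eta> y))\<^sup>2 - 2 * Re (hip (F u) (pull \<eta> y) (pull \<eta> p))))"
    using c1 c2 by (auto simp: continuous_map_tendsto intro!: tendsto_intros)
  then have "continuous_map PT euclidean (\<lambda>y. hdist (F u) (pull \<eta> p) (pull \<eta> y))"
  proof (rule continuous_map_eq)
    fix y assume "y \<in> topspace PT"
    then have y: "y \<in> PD" by (simp only: topspace_PT)
    note m = pull_mem[OF \<eta> p] pull_mem[OF \<eta> y]
    show "sqrt ((hnorm (F u) (pull \<eta> p))\<^sup>2 + (hnorm (F u) (pull \<eta> y))\<^sup>2 - 2 * Re (hip (F u) (pull \<eta> y) (pull \<eta> p)))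
        = hdist (F u) (pull \<eta> p) (pull \<eta> y)"
      using S.hdist_sq[OF m] S.hip_cnj[OF m] S.hdist_nonneg[OF m] by (simp add: real_sqrt_unique)
  qed
  then show "((\<lambda>y. hdist (F u) (pull \<eta> p) (pull \<eta> y)) \<longlongrightarrow> 0) (atin PT p)"
    using p topspace_PT S.hdist_self[OF pull_mem[OF \<eta> p]] by (auto simp: continuous_map_tendsto)
qed

lemma orbit_hcont: "v \<in> S.C \<Longrightarrow> S.hcont KT (\<lambda>k. \<pi> (i k) v)"
proof -
  assume v: "v \<in> S.C"
  have uX: "u \<in> topspace (unit_top G)" using u by (simp add: topspace_unit_top)
  obtain \<zeta> where \<zeta>: "\<zeta> \<in> secs E" "\<zeta> u = v"
    by (rule bun.sec_through[OF uX v])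
  have "continuous_map KT PT (\<lambda>k. k)"
    using K_mem by (auto simp: PD_def continuous_map_in_subtopology intro!: continuous_map_from_subtopology[OF continuous_map_id[unfolded id_def]])
  from S.hcont_compose[OF pull_hcont[OF \<zeta>(1)] this] have h: "S.hcont KT (pull \<zeta>)" .
  have "\<And>k. k \<in> K \<Longrightarrow> pull \<zeta> k = \<pi> (i k) v" using K_mem(3) \<zeta>(2) by (simp add: pull_def)
  then show ?thesis using h by (intro S.hcont_cong[OF h]) (simp only: topspace_KT)
qed

text \<open>The mean of a continuous map into the fibre over \<open>u\<close>, defined weakly by pairing with
  vectors.\<close>

definition vmean :: "('g \<Rightarrow> 'v) \<Rightarrow> 'v" where
  "vmean s = (SOME z. z \<in> S.C \<and> (\<forall>w\<in>S.C. hip (F u) z w = I (\<lambda>k. hip (F u) (s k) w)))"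

lemma hip_fun_continuous: "S.hcont KT s \<Longrightarrow> w \<in> S.C \<Longrightarrow> continuous_map KT euclidean (\<lambda>k. hip (F u) (s k) w)"
  by (intro S.hcont_hip S.hcont_const)

lemma vmean:
  assumes s: "S.hcont KT s"
  shows "vmean s \<in> S.C" "\<And>w. w \<in> S.C \<Longrightarrow> hip (F u) (vmean s) w = I (\<lambda>k. hip (F u) (s k) w)"
proof -
  have sm: "s k \<in> S.C" if "k \<in> K" for k using S.hcont_mem[OF s] that by (simp only: topspace_KT)
  obtain B where B: "\<And>k. k \<in> topspace KT \<Longrightarrow> hnorm (F u) (s k) \<le> B"
    using compact_space_continuous_bounded[OF compact_KT S.hcont_hnorm[OF s]] by blast
  note c = hip_fun_continuous[OF s]
  have "\<exists>z\<in>S.C. \<forall>w\<in>S.C. hip (F u) z w = I (\<lambda>k. hip (F u) (s k) w)"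
  proof (rule S.Riesz_representation)
    fix x y assume x: "x \<in> S.C" and y: "y \<in> S.C"
    have "I (\<lambda>k. hip (F u) (s k) (x \<oplus>\<^bsub>F u\<^esub> y)) = I (\<lambda>k. hip (F u) (s k) x + hip (F u) (s k) y)"
      by (intro I_cong c S.add_mem continuous_map_add x y) (simp add: S.hip_add_right x y sm)
    then show "I (\<lambda>k. hip (F u) (s k) (x \<oplus>\<^bsub>F u\<^esub> y)) = I (\<lambda>k. hip (F u) (s k) x) + I (\<lambda>k. hip (F u) (s k) y)"
      by (simp add: I_add c x y)
  next
    fix a x assume x: "x \<in> S.C"
    have "I (\<lambda>k. hip (F u) (s k) (a \<odot>\<^bsub>F u\<^esub> x)) = I (\<lambda>k. cnj a * hip (F u) (s k) x)"
      by (intro I_cong c S.smult_mem continuous_map_complex_mult x) (auto simp: S.hip_smult_right x sm)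
    then show "I (\<lambda>k. hip (F u) (s k) (a \<odot>\<^bsub>F u\<^esub> x)) = cnj a * I (\<lambda>k. hip (F u) (s k) x)"
      by (simp add: I_mult c x)
  next
    fix x assume x: "x \<in> S.C"
    show "cmod (I (\<lambda>k. hip (F u) (s k) x)) \<le> B * hnorm (F u) x"
    proof (rule I_le[OF c[OF x]])
      fix k assume k: "k \<in> K"
      have "cmod (hip (F u) (s k) x) \<le> hnorm (F u) (s k) * hnorm (F u) x" by (rule S.Cauchy_Schwarz[OF sm[OF k] x])
      also have "\<dots> \<le> B * hnorm (F u) x"
        using B[of k] k K_mem(2) by (intro mult_right_mono S.hnorm_nonneg x) auto
      finally show "cmod (hip (F u) (s k) x) \<le> B * hnorm (F u) x" .
    qed
  qed
  then have "\<exists>z. z \<in> S.C \<and> (\<forall>w\<in>S.C. hip (F u) z w = I (\<lambda>k. hip (F u) (s k) w))"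
    unfolding Bex_def .
  then have "vmean s \<in> S.C \<and> (\<forall>w\<in>S.C. hip (F u) (vmean s) w = I (\<lambda>k. hip (F u) (s k) w))"
    unfolding vmean_def by (rule someI_ex)
  then show "vmean s \<in> S.C" "\<And>w. w \<in> S.C \<Longrightarrow> hip (F u) (vmean s) w = I (\<lambda>k. hip (F u) (s k) w)" by auto
qed

lemma hnorm_vmean_le:
  assumes s: "S.hcont KT s" and B: "\<And>k. k \<in> K \<Longrightarrow> hnorm (F u) (s k) \<le> B" and B0: "0 \<le> B"
  shows "hnorm (F u) (vmean s) \<le> B"
proof (rule S.hnorm_le_test[OF vmean(1)[OF s] B0])
  fix w assume w: "w \<in> S.C"
  have sm: "s k \<in> S.C" if "k \<in> K" for k using S.hcont_mem[OF s] that by (simp only: topspace_KT)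
  show "cmod (hip (F u) (vmean s) w) \<le> B * hnorm (F u) w"
    unfolding vmean(2)[OF s w]
  proof (rule I_le[OF hip_fun_continuous[OF s w]])
    fix k assume k: "k \<in> K"
    show "cmod (hip (F u) (s k) w) \<le> B * hnorm (F u) w"
      by (rule order_trans[OF S.Cauchy_Schwarz[OF sm[OF k] w] mult_right_mono[OF B[OF k] S.hnorm_nonneg[OF w]]])
  qed
qed

lemma hdist_vmean_le:
  assumes s: "S.hcont KT s" and t: "S.hcont KT t"
    and B: "\<And>k. k \<in> K \<Longrightarrow> hdist (F u) (s k) (t k) \<le> B" and B0: "0 \<le> B"
  shows "hdist (F u) (vmean s) (vmean t) \<le> B"
  unfolding hdist_def
proof (rule S.hnorm_le_test[OF S.diff_mem[OF vmean(1)[OF s] vmean(1)[OF t]] B0])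
  fix w assume w: "w \<in> S.C"
  have sm: "s k \<in> S.C" "t k \<in> S.C" if "k \<in> K" for k
    using S.hcont_mem[OF s, of k] S.hcont_mem[OF t, of k] that by (simp_all only: topspace_KT)
  have "hip (F u) (S.diff (vmean s) (vmean t)) w = I (\<lambda>k. hip (F u) (s k) w - hip (F u) (t k) w)"
    by (simp only: S.hip_diff[OF vmean(1)[OF s] vmean(1)[OF t] w] vmean(2)[OF s w] vmean(2)[OF t w]
      I_diff[OF hip_fun_continuous[OF s w] hip_fun_continuous[OF t w]])
  also have "cmod \<dots> \<le> B * hnorm (F u) w"
  proof (rule I_le)
    show "continuous_map KT euclidean (\<lambda>k. hip (F u) (s k) w - hip (F u) (t k) w)"
      by (intro continuous_map_diff hip_fun_continuous s t w)
    fix k assume k: "k \<in> K"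
    have "hip (F u) (s k) w - hip (F u) (t k) w = hip (F u) (S.diff (s k) (t k)) w"
      using sm[OF k] w by (simp only: S.hip_diff)
    also have "cmod \<dots> \<le> hdist (F u) (s k) (t k) * hnorm (F u) w"
      unfolding hdist_def by (intro S.Cauchy_Schwarz S.diff_mem sm k w)
    also have "\<dots> \<le> B * hnorm (F u) w" by (intro mult_right_mono B k S.hnorm_nonneg w)
    finally show "cmod (hip (F u) (s k) w - hip (F u) (t k) w) \<le> B * hnorm (F u) w" .
  qed
  finally show "cmod (hip (F u) (S.diff (vmean s) (vmean t)) w) \<le> B * hnorm (F u) w" .
qed

end

context intertwining_kernel
begin

lemma G0D: "x \<in> G0 \<Longrightarrow> x \<in> A" "x \<in> G0 \<Longrightarrow> r x = u" "x \<in> G0 \<Longrightarrow> d x = u"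
  by (auto simp: G0_def)

lemma topspace_GT: "topspace GT = G0"
  using G0D(1) by auto

lemma GK_mult: "y \<in> G0 \<Longrightarrow> k \<in> K \<Longrightarrow> y \<cdot> k \<in> G0" "y \<in> G0 \<Longrightarrow> k \<in> K \<Longrightarrow> k \<cdot> y \<in> G0"
  using K_mem by (simp_all add: G0_def gsimps)

lemma K_G0: "k \<in> K \<Longrightarrow> k \<in> G0"
  using K_mem by (simp add: G0_def)

lemma continuous_id_sub: "continuous_map (subtopology X T) X (\<lambda>x. x)"
  using continuous_map_id_subt[of X T] by (simp add: id_def)

definition bump :: "nat \<Rightarrow> 'g \<Rightarrow> real" where
  "bump n x = max 0 (1 / real (Suc n) - \<rho> x)"

lemma bump_nonneg: "0 \<le> bump n x" and bump_le: "bump n x \<le> 1"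
proof -
  have "1 / real (Suc n) \<le> 1" by simp
  then show "bump n x \<le> 1" using \<rho>_nonneg[of x] unfolding bump_def by linarith
qed (simp add: bump_def)

lemma bump_diff: "\<bar>bump n x - bump n y\<bar> \<le> \<bar>\<rho> x - \<rho> y\<bar>"
  unfolding bump_def by (auto simp: max_def abs_if)

lemma bump_continuous:
  "continuous_map Z (gtop G) f \<Longrightarrow> continuous_map Z euclidean (\<lambda>z. complex_of_real (bump n (f z)))"
proof -
  assume f: "continuous_map Z (gtop G) f"
  have "continuous_map Z euclidean (\<lambda>z. bump n (f z))"
    unfolding bump_def using continuous_map_compose[OF f \<rho>_continuous]
    by (intro continuous_intros) (auto simp: o_def)
  then show ?thesis by (simp add: continuous_map_Re_Im)
qed

text \<open>The weight \<open>bump n (y \<cdot> k)\<close> is concentrated where \<open>k\<close> is close to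
  the inverse of \<open>y\<close>, where \<open>\<pi>\<close> of the inverse of \<open>k\<close>
  is close to \<open>\<pi> y\<close> in case \<open>y\<close> lies in \<open>K\<close>. Thus
  \<open>Q n\<close> is a smeared multiple of \<open>\<pi>\<close> that makes sense on all of
  \<open>G0\<close>.\<close>

definition Q :: "nat \<Rightarrow> 'g \<Rightarrow> 'v \<Rightarrow> 'v" where
  "Q n y w = vmean (\<lambda>k. of_real (bump n (y \<cdot> k)) \<odot>\<^bsub>F u\<^esub> \<pi> (i k) w)"

lemma translate_continuous: "y \<in> G0 \<Longrightarrow> continuous_map KT (gtop G) (\<lambda>k. y \<cdot> k)"
  using K_mem G0D by (intro continuous_mult continuous_id_sub) auto

lemma Q_integrand_hcont:
  "y \<in> G0 \<Longrightarrow> w \<in> S.C \<Longrightarrow> S.hcont KT (\<lambda>k. of_real (bump n (y \<cdot> k)) \<odot>\<^bsub>F u\<^esub> \<pi> (i k) w)"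
  by (intro S.hcont_smult orbit_hcont bump_continuous translate_continuous)

lemma Q_mem: "y \<in> G0 \<Longrightarrow> w \<in> S.C \<Longrightarrow> Q n y w \<in> S.C"
  unfolding Q_def by (rule vmean(1)[OF Q_integrand_hcont])

lemma Q_coefficient_continuous:
  "y \<in> G0 \<Longrightarrow> w \<in> S.C \<Longrightarrow> z \<in> S.C \<Longrightarrow>
    continuous_map KT euclidean (\<lambda>k. of_real (bump n (y \<cdot> k)) * hip (F u) (\<pi> (i k) w) z)"
  by (intro continuous_map_complex_mult bump_continuous translate_continuous hip_fun_continuous orbit_hcont)

lemma hip_Q:
  assumes y: "y \<in> G0" and w: "w \<in> S.C" and z: "z \<in> S.C"
  shows "hip (F u) (Q n y w) z = I (\<lambda>k. of_real (bump n (y \<cdot> k)) * hip (F u) (\<pi> (i k) w) z)"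
  unfolding Q_def vmean(2)[OF Q_integrand_hcont[OF y w] z]
  by (intro I_cong hip_fun_continuous Q_integrand_hcont Q_coefficient_continuous y w z)
    (simp add: S.hip_smult \<pi>_K(1)[OF K_mem(5)] w z)

lemma Q_add:
  assumes y: "y \<in> G0" and v: "v \<in> S.C" and w: "w \<in> S.C"
  shows "Q n y (v \<oplus>\<^bsub>F u\<^esub> w) = Q n y v \<oplus>\<^bsub>F u\<^esub> Q n y w"
proof (rule S.vec_eqI)
  fix z assume z: "z \<in> S.C"
  note c = Q_coefficient_continuous[OF y _ z]
  have "hip (F u) (Q n y (v \<oplus>\<^bsub>F u\<^esub> w)) z = I (\<lambda>k. of_real (bump n (y \<cdot> k)) * hip (F u) (\<pi> (i k) v) z
      + of_real (bump n (y \<cdot> k)) * hip (F u) (\<pi> (i k) w) z)"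
    unfolding hip_Q[OF y S.add_mem[OF v w] z]
    by (intro I_cong c continuous_map_add v w S.add_mem)
      (simp add: \<pi>_K[OF K_mem(5)] v w z S.hip_add algebra_simps)
  also have "\<dots> = hip (F u) (Q n y v \<oplus>\<^bsub>F u\<^esub> Q n y w) z"
    using y v w z by (simp add: I_add c S.hip_add Q_mem hip_Q)
  finally show "hip (F u) (Q n y (v \<oplus>\<^bsub>F u\<^esub> w)) z = hip (F u) (Q n y v \<oplus>\<^bsub>F u\<^esub> Q n y w) z" .
qed (use assms in \<open>auto intro: Q_mem S.add_mem\<close>)

lemma Q_smult:
  assumes y: "y \<in> G0" and v: "v \<in> S.C"
  shows "Q n y (c \<odot>\<^bsub>F u\<^esub> v) = c \<odot>\<^bsub>F u\<^esub> Q n y v"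
proof (rule S.vec_eqI)
  fix z assume z: "z \<in> S.C"
  note cc = Q_coefficient_continuous[OF y _ z]
  have "hip (F u) (Q n y (c \<odot>\<^bsub>F u\<^esub> v)) z = I (\<lambda>k. c * (of_real (bump n (y \<cdot> k)) * hip (F u) (\<pi> (i k) v) z))"
    unfolding hip_Q[OF y S.smult_mem[OF v] z]
    by (intro I_cong cc continuous_map_complex_mult[of _ "\<lambda>_. c"] v S.smult_mem)
      (auto simp: \<pi>_K[OF K_mem(5)] v z S.hip_smult algebra_simps)
  also have "\<dots> = hip (F u) (c \<odot>\<^bsub>F u\<^esub> Q n y v) z"
    using y v z by (simp add: I_mult cc S.hip_smult Q_mem hip_Q)
  finally show "hip (F u) (Q n y (c \<odot>\<^bsub>F u\<^esub> v)) z = hip (F u) (c \<odot>\<^bsub>F u\<^esub> Q n y v) z" .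
qed (use assms in \<open>auto intro: Q_mem S.smult_mem\<close>)

text \<open>Left invariance of the mean, with the substitution \<open>l \<mapsto> k \<cdot> l\<close>.\<close>

lemma Q_right:
  assumes y: "y \<in> G0" and k: "k \<in> K" and w: "w \<in> S.C"
  shows "Q n (y \<cdot> k) w = Q n y (\<pi> k w)"
proof (rule S.vec_eqI)
  have kw: "\<pi> k w \<in> S.C" and yk: "y \<cdot> k \<in> G0" using \<pi>_K(1)[OF k w] GK_mult(1)[OF y k] by auto
  then show "Q n (y \<cdot> k) w \<in> S.C" "Q n y (\<pi> k w) \<in> S.C" using y w by (auto intro: Q_mem)
  fix z assume z: "z \<in> S.C"
  let ?f = "\<lambda>l. of_real (bump n (y \<cdot> l)) * hip (F u) (\<pi> (i l) (\<pi> k w)) z"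
  have f: "continuous_map KT euclidean ?f" by (rule Q_coefficient_continuous[OF y kw z])
  have "hip (F u) (Q n y (\<pi> k w)) z = I (\<lambda>l. ?f (k \<cdot> l))"
    unfolding hip_Q[OF y kw z] by (rule I_translate[OF f k, symmetric])
  also have "\<dots> = I (\<lambda>l. of_real (bump n (y \<cdot> k \<cdot> l)) * hip (F u) (\<pi> (i l) w) z)"
  proof (rule I_cong)
    show "continuous_map KT euclidean (\<lambda>l. ?f (k \<cdot> l))"
      using continuous_map_compose[OF translate_K_continuous[OF k] f] by (simp add: o_def)
    show "continuous_map KT euclidean (\<lambda>l. of_real (bump n (y \<cdot> k \<cdot> l)) * hip (F u) (\<pi> (i l) w) z)"
      by (rule Q_coefficient_continuous[OF yk w z])
    fix l assume l: "l \<in> K"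
    have "i (k \<cdot> l) \<cdot> k = i l" using K_mem[OF k] K_mem[OF l] by (simp add: inv_mult gsimps mult_unit)
    then have "\<pi> (i (k \<cdot> l)) (\<pi> k w) = \<pi> (i l) w"
      using \<pi>_K(6)[OF K_mem(5)[OF K_mult[OF k l]] w k] by simp
    moreover have "y \<cdot> (k \<cdot> l) = y \<cdot> k \<cdot> l" using G0D[OF y] K_mem[OF k] K_mem[OF l] by (simp add: gsimps)
    ultimately show "?f (k \<cdot> l) = of_real (bump n (y \<cdot> k \<cdot> l)) * hip (F u) (\<pi> (i l) w) z" by simp
  qed
  also have "\<dots> = hip (F u) (Q n (y \<cdot> k) w) z" by (rule hip_Q[OF yk w z, symmetric])
  finally show "hip (F u) (Q n (y \<cdot> k) w) z = hip (F u) (Q n y (\<pi> k w)) z" by simp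
qed

lemma hnorm_Q_le: "y \<in> G0 \<Longrightarrow> w \<in> S.C \<Longrightarrow> hnorm (F u) (Q n y w) \<le> hnorm (F u) w"
  unfolding Q_def
proof (rule hnorm_vmean_le[OF Q_integrand_hcont])
  assume w: "w \<in> S.C"
  fix k assume k: "k \<in> K"
  show "hnorm (F u) (of_real (bump n (y \<cdot> k)) \<odot>\<^bsub>F u\<^esub> \<pi> (i k) w) \<le> hnorm (F u) w"
    using bump_nonneg bump_le \<pi>_K(1,5)[OF K_mem(5)[OF k] w] S.hnorm_nonneg[OF w]
    by (simp add: S.hnorm_smult mult_left_le_one_le)
qed (auto intro: S.hnorm_nonneg)

text \<open>The bound does not depend on \<open>n\<close>, because all bump functions have the same modulus of
  continuity in terms of \<open>\<rho>\<close>. This is what makes the sum over \<open>n\<close>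
  continuous.\<close>

lemma hdist_Q_le:
  assumes y: "y \<in> G0" and y': "y' \<in> G0" and w: "w \<in> S.C"
    and e: "\<And>k. k \<in> K \<Longrightarrow> \<bar>\<rho> (y \<cdot> k) - \<rho> (y' \<cdot> k)\<bar> \<le> e"
  shows "hdist (F u) (Q n y w) (Q n y' w) \<le> hnorm (F u) w * e"
  unfolding Q_def
proof (rule hdist_vmean_le[OF Q_integrand_hcont[OF y w] Q_integrand_hcont[OF y' w]])
  have "0 \<le> e" using e[OF u_K] by linarith
  then show "0 \<le> hnorm (F u) w * e" using w by (simp add: S.hnorm_nonneg)
  fix k assume k: "k \<in> K"
  note m = \<pi>_K(1,5)[OF K_mem(5)[OF k] w]
  have "\<bar>bump n (y \<cdot> k) - bump n (y' \<cdot> k)\<bar> \<le> e" using bump_diff e[OF k] order_trans by blast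
  then have "cmod (complex_of_real (bump n (y \<cdot> k)) - complex_of_real (bump n (y' \<cdot> k))) \<le> e"
    by (metis norm_of_real of_real_diff real_norm_def)
  then show "hdist (F u) (of_real (bump n (y \<cdot> k)) \<odot>\<^bsub>F u\<^esub> \<pi> (i k) w) (of_real (bump n (y' \<cdot> k)) \<odot>\<^bsub>F u\<^esub> \<pi> (i k) w)
      \<le> hnorm (F u) w * e"
    unfolding S.hdist_smult_left[OF m(1)] m(2) using mult_right_mono[OF _ S.hnorm_nonneg[OF w]]
    by (simp only: mult.commute[of "hnorm (F u) w"])
qed

lemma Q_hcont:
  assumes w: "w \<in> S.C" shows "S.hcont GT (\<lambda>y. Q n y w)"
proof (rule S.hcontI_uniform[where c = "hnorm (F u) w"])
  show "Q n y w \<in> S.C" if "y \<in> topspace GT" for y using that w by (simp add: Q_mem)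
  fix y and e :: real assume y: "y \<in> topspace GT" and e: "0 < e"
  have "continuous_map (prod_topology GT KT) (gtop G) (\<lambda>p. fst p \<cdot> snd p)"
  proof (rule continuous_mult)
    show "continuous_map (prod_topology GT KT) (gtop G) fst"
      using continuous_map_fst continuous_map_into_fulltopology by blast
    show "continuous_map (prod_topology GT KT) (gtop G) snd"
      using continuous_map_snd continuous_map_into_fulltopology by blast
  qed (use K_mem G0D in auto)
  from continuous_map_compose[OF this \<rho>_continuous]
  have "continuous_map (prod_topology GT KT) euclidean (\<lambda>p. \<rho> (fst p \<cdot> snd p))" by (simp add: o_def)
  then obtain U where U: "openin GT U" "y \<in> U"
    "\<And>x k. x \<in> U \<Longrightarrow> k \<in> topspace KT \<Longrightarrow> \<bar>\<rho> (fst (y, k) \<cdot> snd (y, k)) - \<rho> (fst (x, k) \<cdot> snd (x, k))\<bar> < e"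
    by (rule compact_parameter_uniform[OF _ compact_KT y e]) blast
  have "hdist (F u) (Q n y w) (Q n x w) \<le> hnorm (F u) w * e" if x: "x \<in> U" for x
  proof (rule hdist_Q_le)
    show "y \<in> G0" "x \<in> G0" using y openin_subset[OF U(1)] x unfolding topspace_GT by auto
    show "\<bar>\<rho> (y \<cdot> k) - \<rho> (x \<cdot> k)\<bar> \<le> e" if k: "k \<in> K" for k
      using U(3)[OF x, of k] k unfolding topspace_KT by simp
  qed (rule w)
  then show "\<exists>U. openin GT U \<and> y \<in> U \<and> (\<forall>x\<in>U. hdist (F u) (Q n y w) (Q n x w) \<le> hnorm (F u) w * e)"
    using U(1,2) by blast
qed

text \<open>For large \<open>n\<close> the operator \<open>Q n u\<close> only averages over \<open>k\<close>
  so close to \<open>u\<close> that \<open>\<langle>\<pi>(k\<^sup>-\<^sup>1) v, v\<rangle>\<close>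
  stays near \<open>\<parallel>v\<parallel>\<^sup>2\<close>. The index \<open>n\<close> depends on
  \<open>v\<close>, which is why the kernel has to combine all of them.\<close>

lemma Q_separates:
  assumes v: "v \<in> S.C" and nz: "v \<noteq> \<zero>\<^bsub>F u\<^esub>"
  obtains n where "Q n u v \<noteq> \<zero>\<^bsub>F u\<^esub>"
proof -
  define c where "c = (hnorm (F u) v)\<^sup>2 / 2"
  have "hnorm (F u) v \<noteq> 0" using S.hnorm_eq_0[OF v] nz by blast
  then have c: "0 < c" by (simp add: c_def)
  have coef: "continuous_map KT euclidean (\<lambda>k. hip (F u) (\<pi> (i k) v) v)"
    by (intro hip_fun_continuous orbit_hcont v)
  have closed: "closedin KT {k \<in> topspace KT. Re (hip (F u) (\<pi> (i k) v) v) \<in> {..c}}"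
    using coef by (intro closedin_continuous_map_preimage) (auto simp: continuous_map_Re_Im)
  have \<rho>K: "continuous_map KT euclidean \<rho>" by (rule continuous_map_from_subtopology[OF \<rho>_continuous])
  obtain e where e: "0 < e" "\<And>k. k \<in> {k \<in> topspace KT. Re (hip (F u) (\<pi> (i k) v) v) \<in> {..c}} \<Longrightarrow> e \<le> \<rho> k"
  proof (rule compact_space_continuous_positive[OF compact_KT \<rho>K closed])
    fix k assume "k \<in> {k \<in> topspace KT. Re (hip (F u) (\<pi> (i k) v) v) \<in> {..c}}"
    then have k: "k \<in> A" "Re (hip (F u) (\<pi> (i k) v) v) \<le> c" by auto
    have "k \<noteq> u"
    proof
      assume "k = u"
      then have "(hnorm (F u) v)\<^sup>2 \<le> c" using k(2) v by (simp add: inv_unit[OF u] \<pi>_u S.hnorm_sq)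
      then show False using c by (simp add: c_def)
    qed
    then show "0 < \<rho> k" using \<rho>_zero[OF k(1)] \<rho>_nonneg[of k] by simp
  qed blast
  obtain n where n: "1 / real (Suc n) < e" using e(1) nat_approx_posE by metis
  have big: "c * bump n k \<le> bump n k * Re (hip (F u) (\<pi> (i k) v) v)" if k: "k \<in> K" for k
  proof (cases "bump n k = 0")
    case False
    then have "\<rho> k < e" using n by (auto simp: bump_def max_def split: if_splits)
    then have "c < Re (hip (F u) (\<pi> (i k) v) v)" using e(2)[of k] k K_mem(2)[OF k] by force
    then show ?thesis using mult_left_mono[of c _ "bump n k"] bump_nonneg[of n k] by (simp only: mult.commute[of c])
  qed simp
  have uG: "u \<in> G0" by (rule K_G0[OF u_K])
  have b: "continuous_map KT euclidean (\<lambda>k. complex_of_real (bump n k))"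
    by (rule bump_continuous[OF continuous_id_sub])
  have "0 < Re (I (\<lambda>k. complex_of_real (bump n k)))"
  proof (rule I_Re_pos[OF b _ u_K])
    show "0 < Re (complex_of_real (bump n u))"
      using \<rho>_zero[of u] unit_arrow[OF u] by (simp add: bump_def)
  qed (simp add: bump_nonneg)
  then have "0 < c * Re (I (\<lambda>k. complex_of_real (bump n k)))" using c by simp
  also have "\<dots> = Re (I (\<lambda>k. of_real c * of_real (bump n k)))" by (simp add: I_mult b)
  also have "\<dots> \<le> Re (hip (F u) (Q n u v) v)"
  proof -
    let ?f = "\<lambda>k. of_real (bump n (u \<cdot> k)) * hip (F u) (\<pi> (i k) v) v"
    have f: "continuous_map KT euclidean ?f" by (rule Q_coefficient_continuous[OF uG v v])
    have cb: "continuous_map KT euclidean (\<lambda>k. of_real c * complex_of_real (bump n k))"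
      using b by (intro continuous_map_complex_mult) auto
    have "0 \<le> Re (I (\<lambda>k. ?f k - of_real c * of_real (bump n k)))"
    proof (rule I_Re_nonneg)
      fix k assume k: "k \<in> K"
      then show "0 \<le> Re (?f k - of_real c * of_real (bump n k))"
        using big[OF k] K_mem[OF k] by (simp add: unit_mult)
    qed (intro continuous_map_diff f cb)
    then show ?thesis by (simp add: I_diff[OF f cb] hip_Q[OF uG v v])
  qed
  finally have "Q n u v \<noteq> \<zero>\<^bsub>F u\<^esub>" using S.hip_zero[OF v] by auto
  then show ?thesis using that by blast
qed

text \<open>The kernel is \<open>\<Sum>n 2\<^sup>-\<^sup>n\<^sup>-\<^sup>1 \<integral> R n (j\<^sup>-\<^sup>1
  x) (R n j\<^sup>-\<^sup>1)\<^sup>* dj\<close>, where \<open>R n y\<close> is the adjoint of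
  \<open>Q n y\<close> and the integral is the mean over \<open>K\<close>. The factor \<open>R n
  (j\<^sup>-\<^sup>1 x)\<close> transforms under right translation of \<open>x\<close>; averaging
  over \<open>j\<close> yields the transformation under left translation. At the unit this is an
  average of positive operators.\<close>

definition kterm :: "'g \<Rightarrow> 'v \<Rightarrow> 'v \<Rightarrow> nat \<Rightarrow> 'g \<Rightarrow> complex" where
  "kterm x v w n j = hip (F u) (Q n (i j) v) (Q n (i j \<cdot> x) w)"

definition kform :: "'g \<Rightarrow> 'v \<Rightarrow> 'v \<Rightarrow> complex" where
  "kform x v w = (\<Sum>n. of_real ((1/2) ^ Suc n) * I (kterm x v w n))"

definition Ker :: "'g \<Rightarrow> 'v \<Rightarrow> 'v" where
  "Ker x v = (SOME z. z \<in> S.C \<and> (\<forall>w\<in>S.C. hip (F u) z w = kform x v w))"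

lemma inv_K_continuous: "continuous_map KT GT i"
  using K_mem(5) K_G0 continuous_map_from_subtopology[OF continuous_inv]
  by (auto simp: continuous_map_in_subtopology)

lemma inv_translate_continuous: "x \<in> G0 \<Longrightarrow> continuous_map KT GT (\<lambda>j. i j \<cdot> x)"
proof -
  assume x: "x \<in> G0"
  have "continuous_map KT (gtop G) (\<lambda>j. i j \<cdot> x)"
    using G0D[OF x] K_mem by (intro continuous_mult continuous_map_from_subtopology[OF continuous_inv])
      (auto simp: gsimps)
  then show ?thesis using GK_mult(2)[OF x K_mem(5)] by (auto simp: continuous_map_in_subtopology)
qed

lemma kterm_continuous:
  assumes "x \<in> G0" "v \<in> S.C" "w \<in> S.C" shows "continuous_map KT euclidean (kterm x v w n)"
  unfolding kterm_def
  by (intro S.hcont_hip S.hcont_compose[OF Q_hcont inv_K_continuous]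
      S.hcont_compose[OF Q_hcont inv_translate_continuous] assms)

lemma kterm_le:
  assumes x: "x \<in> G0" and v: "v \<in> S.C" and w: "w \<in> S.C" and j: "j \<in> K"
  shows "cmod (kterm x v w n j) \<le> hnorm (F u) v * hnorm (F u) w"
proof -
  have 1: "i j \<in> G0" "i j \<cdot> x \<in> G0" using K_G0 K_mem(5)[OF j] GK_mult(2)[OF x] by blast+
  have "cmod (kterm x v w n j) \<le> hnorm (F u) (Q n (i j) v) * hnorm (F u) (Q n (i j \<cdot> x) w)"
    unfolding kterm_def by (intro S.Cauchy_Schwarz Q_mem 1 v w)
  also have "\<dots> \<le> hnorm (F u) v * hnorm (F u) w"
    by (intro mult_mono hnorm_Q_le S.hnorm_nonneg Q_mem 1 v w)
  finally show ?thesis .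
qed

lemma half_sums: "(\<lambda>n. (1/2 :: real) ^ Suc n) sums 1"
  using power_half_series by simp

lemma summable_bounded_half:
  fixes f :: "nat \<Rightarrow> complex"
  assumes f: "\<And>n. cmod (f n) \<le> B"
  shows "summable (\<lambda>n. of_real ((1/2) ^ Suc n) * f n)" "cmod (\<Sum>n. of_real ((1/2) ^ Suc n) * f n) \<le> B"
proof -
  have le: "cmod (of_real ((1/2) ^ Suc n) * f n) \<le> B * (1/2) ^ Suc n" for n
    using mult_left_mono[OF f, of "(1/2) ^ Suc n" n] by (simp add: norm_mult norm_power mult.commute)
  have sums: "(\<lambda>n. B * (1/2 :: real) ^ Suc n) sums (B * 1)" by (rule sums_mult[OF half_sums])
  show "summable (\<lambda>n. of_real ((1/2) ^ Suc n) * f n)"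
    by (rule summable_comparison_test[OF _ sums_summable[OF sums]]) (use le in auto)
  have "cmod (\<Sum>n. of_real ((1/2) ^ Suc n) * f n) \<le> (\<Sum>n. B * (1/2) ^ Suc n)"
    by (rule norm_suminf_le[OF le sums_summable[OF sums]])
  then show "cmod (\<Sum>n. of_real ((1/2) ^ Suc n) * f n) \<le> B" using sums_unique[OF sums] by simp
qed

lemma I_kterm_le:
  "x \<in> G0 \<Longrightarrow> v \<in> S.C \<Longrightarrow> w \<in> S.C \<Longrightarrow> cmod (I (kterm x v w n)) \<le> hnorm (F u) v * hnorm (F u) w"
  by (intro I_le kterm_continuous kterm_le)

lemmas kform_summable = summable_bounded_half(1)[OF I_kterm_le]

lemma kform_le:
  "x \<in> G0 \<Longrightarrow> v \<in> S.C \<Longrightarrow> w \<in> S.C \<Longrightarrow> cmod (kform x v w) \<le> hnorm (F u) v * hnorm (F u) w"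
  unfolding kform_def by (intro summable_bounded_half I_kterm_le)

lemma kform_cong:
  assumes "x \<in> G0" "v \<in> S.C" "w \<in> S.C" "x' \<in> G0" "v' \<in> S.C" "w' \<in> S.C"
    and "\<And>n j. j \<in> K \<Longrightarrow> kterm x v w n j = kterm x' v' w' n j"
  shows "kform x v w = kform x' v' w'"
  unfolding kform_def
  by (intro suminf_cong arg_cong2[where f = "(*)"] refl I_cong kterm_continuous assms)

lemma Q_inv_mem: "j \<in> K \<Longrightarrow> v \<in> S.C \<Longrightarrow> Q n (i j) v \<in> S.C"
  by (rule Q_mem[OF K_G0[OF K_mem(5)]])

lemma Q_inv_mult_mem: "j \<in> K \<Longrightarrow> x \<in> G0 \<Longrightarrow> v \<in> S.C \<Longrightarrow> Q n (i j \<cdot> x) v \<in> S.C"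
  by (rule Q_mem[OF GK_mult(2)[OF _ K_mem(5)]])

lemma kform_add_right:
  assumes x: "x \<in> G0" and v: "v \<in> S.C" and w: "w \<in> S.C" and z: "z \<in> S.C"
  shows "kform x v (w \<oplus>\<^bsub>F u\<^esub> z) = kform x v w + kform x v z"
proof -
  have "I (kterm x v (w \<oplus>\<^bsub>F u\<^esub> z) n) = I (\<lambda>j. kterm x v w n j + kterm x v z n j)" for n
    by (intro I_cong kterm_continuous continuous_map_add x v w z S.add_mem)
      (simp add: kterm_def Q_add GK_mult(2)[OF x K_mem(5)] v w z S.hip_add_right Q_inv_mem Q_inv_mult_mem x)
  then have eq: "I (kterm x v (w \<oplus>\<^bsub>F u\<^esub> z) n) = I (kterm x v w n) + I (kterm x v z n)" for n
    by (simp add: I_add kterm_continuous x v w z)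
  show ?thesis
    unfolding kform_def eq distrib_left
    by (rule suminf_add[symmetric, OF kform_summable[OF x v w] kform_summable[OF x v z]])
qed

lemma kform_smult_right:
  assumes x: "x \<in> G0" and v: "v \<in> S.C" and w: "w \<in> S.C"
  shows "kform x v (c \<odot>\<^bsub>F u\<^esub> w) = cnj c * kform x v w"
proof -
  have "I (kterm x v (c \<odot>\<^bsub>F u\<^esub> w) n) = I (\<lambda>j. cnj c * kterm x v w n j)" for n
    by (intro I_cong kterm_continuous continuous_map_complex_mult[of _ "\<lambda>_. cnj c"] x v w S.smult_mem)
      (auto simp: kterm_def Q_smult GK_mult(2)[OF x K_mem(5)] v w S.hip_smult_right Q_inv_mem Q_inv_mult_mem x)
  then have "I (kterm x v (c \<odot>\<^bsub>F u\<^esub> w) n) = cnj c * I (kterm x v w n)" for n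
    by (simp add: I_mult kterm_continuous x v w)
  then show ?thesis
    unfolding kform_def using suminf_mult[OF kform_summable[OF x v w], of "cnj c"] by (simp add: mult.left_commute)
qed

lemma Ker:
  assumes x: "x \<in> G0" and v: "v \<in> S.C"
  shows "Ker x v \<in> S.C" "\<And>w. w \<in> S.C \<Longrightarrow> hip (F u) (Ker x v) w = kform x v w"
proof -
  have "\<exists>z\<in>S.C. \<forall>w\<in>S.C. hip (F u) z w = kform x v w"
    by (intro S.Riesz_representation[where B = "hnorm (F u) v"] kform_add_right kform_smult_right kform_le x v)
  then have "\<exists>z. z \<in> S.C \<and> (\<forall>w\<in>S.C. hip (F u) z w = kform x v w)" unfolding Bex_def .
  then have "Ker x v \<in> S.C \<and> (\<forall>w\<in>S.C. hip (F u) (Ker x v) w = kform x v w)"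
    unfolding Ker_def by (rule someI_ex)
  then show "Ker x v \<in> S.C" "\<And>w. w \<in> S.C \<Longrightarrow> hip (F u) (Ker x v) w = kform x v w" by auto
qed

lemma hnorm_Ker_le: "x \<in> G0 \<Longrightarrow> v \<in> S.C \<Longrightarrow> hnorm (F u) (Ker x v) \<le> hnorm (F u) v"
  by (rule S.hnorm_le_test) (auto simp: Ker S.hnorm_nonneg intro: kform_le)

lemma Ker_add:
  assumes x: "x \<in> G0" and v: "v \<in> S.C" and w: "w \<in> S.C"
  shows "Ker x (v \<oplus>\<^bsub>F u\<^esub> w) = Ker x v \<oplus>\<^bsub>F u\<^esub> Ker x w"
proof (rule S.vec_eqI)
  fix z assume z: "z \<in> S.C"
  have "I (kterm x (v \<oplus>\<^bsub>F u\<^esub> w) z n) = I (\<lambda>j. kterm x v z n j + kterm x w z n j)" for n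
    by (intro I_cong kterm_continuous continuous_map_add x v w z S.add_mem)
      (simp add: kterm_def Q_add K_G0[OF K_mem(5)] v w z S.hip_add Q_inv_mem Q_inv_mult_mem x)
  then have eq: "I (kterm x (v \<oplus>\<^bsub>F u\<^esub> w) z n) = I (kterm x v z n) + I (kterm x w z n)" for n
    by (simp add: I_add kterm_continuous x v w z)
  have "kform x (v \<oplus>\<^bsub>F u\<^esub> w) z = kform x v z + kform x w z"
    unfolding kform_def eq distrib_left
    by (rule suminf_add[symmetric, OF kform_summable[OF x v z] kform_summable[OF x w z]])
  then show "hip (F u) (Ker x (v \<oplus>\<^bsub>F u\<^esub> w)) z = hip (F u) (Ker x v \<oplus>\<^bsub>F u\<^esub> Ker x w) z"
    by (simp add: Ker x v w z S.add_mem S.hip_add)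
qed (auto intro: Ker x v w S.add_mem)

lemma Ker_smult:
  assumes x: "x \<in> G0" and v: "v \<in> S.C"
  shows "Ker x (c \<odot>\<^bsub>F u\<^esub> v) = c \<odot>\<^bsub>F u\<^esub> Ker x v"
proof (rule S.vec_eqI)
  fix z assume z: "z \<in> S.C"
  have "I (kterm x (c \<odot>\<^bsub>F u\<^esub> v) z n) = I (\<lambda>j. c * kterm x v z n j)" for n
    by (intro I_cong kterm_continuous continuous_map_complex_mult[of _ "\<lambda>_. c"] x v z S.smult_mem)
      (auto simp: kterm_def Q_smult K_G0[OF K_mem(5)] v z S.hip_smult Q_inv_mem Q_inv_mult_mem x)
  then have "I (kterm x (c \<odot>\<^bsub>F u\<^esub> v) z n) = c * I (kterm x v z n)" for n
    by (simp add: I_mult kterm_continuous x v z)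
  then have "kform x (c \<odot>\<^bsub>F u\<^esub> v) z = c * kform x v z"
    unfolding kform_def using suminf_mult[OF kform_summable[OF x v z], of c] by (simp add: mult.left_commute)
  then show "hip (F u) (Ker x (c \<odot>\<^bsub>F u\<^esub> v)) z = hip (F u) (c \<odot>\<^bsub>F u\<^esub> Ker x v) z"
    by (simp add: Ker x v z S.smult_mem S.hip_smult)
qed (auto intro: Ker x v S.smult_mem)

lemma Ker_right:
  assumes x: "x \<in> G0" and k: "k \<in> K" and v: "v \<in> S.C"
  shows "Ker (x \<cdot> k) v = \<pi> (i k) (Ker x v)"
proof (rule S.vec_eqI)
  have xk: "x \<cdot> k \<in> G0" by (rule GK_mult(1)[OF x k])
  show "Ker (x \<cdot> k) v \<in> S.C" by (rule Ker(1)[OF xk v])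
  show "\<pi> (i k) (Ker x v) \<in> S.C" by (rule \<pi>_K(1)[OF K_mem(5)[OF k] Ker(1)[OF x v]])
  fix w assume w: "w \<in> S.C"
  have kw: "\<pi> k w \<in> S.C" by (rule \<pi>_K(1)[OF k w])
  have "kform (x \<cdot> k) v w = kform x v (\<pi> k w)"
  proof (rule kform_cong[OF xk v w x v kw])
    fix n j assume j: "j \<in> K"
    have "i j \<cdot> (x \<cdot> k) = i j \<cdot> x \<cdot> k" using G0D[OF x] K_mem[OF k] K_mem[OF j] by (simp add: gsimps)
    then show "kterm (x \<cdot> k) v w n j = kterm x v (\<pi> k w) n j"
      by (simp add: kterm_def Q_right[OF GK_mult(2)[OF x K_mem(5)[OF j]] k w])
  qed
  then show "hip (F u) (Ker (x \<cdot> k) v) w = hip (F u) (\<pi> (i k) (Ker x v)) w"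
    unfolding \<pi>_K_adjoint[OF k Ker(1)[OF x v] w] by (simp add: Ker(2)[OF xk v w] Ker(2)[OF x v kw])
qed

text \<open>Left invariance of the outer mean, with the substitution \<open>j \<mapsto> k \<cdot> j\<close>.\<close>

lemma Ker_left:
  assumes x: "x \<in> G0" and k: "k \<in> K" and v: "v \<in> S.C"
  shows "Ker (k \<cdot> x) v = Ker x (\<pi> (i k) v)"
proof (rule S.vec_eqI)
  have kx: "k \<cdot> x \<in> G0" by (rule GK_mult(2)[OF x k])
  have kv: "\<pi> (i k) v \<in> S.C" by (rule \<pi>_K(1)[OF K_mem(5)[OF k] v])
  show "Ker (k \<cdot> x) v \<in> S.C" by (rule Ker(1)[OF kx v])
  show "Ker x (\<pi> (i k) v) \<in> S.C" by (rule Ker(1)[OF x kv])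
  fix w assume w: "w \<in> S.C"
  have "I (kterm (k \<cdot> x) v w n) = I (kterm x (\<pi> (i k) v) w n)" for n
  proof -
    note f = kterm_continuous[OF kx v w, of n]
    have "I (kterm (k \<cdot> x) v w n) = I (\<lambda>j. kterm (k \<cdot> x) v w n (k \<cdot> j))"
      by (rule I_translate[OF f k, symmetric])
    also have "\<dots> = I (kterm x (\<pi> (i k) v) w n)"
    proof (rule I_cong)
      show "continuous_map KT euclidean (\<lambda>j. kterm (k \<cdot> x) v w n (k \<cdot> j))"
        using continuous_map_compose[OF translate_K_continuous[OF k] f] by (simp add: o_def)
      show "continuous_map KT euclidean (kterm x (\<pi> (i k) v) w n)" by (rule kterm_continuous[OF x kv w])
      fix j assume j: "j \<in> K"
      have 1: "i (k \<cdot> j) = i j \<cdot> i k" using K_mem[OF k] K_mem[OF j] by (simp add: inv_mult)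
      have 2: "i (k \<cdot> j) \<cdot> (k \<cdot> x) = i j \<cdot> x"
        unfolding 1 using G0D[OF x] K_mem[OF k] K_mem[OF j] by (simp add: gsimps inv_mult_cancel)
      show "kterm (k \<cdot> x) v w n (k \<cdot> j) = kterm x (\<pi> (i k) v) w n j"
        unfolding kterm_def 2 unfolding 1 by (simp add: Q_right[OF K_G0[OF K_mem(5)[OF j]] K_mem(5)[OF k] v])
    qed
    finally show ?thesis .
  qed
  then have "kform (k \<cdot> x) v w = kform x (\<pi> (i k) v) w" by (simp add: kform_def)
  then show "hip (F u) (Ker (k \<cdot> x) v) w = hip (F u) (Ker x (\<pi> (i k) v)) w"
    by (simp add: Ker(2)[OF kx v w] Ker(2)[OF x kv w])
qed

text \<open>At the unit all terms are means of \<open>\<parallel>Q n j\<^sup>-\<^sup>1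
  v\<parallel>\<^sup>2\<close>. For some \<open>n\<close> the integrand is positive at \<open>j =
  u\<close>, and the mean is faithful.\<close>

lemma Ker_unit_nonzero:
  assumes v: "v \<in> S.C" and nz: "v \<noteq> \<zero>\<^bsub>F u\<^esub>"
  shows "Ker u v \<noteq> \<zero>\<^bsub>F u\<^esub>"
proof -
  have uG: "u \<in> G0" by (rule K_G0[OF u_K])
  have kt: "kterm u v v n j = of_real ((hnorm (F u) (Q n (i j) v))\<^sup>2)" if j: "j \<in> K" for n j
  proof -
    have "i j \<cdot> u = i j" using K_mem[OF K_mem(5)[OF j]] by (intro mult_unit)
    then show ?thesis unfolding kterm_def using S.hip_self_hnorm[OF Q_inv_mem[OF j v]] by simp
  qed
  define a where "a n = (1/2) ^ Suc n * Re (I (kterm u v v n))" for n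
  have a0: "0 \<le> a n" for n
    unfolding a_def by (intro mult_nonneg_nonneg I_Re_nonneg kterm_continuous uG v) (simp_all add: kt)
  obtain m where m: "Q m u v \<noteq> \<zero>\<^bsub>F u\<^esub>" by (rule Q_separates[OF v nz])
  have "0 < Re (I (kterm u v v m))"
  proof (rule I_Re_pos[OF kterm_continuous[OF uG v v] _ u_K])
    have "hnorm (F u) (Q m u v) \<noteq> 0" using m S.hnorm_eq_0[OF Q_mem[OF uG v]] by blast
    then show "0 < Re (kterm u v v m u)" by (simp add: kt[OF u_K] inv_unit[OF u])
  qed (simp add: kt)
  then have am: "0 < a m" by (simp add: a_def)
  have s: "summable (\<lambda>n. of_real ((1/2) ^ Suc n) * I (kterm u v v n))" by (rule kform_summable[OF uG v v])
  have eq: "a = (\<lambda>n. Re (of_real ((1/2) ^ Suc n) * I (kterm u v v n)))" 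
  proof -
    have "Re (of_real t * z) = t * Re z" for t z by simp
    then show ?thesis unfolding a_def by (simp only:)
  qed
  have sa: "summable a" unfolding eq by (rule summable_Re[OF s])
  have "Re (kform u v v) = suminf a" unfolding kform_def eq by (rule Re_suminf[OF s])
  also have "\<dots> > 0" by (rule suminf_pos2[OF sa a0 am])
  finally have "hip (F u) (Ker u v) v \<noteq> 0" by (auto simp: Ker(2)[OF uG v v])
  then show ?thesis using S.hip_zero[OF v] by auto
qed

lemma hdist_Ker_le:
  assumes x: "x \<in> G0" and y: "y \<in> G0" and v: "v \<in> S.C"
    and e: "\<And>j k. j \<in> K \<Longrightarrow> k \<in> K \<Longrightarrow> \<bar>\<rho> (i j \<cdot> x \<cdot> k) - \<rho> (i j \<cdot> y \<cdot> k)\<bar> \<le> e"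
  shows "hdist (F u) (Ker x v) (Ker y v) \<le> hnorm (F u) v * e"
  unfolding hdist_def
proof (rule S.hnorm_le_test[OF S.diff_mem[OF Ker(1)[OF x v] Ker(1)[OF y v]]])
  have e0: "0 \<le> e" using e[OF u_K u_K] by linarith
  then show "0 \<le> hnorm (F u) v * e" using v by (simp add: S.hnorm_nonneg)
  fix w assume w: "w \<in> S.C"
  note c = kterm_continuous[OF x v w] kterm_continuous[OF y v w]
  have le: "cmod (I (\<lambda>j. kterm x v w n j - kterm y v w n j)) \<le> hnorm (F u) v * e * hnorm (F u) w" for n
  proof (rule I_le[OF continuous_map_diff[OF c]])
    fix j assume j: "j \<in> K"
    have g: "i j \<cdot> x \<in> G0" "i j \<cdot> y \<in> G0" using GK_mult(2)[OF x K_mem(5)[OF j]] GK_mult(2)[OF y K_mem(5)[OF j]] by auto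
    note m = Q_inv_mem[OF j v, of n] Q_mem[OF g(1) w, of n] Q_mem[OF g(2) w, of n]
    have "kterm x v w n j - kterm y v w n j = hip (F u) (Q n (i j) v) (S.diff (Q n (i j \<cdot> x) w) (Q n (i j \<cdot> y) w))"
      unfolding kterm_def using m by (simp only: S.hip_diff_right)
    also have "cmod \<dots> \<le> hnorm (F u) (Q n (i j) v) * hdist (F u) (Q n (i j \<cdot> x) w) (Q n (i j \<cdot> y) w)"
      unfolding hdist_def by (intro S.Cauchy_Schwarz S.diff_mem m)
    also have "\<dots> \<le> hnorm (F u) v * (hnorm (F u) w * e)"
      by (intro mult_mono hnorm_Q_le K_G0 K_mem(5) j v hdist_Q_le g w e S.hnorm_nonneg S.hdist_nonneg m)
    finally show "cmod (kterm x v w n j - kterm y v w n j) \<le> hnorm (F u) v * e * hnorm (F u) w" by (simp add: mult_ac)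
  qed
  have "hip (F u) (S.diff (Ker x v) (Ker y v)) w = kform x v w - kform y v w"
    by (simp only: S.hip_diff[OF Ker(1)[OF x v] Ker(1)[OF y v] w] Ker(2)[OF x v w] Ker(2)[OF y v w])
  also have "\<dots> = (\<Sum>n. of_real ((1/2) ^ Suc n) * I (\<lambda>j. kterm x v w n j - kterm y v w n j))"
    unfolding kform_def I_diff[OF c] right_diff_distrib
    by (rule suminf_diff) (intro kform_summable x y v w)+
  also have "cmod \<dots> \<le> hnorm (F u) v * e * hnorm (F u) w" by (rule summable_bounded_half(2)[OF le])
  finally show "cmod (hip (F u) (S.diff (Ker x v) (Ker y v)) w) \<le> hnorm (F u) v * e * hnorm (F u) w" .
qed

lemma Ker_hcont_arg:
  assumes v: "v \<in> S.C" shows "S.hcont GT (\<lambda>x. Ker x v)"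
proof (rule S.hcontI_uniform[where c = "hnorm (F u) v"])
  show "Ker y v \<in> S.C" if "y \<in> topspace GT" for y using that v by (simp add: Ker)
  fix y and e :: real assume y: "y \<in> topspace GT" and e: "0 < e"
  let ?KK = "prod_topology KT KT"
  let ?f = "\<lambda>p. i (fst (snd p)) \<cdot> fst p \<cdot> snd (snd p)"
  have a: "continuous_map (prod_topology GT ?KK) (gtop G) fst"
    using continuous_map_fst continuous_map_into_fulltopology by blast
  have b: "continuous_map (prod_topology GT ?KK) (gtop G) (\<lambda>p. fst (snd p))"
    using continuous_map_fst_of[OF continuous_map_snd, of GT KT KT, unfolded o_def] continuous_map_into_fulltopology by blast
  have c: "continuous_map (prod_topology GT ?KK) (gtop G) (\<lambda>p. snd (snd p))"
    using continuous_map_snd_of[OF continuous_map_snd, of GT KT KT, unfolded o_def] continuous_map_into_fulltopology by blast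
  have "continuous_map (prod_topology GT ?KK) (gtop G) ?f"
  proof (intro continuous_mult continuous_inv' a b c)
    fix p assume "p \<in> topspace (prod_topology GT ?KK)"
    then have "fst p \<in> G0" "fst (snd p) \<in> K" "snd (snd p) \<in> K"
      unfolding topspace_prod_topology topspace_GT topspace_KT by auto
    note m = G0D[OF this(1)] K_mem[OF this(2)] K_mem[OF this(3)]
    show "d (i (fst (snd p))) = r (fst p)" using m by (simp add: gsimps)
    show "d (i (fst (snd p)) \<cdot> fst p) = r (snd (snd p))" using m by (simp add: gsimps)
  qed
  from continuous_map_compose[OF this \<rho>_continuous]
  have cont: "continuous_map (prod_topology GT ?KK) euclidean (\<lambda>p. \<rho> (?f p))" by (simp add: o_def)
  have comp: "compact_space ?KK" by (simp add: compact_space_prod_topology compact_KT)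
  obtain U where U: "openin GT U" "y \<in> U"
    "\<And>x c. x \<in> U \<Longrightarrow> c \<in> topspace ?KK \<Longrightarrow> \<bar>\<rho> (?f (y, c)) - \<rho> (?f (x, c))\<bar> < e"
    by (rule compact_parameter_uniform[OF cont comp y e]) blast
  have "hdist (F u) (Ker y v) (Ker x v) \<le> hnorm (F u) v * e" if x: "x \<in> U" for x
  proof (rule hdist_Ker_le)
    show "y \<in> G0" "x \<in> G0" using y openin_subset[OF U(1)] x unfolding topspace_GT by auto
    show "\<bar>\<rho> (i j \<cdot> y \<cdot> k) - \<rho> (i j \<cdot> x \<cdot> k)\<bar> \<le> e" if j: "j \<in> K" and k: "k \<in> K" for j k
      using U(3)[OF x, of "(j, k)"] j k unfolding topspace_prod_topology topspace_KT by simp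
  qed (rule v)
  then show "\<exists>U. openin GT U \<and> y \<in> U \<and> (\<forall>x\<in>U. hdist (F u) (Ker y v) (Ker x v) \<le> hnorm (F u) v * e)"
    using U(1,2) by blast
qed

lemma hdist_Ker_contraction:
  assumes x: "x \<in> G0" and v: "v \<in> S.C" and w: "w \<in> S.C"
  shows "hdist (F u) (Ker x v) (Ker x w) \<le> hdist (F u) v w"
proof -
  have "S.diff (Ker x v) (Ker x w) = Ker x (S.diff v w)"
    by (simp add: Ker_add Ker_smult x v w S.smult_mem)
  then show ?thesis unfolding hdist_def using hnorm_Ker_le[OF x S.diff_mem[OF v w]] by simp
qed

lemma Ker_hcont:
  assumes x: "continuous_map Z GT x" and s: "S.hcont Z s"
  shows "S.hcont Z (\<lambda>z. Ker (x z) (s z))"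
proof (rule S.hcontI_le)
  have xG: "x z \<in> G0" if "z \<in> topspace Z" for z
    using x that unfolding continuous_map_def topspace_GT by blast
  then show "Ker (x z) (s z) \<in> S.C" if "z \<in> topspace Z" for z
    using S.hcont_mem[OF s that] that Ker(1) by blast
  show "((\<lambda>y. hdist (F u) (Ker (x z) (s z)) (Ker (x y) (s z)) + hdist (F u) (s z) (s y)) \<longlongrightarrow> 0) (atin Z z)"
    if z: "z \<in> topspace Z" for z
    using tendsto_add[OF S.hcont_tendsto[OF S.hcont_compose[OF Ker_hcont_arg[OF S.hcont_mem[OF s z]] x] z]
      S.hcont_tendsto[OF s z]] by simp
  fix z y assume z: "z \<in> topspace Z" and y: "y \<in> topspace Z"
  note m = S.hcont_mem[OF s z] S.hcont_mem[OF s y]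
  show "hdist (F u) (Ker (x z) (s z)) (Ker (x y) (s y))
      \<le> hdist (F u) (Ker (x z) (s z)) (Ker (x y) (s z)) + hdist (F u) (s z) (s y)"
    using S.hdist_triangle[OF Ker(1)[OF xG[OF z] m(1)] Ker(1)[OF xG[OF y] m(1)] Ker(1)[OF xG[OF y] m(2)]]
      hdist_Ker_contraction[OF xG[OF y] m] by simp
qed

end

section \<open>Extending the kernel to the groupoid\<close>

locale induced_kernel = induced_setting G H \<mu> E \<pi> + intertwining_kernel G H E \<pi> u I \<rho>
  for G :: "'g groupoid" and H :: "'g set" and \<mu> :: "'g \<Rightarrow> 'g set measure"
    and E :: "('g, 'v) hbundle" and \<pi> :: "'g \<Rightarrow> 'v \<Rightarrow> 'v"
    and u :: 'g and I :: "('g \<Rightarrow> complex) \<Rightarrow> complex" and \<rho> :: "'g \<Rightarrow> real" +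
  assumes transitive_H: "v \<in> units G \<Longrightarrow> \<exists>p\<in>H. r p = v \<and> d p = u"
begin

definition frame :: "'g \<Rightarrow> 'g" where
  "frame v = (SOME p. p \<in> PD \<and> r p = v)"

lemma frame: "v \<in> units G \<Longrightarrow> frame v \<in> PD \<and> r (frame v) = v"
  unfolding frame_def by (rule someI_ex) (use transitive_H in \<open>auto simp: PD_def\<close>)

text \<open>Bounded operators on the fibre over \<open>u\<close> commuting with the isotropy group: those that
  can be inserted in front of the kernel without destroying equivariance.\<close>

definition K_map :: "('v \<Rightarrow> 'v) \<Rightarrow> bool" where
  "K_map B \<longleftrightarrow> (\<forall>x\<in>S.C. B x \<in> S.C) \<and>
    (\<forall>x\<in>S.C. \<forall>y\<in>S.C. B (x \<oplus>\<^bsub>F u\<^esub> y) = B x \<oplus>\<^bsub>F u\<^esub> B y) \<and>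
    (\<forall>c. \<forall>x\<in>S.C. B (c \<odot>\<^bsub>F u\<^esub> x) = c \<odot>\<^bsub>F u\<^esub> B x) \<and>
    (\<exists>c. \<forall>x\<in>S.C. hnorm (F u) (B x) \<le> c * hnorm (F u) x) \<and>
    (\<forall>k\<in>K. \<forall>x\<in>S.C. B (\<pi> k x) = \<pi> k (B x))"

lemma K_mapD:
  assumes "K_map B"
  shows "\<And>x. x \<in> S.C \<Longrightarrow> B x \<in> S.C"
    "\<And>x y. x \<in> S.C \<Longrightarrow> y \<in> S.C \<Longrightarrow> B (x \<oplus>\<^bsub>F u\<^esub> y) = B x \<oplus>\<^bsub>F u\<^esub> B y"
    "\<And>x c. x \<in> S.C \<Longrightarrow> B (c \<odot>\<^bsub>F u\<^esub> x) = c \<odot>\<^bsub>F u\<^esub> B x"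
    "\<And>k x. k \<in> K \<Longrightarrow> x \<in> S.C \<Longrightarrow> B (\<pi> k x) = \<pi> k (B x)"
  using assms by (simp_all add: K_map_def)

lemma K_map_hcont: "K_map B \<Longrightarrow> S.hcont Z s \<Longrightarrow> S.hcont Z (\<lambda>z. B (s z))"
proof -
  assume B: "K_map B" and s: "S.hcont Z s"
  from B have "\<exists>c. \<forall>x\<in>S.C. hnorm (F u) (B x) \<le> c * hnorm (F u) x" by (simp only: K_map_def)
  then obtain c where c: "\<And>x. x \<in> S.C \<Longrightarrow> hnorm (F u) (B x) \<le> c * hnorm (F u) x" by blast
  show ?thesis
  proof (rule S.hcont_bounded_op[OF s K_mapD(1)[OF B]])
    fix x y assume x: "x \<in> S.C" and y: "y \<in> S.C"
    have "S.diff (B x) (B y) = B (S.diff x y)"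
      by (simp add: K_mapD[OF B] x y S.smult_mem)
    then show "hdist (F u) (B x) (B y) \<le> c * hdist (F u) x y"
      unfolding hdist_def using c[OF S.diff_mem[OF x y]] by simp
  qed
qed

lemma \<pi>_inv_PD: "p \<in> PD \<Longrightarrow> v \<in> carrier (F (r p)) \<Longrightarrow> \<pi> (i p) v \<in> S.C"
  using \<pi>_mem[OF sub_inv, of p v] PD_mem[of p] by (simp add: gsimps)

lemma \<pi>_PD: "p \<in> PD \<Longrightarrow> x \<in> S.C \<Longrightarrow> \<pi> p x \<in> carrier (F (r p))"
  using \<pi>_mem[of p x] PD_mem[of p] by simp

lemma \<pi>_PD_inv: "p \<in> PD \<Longrightarrow> v \<in> carrier (F (r p)) \<Longrightarrow> \<pi> p (\<pi> (i p) v) = v"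
  using \<pi>_inv[OF sub_inv, of p v] PD_mem[of p] by (simp add: gsimps inv_inv)

text \<open>The kernel transported to an arrow \<open>y\<close>, along arrows of \<open>H\<close> joining its
  endpoints to \<open>u\<close>. A chosen arrow of \<open>H\<close> for each unit is in general
  not continuous in the unit; by \<open>trans_ker_eq\<close> the choice is immaterial, so
  continuity can be checked without it.\<close>

definition trans_ker :: "('v \<Rightarrow> 'v) \<Rightarrow> 'v \<Rightarrow> 'g \<Rightarrow> 'v" where
  "trans_ker B v y = (let p = frame (r y); t = frame (d y) in \<pi> t (Ker (i p \<cdot> y \<cdot> t) (B (\<pi> (i p) v))))"

lemma conj_G0: "y \<in> A \<Longrightarrow> p \<in> PD \<Longrightarrow> t \<in> PD \<Longrightarrow> r p = r y \<Longrightarrow> r t = d y \<Longrightarrow> i p \<cdot> y \<cdot> t \<in> G0"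
  using PD_mem[of p] PD_mem[of t] by (simp add: G0_def gsimps)

text \<open>Two choices of connecting arrows differ by elements of \<open>K\<close>, which are absorbed by the
  equivariance of \<open>Ker\<close> on both sides and by \<open>B\<close>.\<close>

lemma trans_ker_eq:
  assumes B: "K_map B" and y: "y \<in> A" and v: "v \<in> carrier (F (r y))"
    and p: "p \<in> PD" "r p = r y" and t: "t \<in> PD" "r t = d y"
  shows "trans_ker B v y = \<pi> t (Ker (i p \<cdot> y \<cdot> t) (B (\<pi> (i p) v)))"
proof -
  define p0 where "p0 = frame (r y)"
  define t0 where "t0 = frame (d y)"
  have p0: "p0 \<in> PD" "r p0 = r y" and t0: "t0 \<in> PD" "r t0 = d y"
    using frame[OF rng_unit[OF y]] frame[OF dom_unit[OF y]] by (auto simp: p0_def t0_def)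
  note m = PD_mem(1-3)[OF p(1)] PD_mem(1-3)[OF t(1)] PD_mem(1-3)[OF p0(1)] PD_mem(1-3)[OF t0(1)] y
  define k where "k = i p0 \<cdot> p"
  define l where "l = i t0 \<cdot> t"
  have kH: "k \<in> H" "l \<in> H" using m p t p0 t0 by (auto simp: k_def l_def gsimps intro!: sub_mul sub_inv)
  have k: "k \<in> K" "l \<in> K" using kH m p t p0 t0 by (auto simp: isotropy_def k_def l_def gsimps)
  let ?x = "i p0 \<cdot> y \<cdot> t0"
  have x: "?x \<in> G0" by (rule conj_G0[OF y p0(1) t0(1) p0(2) t0(2)])
  have w: "\<pi> (i p) v \<in> S.C" using \<pi>_inv_PD[OF p(1)] v p(2) by simp
  have Bw: "B (\<pi> (i p) v) \<in> S.C" by (rule K_mapD(1)[OF B w])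
  have e1: "i p \<cdot> y \<cdot> t = (i k \<cdot> ?x) \<cdot> l"
    using m p t p0 t0 by (simp add: k_def l_def inv_mult inv_inv gsimps mult_inv_cancel)
  have e2: "k \<cdot> i p = i p0" using m p p0 by (simp add: k_def gsimps mult_unit)
  have e3: "t \<cdot> i l = t0" using m t t0 by (simp add: l_def inv_mult inv_inv gsimps mult_inv_cancel)
  have "Ker (i p \<cdot> y \<cdot> t) (B (\<pi> (i p) v)) = \<pi> (i l) (Ker (i k \<cdot> ?x) (B (\<pi> (i p) v)))"
    unfolding e1 by (rule Ker_right[OF GK_mult(2)[OF x K_mem(5)[OF k(1)]] k(2) Bw])
  also have "Ker (i k \<cdot> ?x) (B (\<pi> (i p) v)) = Ker ?x (\<pi> k (B (\<pi> (i p) v)))"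
    using Ker_left[OF x K_mem(5)[OF k(1)] Bw] K_mem[OF k(1)] by (simp add: inv_inv)
  also have "\<pi> k (B (\<pi> (i p) v)) = B (\<pi> k (\<pi> (i p) v))" by (rule K_mapD(4)[OF B k(1) w, symmetric])
  also have "\<pi> k (\<pi> (i p) v) = \<pi> (i p0) v"
    using \<pi>_mult[of k "i p" v] kH sub_inv m p p0 v e2 K_mem[OF k(1)] by (simp add: gsimps)
  finally have eq: "Ker (i p \<cdot> y \<cdot> t) (B (\<pi> (i p) v)) = \<pi> (i l) (Ker ?x (B (\<pi> (i p0) v)))" .
  have w0: "\<pi> (i p0) v \<in> S.C" using \<pi>_inv_PD[OF p0(1)] v p0(2) by simp
  have Kx: "Ker ?x (B (\<pi> (i p0) v)) \<in> S.C" by (rule Ker(1)[OF x K_mapD(1)[OF B w0]])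
  have "\<pi> t (\<pi> (i l) (Ker ?x (B (\<pi> (i p0) v)))) = \<pi> t0 (Ker ?x (B (\<pi> (i p0) v)))"
    using \<pi>_mult[of t "i l"] m Kx e3 K_mem[OF k(2)] K_mem[OF K_mem(5)[OF k(2)]] by simp
  then show ?thesis unfolding eq trans_ker_def Let_def p0_def[symmetric] t0_def[symmetric] by simp
qed

lemma trans_ker_mem:
  assumes B: "K_map B" and y: "y \<in> A" and v: "v \<in> carrier (F (r y))"
  shows "trans_ker B v y \<in> carrier (F (d y))"
proof -
  note p = frame[OF rng_unit[OF y]] and t = frame[OF dom_unit[OF y]]
  have "\<pi> (i (frame (r y))) v \<in> S.C" using \<pi>_inv_PD[OF conjunct1[OF p]] p v by simp
  then show ?thesis
    using \<pi>_PD[OF conjunct1[OF t] Ker(1)[OF conj_G0[OF y conjunct1[OF p] conjunct1[OF t]] K_mapD(1)[OF B]]] p t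
    by (simp add: trans_ker_def Let_def)
qed

lemma trans_ker_right:
  assumes B: "K_map B" and y: "y \<in> A" and v: "v \<in> carrier (F (r y))" and h: "h \<in> H" "d y = r h"
  shows "trans_ker B v (y \<cdot> h) = \<pi> (i h) (trans_ker B v y)"
proof -
  define p where "p = frame (r y)"
  define t where "t = frame (d y)"
  have p: "p \<in> PD" "r p = r y" and t: "t \<in> PD" "r t = d y"
    using frame[OF rng_unit[OF y]] frame[OF dom_unit[OF y]] by (auto simp: p_def t_def)
  note m = PD_mem(1-3)[OF p(1)] PD_mem(1-3)[OF t(1)] y h H_arrow[OF h(1)]
  have q': "i h \<cdot> t \<in> PD" "r (i h \<cdot> t) = d (y \<cdot> h)"
    using m p t sub_inv[OF h(1)] by (auto simp: PD_def gsimps intro!: sub_mul)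
  have w: "\<pi> (i p) v \<in> S.C" using \<pi>_inv_PD[OF p(1)] v p(2) by simp
  have x: "i p \<cdot> y \<cdot> t \<in> G0" by (rule conj_G0[OF y p(1) t(1) p(2) t(2)])
  have e: "i p \<cdot> (y \<cdot> h) \<cdot> (i h \<cdot> t) = i p \<cdot> y \<cdot> t" using m p t by (simp add: gsimps mult_inv_cancel)
  have yh: "y \<cdot> h \<in> A" "r (y \<cdot> h) = r y" using m by (simp_all add: gsimps)
  have "trans_ker B v (y \<cdot> h) = \<pi> (i h \<cdot> t) (Ker (i p \<cdot> y \<cdot> t) (B (\<pi> (i p) v)))"
    using trans_ker_eq[OF B yh(1) _ p(1) _ q'] v p(2) unfolding yh(2) e by simp
  also have "\<dots> = \<pi> (i h) (\<pi> t (Ker (i p \<cdot> y \<cdot> t) (B (\<pi> (i p) v))))"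
    using \<pi>_mult[of "i h" t "Ker (i p \<cdot> y \<cdot> t) (B (\<pi> (i p) v))"] sub_inv[OF h(1)] m t Ker(1)[OF x K_mapD(1)[OF B w]]
    by (simp add: gsimps)
  also have "\<pi> t (Ker (i p \<cdot> y \<cdot> t) (B (\<pi> (i p) v))) = trans_ker B v y"
    by (rule trans_ker_eq[OF B y v p t, symmetric])
  finally show ?thesis .
qed

text \<open>Both sides are computed with suitable connecting arrows: if \<open>p\<close> joins
  \<open>u\<close> to the domain of \<open>h\<close>, then \<open>h \<cdot> p\<close> joins
  \<open>u\<close> to the range of \<open>h\<close>.\<close>

lemma trans_ker_left:
  assumes B: "K_map B" and h: "h \<in> H" and v: "v \<in> carrier (F (d h))" and y: "y \<in> rfib G (r h)"
  shows "trans_ker B (\<pi> h v) y = trans_ker B v (i h \<cdot> y)"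
proof -
  have yA: "y \<in> A" "r y = r h" using y by (auto simp: rfib_def)
  have hA: "h \<in> A" using h H_arrow by blast
  define p where "p = frame (d h)"
  define t where "t = frame (d y)"
  have p: "p \<in> PD" "r p = d h" and t: "t \<in> PD" "r t = d y"
    using frame[OF dom_unit[OF hA]] frame[OF dom_unit[OF yA(1)]] by (auto simp: p_def t_def)
  note m = PD_mem(1-3)[OF p(1)] PD_mem(1-3)[OF t(1)] yA h hA
  have hp: "h \<cdot> p \<in> PD" "r (h \<cdot> p) = r y" using m p by (auto simp: PD_def gsimps intro!: sub_mul)
  have hy: "i h \<cdot> y \<in> A" "r (i h \<cdot> y) = d h" "d (i h \<cdot> y) = d y" using m by (simp_all add: gsimps)
  have hv: "\<pi> h v \<in> carrier (F (r y))" using \<pi>_mem[OF h v] yA by simp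
  have "trans_ker B (\<pi> h v) y = \<pi> t (Ker (i (h \<cdot> p) \<cdot> y \<cdot> t) (B (\<pi> (i (h \<cdot> p)) (\<pi> h v))))"
    by (rule trans_ker_eq[OF B yA(1) hv hp t])
  also have "i (h \<cdot> p) \<cdot> y \<cdot> t = i p \<cdot> (i h \<cdot> y) \<cdot> t" using m p t by (simp add: inv_mult gsimps)
  also have "\<pi> (i (h \<cdot> p)) (\<pi> h v) = \<pi> (i p) v"
  proof -
    have "i (h \<cdot> p) \<cdot> h = i p" using m p by (simp add: inv_mult gsimps mult_unit)
    then show ?thesis using \<pi>_mult[of "i (h \<cdot> p)" h v] sub_inv PD_mem[OF hp(1)] hp h v yA by (simp add: gsimps)
  qed
  also have "\<pi> t (Ker (i p \<cdot> (i h \<cdot> y) \<cdot> t) (B (\<pi> (i p) v))) = trans_ker B v (i h \<cdot> y)"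
    by (rule trans_ker_eq[OF B hy(1), symmetric]) (use v p t hy in simp_all)
  finally show ?thesis .
qed

lemma trans_ker_add:
  assumes B: "K_map B" and y: "y \<in> A" and v: "v \<in> carrier (F (r y))" and w: "w \<in> carrier (F (r y))"
  shows "trans_ker B (v \<oplus>\<^bsub>F (r y)\<^esub> w) y = trans_ker B v y \<oplus>\<^bsub>F (d y)\<^esub> trans_ker B w y"
proof -
  define p where "p = frame (r y)"
  define t where "t = frame (d y)"
  have p: "p \<in> PD" "r p = r y" and t: "t \<in> PD" "r t = d y"
    using frame[OF rng_unit[OF y]] frame[OF dom_unit[OF y]] by (auto simp: p_def t_def)
  have x: "i p \<cdot> y \<cdot> t \<in> G0" by (rule conj_G0[OF y p(1) t(1) p(2) t(2)])
  note m = PD_mem(1-3)[OF p(1)] PD_mem(1-3)[OF t(1)]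
  have pv: "\<pi> (i p) v \<in> S.C" "\<pi> (i p) w \<in> S.C" using \<pi>_inv_PD[OF p(1)] v w p(2) by simp_all
  have "\<pi> (i p) (v \<oplus>\<^bsub>F (r y)\<^esub> w) = \<pi> (i p) v \<oplus>\<^bsub>F u\<^esub> \<pi> (i p) w"
    using \<pi>_add[OF sub_inv, of p v w] m p v w by (simp add: gsimps)
  then show ?thesis
    using \<pi>_add[of t] m t pv Ker(1)[OF x] K_mapD(1)[OF B]
    by (simp add: trans_ker_def Let_def p_def[symmetric] t_def[symmetric] K_mapD(2)[OF B] Ker_add[OF x])
qed

lemma trans_ker_smult:
  assumes B: "K_map B" and y: "y \<in> A" and v: "v \<in> carrier (F (r y))"
  shows "trans_ker B (c \<odot>\<^bsub>F (r y)\<^esub> v) y = c \<odot>\<^bsub>F (d y)\<^esub> trans_ker B v y"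
proof -
  define p where "p = frame (r y)"
  define t where "t = frame (d y)"
  have p: "p \<in> PD" "r p = r y" and t: "t \<in> PD" "r t = d y"
    using frame[OF rng_unit[OF y]] frame[OF dom_unit[OF y]] by (auto simp: p_def t_def)
  have x: "i p \<cdot> y \<cdot> t \<in> G0" by (rule conj_G0[OF y p(1) t(1) p(2) t(2)])
  note m = PD_mem(1-3)[OF p(1)] PD_mem(1-3)[OF t(1)]
  have pv: "\<pi> (i p) v \<in> S.C" using \<pi>_inv_PD[OF p(1)] v p(2) by simp
  have "\<pi> (i p) (c \<odot>\<^bsub>F (r y)\<^esub> v) = c \<odot>\<^bsub>F u\<^esub> \<pi> (i p) v"
    using \<pi>_smult[OF sub_inv, of p v] m p v by (simp add: gsimps)
  then show ?thesis
    using \<pi>_smult[of t] m t pv Ker(1)[OF x] K_mapD(1)[OF B]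
    by (simp add: trans_ker_def Let_def p_def[symmetric] t_def[symmetric] K_mapD(3)[OF B] Ker_smult[OF x])
qed

definition sec_fun :: "('v \<Rightarrow> 'v) \<Rightarrow> ('g \<Rightarrow> 'v) \<Rightarrow> 'g \<Rightarrow> 'v" where
  "sec_fun B \<eta> = (\<lambda>y\<in>A. trans_ker B (\<eta> (r y)) y)"

lemma compact_PT: "compact_space PT"
proof -
  have "PD = H \<inter> {x \<in> A. d x = u}" using H_arrow by (auto simp: PD_def)
  then have "closedin (gtop G) PD"
    using u unit_arrow by (auto intro!: closedin_Int closed_H closedin_equalizer_gtop continuous_dom)
  then show ?thesis by (intro compact_space_subtopology closedin_compact_space[OF compact_gtop])
qed

lemma compact_GT: "compact_space GT"
proof -
  have "G0 = {x \<in> A. r x = u} \<inter> {x \<in> A. d x = u}" by (auto simp: G0_def)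
  then have "closedin (gtop G) G0"
    using u unit_arrow by (auto intro!: closedin_Int closedin_equalizer_gtop continuous_rng continuous_dom)
  then show ?thesis by (intro compact_space_subtopology closedin_compact_space[OF compact_gtop])
qed

abbreviation ZT where "ZT \<equiv> prod_topology PT (prod_topology GT PT)"
abbreviation \<Theta> where "\<Theta> z \<equiv> fst z \<cdot> fst (snd z) \<cdot> i (snd (snd z))"

lemma topspace_ZT: "z \<in> topspace ZT \<longleftrightarrow> fst z \<in> PD \<and> fst (snd z) \<in> G0 \<and> snd (snd z) \<in> PD"
  unfolding topspace_prod_topology topspace_PT topspace_GT by (auto simp: mem_Times_iff)

lemma ZT_continuous:
  "continuous_map ZT PT fst" "continuous_map ZT GT (\<lambda>z. fst (snd z))" "continuous_map ZT PT (\<lambda>z. snd (snd z))"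
  using continuous_map_fst continuous_map_fst_of[OF continuous_map_snd, of PT GT PT, unfolded o_def]
    continuous_map_snd_of[OF continuous_map_snd, of PT GT PT, unfolded o_def] by auto

text \<open>Since \<open>H\<close> is transitive, every arrow factors through the isotropy group of
  \<open>u\<close>. The factorisation map \<open>(p, x, t) \<mapsto> p x t\<^sup>-\<^sup>1\<close>
  is a quotient map by compactness, so continuity may be tested on factors.\<close>

lemma quotient_map_\<Theta>: "quotient_map ZT (gtop G) \<Theta>"
proof (rule continuous_imp_quotient_map)
  have full: "continuous_map ZT (gtop G) fst" "continuous_map ZT (gtop G) (\<lambda>z. fst (snd z))"
    "continuous_map ZT (gtop G) (\<lambda>z. snd (snd z))"
    using ZT_continuous continuous_map_into_fulltopology by blast+
  show "continuous_map ZT (gtop G) \<Theta>"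
  proof (intro continuous_mult continuous_inv' full)
    fix z assume "z \<in> topspace ZT"
    then have z: "fst z \<in> PD" "fst (snd z) \<in> G0" "snd (snd z) \<in> PD" unfolding topspace_ZT by auto
    note m = PD_mem[OF z(1)] G0D[OF z(2)] PD_mem[OF z(3)]
    show "d (fst z) = r (fst (snd z))" using m by simp
    show "d (fst z \<cdot> fst (snd z)) = r (i (snd (snd z)))" using m by (simp add: gsimps)
  qed
  show "compact_space ZT" by (simp add: compact_space_prod_topology compact_PT compact_GT)
  show "Hausdorff_space (gtop G)" by (rule Hausdorff_gtop)
  show "\<Theta> ` topspace ZT = topspace (gtop G)"
  proof (intro equalityI subsetI)
    fix y assume "y \<in> \<Theta> ` topspace ZT"
    then obtain z where y: "y = \<Theta> z" and "z \<in> topspace ZT" by blast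
    then have z: "fst z \<in> PD" "fst (snd z) \<in> G0" "snd (snd z) \<in> PD" unfolding topspace_ZT by auto
    note m = PD_mem[OF z(1)] G0D[OF z(2)] PD_mem[OF z(3)]
    show "y \<in> A" unfolding y using m by (simp add: gsimps)
  next
    fix y assume y: "y \<in> A"
    note p = frame[OF rng_unit[OF y]] and t = frame[OF dom_unit[OF y]]
    let ?p = "frame (r y)" and ?t = "frame (d y)"
    have "(?p, i ?p \<cdot> y \<cdot> ?t, ?t) \<in> topspace ZT"
      unfolding topspace_ZT using p t conj_G0[OF y, of ?p ?t] by simp
    moreover have "y = \<Theta> (?p, i ?p \<cdot> y \<cdot> ?t, ?t)"
      using p t y PD_mem[of ?p] PD_mem[of ?t] by (simp add: gsimps mult_inv_cancel mult_unit)
    ultimately show "y \<in> \<Theta> ` topspace ZT" by blast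
  qed
qed

lemma sec_fun_\<Theta>:
  assumes B: "K_map B" and \<eta>: "\<eta> \<in> secs E" and z: "z \<in> topspace ZT"
  shows "d (\<Theta> z) = r (snd (snd z))"
    and "sec_fun B \<eta> (\<Theta> z) = \<pi> (snd (snd z)) (Ker (fst (snd z)) (B (pull \<eta> (fst z))))"
proof -
  have z: "fst z \<in> PD" "fst (snd z) \<in> G0" "snd (snd z) \<in> PD" using z unfolding topspace_ZT by auto
  note m = PD_mem(1-3)[OF z(1)] G0D[OF z(2)] PD_mem(1-3)[OF z(3)]
  have t: "\<Theta> z \<in> A" "r (\<Theta> z) = r (fst z)" "d (\<Theta> z) = r (snd (snd z))" using m by (simp_all add: gsimps)
  show "d (\<Theta> z) = r (snd (snd z))" by (rule t(3))
  have e: "i (fst z) \<cdot> \<Theta> z \<cdot> snd (snd z) = fst (snd z)" using m by (simp add: gsimps inv_mult_cancel mult_unit)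
  have "\<eta> (r (\<Theta> z)) \<in> carrier (F (r (\<Theta> z)))" by (rule sec_mem_unit[OF \<eta> rng_unit[OF t(1)]])
  from trans_ker_eq[OF B t(1) this z(1) _ z(3)]
  show "sec_fun B \<eta> (\<Theta> z) = \<pi> (snd (snd z)) (Ker (fst (snd z)) (B (pull \<eta> (fst z))))"
    using t unfolding e by (simp add: sec_fun_def pull_def)
qed

lemma hdist_\<pi>:
  assumes h: "h \<in> H" and v: "v \<in> carrier (F (d h))" and w: "w \<in> carrier (F (d h))"
  shows "hdist (F (r h)) (\<pi> h v) (\<pi> h w) = hdist (F (d h)) v w"
proof -
  have hA: "h \<in> A" using h H_arrow by blast
  interpret D: semi_inner "F (d h)" "carrier (F (d h))" by (rule fib_semi[OF dom_unit[OF hA]])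
  interpret R: semi_inner "F (r h)" "carrier (F (r h))" by (rule fib_semi[OF rng_unit[OF hA]])
  note m = \<pi>_mem[OF h v] \<pi>_mem[OF h w]
  have "(hdist (F (r h)) (\<pi> h v) (\<pi> h w))\<^sup>2 = (hdist (F (d h)) v w)\<^sup>2"
    unfolding R.hdist_sq[OF m] D.hdist_sq[OF v w] by (simp add: \<pi>_hnorm \<pi>_hip h v w)
  then show ?thesis using R.hdist_nonneg[OF m] D.hdist_nonneg[OF v w] by simp
qed

text \<open>On the factors \<open>(p, x, t)\<close> the function is \<open>\<pi>(t) Ker x (B (pull \<eta>
  p))\<close>; its distance to a section \<open>\<xi>\<close> is the distance of \<open>Ker x (B
  (pull \<eta> p))\<close> to \<open>pull \<xi> t\<close>, a statement about norm continuous maps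
  into one space.\<close>

lemma sec_fun_eqv:
  assumes B: "K_map B" and \<eta>: "\<eta> \<in> secs E"
  shows "sec_fun B \<eta> \<in> eqv A"
proof -
  have \<eta>m: "\<eta> (r y) \<in> carrier (F (r y))" if "y \<in> A" for y by (rule sec_mem_unit[OF \<eta> rng_unit[OF that]])
  let ?s = "\<lambda>z. Ker (fst (snd z)) (B (pull \<eta> (fst z)))"
  have s: "S.hcont ZT ?s"
    by (intro Ker_hcont ZT_continuous K_map_hcont[OF B] S.hcont_compose[OF pull_hcont[OF \<eta>]])
  have cont: "continuous_map ZT (total_top (unit_top G) E) (\<lambda>z. (r (snd (snd z)), \<pi> (snd (snd z)) (?s z)))"
  proof (rule bun.continuous_map_total_topI)
    have "continuous_map ZT (gtop G) (\<lambda>z. snd (snd z))"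
      using ZT_continuous(3) continuous_map_into_fulltopology by blast
    from continuous_map_compose[OF this continuous_rng_unit]
    show "continuous_map ZT (unit_top G) (\<lambda>z. r (snd (snd z)))" by (simp add: o_def)
    show "\<pi> (snd (snd z)) (?s z) \<in> carrier (F (r (snd (snd z))))" if z: "z \<in> topspace ZT" for z
      using \<pi>_PD[OF _ S.hcont_mem[OF s z]] z unfolding topspace_ZT by blast
    fix \<xi> assume \<xi>: "\<xi> \<in> secs E"
    have "continuous_map ZT euclidean (\<lambda>z. hdist (F u) (?s z) (pull \<xi> (snd (snd z))))"
      by (intro S.hcont_hdist s S.hcont_compose[OF pull_hcont[OF \<xi>]] ZT_continuous)
    then show "continuous_map ZT euclidean
        (\<lambda>z. hdist (F (r (snd (snd z)))) (\<pi> (snd (snd z)) (?s z)) (\<xi> (r (snd (snd z)))))"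
    proof (rule continuous_map_eq)
      fix z assume z: "z \<in> topspace ZT"
      then have t: "snd (snd z) \<in> PD" unfolding topspace_ZT by auto
      let ?t = "snd (snd z)"
      note m = PD_mem[OF t]
      have "\<xi> (r ?t) = \<pi> ?t (pull \<xi> ?t)"
        unfolding pull_def using \<pi>_PD_inv[OF t sec_mem_unit[OF \<xi> m(4)]] by simp
      then show "hdist (F u) (?s z) (pull \<xi> ?t) = hdist (F (r ?t)) (\<pi> ?t (?s z)) (\<xi> (r ?t))"
        using hdist_\<pi>[OF m(1), of "?s z" "pull \<xi> ?t"] S.hcont_mem[OF s z] pull_mem[OF \<xi> t] m(3) by simp
    qed
  qed
  have "continuous_map (gtop G) (total_top (unit_top G) E) (\<lambda>y. (d y, sec_fun B \<eta> y))"
  proof (rule continuous_compose_quotient_map[OF quotient_map_\<Theta>])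
    show "continuous_map ZT (total_top (unit_top G) E) ((\<lambda>y. (d y, sec_fun B \<eta> y)) \<circ> \<Theta>)"
      by (rule continuous_map_eq[OF cont]) (simp add: sec_fun_\<Theta>[OF B \<eta>] del: topspace_prod_topology)
  qed
  then have "bun.section_approximable (gtop G) d (sec_fun B \<eta>)"
    by (rule bun.total_top_section_approximable)
  then show ?thesis
    using trans_ker_mem[OF B _ \<eta>m] trans_ker_right[OF B _ \<eta>m]
    by (auto simp: eqv_def sec_fun_def mult_rng H_arrow)
qed

text \<open>The restriction of \<open>sec_fun B \<eta>\<close> to an \<open>r\<close>-fibre only depends on
  the value of \<open>\<eta>\<close> there.\<close>

definition vec_fun :: "('v \<Rightarrow> 'v) \<Rightarrow> 'g \<Rightarrow> 'v \<Rightarrow> 'g \<Rightarrow> 'v" where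
  "vec_fun B w v = (\<lambda>y\<in>rfib G w. trans_ker B v y)"

lemma vec_fun_sec: "restrict (sec_fun B \<eta>) (rfib G w) = vec_fun B w (\<eta> w)"
  by (auto simp: vec_fun_def sec_fun_def rfib_def fun_eq_iff restrict_def)

lemma vec_fun_carrier:
  assumes B: "K_map B" and w: "w \<in> units G" and v: "v \<in> carrier (F w)"
  shows "vec_fun B w v \<in> carrier (P w)"
proof -
  have wX: "w \<in> topspace (unit_top G)" using w by (simp add: topspace_unit_top)
  obtain \<eta> where \<eta>: "\<eta> \<in> secs E" "\<eta> w = v" by (rule bun.sec_through[OF wX v])
  show ?thesis
    unfolding P_simps(1)
    by (rule image_eqI[where f = "\<lambda>f. restrict f (rfib G w)", OF _ sec_fun_eqv[OF B \<eta>(1)]]) (simp add: vec_fun_sec \<eta>(2))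
qed

lemma vec_fun_add:
  assumes B: "K_map B" and v: "v \<in> carrier (F w)" and v': "v' \<in> carrier (F w)"
  shows "vec_fun B w (v \<oplus>\<^bsub>F w\<^esub> v') = vec_fun B w v \<oplus>\<^bsub>P w\<^esub> vec_fun B w v'"
  using trans_ker_add[OF B] v v' by (auto simp: vec_fun_def P_simps rfib_def fun_eq_iff restrict_def)

lemma vec_fun_smult:
  assumes B: "K_map B" and v: "v \<in> carrier (F w)"
  shows "vec_fun B w (c \<odot>\<^bsub>F w\<^esub> v) = c \<odot>\<^bsub>P w\<^esub> vec_fun B w v"
  using trans_ker_smult[OF B] v by (auto simp: vec_fun_def P_simps rfib_def fun_eq_iff restrict_def)

lemma vec_fun_translate:
  assumes B: "K_map B" and h: "h \<in> H" and v: "v \<in> carrier (F (d h))"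
  shows "left_translate G h (vec_fun B (d h) v) = vec_fun B (r h) (\<pi> h v)"
proof
  fix y
  have hA: "h \<in> A" using h H_arrow by blast
  show "left_translate G h (vec_fun B (d h) v) y = vec_fun B (r h) (\<pi> h v) y"
  proof (cases "y \<in> rfib G (r h)")
    case True
    then have "i h \<cdot> y \<in> rfib G (d h)" using hA by (simp add: rfib_def gsimps)
    then show ?thesis using True trans_ker_left[OF B h v True] by (simp add: left_translate_def vec_fun_def)
  qed (simp add: left_translate_def vec_fun_def)
qed

lemma K_map_id: "K_map (\<lambda>x. x)"
  unfolding K_map_def using \<pi>_K by (auto intro!: exI[of _ 1])

text \<open>Over \<open>u\<close> the operator \<open>B\<close> acts on the vector itself.\<close>

lemma vec_fun_at_u:
  assumes B: "K_map B" and x: "x \<in> S.C"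
  shows "vec_fun B u x = vec_fun (\<lambda>x. x) u (B x)"
proof
  fix y
  show "vec_fun B u x y = vec_fun (\<lambda>x. x) u (B x) y"
  proof (cases "y \<in> rfib G u")
    case True
    then have y: "y \<in> A" "r y = u" by (auto simp: rfib_def)
    have uP: "u \<in> PD" "r u = r y" using K_mem[OF u_K] y by (auto simp: PD_def)
    note t = frame[OF dom_unit[OF y(1)]]
    show ?thesis
      using True trans_ker_eq[OF B y(1) _ uP conjunct1[OF t] conjunct2[OF t], of x]
        trans_ker_eq[OF K_map_id y(1) _ uP conjunct1[OF t] conjunct2[OF t], of "B x"] x y
      by (simp add: vec_fun_def inv_unit[OF u] \<pi>_u K_mapD(1)[OF B])
  qed (simp add: vec_fun_def)
qed

text \<open>The inner product of the induced fibre over \<open>u\<close> pulled back to the fibre of the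
  representation.\<close>

definition \<tau> :: "'v \<Rightarrow> 'v \<Rightarrow> complex" where
  "\<tau> x y = hip (P u) (vec_fun (\<lambda>x. x) u x) (vec_fun (\<lambda>x. x) u y)"

text \<open>Translation by \<open>p\<close> preserves inner products and carries the functions attached to
  vectors over \<open>u\<close> to those attached to vectors over \<open>r p\<close>.\<close>

lemma hip_vec_fun:
  assumes B: "K_map B" and B': "K_map B'" and p: "p \<in> PD"
    and v: "v \<in> carrier (F (r p))" and v': "v' \<in> carrier (F (r p))"
  shows "hip (P (r p)) (vec_fun B (r p) v) (vec_fun B' (r p) v') = \<tau> (B (\<pi> (i p) v)) (B' (\<pi> (i p) v'))"
proof -
  note m = PD_mem[OF p]
  have x: "\<pi> (i p) v \<in> S.C" "\<pi> (i p) v' \<in> S.C" using \<pi>_inv_PD[OF p] v v' by auto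
  have "vec_fun B (r p) v = left_translate G p (vec_fun B u (\<pi> (i p) v))"
    "vec_fun B' (r p) v' = left_translate G p (vec_fun B' u (\<pi> (i p) v'))"
    using vec_fun_translate[OF B m(1), of "\<pi> (i p) v"] vec_fun_translate[OF B' m(1), of "\<pi> (i p) v'"] x m(3)
    by (simp_all add: \<pi>_PD_inv[OF p] v v')
  then have "hip (P (r p)) (vec_fun B (r p) v) (vec_fun B' (r p) v')
      = hip (P u) (vec_fun B u (\<pi> (i p) v)) (vec_fun B' u (\<pi> (i p) v'))"
    using hip_left_translate[OF m(2), unfolded m(3), OF vec_fun_carrier[OF B u x(1)] vec_fun_carrier[OF B' u x(2)]] by simp
  then show ?thesis unfolding \<tau>_def vec_fun_at_u[OF B x(1)] vec_fun_at_u[OF B' x(2)] .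
qed

end

section \<open>The isometry into the induced representation\<close>

context induced_kernel
begin

abbreviation vid where "vid x \<equiv> vec_fun (\<lambda>x. x) u x"

lemma pre_P_u: "pre_hilbert (P u) (W u)"
  by (rule pre_hilbert_P[OF u])

sublocale PU: pre_hilbert "P u" "W u"
  by (rule pre_P_u)

lemma vid_carrier: "x \<in> S.C \<Longrightarrow> vid x \<in> carrier (P u)"
  by (rule vec_fun_carrier[OF K_map_id u])

lemma vid_W: "x \<in> S.C \<Longrightarrow> vid x \<in> W u"
  using vid_carrier PU.carrier_subset by blast

lemma \<tau>_add_right: "x \<in> S.C \<Longrightarrow> y \<in> S.C \<Longrightarrow> z \<in> S.C \<Longrightarrow> \<tau> z (x \<oplus>\<^bsub>F u\<^esub> y) = \<tau> z x + \<tau> z y"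
  and \<tau>_smult: "x \<in> S.C \<Longrightarrow> z \<in> S.C \<Longrightarrow> \<tau> (c \<odot>\<^bsub>F u\<^esub> x) z = c * \<tau> x z"
  and \<tau>_smult_right: "x \<in> S.C \<Longrightarrow> z \<in> S.C \<Longrightarrow> \<tau> z (c \<odot>\<^bsub>F u\<^esub> x) = cnj c * \<tau> z x"
  and \<tau>_cnj: "x \<in> S.C \<Longrightarrow> y \<in> S.C \<Longrightarrow> \<tau> y x = cnj (\<tau> x y)"
  and \<tau>_nonneg: "x \<in> S.C \<Longrightarrow> 0 \<le> Re (\<tau> x x)"
  unfolding \<tau>_def
  by (simp_all only: vec_fun_add[OF K_map_id] vec_fun_smult[OF K_map_id] vid_W PU.hip_add PU.hip_add_right
    PU.hip_smult PU.hip_smult_right PU.hip_nonneg) (rule PU.hip_cnj[OF vid_W vid_W])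

lemma \<tau>_K: "k \<in> K \<Longrightarrow> x \<in> S.C \<Longrightarrow> y \<in> S.C \<Longrightarrow> \<tau> (\<pi> k x) (\<pi> k y) = \<tau> x y"
  unfolding \<tau>_def
  using vec_fun_translate[OF K_map_id, of k x] vec_fun_translate[OF K_map_id, of k y]
    hip_left_translate[of k "vid x" "vid y"] K_mem[of k] vid_carrier by simp

lemma trans_ker_at_u:
  assumes x: "x \<in> S.C" shows "trans_ker (\<lambda>x. x) x u = Ker u x"
proof -
  have uP: "u \<in> PD" and ua: "u \<in> A" "r u = u" "d u = u" using K_mem[OF u_K] by (auto simp: PD_def)
  have uu: "u \<cdot> u = u" using unit_mult[OF ua(1,2)] .
  have "trans_ker (\<lambda>x. x) x u = \<pi> u (Ker (i u \<cdot> u \<cdot> u) (\<pi> (i u) x))"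
    by (rule trans_ker_eq[OF K_map_id ua(1) _ uP _ uP]) (use x ua in simp_all)
  then show ?thesis using x Ker(1)[OF K_G0[OF u_K] x] by (simp add: inv_unit[OF u] uu \<pi>_u)
qed

text \<open>The function attached to \<open>x\<close> has the value \<open>Ker u x\<close> at the unit, which
  does not vanish.\<close>

lemma \<tau>_pos:
  assumes x: "x \<in> S.C" and nz: "x \<noteq> \<zero>\<^bsub>F u\<^esub>" shows "0 < Re (\<tau> x x)"
proof -
  have uX: "u \<in> topspace (unit_top G)" using u by (simp add: topspace_unit_top)
  have ua: "u \<in> A" "r u = u" "d u = u" using K_mem[OF u_K] by auto
  obtain \<eta> where \<eta>: "\<eta> \<in> secs E" "\<eta> u = x" by (rule bun.sec_through[OF uX x])
  let ?f = "sec_fun (\<lambda>x. x) \<eta>"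
  have f: "?f u = Ker u x" using ua \<eta> trans_ker_at_u[OF x] by (simp add: sec_fun_def)
  have KC: "Ker u x \<in> S.C" by (rule Ker(1)[OF K_G0[OF u_K] x])
  have "hnorm (F u) (Ker u x) \<noteq> 0" using S.hnorm_eq_0[OF KC] Ker_unit_nonzero[OF x nz] by blast
  then have "hip (F (d u)) (?f u) (?f u) \<noteq> 0" using S.hip_self_hnorm[OF KC] ua by (simp add: f)
  moreover have "u \<in> rfib G u" using ua by (simp add: rfib_def)
  ultimately have "0 < Re (hip (P u) (restrict ?f (rfib G u)) (restrict ?f (rfib G u)))"
    by (intro hip_P_pos[OF u sec_fun_eqv[OF K_map_id \<eta>(1)]])
  then show ?thesis unfolding vec_fun_sec \<eta>(2) \<tau>_def .
qed

text \<open>Any positive number above the total mass serves; adding one avoids a discussion of mass zero.\<close>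

definition M where "M = measure (\<mu> u) (space (\<mu> u)) + 1"

lemma M_pos: "0 < M"
  by (simp add: M_def add_nonneg_pos)

lemma hnorm_trans_ker_le:
  assumes x: "x \<in> S.C" and y: "y \<in> rfib G u"
  shows "hnorm (F (d y)) (trans_ker (\<lambda>x. x) x y) \<le> hnorm (F u) x"
proof -
  have yA: "y \<in> A" "r y = u" using y by (auto simp: rfib_def)
  define t where "t = frame (d y)"
  have t: "t \<in> PD" "r t = d y" using frame[OF dom_unit[OF yA(1)]] by (auto simp: t_def)
  have uP: "u \<in> PD" "r u = r y" using K_mem[OF u_K] yA by (auto simp: PD_def)
  have g: "i u \<cdot> y \<cdot> t \<in> G0" by (rule conj_G0[OF yA(1) uP(1) t(1) uP(2) t(2)])
  have "trans_ker (\<lambda>x. x) x y = \<pi> t (Ker (i u \<cdot> y \<cdot> t) (\<pi> (i u) x))"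
    by (rule trans_ker_eq[OF K_map_id yA(1) _ uP t]) (use x yA in simp)
  also have "\<pi> (i u) x = x" using x by (simp add: inv_unit[OF u] \<pi>_u)
  finally have "hnorm (F (d y)) (trans_ker (\<lambda>x. x) x y) = hnorm (F u) (Ker (i u \<cdot> y \<cdot> t) x)"
    using \<pi>_hnorm[of t "Ker (i u \<cdot> y \<cdot> t) x"] PD_mem[OF t(1)] t(2) Ker(1)[OF g x] by simp
  then show ?thesis using hnorm_Ker_le[OF g x] by simp
qed

lemma \<tau>_le: "x \<in> S.C \<Longrightarrow> Re (\<tau> x x) \<le> M * (hnorm (F u) x)\<^sup>2"
proof -
  assume x: "x \<in> S.C"
  interpret finite_measure "\<mu> u" by (rule \<mu>.finite_measure_\<mu>[OF u])
  let ?N = "(hnorm (F u) x)\<^sup>2"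
  let ?f = "\<lambda>\<omega>. indicator (Fib u) \<omega> *\<^sub>R pairing (vid x) (vid x) \<omega>"
  have int: "integrable (\<mu> u) ?f"
    using pairing_integrable[OF u vid_W[OF x] vid_W[OF x]] by (simp add: set_integrable_def)
  have le: "norm (?f \<omega>) \<le> ?N" for \<omega>
  proof (cases "\<omega> \<in> Fib u")
    case True
    then obtain y where y: "y \<in> rfib G u" "\<omega> = q y" unfolding Fib_eq by blast
    have yA: "y \<in> A" "r y = u" using y by (auto simp: rfib_def)
    interpret Y: semi_inner "F (d y)" "carrier (F (d y))" by (rule fib_semi[OF dom_unit[OF yA(1)]])
    have m: "vid x y \<in> carrier (F (d y))" by (rule eqv_mem[OF vid_W[OF x] y(1)])
    have "pairing (vid x) (vid x) \<omega> = of_real ((hnorm (F (d y)) (vid x y))\<^sup>2)"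
      unfolding y(2) eqv_hip_coset[OF vid_W[OF x] vid_W[OF x] y(1)] by (rule Y.hip_self_hnorm[OF m])
    then have "norm (pairing (vid x) (vid x) \<omega>) = (hnorm (F (d y)) (vid x y))\<^sup>2" by (simp add: norm_power)
    also have "\<dots> \<le> ?N"
      using hnorm_trans_ker_le[OF x y(1)] y(1) Y.hnorm_nonneg[OF m] by (intro power_mono) (auto simp: vec_fun_def)
    finally show ?thesis using True by (simp add: indicator_def)
  next
    case False
    then show ?thesis by (simp add: indicator_def del: mem_Collect_eq)
  qed
  have eq: "\<tau> x x = integral\<^sup>L (\<mu> u) ?f" by (simp add: \<tau>_def P_simps set_lebesgue_integral_def)
  have "Re (\<tau> x x) \<le> cmod (integral\<^sup>L (\<mu> u) ?f)" unfolding eq by (rule complex_Re_le_cmod)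
  also have "\<dots> \<le> (LINT \<omega>|\<mu> u. norm (?f \<omega>))" by (rule integral_norm_bound)
  also have "\<dots> \<le> (LINT \<omega>|\<mu> u. ?N)" by (intro integral_mono integrable_norm[OF int] le) simp
  also have "\<dots> \<le> M * ?N" by (simp add: M_def algebra_simps)
  finally show ?thesis .
qed

lemma \<tau>_cmod_le: "x \<in> S.C \<Longrightarrow> y \<in> S.C \<Longrightarrow> cmod (\<tau> x y) \<le> M * (hnorm (F u) x * hnorm (F u) y)"
proof -
  have n: "hnorm (P u) (vid x) \<le> sqrt M * hnorm (F u) x" if x: "x \<in> S.C" for x
  proof -
    have "hnorm (P u) (vid x) = sqrt (Re (\<tau> x x))" by (simp add: hnorm_def \<tau>_def)
    also have "\<dots> \<le> sqrt (M * (hnorm (F u) x)\<^sup>2)" using \<tau>_le[OF x] by simp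
    also have "\<dots> = sqrt M * hnorm (F u) x" using S.hnorm_nonneg[OF x] by (simp add: real_sqrt_mult)
    finally show ?thesis .
  qed
  assume x: "x \<in> S.C" and y: "y \<in> S.C"
  have "cmod (\<tau> x y) \<le> hnorm (P u) (vid x) * hnorm (P u) (vid y)"
    unfolding \<tau>_def by (intro PU.Cauchy_Schwarz vid_W x y)
  also have "\<dots> \<le> (sqrt M * hnorm (F u) x) * (sqrt M * hnorm (F u) y)"
    using M_pos by (intro mult_mono n x y PU.hnorm_nonneg vid_W mult_nonneg_nonneg S.hnorm_nonneg) auto
  also have "\<dots> = (sqrt M * sqrt M) * (hnorm (F u) x * hnorm (F u) y)" by (simp only: mult_ac)
  also have "sqrt M * sqrt M = M" using M_pos by simp
  finally show ?thesis .
qed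

text \<open>The form \<open>\<tau> / M\<close> is represented by \<open>1 - D\<close>.\<close>

definition D :: "'v \<Rightarrow> 'v" where
  "D x = (SOME z. z \<in> S.C \<and> (\<forall>w\<in>S.C. hip (F u) z w = hip (F u) x w - \<tau> x w / of_real M))"

lemma D:
  assumes x: "x \<in> S.C"
  shows "D x \<in> S.C" "\<And>w. w \<in> S.C \<Longrightarrow> hip (F u) (D x) w = hip (F u) x w - \<tau> x w / of_real M"
proof -
  have "\<exists>z\<in>S.C. \<forall>w\<in>S.C. hip (F u) z w = hip (F u) x w - \<tau> x w / of_real M"
  proof (rule S.Riesz_representation[where B = "2 * hnorm (F u) x"])
    fix w assume w: "w \<in> S.C"
    have "cmod (\<tau> x w / of_real M) \<le> hnorm (F u) x * hnorm (F u) w"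
      using \<tau>_cmod_le[OF x w] M_pos by (simp add: norm_divide pos_divide_le_eq mult_ac)
    moreover have "cmod (hip (F u) x w) \<le> hnorm (F u) x * hnorm (F u) w" by (rule S.Cauchy_Schwarz[OF x w])
    ultimately show "cmod (hip (F u) x w - \<tau> x w / of_real M) \<le> 2 * hnorm (F u) x * hnorm (F u) w"
      using norm_triangle_ineq4[of "hip (F u) x w" "\<tau> x w / of_real M"] by linarith
  qed (simp_all add: x \<tau>_add_right \<tau>_smult_right S.hip_add_right S.hip_smult_right add_divide_distrib algebra_simps)
  then have "\<exists>z. z \<in> S.C \<and> (\<forall>w\<in>S.C. hip (F u) z w = hip (F u) x w - \<tau> x w / of_real M)" unfolding Bex_def .
  then have "D x \<in> S.C \<and> (\<forall>w\<in>S.C. hip (F u) (D x) w = hip (F u) x w - \<tau> x w / of_real M)"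
    unfolding D_def by (rule someI_ex)
  then show "D x \<in> S.C" "\<And>w. w \<in> S.C \<Longrightarrow> hip (F u) (D x) w = hip (F u) x w - \<tau> x w / of_real M" by auto
qed

sublocale pc: positive_contraction "F u" D
proof
  fix v w assume v: "v \<in> S.C" and w: "w \<in> S.C"
  have "hip (F u) v (D w) = cnj (hip (F u) (D w) v)" using S.hip_cnj[OF D(1)[OF w] v] .
  also have "\<dots> = hip (F u) v w - \<tau> v w / of_real M"
    using D(2)[OF w v] S.hip_cnj[OF w v] \<tau>_cnj[OF w v] by simp
  finally show "hip (F u) (D v) w = hip (F u) v (D w)" using D(2)[OF v w] by simp
next
  fix v assume v: "v \<in> S.C"
  have eq: "Re (hip (F u) (D v) v) = Re (hip (F u) v v) - Re (\<tau> v v) / M" by (simp add: D(2)[OF v v])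
  have "Re (\<tau> v v) / M \<le> (hnorm (F u) v)\<^sup>2" using \<tau>_le[OF v] M_pos by (simp add: pos_divide_le_eq mult.commute)
  then show "0 \<le> Re (hip (F u) (D v) v)" unfolding eq by (simp add: S.hnorm_sq[OF v])
  show "Re (hip (F u) (D v) v) \<le> Re (hip (F u) v v)" unfolding eq using \<tau>_nonneg[OF v] M_pos by simp
  show "v = \<zero>\<^bsub>F u\<^esub>" if "Re (hip (F u) (D v) v) = Re (hip (F u) v v)"
    using that \<tau>_pos[OF v] M_pos unfolding eq by (cases "v = \<zero>\<^bsub>F u\<^esub>") auto
qed (rule D(1))

lemma D_commute:
  assumes k: "k \<in> K" and x: "x \<in> S.C" shows "D (\<pi> k x) = \<pi> k (D x)"
proof (rule S.vec_eqI)
  have kx: "\<pi> k x \<in> S.C" by (rule \<pi>_K(1)[OF k x])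
  show "D (\<pi> k x) \<in> S.C" "\<pi> k (D x) \<in> S.C" using D(1)[OF kx] \<pi>_K(1)[OF k D(1)[OF x]] by auto
  fix w assume w: "w \<in> S.C"
  define z where "z = \<pi> (i k) w"
  have z: "z \<in> S.C" and w_eq: "w = \<pi> k z"
    unfolding z_def using \<pi>_K(1)[OF K_mem(5)[OF k] w] \<pi>_inv[of "i k" w] K_mem[OF K_mem(5)[OF k]] K_mem[OF k] w
    by (simp_all add: inv_inv)
  show "hip (F u) (D (\<pi> k x)) w = hip (F u) (\<pi> k (D x)) w"
    unfolding w_eq using D(2)[OF kx \<pi>_K(1)[OF k z]] D(2)[OF x z] \<tau>_K[OF k x z] \<pi>_K(4)[OF k x z] \<pi>_K(4)[OF k D(1)[OF x] z]
    by simp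
qed

text \<open>Approximations of the inverse square root of the operator representing \<open>\<tau>\<close>,
  which is \<open>M (1 - D)\<close>.\<close>

definition B :: "nat \<Rightarrow> 'v \<Rightarrow> 'v" where
  "B n x = of_real (1 / sqrt M) \<odot>\<^bsub>F u\<^esub> pc.invsqrt_sum n x"

lemma K_map_B: "K_map (B n)"
proof -
  let ?c = "complex_of_real (1 / sqrt M)"
  note m = pc.invsqrt_sum_mem
  have mem: "B n x \<in> S.C" if "x \<in> S.C" for x unfolding B_def by (intro S.smult_mem m that)
  have add: "B n (x \<oplus>\<^bsub>F u\<^esub> y) = B n x \<oplus>\<^bsub>F u\<^esub> B n y" if "x \<in> S.C" "y \<in> S.C" for x y
    by (rule S.vec_eqI)
      (use that in \<open>simp_all add: mem S.add_mem S.hip_add S.hip_smult B_def m pc.invsqrt_sum_linear S.smult_mem algebra_simps\<close>)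
  have smult: "B n (c \<odot>\<^bsub>F u\<^esub> x) = c \<odot>\<^bsub>F u\<^esub> B n x" if "x \<in> S.C" for x c
    by (rule S.vec_eqI)
      (use that in \<open>simp_all add: mem S.smult_mem S.hip_smult B_def m pc.invsqrt_sum_linear algebra_simps\<close>)
  have "hnorm (F u) (B n x) \<le> (cmod ?c * (\<Sum>k\<le>n. invsqrt_coeff k)) * hnorm (F u) x" if x: "x \<in> S.C" for x
    unfolding B_def S.hnorm_smult[OF m[OF x]] using mult_left_mono[OF pc.hnorm_invsqrt_sum_le[OF x], of "cmod ?c" n]
    by (simp add: mult.assoc)
  then have bdd: "\<exists>c. \<forall>x\<in>S.C. hnorm (F u) (B n x) \<le> c * hnorm (F u) x" by blast
  have "B n (\<pi> k x) = \<pi> k (B n x)" if k: "k \<in> K" and x: "x \<in> S.C" for k x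
    unfolding B_def using pc.invsqrt_sum_commute[of "\<pi> k" x n] \<pi>_K[OF k] D_commute[OF k] x m by simp
  then show ?thesis unfolding K_map_def using mem add smult bdd by blast
qed

lemma \<tau>_B:
  assumes x: "x \<in> S.C"
  shows "\<exists>a. \<tau> (B n x) (B m x) = of_real a \<and>
    (hnorm (F u) x)\<^sup>2 - pc.moment (Suc (min n m)) x \<le> a \<and> a \<le> (hnorm (F u) x)\<^sup>2"
proof -
  let ?a = "pc.invsqrt_sum n x" and ?b = "pc.invsqrt_sum m x"
  have ab: "?a \<in> S.C" "?b \<in> S.C" using pc.invsqrt_sum_mem[OF x] by auto
  have "complex_of_real (1 / sqrt M) * of_real (1 / sqrt M) = of_real (1 / M)"
    using M_pos by (simp flip: of_real_mult)
  then have "\<tau> (B n x) (B m x) = of_real (1 / M) * \<tau> ?a ?b"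
    using ab by (simp add: B_def \<tau>_smult \<tau>_smult_right S.smult_mem mult.assoc[symmetric])
  also have "\<dots> = hip (F u) ?a ?b - hip (F u) (D ?a) ?b" using D(2)[OF ab] by simp
  finally show ?thesis using pc.invsqrt_form[OF x, of n m] by simp
qed

context
  fixes w v assumes w: "w \<in> units G" and v: "v \<in> carrier (F w)"
begin

abbreviation (input) base where "base \<equiv> \<pi> (i (frame w)) v"

lemma base_mem: "base \<in> S.C" and hnorm_base: "hnorm (F u) base = hnorm (F w) v"
proof -
  note p = frame[OF w]
  show "base \<in> S.C" using \<pi>_inv_PD[of "frame w" v] p v by simp
  show "hnorm (F u) base = hnorm (F w) v"
    using \<pi>_hnorm[OF sub_inv[OF PD_mem(1)[OF conjunct1[OF p]]], of v] PD_mem[OF conjunct1[OF p]] p v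
    by (simp add: gsimps)
qed

text \<open>For a vector over any unit \<open>w\<close>, the approximations inherit the near isometry of
  \<open>\<tau>_B\<close> at the vector transported to \<open>u\<close>.\<close>

lemma hip_approx:
  "\<exists>a. hip (P w) (vec_fun (B n) w v) (vec_fun (B m) w v) = of_real a \<and>
    (hnorm (F w) v)\<^sup>2 - pc.moment (Suc (min n m)) base \<le> a \<and> a \<le> (hnorm (F w) v)\<^sup>2"
  using \<tau>_B[OF base_mem, of n m] hip_vec_fun[OF K_map_B K_map_B, of "frame w" v v n m] frame[OF w] v
  by (simp add: hnorm_base)

lemma approx_carrier: "vec_fun (B n) w v \<in> carrier (P w)"
  by (rule vec_fun_carrier[OF K_map_B w v])

lemma approx_W: "vec_fun (B n) w v \<in> W w"
  using approx_carrier pre_hilbert.carrier_subset[OF pre_hilbert_P[OF w]] by blast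

lemma hdist_approx:
  "(hdist (P w) (vec_fun (B n) w v) (vec_fun (B m) w v))\<^sup>2 \<le> 2 * pc.moment (Suc (min n m)) base"
proof -
  interpret PW: pre_hilbert "P w" "W w" by (rule pre_hilbert_P[OF w])
  obtain a b c where
    "hip (P w) (vec_fun (B n) w v) (vec_fun (B n) w v) = of_real a" "a \<le> (hnorm (F w) v)\<^sup>2"
    "hip (P w) (vec_fun (B m) w v) (vec_fun (B m) w v) = of_real b" "b \<le> (hnorm (F w) v)\<^sup>2"
    "hip (P w) (vec_fun (B n) w v) (vec_fun (B m) w v) = of_real c"
    "(hnorm (F w) v)\<^sup>2 - pc.moment (Suc (min n m)) base \<le> c"
    using hip_approx[of n n] hip_approx[of m m] hip_approx[of n m] by blast
  then show ?thesis unfolding PW.hdist_sq[OF approx_W approx_W] PW.hnorm_sq[OF approx_W] by simp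
qed

lemma hCauchy_approx: "hCauchy (P w) (\<lambda>n. vec_fun (B n) w v)"
  unfolding hCauchy_def
proof (intro conjI allI impI)
  show "range (\<lambda>n. vec_fun (B n) w v) \<subseteq> carrier (P w)" using approx_carrier by auto
  fix e :: real assume e: "0 < e"
  then have "\<forall>\<^sub>F n in sequentially. pc.moment n base < e\<^sup>2 / 2"
    by (intro order_tendstoD(2)[OF pc.moment_tendsto_0[OF base_mem]]) simp
  then obtain N where N: "\<And>n. N \<le> n \<Longrightarrow> pc.moment n base < e\<^sup>2 / 2" by (auto simp: eventually_sequentially)
  have "hdist (P w) (vec_fun (B m) w v) (vec_fun (B n) w v) < e" if mn: "N \<le> m" "N \<le> n" for m n
  proof -
    have "(hdist (P w) (vec_fun (B m) w v) (vec_fun (B n) w v))\<^sup>2 < e\<^sup>2"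
    proof -
      have "N \<le> Suc (min m n)" using mn by simp
      from N[OF this] hdist_approx[of m n] show ?thesis by simp
    qed
    then show ?thesis using e by (simp add: power_less_imp_less_base)
  qed
  then show "\<exists>N. \<forall>m\<ge>N. \<forall>n\<ge>N. hdist (P w) (vec_fun (B m) w v) (vec_fun (B n) w v) < e" by blast
qed

lemma hnorm_approx: "(\<lambda>n. hnorm (P w) (vec_fun (B n) w v)) \<longlonglongrightarrow> hnorm (F w) v"
proof -
  interpret PW: pre_hilbert "P w" "W w" by (rule pre_hilbert_P[OF w])
  have b: "(hnorm (F w) v)\<^sup>2 - pc.moment (Suc n) base \<le> Re (hip (P w) (vec_fun (B n) w v) (vec_fun (B n) w v))"
    "Re (hip (P w) (vec_fun (B n) w v) (vec_fun (B n) w v)) \<le> (hnorm (F w) v)\<^sup>2" for n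
    using hip_approx[of n n] by auto
  have "(\<lambda>n. (hnorm (F w) v)\<^sup>2 - pc.moment (Suc n) base) \<longlonglongrightarrow> (hnorm (F w) v)\<^sup>2 - 0"
    by (intro tendsto_diff tendsto_const LIMSEQ_Suc pc.moment_tendsto_0 base_mem)
  then have lim: "(\<lambda>n. (hnorm (F w) v)\<^sup>2 - pc.moment (Suc n) base) \<longlonglongrightarrow> (hnorm (F w) v)\<^sup>2" by simp
  have "(\<lambda>n. Re (hip (P w) (vec_fun (B n) w v) (vec_fun (B n) w v))) \<longlonglongrightarrow> (hnorm (F w) v)\<^sup>2"
    by (rule tendsto_sandwich[OF always_eventually always_eventually lim tendsto_const]) (simp_all only: b simp_thms)
  then have "(\<lambda>n. hnorm (P w) (vec_fun (B n) w v)) \<longlonglongrightarrow> sqrt ((hnorm (F w) v)\<^sup>2)"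
    unfolding hnorm_def[of "P w"] by (rule tendsto_real_sqrt)
  then show ?thesis using semi_inner.hnorm_nonneg[OF fib_semi[OF w] v] by simp
qed

end

definition U :: "'g \<Rightarrow> 'v \<Rightarrow> (nat \<Rightarrow> 'g \<Rightarrow> 'v) set" where
  "U w v = completion_class (P w) (\<lambda>n. vec_fun (B n) w v)"

abbreviation IF where "IF w \<equiv> ind_fib G H \<mu> E \<pi> w"

lemma U_carrier: "w \<in> units G \<Longrightarrow> v \<in> carrier (F w) \<Longrightarrow> U w v \<in> carrier (IF w)"
  using hCauchy_approx by (auto simp: ind_fib_def hcompletion_def U_def)

lemma U_isometry: "w \<in> units G \<Longrightarrow> linear_isometry (F w) (IF w) (U w)"
proof -
  assume w: "w \<in> units G"
  interpret PW: pre_hilbert "P w" "W w" by (rule pre_hilbert_P[OF w])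
  note C = hCauchy_approx[OF w]
  have "U w (v \<oplus>\<^bsub>F w\<^esub> v') = U w v \<oplus>\<^bsub>IF w\<^esub> U w v'" if v: "v \<in> carrier (F w)" "v' \<in> carrier (F w)" for v v'
    unfolding U_def ind_fib_def PW.hcompletion_add[OF C[OF v(1)] C[OF v(2)]]
    by (simp add: vec_fun_add[OF K_map_B v])
  moreover have "U w (c \<odot>\<^bsub>F w\<^esub> v) = c \<odot>\<^bsub>IF w\<^esub> U w v" if v: "v \<in> carrier (F w)" for c v
    unfolding U_def ind_fib_def PW.hcompletion_smult[OF C[OF v]] by (simp add: vec_fun_smult[OF K_map_B v])
  moreover have "hnorm (IF w) (U w v) = hnorm (F w) v" if v: "v \<in> carrier (F w)" for v
    unfolding U_def ind_fib_def by (rule PW.hcompletion_hnorm[OF C[OF v] hnorm_approx[OF w v]])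
  ultimately show ?thesis using U_carrier[OF w] by (auto simp: linear_isometry_def)
qed

text \<open>The approximations are intertwined exactly, and translation preserves the distances of elements of
  the carrier, so it maps all representatives of a class into one class.\<close>

lemma U_equivariant:
  assumes h: "h \<in> H" and v: "v \<in> carrier (F (d h))"
  shows "U (r h) (\<pi> h v) = ind_rep G H \<mu> E \<pi> h (U (d h) v)"
proof -
  have hA: "h \<in> A" using h H_arrow by blast
  interpret PD: pre_hilbert "P (d h)" "W (d h)" by (rule pre_hilbert_P[OF dom_unit[OF hA]])
  interpret PR: pre_hilbert "P (r h)" "W (r h)" by (rule pre_hilbert_P[OF rng_unit[OF hA]])
  let ?s = "\<lambda>n. vec_fun (B n) (d h) v"
  have C: "hCauchy (P (d h)) ?s" by (rule hCauchy_approx[OF dom_unit[OF hA] v])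
  have s: "?s n \<in> carrier (P (d h))" for n by (rule approx_carrier[OF dom_unit[OF hA] v])
  have sL: "left_translate G h (?s n) = vec_fun (B n) (r h) (\<pi> h v)" for n
    by (rule vec_fun_translate[OF K_map_B h v])
  have LW: "left_translate G h a \<in> W (r h)" if "a \<in> W (d h)" for a by (rule left_translate_eqv[OF hA that])
  have dist: "hdist (P (r h)) (left_translate G h a) (left_translate G h b) = hdist (P (d h)) a b"
    if a: "a \<in> carrier (P (d h))" and b: "b \<in> carrier (P (d h))" for a b
  proof -
    have W: "a \<in> W (d h)" "b \<in> W (d h)" using a b PD.carrier_subset by auto
    have "(hdist (P (r h)) (left_translate G h a) (left_translate G h b))\<^sup>2 = (hdist (P (d h)) a b)\<^sup>2"
      unfolding PR.hdist_sq[OF LW[OF W(1)] LW[OF W(2)]] PD.hdist_sq[OF W]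
        PR.hnorm_sq[OF LW[OF W(1)]] PR.hnorm_sq[OF LW[OF W(2)]] PD.hnorm_sq[OF W(1)] PD.hnorm_sq[OF W(2)]
      by (simp only: hip_left_translate[OF hA] a b)
    then show ?thesis using PR.hdist_nonneg[OF LW[OF W(1)] LW[OF W(2)]] PD.hdist_nonneg[OF W] by simp
  qed
  have "completion_class (P (r h)) (\<lambda>n. left_translate G h (a n)) = U (r h) (\<pi> h v)" if a: "a \<in> U (d h) v" for a
    unfolding U_def
  proof (rule PR.completion_class_eqI)
    note A = PD.completion_class_memD[OF C a[unfolded U_def]]
    show "left_translate G h (a n) \<in> W (r h)" for n by (rule LW[OF A(3)])
    show "vec_fun (B n) (r h) (\<pi> h v) \<in> W (r h)" for n
      unfolding sL[symmetric] using s PD.carrier_subset by (intro LW) blast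
    have "hdist (P (r h)) (left_translate G h (a n)) (vec_fun (B n) (r h) (\<pi> h v)) = hdist (P (d h)) (?s n) (a n)" for n
      unfolding sL[symmetric] dist[OF A(4) s] using A(3) s PD.carrier_subset by (intro PD.hdist_commute) auto
    then show "(\<lambda>n. hdist (P (r h)) (left_translate G h (a n)) (vec_fun (B n) (r h) (\<pi> h v))) \<longlonglongrightarrow> 0"
      using A(2) by simp
  qed
  moreover have "?s \<in> U (d h) v" unfolding U_def by (rule PD.completion_class_self[OF C])
  ultimately show ?thesis unfolding ind_rep_def by (intro UN_constant_eqI[symmetric])
qed

text \<open>Dini's theorem: the moments of \<open>pull \<xi> p\<close> are continuous in \<open>p\<close> and
  decrease to zero pointwise on a compact space. Working with all \<open>p\<close> in
  \<open>PD\<close> rather than with units avoids a continuous choice of connecting arrows.\<close>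

lemma moment_uniform:
  assumes \<xi>: "\<xi> \<in> secs E" and e: "0 < e"
  obtains N where "\<And>p n. p \<in> PD \<Longrightarrow> N \<le> n \<Longrightarrow> pc.moment n (pull \<xi> p) < e"
proof -
  have hc: "S.hcont PT (\<lambda>p. (D ^^ n) (pull \<xi> p))" for n
  proof (rule S.hcont_bounded_op[OF pull_hcont[OF \<xi>], where c = 1])
    show "(D ^^ n) x \<in> S.C" if "x \<in> S.C" for x by (rule pc.Dpow_mem[OF that])
    fix x y assume x: "x \<in> S.C" and y: "y \<in> S.C"
    have "S.diff ((D ^^ n) x) ((D ^^ n) y) = (D ^^ n) (S.diff x y)"
      by (rule S.vec_eqI)
        (simp_all add: pc.Dpow_mem x y S.diff_mem S.hip_diff pc.Dpow_self_adjoint)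
    then show "hdist (F u) ((D ^^ n) x) ((D ^^ n) y) \<le> 1 * hdist (F u) x y"
      unfolding hdist_def using pc.hnorm_Dpow_le[OF S.diff_mem[OF x y], of n] by simp
  qed
  define V where "V n = {p \<in> topspace PT. pc.moment n (pull \<xi> p) < e}" for n
  have V: "openin PT (V n)" for n
    unfolding V_def
  proof (rule continuous_map_preimage_less)
    show "continuous_map PT euclidean (\<lambda>p. pc.moment n (pull \<xi> p))"
      unfolding pc.moment_def using S.hcont_hip[OF hc pull_hcont[OF \<xi>]] by (simp add: continuous_map_Re_Im)
  qed
  have "PD \<subseteq> \<Union> (range V)"
  proof
    fix p assume p: "p \<in> PD"
    have "\<forall>\<^sub>F n in sequentially. pc.moment n (pull \<xi> p) < e"
      by (rule order_tendstoD(2)[OF pc.moment_tendsto_0[OF pull_mem[OF \<xi> p]] e])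
    then obtain n where "pc.moment n (pull \<xi> p) < e" by (auto simp: eventually_sequentially)
    then have "p \<in> V n" using p unfolding V_def topspace_PT by blast
    then show "p \<in> \<Union> (range V)" by blast
  qed
  moreover have "compactin PT PD" using compact_PT unfolding compact_space_def topspace_PT .
  ultimately have "\<exists>\<F>. finite \<F> \<and> \<F> \<subseteq> range V \<and> PD \<subseteq> \<Union>\<F>"
    using V unfolding compactin_def by (elim conjE allE[of _ "range V"]) auto
  then obtain \<F> where \<F>: "finite \<F>" "\<F> \<subseteq> range V" "PD \<subseteq> \<Union>\<F>" by blast
  obtain T where T: "finite T" "\<F> = V ` T" using finite_subset_image[OF \<F>(1,2)] by blast
  show ?thesis
  proof (rule that[of "Max (insert 0 T)"])
    fix p n assume p: "p \<in> PD" and n: "Max (insert 0 T) \<le> n"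
    obtain m where m: "m \<in> T" "p \<in> V m" using p \<F>(3) T(2) by blast
    have "m \<le> Max (insert 0 T)" using T(1) m(1) by (intro Max_ge) auto
    then have "m \<le> n" using n by simp
    then have "pc.moment n (pull \<xi> p) \<le> pc.moment m (pull \<xi> p)" by (rule pc.moment_antimono[OF pull_mem[OF \<xi> p]])
    also have "\<dots> < e" using m(2) by (simp add: V_def)
    finally show "pc.moment n (pull \<xi> p) < e" .
  qed
qed

text \<open>The functions \<open>sec_fun (B N) \<xi>\<close> approximate the image of \<open>\<xi>\<close>
  uniformly over the unit space.\<close>

lemma U_section:
  assumes \<xi>: "\<xi> \<in> secs E"
  shows "(\<lambda>w\<in>units G. U w (\<xi> w)) \<in> secs (ind_bundle G H \<mu> E \<pi>)"
proof -
  let ?U = "\<lambda>w\<in>units G. U w (\<xi> w)"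
  have \<xi>m: "\<xi> w \<in> carrier (F w)" if "w \<in> units G" for w by (rule sec_mem_unit[OF \<xi> that])
  have sec: "?U \<in> all_sections (unit_top G) IF"
    using U_carrier \<xi>m by (auto simp: all_sections_def topspace_unit_top)
  have "?U \<in> ind_module G H \<mu> E \<pi>"
    unfolding ind_module_def
  proof (intro CollectI conjI sec allI impI)
    fix e :: real assume e: "0 < e"
    \<comment> \<open>Squared distances are at most twice a moment, so this bound gives distances of at most
      \<open>e / 2\<close>.\<close>
    then have "0 < e\<^sup>2 / 8" by simp
    then obtain N where N: "\<And>p n. p \<in> PD \<Longrightarrow> N \<le> n \<Longrightarrow> pc.moment n (pull \<xi> p) < e\<^sup>2 / 8"
      by (rule moment_uniform[OF \<xi>]) blast
    have "hdist (IF w) (?U w) (ind_section G H \<mu> E \<pi> (sec_fun (B N) \<xi>) w) < e" if w: "w \<in> units G" for w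
    proof -
      interpret PW: pre_hilbert "P w" "W w" by (rule pre_hilbert_P[OF w])
      note c = approx_carrier[OF w \<xi>m[OF w]]
      have p: "frame w \<in> PD" "r (frame w) = w" using frame[OF w] by auto
      have close: "hdist (P w) (vec_fun (B n) w (\<xi> w)) (vec_fun (B N) w (\<xi> w)) \<le> e / 2" if n: "N \<le> n" for n
      proof -
        have "(hdist (P w) (vec_fun (B n) w (\<xi> w)) (vec_fun (B N) w (\<xi> w)))\<^sup>2 \<le> 2 * pc.moment (Suc (min n N)) (pull \<xi> (frame w))"
          using hdist_approx[OF w \<xi>m[OF w], of n N] p by (simp add: pull_def)
        also have "\<dots> \<le> (e / 2)\<^sup>2"
        proof -
          have "N \<le> Suc (min n N)" using n by simp
          from N[OF p(1) this] show ?thesis by (simp add: power_divide)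
        qed
        finally show ?thesis by (rule power2_le_imp_le) (use e in simp)
      qed
      have "ind_section G H \<mu> E \<pi> (sec_fun (B N) \<xi>) w = completion_class (P w) (\<lambda>n. vec_fun (B N) w (\<xi> w))"
        using w by (simp add: ind_section_def completion_embed_def vec_fun_sec)
      then have "hdist (IF w) (?U w) (ind_section G H \<mu> E \<pi> (sec_fun (B N) \<xi>) w)
          = hdist (hcompletion (P w)) (completion_class (P w) (\<lambda>n. vec_fun (B n) w (\<xi> w)))
              (completion_class (P w) (\<lambda>n. vec_fun (B N) w (\<xi> w)))"
        using w by (simp add: U_def ind_fib_def)
      also have "\<dots> \<le> e / 2"
        by (rule PW.hcompletion_hdist_le[OF hCauchy_approx[OF w \<xi>m[OF w]] PW.hCauchy_const[OF c]])
          (use close in \<open>auto simp: eventually_sequentially\<close>)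
      finally show ?thesis using e by simp
    qed
    then show "\<exists>f\<in>ind_F0 G H E \<pi>. \<forall>w\<in>units G. hdist (IF w) (?U w) (ind_section G H \<mu> E \<pi> f w) < e"
      unfolding ind_F0_eq_eqv using sec_fun_eqv[OF K_map_B \<xi>] by blast
  qed
  moreover have "hdist (IF w) (?U w) (?U w) < e" if w: "w \<in> units G" and e: "0 < e" for w and e :: real
  proof -
    interpret PW: pre_hilbert "P w" "W w" by (rule pre_hilbert_P[OF w])
    note c = hCauchy_approx[OF w \<xi>m[OF w]]
    have "hdist (hcompletion (P w)) (U w (\<xi> w)) (U w (\<xi> w)) \<le> 0"
      unfolding U_def
      by (rule PW.hcompletion_hdist_le[OF c c]) (simp add: PW.hdist_self[OF approx_W[OF w \<xi>m[OF w]]])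
    then show ?thesis using w e by (simp add: ind_fib_def)
  qed
  ultimately have "\<exists>V. openin (unit_top G) V \<and> x \<in> V \<and> (\<exists>\<eta>\<in>ind_module G H \<mu> E \<pi>. \<forall>w\<in>V. hdist (IF w) (?U w) (\<eta> w) < e)"
    if "x \<in> topspace (unit_top G)" "0 < e" for x and e :: real
    using that(1) by (intro exI[of _ "topspace (unit_top G)"] conjI openin_topspace bexI[of _ ?U] ballI)
      (auto simp only: topspace_unit_top that(2))
  then have "?U \<in> locally_uniform_closure (unit_top G) IF (ind_module G H \<mu> E \<pi>)"
    unfolding locally_uniform_closure_def using sec by blast
  then show ?thesis by (simp add: ind_bundle_def)
qed

lemma subrepresentation_induced:
  "subrepresentation (restrict_groupoid G H) E \<pi> (ind_bundle G H \<mu> E \<pi>) (ind_rep G H \<mu> E \<pi>)"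
  unfolding subrepresentation_def units_restrict arrows_restrict restrict_simps(2-5)
  using U_isometry U_section U_equivariant
  by (intro exI[of _ U]) (auto simp: ind_bundle_def)

end

theorem theorem6p3:
  fixes G :: "'g groupoid" and H :: "'g set"
    and haarG haarH :: "'g \<Rightarrow> 'g measure"
    and \<mu> :: "'g \<Rightarrow> 'g set measure"
    and E :: "('g, 'v) hbundle" and \<pi> :: "'g \<Rightarrow> 'v \<Rightarrow> 'v"
  assumes "topological_groupoid G"
    and "haar_system G haarG"
    and "compact_space (gtop G)"
    and "transitive_groupoid G"
    and "wide_subgroupoid G H"
    and "closedin (gtop G) H"
    and "normalized_haar_system (restrict_groupoid G H) haarH"
    and "transitive_groupoid (restrict_groupoid G H)"
    and "coset_measure_system G H \<mu>"
    and "continuous_unitary_rep (restrict_groupoid G H) E \<pi>"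
  shows "subrepresentation (restrict_groupoid G H) E \<pi>
    (ind_bundle G H \<mu> E \<pi>) (ind_rep G H \<mu> E \<pi>)"
proof -
  interpret induced_setting G H \<mu> E \<pi>
    using assms
    by (intro induced_setting.intro coset_measures.intro groupoid_pair.intro groupoid_pair_axioms.intro
      coset_measures_axioms.intro groupoid_pair_rep.intro groupoid_pair_rep_axioms.intro)
  show ?thesis
  proof (cases "units G = {}")
    \<comment> \<open>Without units there are no arrows, and every condition is vacuous.\<close>
    case True
    then have "H = {}" using rng_unit H_arrow by blast
    then show ?thesis
      unfolding subrepresentation_def units_restrict arrows_restrict
      using True
      by (auto simp: ind_bundle_def locally_uniform_closure_def all_sections_def topspace_unit_top restrict_def)
  next
    case False
    then obtain u where u: "u \<in> units G" by blast
    obtain I where I: "invariant_mean G H u I"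
      using ex_invariant_mean[OF _ u] assms(7) by (auto simp: normalized_haar_system_def)
    have t1: "t1_space (gtop G)" using Hausdorff_gtop Hausdorff_imp_t1_space by blast
    obtain \<rho> :: "'g \<Rightarrow> real" where \<rho>: "continuous_map (gtop G) euclidean \<rho>" "\<And>x. 0 \<le> \<rho> x"
      "\<And>x. x \<in> topspace (gtop G) \<Longrightarrow> \<rho> x = 0 \<longleftrightarrow> x = u"
      by (rule ex_continuous_zero_at_point[OF normal_gtop t1 second_countable_gtop unit_arrow[OF u]]) blast
    have "\<exists>p\<in>H. grng G p = v \<and> gdom G p = u" if "v \<in> units G" for v
      using assms(8) that u unfolding transitive_groupoid_def units_restrict arrows_restrict restrict_simps(2,3)
      by blast
    then interpret induced_kernel G H \<mu> E \<pi> u I \<rho>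
      using I \<rho>
      by (intro induced_kernel.intro intertwining_kernel.intro intertwining_kernel_axioms.intro
        induced_kernel_axioms.intro induced_setting_axioms groupoid_pair_rep_axioms) auto
    show ?thesis by (rule subrepresentation_induced)
  qed
qed

end
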